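(* There exist an integer $n\geq 2$, a properly convex, strictly convex open set $\Omega\subset\mathbb{P}^n$ with $C^1$ boundary and a discrete torsion-free subgroup $\Gamma$ of $\mathrm{Aut}(\Omega)$ such that $M=\Omega/\Gamma$ is a geometrically finite manifold whose geodesic flow has a zero Lyapunov exponent. In particular, the geodesic flow of $M$ is not uniformly hyperbolic (on its non-wandering set $NW$).
   Context: Hilbert geometry. $\mathbb{P}^n$ is real projective space. An open set $\Omega\subset\mathbb{P}^n$ is properly convex if its closure lies in an affine chart in which $\Omega$ is convex; it is strictly convex if $\partial\Omega$ contains no nontrivial segment. The Hilbert distance is $d_\Omega(x,y)=\frac12\ln\frac{|qy|\,|px|}{|qx|\,|py|}$ for $x\neq y$, where $q,p$ are the intersections of the line $(xy)$ with $\partial\Omega$, in the order $q,x,y,p$ ($|\cdot|$ any Euclidean norm on an affine chart containing $\overline\Omega$). It is induced by the Finsler norm $F(x,v)=\frac{|v|}{2}\left(\frac1{|xx^-|}+\frac1{|xx^+|}\right)$, where $x^{\pm}$ are the points where the half-lines from $x$ in the directions $\pm v$ meet $\partial\Omega$. $\mathrm{Aut}(\Omega)=\{g\in \mathrm{SL}_{n+1}(\mathbb{R}): g\Omega=\Omega\}$. For $\Omega$ strictly convex with $C^1$ boundary and $\xi\in\partial\Omega$, put $b_\xi(x,y)=\lim_{z\to\xi}(d_\Omega(y,z)-d_\Omega(x,z))$; the horosphere (resp. horoball) based at $\xi$ through $x$ is $\{y: b_\xi(x,y)=0\}$ (resp. $<0$). An element of $\mathrm{Aut}(\Omega)$ is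 parabolic if it is not of torsion (not elliptic) and has exactly one fixed point in $\partial\Omega$; a discrete torsion-free group is parabolic if all its nontrivial elements are parabolic (they then share their fixed point). Geometric finiteness. For a discrete subgroup $\Gamma\subset\mathrm{Aut}(\Omega)$, the limit set is $\Lambda_\Gamma=\overline{\Gamma x}\smallsetminus\Gamma x\subset\partial\Omega$ ($x\in\Omega$ arbitrary), $C(\Lambda_\Gamma)$ is the convex hull of $\Lambda_\Gamma$ in $\Omega$, and the convex core of $M=\Omega/\Gamma$ is $C(M)=\overline{C(\Lambda_\Gamma)}^{\Omega}/\Gamma$. $M$ is geometrically finite if $C(M)$ is the union of a compact set and finitely many cusps $(H_i\cap\overline{C(\Lambda_\Gamma)}^{\Omega})/\mathcal P_i$, where $H_i$ is a horoball based at a point $p_i\in\partial\Omega$ and $\mathcal P_i=\mathrm{Stab}_\Gamma(p_i)$ is a maximal parabolic subgroup of $\Gamma$. Geodesic flow. $H\Omega=(T\Omega\smallsetminus\{0\})/\mathbb{R}_+^*$, with projection $\pi$ to $\Omega$; $HM=H\Omega/\Gamma$. For $w=(x,[\xi])\in H\Omega$, $\varphi^t(w)$ is obtained by following for $d_\Omega$-time $t$ the straight line from $x$ in the direction $[\xi]$, $X$ is the generator of $\varphi^t$, and $x^+,x^-\in\partial\Omega$ are the forward and backward endpoints of this line. The stable manifold of $w$ is $\{(y,[yx^+])\}$ with $y$ on the horosphere based at $x^+$ through $x$; the unstable manifold is $\{(y,[x^-y])\}$ with $y$ on the horosphere based at $x^-$ through $x$. $E^s,E^u$ are their tangent distributions,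 $TH\Omega=\mathbb{R}X\oplus E^s\oplus E^u$ (and similarly on $HM$), and $\|aX+Z^s+Z^u\|=(a^2+F(d\pi Z^s)^2+F(d\pi Z^u)^2)^{1/2}$. The non-wandering set $NW\subset HM$ is the projection of $\{w\in H\Omega: x^+,x^-\in\Lambda_\Gamma\}$. The flow has a zero Lyapunov exponent if there are $w\in NW$ and a nonzero $Z\in E^s(w)\oplus E^u(w)$ with $\limsup_{t\to+\infty}\frac1t\ln\|d\varphi^tZ\|=0$. The flow is uniformly hyperbolic on $NW$ if there are a $\varphi^t$-invariant decomposition $THM=\mathbb{R}X\oplus E^s\oplus E^u$ at points of $NW$ and constants $a,C>0$ with $\|d\varphi^tZ^s\|\leq Ce^{-at}\|Z^s\|$, $\|d\varphi^{-t}Z^u\|\leq Ce^{-at}\|Z^u\|$ for $t\geq0$, $Z^s\in E^s$, $Z^u\in E^u$. *)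

theory Defs
  imports
    "HOL-Analysis.Analysis"
    "HOL-Library.Poly_Mapping"
    "Jordan_Normal_Form.Determinant"
begin

(* The dimension n is quantified inside the statement, so the spaces R^m, for varying m, are taken
   as subspaces of one Euclidean space of finitely supported real sequences. The instances below
   give finitely supported functions the inner product (sum over i of x_i y_i). *)

instantiation poly_mapping :: (type, real_vector) real_vector
begin

definition scaleR_poly_mapping :: "real \<Rightarrow> ('a \<Rightarrow>\<^sub>0 'b) \<Rightarrow> 'a \<Rightarrow>\<^sub>0 'b" where
  "scaleR_poly_mapping c x = Poly_Mapping.map (scaleR c) x"

lemma lookup_scaleR [simp]:
  fixes x :: "'a \<Rightarrow>\<^sub>0 'b"
  shows "Poly_Mapping.lookup (c *\<^sub>R x) i = c *\<^sub>R Poly_Mapping.lookup x i"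
  by (simp add: scaleR_poly_mapping_def Poly_Mapping.map.rep_eq when_def)

instance
  by standard
    (auto intro!: poly_mapping_eqI simp: lookup_add scaleR_add_right scaleR_add_left)

end

instantiation poly_mapping :: (type, real_inner) real_inner
begin

definition inner_poly_mapping :: "('a \<Rightarrow>\<^sub>0 'b) \<Rightarrow> ('a \<Rightarrow>\<^sub>0 'b) \<Rightarrow> real" where
  "inner_poly_mapping x y =
     (\<Sum>i\<in>Poly_Mapping.keys x. inner (Poly_Mapping.lookup x i) (Poly_Mapping.lookup y i))"

definition norm_poly_mapping :: "('a \<Rightarrow>\<^sub>0 'b) \<Rightarrow> real" where
  "norm_poly_mapping x = sqrt (inner x x)"

definition sgn_poly_mapping :: "('a \<Rightarrow>\<^sub>0 'b) \<Rightarrow> 'a \<Rightarrow>\<^sub>0 'b" where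
  "sgn_poly_mapping x = x /\<^sub>R norm x"

definition dist_poly_mapping :: "('a \<Rightarrow>\<^sub>0 'b) \<Rightarrow> ('a \<Rightarrow>\<^sub>0 'b) \<Rightarrow> real" where
  "dist_poly_mapping x y = norm (x - y)"

definition uniformity_poly_mapping :: "(('a \<Rightarrow>\<^sub>0 'b) \<times> ('a \<Rightarrow>\<^sub>0 'b)) filter" where
  "uniformity_poly_mapping = (INF e\<in>{0<..}. principal {(x, y). dist x y < e})"

definition open_poly_mapping :: "('a \<Rightarrow>\<^sub>0 'b) set \<Rightarrow> bool" where
  "open_poly_mapping U \<longleftrightarrow> (\<forall>x\<in>U. eventually (\<lambda>(x', y). x' = x \<longrightarrow> y \<in> U) uniformity)"

lemma inner_poly_mapping_superset:
  fixes x y :: "'a \<Rightarrow>\<^sub>0 'b"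
  assumes "finite A" "Poly_Mapping.keys x \<subseteq> A"
  shows "inner x y = (\<Sum>i\<in>A. inner (Poly_Mapping.lookup x i) (Poly_Mapping.lookup y i))"
  unfolding inner_poly_mapping_def
  by (rule sum.mono_neutral_left) (use assms in \<open>auto simp: in_keys_iff\<close>)

instance
proof
  fix x y z :: "'a \<Rightarrow>\<^sub>0 'b" and r :: real
  have f: "finite (Poly_Mapping.keys x \<union> Poly_Mapping.keys y)" by simp
  show "sgn x = x /\<^sub>R norm x" by (rule sgn_poly_mapping_def)
  show "dist x y = norm (x - y)" by (rule dist_poly_mapping_def)
  show "(uniformity :: (('a \<Rightarrow>\<^sub>0 'b) \<times> ('a \<Rightarrow>\<^sub>0 'b)) filter)
      = (INF e\<in>{0<..}. principal {(x, y). dist x y < e})"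
    by (rule uniformity_poly_mapping_def)
  show "open U \<longleftrightarrow> (\<forall>x\<in>U. eventually (\<lambda>(x', y). x' = x \<longrightarrow> y \<in> U) uniformity)"
    for U :: "('a \<Rightarrow>\<^sub>0 'b) set"
    by (rule open_poly_mapping_def)
  show "norm x = sqrt (inner x x)" by (rule norm_poly_mapping_def)
  show "inner x y = inner y x"
    using inner_poly_mapping_superset[OF f, of x y] inner_poly_mapping_superset[OF f, of y x]
    by (simp add: inner_commute)
  have k: "Poly_Mapping.keys (x + y) \<subseteq> Poly_Mapping.keys x \<union> Poly_Mapping.keys y" by (rule Poly_Mapping.keys_add)
  show "inner (x + y) z = inner x z + inner y z"
    using inner_poly_mapping_superset[OF f k, of z] inner_poly_mapping_superset[OF f, of x z]
      inner_poly_mapping_superset[OF f, of y z]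
    by (simp add: lookup_add inner_add_left sum.distrib)
  have k': "Poly_Mapping.keys (r *\<^sub>R x) \<subseteq> Poly_Mapping.keys x" by (auto simp: in_keys_iff)
  show "inner (r *\<^sub>R x) y = r * inner x y"
    using inner_poly_mapping_superset[OF _ k', of y]
    by (simp add: inner_poly_mapping_def[of x] sum_distrib_left)
  show "0 \<le> inner x x" by (simp add: inner_poly_mapping_def sum_nonneg)
  show "inner x x = 0 \<longleftrightarrow> x = 0"
  proof
    assume "inner x x = 0"
    then have "\<forall>i\<in>Poly_Mapping.keys x. inner (Poly_Mapping.lookup x i) (Poly_Mapping.lookup x i) = 0"
      unfolding inner_poly_mapping_def by (subst (asm) sum_nonneg_eq_0_iff) auto
    then show "x = 0" by (intro poly_mapping_eqI) (auto simp: in_keys_iff)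
  qed (simp add: inner_poly_mapping_def)
qed

end

type_synonym rseq = "nat \<Rightarrow>\<^sub>0 real"

definition Rn :: "nat \<Rightarrow> rseq set" where
  "Rn m = {v. Poly_Mapping.keys v \<subseteq> {..<m}}"

definition quotient_topology :: "'a topology \<Rightarrow> ('a \<Rightarrow> 'b) \<Rightarrow> 'b topology" where
  "quotient_topology X f =
     topology (\<lambda>U. U \<subseteq> f ` topspace X \<and> openin X {x \<in> topspace X. f x \<in> U})"

lemma openin_quotient_topology:
  "openin (quotient_topology X f) U \<longleftrightarrow>
     U \<subseteq> f ` topspace X \<and> openin X {x \<in> topspace X. f x \<in> U}"
proof -
  have "istopology (\<lambda>U. U \<subseteq> f ` topspace X \<and> openin X {x \<in> topspace X. f x \<in> U})"
    unfolding istopology_def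
  proof (intro conjI allI impI)
    fix S T
    assume S: "S \<subseteq> f ` topspace X \<and> openin X {x \<in> topspace X. f x \<in> S}"
      and T: "T \<subseteq> f ` topspace X \<and> openin X {x \<in> topspace X. f x \<in> T}"
    show "S \<inter> T \<subseteq> f ` topspace X" using S by blast
    have "{x \<in> topspace X. f x \<in> S \<inter> T}
        = {x \<in> topspace X. f x \<in> S} \<inter> {x \<in> topspace X. f x \<in> T}"
      by blast
    then show "openin X {x \<in> topspace X. f x \<in> S \<inter> T}" using S T by auto
  next
    fix K
    assume K: "\<forall>S\<in>K. S \<subseteq> f ` topspace X \<and> openin X {x \<in> topspace X. f x \<in> S}"
    show "\<Union> K \<subseteq> f ` topspace X" using K by blast
    have "{x \<in> topspace X. f x \<in> \<Union> K} = (\<Union>S\<in>K. {x \<in> topspace X. f x \<in> S})"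
      by blast
    then show "openin X {x \<in> topspace X. f x \<in> \<Union> K}" using K by auto
  qed
  then show ?thesis by (simp add: quotient_topology_def)
qed

lemma topspace_quotient_topology: "topspace (quotient_topology X f) = f ` topspace X"
proof (rule antisym)
  show "topspace (quotient_topology X f) \<subseteq> f ` topspace X"
    using openin_quotient_topology[of X f] openin_topspace by blast
  have "{x \<in> topspace X. f x \<in> f ` topspace X} = topspace X" by blast
  then have "openin (quotient_topology X f) (f ` topspace X)"
    by (simp add: openin_quotient_topology)
  then show "f ` topspace X \<subseteq> topspace (quotient_topology X f)"
    by (rule openin_subset)
qed

lemma quotient_map_quotient_topology: "quotient_map X (quotient_topology X f) f"
  unfolding quotient_map_def topspace_quotient_topology
  by (auto simp: openin_quotient_topology)

(* The points of P^n are the lines span {v} of R^(n+1). *)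
definition proj_space :: "nat \<Rightarrow> rseq set topology" where
  "proj_space n = quotient_topology (top_of_set (Rn (Suc n) - {0})) (\<lambda>v. span {v})"

(* A vector a \<noteq> 0 of R^(n+1) determines the affine chart of the lines not orthogonal to a, such a
   line being identified with its point v normalised by inner a v = 1. The ambient norm restricts
   to a Euclidean norm on this affine space, whose vector space of directions is chart_dirs. *)
definition affine_chart :: "nat \<Rightarrow> rseq \<Rightarrow> rseq set" where
  "affine_chart n a = {v \<in> Rn (Suc n). inner a v = 1}"

definition chart_dirs :: "nat \<Rightarrow> rseq \<Rightarrow> rseq set" where
  "chart_dirs n a = {v \<in> Rn (Suc n). inner a v = 0}"

definition in_chart :: "nat \<Rightarrow> rseq \<Rightarrow> rseq set set \<Rightarrow> rseq set" where
  "in_chart n a \<Omega> = {v \<in> affine_chart n a. span {v} \<in> \<Omega>}"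

definition properly_convex_in :: "nat \<Rightarrow> rseq \<Rightarrow> rseq set set \<Rightarrow> bool" where
  "properly_convex_in n a \<Omega> \<longleftrightarrow>
     a \<in> Rn (Suc n) \<and> a \<noteq> 0 \<and> \<Omega> \<noteq> {} \<and> openin (proj_space n) \<Omega> \<and>
     proj_space n closure_of \<Omega> \<subseteq> (\<lambda>v. span {v}) ` affine_chart n a \<and>
     convex (in_chart n a \<Omega>)"

(* From here on a properly convex open set is handled through its image D = in_chart n a \<Omega> in a
   chart a containing its closure, and points of the closure of \<Omega> are identified with points of
   the chart. As D is open in the chart, its boundary is closure D - D. *)
definition bdry :: "'v::real_normed_vector set \<Rightarrow> 'v set" where
  "bdry D = closure D - D"

definition strictly_convex :: "'v::real_normed_vector set \<Rightarrow> bool" where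
  "strictly_convex D \<longleftrightarrow>
     (\<forall>x\<in>bdry D. \<forall>y\<in>bdry D. x \<noteq> y \<longrightarrow> \<not> closed_segment x y \<subseteq> bdry D)"

(* The boundary is locally the zero set of a C^1 function f with nowhere vanishing gradient G. *)
definition C1_boundary :: "nat \<Rightarrow> rseq \<Rightarrow> rseq set \<Rightarrow> bool" where
  "C1_boundary n a D \<longleftrightarrow>
     (\<forall>\<xi>\<in>bdry D. \<exists>U (f :: rseq \<Rightarrow> real) G.
        openin (top_of_set (affine_chart n a)) U \<and> \<xi> \<in> U \<and>
        (\<forall>x\<in>U. G x \<in> chart_dirs n a \<and> G x \<noteq> 0 \<and>
           (f has_derivative (\<lambda>h. inner (G x) h)) (at x within U)) \<and>
        continuous_on U G \<and>
        bdry D \<inter> U = {x \<in> U. f x = 0})"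

section \<open>Hilbert geometry\<close>

definition ray_end :: "'v::real_normed_vector set \<Rightarrow> 'v \<Rightarrow> 'v \<Rightarrow> 'v" where
  "ray_end D x v = x + (THE s. 0 < s \<and> x + s *\<^sub>R v \<in> bdry D) *\<^sub>R v"

definition hilbert_dist :: "'v::real_normed_vector set \<Rightarrow> 'v \<Rightarrow> 'v \<Rightarrow> real" where
  "hilbert_dist D x y =
     (if x = y then 0
      else let p = ray_end D x (y - x); q = ray_end D x (x - y)
           in 1/2 * ln ((dist q y * dist p x) / (dist q x * dist p y)))"

definition finsler :: "'v::real_normed_vector set \<Rightarrow> 'v \<Rightarrow> 'v \<Rightarrow> real" where
  "finsler D x v =
     norm v / 2 * (1 / dist x (ray_end D x (- v)) + 1 / dist x (ray_end D x v))"

definition busemann :: "'v::real_normed_vector set \<Rightarrow> 'v \<Rightarrow> 'v \<Rightarrow> 'v \<Rightarrow> real" where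
  "busemann D \<xi> x y = Lim (at \<xi> within D) (\<lambda>z. hilbert_dist D y z - hilbert_dist D x z)"

definition horosphere :: "'v::real_normed_vector set \<Rightarrow> 'v \<Rightarrow> 'v \<Rightarrow> 'v set" where
  "horosphere D \<xi> x = {y \<in> D. busemann D \<xi> x y = 0}"

definition horoball :: "'v::real_normed_vector set \<Rightarrow> 'v \<Rightarrow> 'v \<Rightarrow> 'v set" where
  "horoball D \<xi> x = {y \<in> D. busemann D \<xi> x y < 0}"

section \<open>Groups of automorphisms\<close>

definition SL :: "nat \<Rightarrow> real mat monoid" where
  "SL m = \<lparr>carrier = {g \<in> carrier_mat m m. Determinant.det g = 1}, mult = (*), one = 1\<^sub>m m\<rparr>"

definition mat_act :: "real mat \<Rightarrow> rseq \<Rightarrow> rseq" where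
  "mat_act g v =
     (\<Sum>i<dim_row g. Poly_Mapping.single i (\<Sum>j<dim_col g. g $$ (i, j) * Poly_Mapping.lookup v j))"

definition Aut :: "nat \<Rightarrow> rseq set set \<Rightarrow> real mat monoid" where
  "Aut n \<Omega> = (SL (Suc n))\<lparr>carrier :=
     {g \<in> carrier (SL (Suc n)). (\<lambda>l. mat_act g ` l) ` \<Omega> = \<Omega>}\<rparr>"

definition discrete_mats :: "nat \<Rightarrow> real mat set \<Rightarrow> bool" where
  "discrete_mats m \<Gamma> \<longleftrightarrow>
     (\<forall>g\<in>\<Gamma>. \<exists>\<epsilon>>0. \<forall>h\<in>\<Gamma>. (\<forall>i<m. \<forall>j<m. \<bar>h $$ (i, j) - g $$ (i, j)\<bar> < \<epsilon>) \<longrightarrow> h = g)"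

definition torsion_mat :: "real mat \<Rightarrow> bool" where
  "torsion_mat g \<longleftrightarrow> (\<exists>k>0. g ^\<^sub>m k = 1\<^sub>m (dim_row g))"

definition torsion_free :: "real mat set \<Rightarrow> bool" where
  "torsion_free \<Gamma> \<longleftrightarrow> (\<forall>g\<in>\<Gamma>. torsion_mat g \<longrightarrow> g = 1\<^sub>m (dim_row g))"

(* the projective action read in the chart a *)
definition chart_act :: "rseq \<Rightarrow> real mat \<Rightarrow> rseq \<Rightarrow> rseq" where
  "chart_act a g x = mat_act g x /\<^sub>R inner a (mat_act g x)"

(* Elliptic elements are those fixing a point of D; in a discrete group they are the torsion
   elements. Both are excluded. *)
definition parabolic :: "rseq \<Rightarrow> rseq set \<Rightarrow> real mat \<Rightarrow> bool" where
  "parabolic a D g \<longleftrightarrow>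
     \<not> torsion_mat g \<and> (\<forall>x\<in>D. chart_act a g x \<noteq> x) \<and>
     (\<exists>!\<xi>. \<xi> \<in> bdry D \<and> chart_act a g \<xi> = \<xi>)"

definition parabolic_subgroup ::
  "nat \<Rightarrow> rseq \<Rightarrow> rseq set \<Rightarrow> real mat set \<Rightarrow> real mat set \<Rightarrow> bool" where
  "parabolic_subgroup n a D \<Gamma> P \<longleftrightarrow>
     subgroup P (SL (Suc n)) \<and> P \<subseteq> \<Gamma> \<and> (\<forall>g\<in>P. g \<noteq> 1\<^sub>m (Suc n) \<longrightarrow> parabolic a D g)"

(* The trivial group, which satisfies the condition on its nontrivial elements vacuously, is not
   allowed as the group of a cusp. *)
definition maximal_parabolic_subgroup ::
  "nat \<Rightarrow> rseq \<Rightarrow> rseq set \<Rightarrow> real mat set \<Rightarrow> real mat set \<Rightarrow> bool" where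
  "maximal_parabolic_subgroup n a D \<Gamma> P \<longleftrightarrow>
     parabolic_subgroup n a D \<Gamma> P \<and> P \<noteq> {1\<^sub>m (Suc n)} \<and>
     (\<forall>Q. parabolic_subgroup n a D \<Gamma> Q \<and> P \<subseteq> Q \<longrightarrow> Q = P)"

definition orbit :: "rseq \<Rightarrow> real mat set \<Rightarrow> rseq \<Rightarrow> rseq set" where
  "orbit a \<Gamma> x = (\<lambda>g. chart_act a g x) ` \<Gamma>"

definition stab :: "rseq \<Rightarrow> real mat set \<Rightarrow> rseq \<Rightarrow> real mat set" where
  "stab a \<Gamma> \<xi> = {g \<in> \<Gamma>. chart_act a g \<xi> = \<xi>}"

section \<open>Geometric finiteness\<close>

(* The choice of the base point in D does not matter. *)
definition limit_set :: "rseq \<Rightarrow> rseq set \<Rightarrow> real mat set \<Rightarrow> rseq set" where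
  "limit_set a D \<Gamma> =
     closure (orbit a \<Gamma> (SOME x. x \<in> D)) - orbit a \<Gamma> (SOME x. x \<in> D)"

definition core_lift :: "rseq \<Rightarrow> rseq set \<Rightarrow> real mat set \<Rightarrow> rseq set" where
  "core_lift a D \<Gamma> = closure ((convex hull limit_set a D \<Gamma>) \<inter> D) \<inter> D"

(* M = \<Omega>/\<Gamma> is the space of orbits. A finite family of horoballs is given by pairs (\<xi>, x) of a base
   point and a point of the bounding horosphere. The last condition on such a pair says that
   (H \<inter> core) / Stab(\<xi>) is a subset of the convex core, i.e. that it is mapped injectively to M. *)
definition geometrically_finite :: "nat \<Rightarrow> rseq \<Rightarrow> rseq set \<Rightarrow> real mat set \<Rightarrow> bool" where
  "geometrically_finite n a D \<Gamma> \<longleftrightarrow>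
     (\<exists>K F. compactin (quotient_topology (top_of_set D) (orbit a \<Gamma>)) K \<and> finite F \<and>
        (\<forall>(\<xi>, x)\<in>F. \<xi> \<in> bdry D \<and> x \<in> D \<and>
           maximal_parabolic_subgroup n a D \<Gamma> (stab a \<Gamma> \<xi>) \<and>
           (\<forall>g\<in>\<Gamma>. \<forall>y\<in>horoball D \<xi> x \<inter> core_lift a D \<Gamma>.
              chart_act a g y \<in> horoball D \<xi> x \<inter> core_lift a D \<Gamma> \<longrightarrow> g \<in> stab a \<Gamma> \<xi>)) \<and>
        orbit a \<Gamma> ` core_lift a D \<Gamma> =
          K \<union> (\<Union>(\<xi>, x)\<in>F. orbit a \<Gamma> ` (horoball D \<xi> x \<inter> core_lift a D \<Gamma>)))"

section \<open>The geodesic flow\<close>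

(* A half-line of directions is represented by its vector of Euclidean norm 1, so that H\<Omega> becomes
   a submanifold of a normed space. Differentials are derivatives within this submanifold, which
   are determined on its tangent vectors. The projection of H\<Omega> to \<Omega> is fst, and so is its
   differential. Objects on HM = H\<Omega>/\<Gamma> are given by their \<Gamma>-invariant lifts to H\<Omega>. *)
definition HOmega :: "nat \<Rightarrow> rseq \<Rightarrow> rseq set \<Rightarrow> (rseq \<times> rseq) set" where
  "HOmega n a D = {(x, u). x \<in> D \<and> u \<in> chart_dirs n a \<and> norm u = 1}"

definition flow ::
  "'v::real_normed_vector set \<Rightarrow> real \<Rightarrow> 'v \<times> 'v \<Rightarrow> 'v \<times> 'v" where
  "flow D t = (\<lambda>(x, u).
     (x + (THE s. x + s *\<^sub>R u \<in> D \<and> sgn s = sgn t \<and> hilbert_dist D x (x + s *\<^sub>R u) = \<bar>t\<bar>) *\<^sub>R u, u))"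

definition flow_field :: "'v::real_normed_vector set \<Rightarrow> 'v \<times> 'v \<Rightarrow> 'v \<times> 'v" where
  "flow_field D w = vector_derivative (\<lambda>t. flow D t w) (at 0)"

definition dflow ::
  "nat \<Rightarrow> rseq \<Rightarrow> rseq set \<Rightarrow> real \<Rightarrow> rseq \<times> rseq \<Rightarrow> rseq \<times> rseq \<Rightarrow> rseq \<times> rseq" where
  "dflow n a D t w = frechet_derivative (flow D t) (at w within HOmega n a D)"

definition fwd_end :: "'v::real_normed_vector set \<Rightarrow> 'v \<times> 'v \<Rightarrow> 'v" where
  "fwd_end D w = ray_end D (fst w) (snd w)"

definition bwd_end :: "'v::real_normed_vector set \<Rightarrow> 'v \<times> 'v \<Rightarrow> 'v" where
  "bwd_end D w = ray_end D (fst w) (- snd w)"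

definition stable_manifold ::
  "'v::real_normed_vector set \<Rightarrow> 'v \<times> 'v \<Rightarrow> ('v \<times> 'v) set" where
  "stable_manifold D w = {(y, sgn (fwd_end D w - y)) | y. y \<in> horosphere D (fwd_end D w) (fst w)}"

definition unstable_manifold ::
  "'v::real_normed_vector set \<Rightarrow> 'v \<times> 'v \<Rightarrow> ('v \<times> 'v) set" where
  "unstable_manifold D w = {(y, sgn (y - bwd_end D w)) | y. y \<in> horosphere D (bwd_end D w) (fst w)}"

definition tangent_space :: "'v::real_normed_vector set \<Rightarrow> 'v \<Rightarrow> 'v set" where
  "tangent_space S w =
     {Z. \<exists>c. c 0 = w \<and> (\<forall>\<^sub>F t in nhds 0. c t \<in> S) \<and> (c has_vector_derivative Z) (at 0)}"

definition E_stable :: "'v::real_normed_vector set \<Rightarrow> 'v \<times> 'v \<Rightarrow> ('v \<times> 'v) set" where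
  "E_stable D w = tangent_space (stable_manifold D w) w"

definition E_unstable :: "'v::real_normed_vector set \<Rightarrow> 'v \<times> 'v \<Rightarrow> ('v \<times> 'v) set" where
  "E_unstable D w = tangent_space (unstable_manifold D w) w"

definition hnorm :: "'v::real_normed_vector set \<Rightarrow> 'v \<times> 'v \<Rightarrow> 'v \<times> 'v \<Rightarrow> real" where
  "hnorm D w Z = (THE r. \<exists>\<alpha>. \<exists>Zs\<in>E_stable D w. \<exists>Zu\<in>E_unstable D w.
     Z = \<alpha> *\<^sub>R flow_field D w + Zs + Zu \<and>
     r = sqrt (\<alpha>\<^sup>2 + (finsler D (fst w) (fst Zs))\<^sup>2 + (finsler D (fst w) (fst Zu))\<^sup>2))"

(* the lift of the non-wandering set to H\<Omega> *)
definition NW_lift :: "nat \<Rightarrow> rseq \<Rightarrow> rseq set \<Rightarrow> real mat set \<Rightarrow> (rseq \<times> rseq) set" where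
  "NW_lift n a D \<Gamma> =
     {w \<in> HOmega n a D. fwd_end D w \<in> limit_set a D \<Gamma> \<and> bwd_end D w \<in> limit_set a D \<Gamma>}"

definition zero_Lyapunov_exponent ::
  "nat \<Rightarrow> rseq \<Rightarrow> rseq set \<Rightarrow> real mat set \<Rightarrow> bool" where
  "zero_Lyapunov_exponent n a D \<Gamma> \<longleftrightarrow>
     (\<exists>w\<in>NW_lift n a D \<Gamma>. \<exists>Zs\<in>E_stable D w. \<exists>Zu\<in>E_unstable D w. Zs + Zu \<noteq> 0 \<and>
        Limsup at_top (\<lambda>t. ereal (1 / t * ln (hnorm D (flow D t w) (dflow n a D t w (Zs + Zu))))) = 0)"

(* the action of g on H\<Omega>: x is moved by chart_act, and the half-line of u by its differential *)
definition H_act :: "rseq \<Rightarrow> real mat \<Rightarrow> rseq \<times> rseq \<Rightarrow> rseq \<times> rseq" where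
  "H_act a g = (\<lambda>(x, u).
     (chart_act a g x, sgn (vector_derivative (\<lambda>s. chart_act a g (x + s *\<^sub>R u)) (at 0))))"

definition dH_act ::
  "nat \<Rightarrow> rseq \<Rightarrow> rseq set \<Rightarrow> real mat \<Rightarrow> rseq \<times> rseq \<Rightarrow> rseq \<times> rseq \<Rightarrow> rseq \<times> rseq" where
  "dH_act n a D g w = frechet_derivative (H_act a g) (at w within HOmega n a D)"

(* As = A^s and Au = A^u are the summands of an arbitrary splitting over NW: fibrewise
   THM = RX + As + Au (direct), flow-invariant, and \<Gamma>-invariant so as to descend to HM. *)
definition uniformly_hyperbolic ::
  "nat \<Rightarrow> rseq \<Rightarrow> rseq set \<Rightarrow> real mat set \<Rightarrow> bool" where
  "uniformly_hyperbolic n a D \<Gamma> \<longleftrightarrow>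
     (\<exists>As Au :: rseq \<times> rseq \<Rightarrow> (rseq \<times> rseq) set.
        (\<forall>w\<in>NW_lift n a D \<Gamma>.
           subspace (As w) \<and> subspace (Au w) \<and>
           bij_betw (\<lambda>(\<alpha>, Zs, Zu). \<alpha> *\<^sub>R flow_field D w + Zs + Zu)
             (UNIV \<times> As w \<times> Au w) (tangent_space (HOmega n a D) w) \<and>
           (\<forall>t. dflow n a D t w ` As w = As (flow D t w) \<and>
                dflow n a D t w ` Au w = Au (flow D t w)) \<and>
           (\<forall>g\<in>\<Gamma>. dH_act n a D g w ` As w = As (H_act a g w) \<and>
                dH_act n a D g w ` Au w = Au (H_act a g w))) \<and>
        (\<exists>b>0. \<exists>C>0. \<forall>w\<in>NW_lift n a D \<Gamma>. \<forall>t\<ge>0.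
           (\<forall>Z\<in>As w. hnorm D (flow D t w) (dflow n a D t w Z) \<le> C * exp (- b * t) * hnorm D w Z) \<and>
           (\<forall>Z\<in>Au w. hnorm D (flow D (- t) w) (dflow n a D (- t) w Z)
                       \<le> C * exp (- b * t) * hnorm D w Z)))"

end

theory Submission
  imports Defs "HOL-Real_Asymp.Real_Asymp"
begin

text \<open>
The example is three-dimensional and fibres over the hyperbolic plane. A vector \<open>(v\<^sub>0, v\<^sub>1, v\<^sub>2, v\<^sub>3)\<close> is read
as a symmetric matrix \<open>X\<close> with diagonal \<open>v\<^sub>0, v\<^sub>2\<close> and off-diagonal entry \<open>v\<^sub>1\<close>, together with a height
\<open>v\<^sub>3\<close>. The positive definite matrices of trace 1 form a round disc, the projective model of the
hyperbolic plane, on which \<open>SL\<^sub>2(\<int>)\<close> acts by \<open>X \<mapsto> A X A\<^sup>T\<close>. The domain is the lens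
\<open>\<bar>v\<^sub>3\<bar> < width X\<close> over this disc, and the group is the principal congruence group of level 3, acting
trivially on the height. It is a torsion-free lattice of the disc, so its limit set is the whole
boundary circle of the disc, the convex core is the flat slice \<open>v\<^sub>3 = 0\<close>, a surface of finite area with
finitely many cusps, and geometric finiteness is the classical reduction theory of binary quadratic
forms (\<open>geometrically_finite_Gam\<close>).

For \<open>width X = sqrt (det X)\<close> the lens would be an ellipsoid and the quotient would be hyperbolic. The
width function is instead flattened inside every cusp. With \<open>prof r = r\<close> for \<open>r \<le> 2\<close> and
\<open>prof r = 2 + 2 ln (r / 2)\<close> beyond, it is the infimum of \<open>q * prof (sqrt (det X) / q)\<close> over the values
\<open>q\<close> of the quadratic form \<open>X\<close> at the primitive integer vectors. Each term is the perspective of a concave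
increasing function evaluated at concave functions of \<open>X\<close>, so \<open>width\<close> is concave and homogeneous, and
it is invariant under \<open>SL\<^sub>2(\<int>)\<close>. Horoballs at different cusps are disjoint (\<open>qf_disjoint\<close>), hence near
every \<open>X\<close> a single term is relevant, and since \<open>prof\<close> is continuously differentiable the boundary of the
lens is smooth over the open disc (\<open>bdry_normal_rank2\<close>). At the boundary circle the supporting plane is
vertical and unique because \<open>prof\<close> is unbounded (\<open>bdry_normal_rank1\<close>). Strict convexity comes from the
strict concavity of \<open>sqrt (det X)\<close> on matrices that are not proportional.

The slow geodesic is \<open>X = diag (r, 1 - r)\<close> with \<open>r \<longlonglongrightarrow> 1\<close>, which runs into the cusp of the vector
\<open>(0, 1)\<close>. The vertical direction is tangent to its stable manifold. In time \<open>t\<close> the differential of the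
flow contracts its Euclidean length by \<open>2 / (1 + e\<^sup>2\<^sup>t)\<close>, while the half-width of the lens
becomes \<open>prof (e\<^sup>t) / (1 + e\<^sup>2\<^sup>t)\<close>. The Finsler norm is the quotient, \<open>2 / prof (e\<^sup>t)\<close>, which is
\<open>1 / (1 + t - ln 2)\<close> for \<open>e\<^sup>t \<ge> 2\<close>: the Lyapunov exponent is zero and the decay is not exponential
(\<open>finsler_vertical_axis\<close>, \<open>zero_exponent\<close>). In an invariant hyperbolic splitting, the contracted
summand would have to contain the vertical vector up to a multiple of the flow direction
(\<open>no_hyperbolic_splitting\<close>), so there is no such splitting.
\<close>

section \<open>Convex domains and the rays to their boundary\<close>

text \<open>In a compact set a sequence that stays away from \<open>L\<close> has a cluster point other
than \<open>L\<close>.\<close>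
lemma tendsto_of_unique_cluster_point:
  fixes f :: "nat \<Rightarrow> 'a::metric_space"
  assumes K: "compact K" and f: "\<And>n. f n \<in> K"
    and u: "\<And>r l. strict_mono r \<Longrightarrow> (f \<circ> r) \<longlonglongrightarrow> l \<Longrightarrow> l = L"
  shows "f \<longlonglongrightarrow> L"
proof (rule ccontr)
  assume "\<not> ?thesis"
  then obtain e where e: "e > 0" and "\<forall>N. \<exists>n\<ge>N. e \<le> dist (f n) L"
    unfolding lim_sequentially by (metis not_less)
  then have inf: "\<exists>\<^sub>\<infinity>n. e \<le> dist (f n) L"
    by (simp add: INFM_nat_le)
  then obtain r :: "nat \<Rightarrow> nat" where r: "strict_mono r" and re: "\<And>n. e \<le> dist (f (r n)) L"
    using infinite_enumerate[of "{n. e \<le> dist (f n) L}"]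
    by (auto simp: INFM_iff_infinite)
  have "\<forall>n. (f \<circ> r) n \<in> K" using f by simp
  then obtain l q where q: "strict_mono q" and l: "((f \<circ> r) \<circ> q) \<longlonglongrightarrow> l"
    using K unfolding compact_def by blast
  have "strict_mono (r \<circ> q)" using r q by (simp add: strict_mono_o)
  then have "l = L" using u[of "r \<circ> q" l] l by (simp add: o_assoc)
  then have "(\<lambda>n. dist (f (r (q n))) L) \<longlonglongrightarrow> 0"
    using l by (simp add: tendsto_dist_iff[of "\<lambda>n. f (r (q n))"] o_def)
  then have "e \<le> 0"
    by (rule LIMSEQ_le_const) (use re in auto)
  then show False using e by simp
qed

text \<open>\<open>ray_end D x v\<close> is the point of the ray at this parameter; the parameter is
easier to compute with, since it is inverse homogeneous in \<open>v\<close>.\<close>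
definition ray_param :: "'v::real_normed_vector set \<Rightarrow> 'v \<Rightarrow> 'v \<Rightarrow> real" where
  "ray_param D x v = (THE s. 0 < s \<and> x + s *\<^sub>R v \<in> bdry D)"

lemma ray_end_eq: "ray_end D x v = x + ray_param D x v *\<^sub>R v"
  by (simp add: ray_end_def ray_param_def)

lemma point_towards:
  fixes x v :: "'v::real_vector"
  shows "x + b *\<^sub>R v + t *\<^sub>R (x - (x + b *\<^sub>R v)) = x + (b - t * b) *\<^sub>R v"
  by (simp add: scaleR_diff_left)

text \<open>\<open>D\<close> is a bounded convex set that is open in an affine space with space of
directions \<open>V\<close>. The ambient space may have infinite dimension, so finite dimension of
\<open>V\<close> enters as compactness of its unit ball.\<close>
locale convex_domain =
  fixes V D :: "'v::real_inner set"
  assumes subspace_V: "subspace V"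
    and compact_V: "compact (V \<inter> cball 0 1)"
    and nonempty_D: "D \<noteq> {}"
    and diff_in_V: "\<lbrakk>x \<in> D; y \<in> D\<rbrakk> \<Longrightarrow> x - y \<in> V"
    and rel_open: "x \<in> D \<Longrightarrow> \<exists>e>0. \<forall>v\<in>V. norm v < e \<longrightarrow> x + v \<in> D"
    and convex_D: "convex D"
    and bounded_D: "bounded D"
begin

lemmas V_intros = subspace_add[OF subspace_V] subspace_diff[OF subspace_V]
  subspace_scale[OF subspace_V] subspace_neg[OF subspace_V] subspace_0[OF subspace_V]

lemma compact_V_cball:
  assumes "r > 0"
  shows "compact (V \<inter> cball 0 r)"
proof -
  have "V \<inter> cball 0 r = (\<lambda>v. r *\<^sub>R v) ` (V \<inter> cball 0 1)"
  proof (intro equalityI subsetI)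
    fix v assume v: "v \<in> V \<inter> cball 0 r"
    then have "v = r *\<^sub>R (v /\<^sub>R r)" "v /\<^sub>R r \<in> V \<inter> cball 0 1"
      using assms by (auto intro!: V_intros simp: field_simps)
    then show "v \<in> (\<lambda>v. r *\<^sub>R v) ` (V \<inter> cball 0 1)" by blast
  next
    fix v assume "v \<in> (\<lambda>v. r *\<^sub>R v) ` (V \<inter> cball 0 1)"
    then show "v \<in> V \<inter> cball 0 r" using assms
      by (auto intro!: V_intros simp: mult_left_le)
  qed
  then show ?thesis using compact_V by (metis compact_scaling)
qed

lemma closed_V: "closed V"
  unfolding closed_sequential_limits
proof (intro allI impI, elim conjE)
  fix x l assume x: "\<forall>n. x n \<in> V" and l: "x \<longlonglongrightarrow> l"
  obtain r where r: "r > 0" "\<And>n. norm (x n) \<le> r"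
    using convergent_imp_bounded[OF l] by (auto simp: bounded_pos)
  have "closed (V \<inter> cball 0 r)" using compact_V_cball[OF r(1)] compact_imp_closed by blast
  moreover have "\<forall>n. x n \<in> V \<inter> cball 0 r" using x r by auto
  ultimately show "l \<in> V" using l unfolding closed_sequential_limits by blast
qed

lemma compact_closure_D: "compact (closure D)"
  and closure_diff_in_V: "\<lbrakk>x \<in> closure D; y \<in> closure D\<rbrakk> \<Longrightarrow> x - y \<in> V"
proof -
  obtain x0 where x0: "x0 \<in> D" using nonempty_D by blast
  obtain r where r: "r > 0" "\<And>x. x \<in> D \<Longrightarrow> norm (x - x0) \<le> r"
  proof -
    obtain e where e: "\<And>x. x \<in> D \<Longrightarrow> dist x0 x \<le> e"
      using bounded_D by (auto simp: bounded_any_center[of D x0])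
    show ?thesis using e by (intro that[of "max e 1"]) (force simp: dist_norm norm_minus_commute)+
  qed
  let ?K = "(\<lambda>v. x0 + v) ` (V \<inter> cball 0 r)"
  have K: "compact ?K" using compact_translation[OF compact_V_cball[OF r(1)]] .
  have "D \<subseteq> ?K"
  proof
    fix x assume "x \<in> D"
    then have "x - x0 \<in> V \<inter> cball 0 r" "x = x0 + (x - x0)" using x0 r diff_in_V by auto
    then show "x \<in> ?K" by blast
  qed
  then have sub: "closure D \<subseteq> ?K" using K compact_imp_closed closure_minimal by blast
  then show "compact (closure D)"
    using compact_Int_closed[OF K closed_closure[of D]] by (simp add: inf.absorb2)
  assume "x \<in> closure D" "y \<in> closure D"
  then obtain v w where "v \<in> V" "w \<in> V" "x = x0 + v" "y = x0 + w" using sub by blast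
  then show "x - y \<in> V" by (simp add: V_intros)
qed

lemma bdry_D_closure: "x \<in> bdry D \<Longrightarrow> x \<in> closure D" "x \<in> bdry D \<Longrightarrow> x \<notin> D"
  by (auto simp: bdry_def)

lemma D_closure: "x \<in> D \<Longrightarrow> x \<in> closure D"
  using closure_subset by blast

lemma compact_bdry: "compact (bdry D)"
proof -
  have "closed (bdry D)"
    unfolding closed_sequential_limits
  proof (intro allI impI, elim conjE)
    fix x l assume x: "\<forall>n. x n \<in> bdry D" and l: "x \<longlonglongrightarrow> l"
    have lc: "l \<in> closure D"
      using x l closed_closure[of D] unfolding closed_sequential_limits bdry_def by blast
    have "l \<notin> D"
    proof
      assume "l \<in> D"
      then obtain e where e: "e > 0" "\<And>v. v \<in> V \<Longrightarrow> norm v < e \<Longrightarrow> l + v \<in> D"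
        using rel_open by blast
      obtain n where n: "dist (x n) l < e" using l e(1) unfolding lim_sequentially by blast
      have "x n - l \<in> V" using x bdry_D_closure closure_diff_in_V lc by blast
      then have "l + (x n - l) \<in> D" using e(2) n unfolding dist_norm by blast
      then show False using x bdry_D_closure by auto
    qed
    then show "l \<in> bdry D" using lc by (simp add: bdry_def)
  qed
  moreover have "bdry D = closure D \<inter> bdry D" by (auto simp: bdry_def)
  ultimately show ?thesis using compact_closure_D compact_Int_closed by metis
qed

text \<open>A point \<open>y'\<close> of \<open>D\<close> near \<open>y\<close> is joined to a point
near \<open>x\<close>, chosen such that the given point lies on this segment; both ends are in the
convex set \<open>D\<close>.\<close>
lemma half_open_segment:
  assumes x: "x \<in> D" and y: "y \<in> closure D" and t: "0 < t" "t \<le> 1"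
  shows "y + t *\<^sub>R (x - y) \<in> D"
proof (cases "t = 1")
  case True
  then show ?thesis using x by simp
next
  case False
  then have t1: "t < 1" using t by simp
  obtain e where e: "e > 0" "\<And>v. v \<in> V \<Longrightarrow> norm v < e \<Longrightarrow> x + v \<in> D" using rel_open[OF x] by blast
  define d where "d = e * t / (1 - t)"
  have "d > 0" using e t t1 by (simp add: d_def)
  then obtain y' where y': "y' \<in> D" "dist y' y < d" using y closure_approachable by blast
  define w where "w = ((1 - t) / t) *\<^sub>R (y - y')"
  have "w \<in> V" unfolding w_def using y' y D_closure by (intro V_intros closure_diff_in_V) auto
  moreover have "norm w < e"
  proof -
    have "norm w = (1 - t) / t * norm (y - y')" using t t1 by (simp add: w_def)
    also have "\<dots> < (1 - t) / t * d" using y'(2) t t1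
      by (intro mult_strict_left_mono) (auto simp: dist_norm norm_minus_commute)
    also have "\<dots> = e" using t t1 by (simp add: d_def)
    finally show ?thesis .
  qed
  ultimately have "x + w \<in> D" using e by blast
  then have "(1 - t) *\<^sub>R y' + t *\<^sub>R (x + w) \<in> D"
    using y'(1) convex_D t by (intro convexD) auto
  moreover have "t *\<^sub>R w = (1 - t) *\<^sub>R (y - y')" using t by (simp add: w_def)
  then have "(1 - t) *\<^sub>R y' + t *\<^sub>R (x + w) = y + t *\<^sub>R (x - y)"
    by (simp add: algebra_simps)
  ultimately show ?thesis by simp
qed

lemma ray_unique:
  assumes x: "x \<in> D" and s: "0 < s" "x + s *\<^sub>R v \<in> bdry D" and s': "0 \<le> s'" "x + s' *\<^sub>R v \<in> closure D"
  shows "s' \<le> s"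
proof (rule ccontr)
  assume "\<not> s' \<le> s"
  then have l: "s < s'" by simp
  have "x + s' *\<^sub>R v + (1 - s/s') *\<^sub>R (x - (x + s' *\<^sub>R v)) \<in> D"
    using s s' l by (intro half_open_segment x) (auto simp: field_simps)
  moreover have "s' - (1 - s/s') * s' = s" using s l by (simp add: field_simps)
  then have "x + s' *\<^sub>R v + (1 - s/s') *\<^sub>R (x - (x + s' *\<^sub>R v)) = x + s *\<^sub>R v"
    by (simp only: point_towards)
  ultimately have "x + s *\<^sub>R v \<in> D" by (simp only:)
  then show False using s bdry_D_closure by blast
qed

lemma ray_exists:
  assumes x: "x \<in> D" and v: "v \<in> V" "v \<noteq> 0"
  shows "\<exists>s>0. x + s *\<^sub>R v \<in> bdry D"
proof -
  let ?S = "{s. 0 \<le> s \<and> x + s *\<^sub>R v \<in> closure D}"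
  have cl: "closed ?S"
  proof -
    have "closed ((\<lambda>s. x + s *\<^sub>R v) -` closure D)"
      by (intro continuous_closed_vimage closed_closure) (auto intro!: continuous_intros)
    moreover have "?S = {0..} \<inter> (\<lambda>s. x + s *\<^sub>R v) -` closure D" by auto
    ultimately show ?thesis by auto
  qed
  obtain r where r: "\<And>y. y \<in> closure D \<Longrightarrow> norm y \<le> r"
    using compact_imp_bounded[OF compact_closure_D] by (auto simp: bounded_iff)
  have "s \<le> (r + norm x) / norm v" if "s \<in> ?S" for s
  proof -
    have "norm (s *\<^sub>R v) \<le> norm (x + s *\<^sub>R v) + norm x"
      by (metis add_diff_cancel_left' norm_triangle_ineq4)
    also have "\<dots> \<le> r + norm x" using r that by simp
    finally show ?thesis using that v by (simp add: field_simps)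
  qed
  then have "bounded ?S"
    unfolding bounded_iff by (intro exI[of _ "(r + norm x) / norm v"]) auto
  then have "compact ?S" using cl compact_eq_bounded_closed by blast
  moreover have "0 \<in> ?S" using x D_closure by simp
  ultimately obtain s where s: "s \<in> ?S" "\<And>s'. s' \<in> ?S \<Longrightarrow> s' \<le> s"
    using compact_attains_sup[of ?S] by blast
  have ext: "\<exists>d>0. y + d *\<^sub>R v \<in> D" if y: "y \<in> D" for y
  proof -
    obtain e where e: "e > 0" "\<And>v. v \<in> V \<Longrightarrow> norm v < e \<Longrightarrow> y + v \<in> D" using rel_open[OF y] by blast
    have "norm ((e / (2 * norm v)) *\<^sub>R v) < e" using v e by simp
    then have "y + (e / (2 * norm v)) *\<^sub>R v \<in> D" using v by (intro e(2)) (auto intro!: V_intros)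
    then show ?thesis using e v by (intro exI[of _ "e / (2 * norm v)"]) auto
  qed
  have nD: "x + s *\<^sub>R v \<notin> D"
  proof
    assume "x + s *\<^sub>R v \<in> D"
    then obtain d where "d > 0" "x + s *\<^sub>R v + d *\<^sub>R v \<in> D" using ext by blast
    then have "s + d \<in> ?S" using s D_closure by (simp add: algebra_simps)
    then show False using s(2)[of "s + d"] \<open>d > 0\<close> by simp
  qed
  then have "s \<noteq> 0" using x by auto
  then show ?thesis using s nD by (intro exI[of _ s]) (auto simp: bdry_def)
qed

lemma ray_param_eqI:
  assumes "x \<in> D" "0 < s" "x + s *\<^sub>R v \<in> bdry D"
  shows "ray_param D x v = s"
  unfolding ray_param_def
proof (rule the_equality)
  fix r assume "0 < r \<and> x + r *\<^sub>R v \<in> bdry D"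
  then show "r = s" using ray_unique[of x r v s] ray_unique[of x s v r] assms bdry_D_closure by force
qed (use assms in simp)

lemma
  assumes "x \<in> D" "v \<in> V" "v \<noteq> 0"
  shows ray_param_pos: "0 < ray_param D x v"
    and ray_param_bdry: "x + ray_param D x v *\<^sub>R v \<in> bdry D"
    and ray_end_bdry: "ray_end D x v \<in> bdry D"
  using ray_exists[OF assms] ray_param_eqI[OF assms(1)] by (auto simp: ray_end_eq)

lemma in_D_if_less_ray_param:
  assumes "x \<in> D" "v \<in> V" "v \<noteq> 0" "0 \<le> s" "s < ray_param D x v"
  shows "x + s *\<^sub>R v \<in> D"
proof -
  let ?r = "ray_param D x v"
  have r: "?r > 0" using ray_param_pos assms by blast
  have "x + ?r *\<^sub>R v + (1 - s / ?r) *\<^sub>R (x - (x + ?r *\<^sub>R v)) \<in> D"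
    using assms r ray_param_bdry[OF assms(1-3)]
    by (intro half_open_segment) (auto simp: field_simps bdry_def)
  moreover have "?r - (1 - s / ?r) * ?r = s" using r by (simp add: field_simps)
  then have "x + ?r *\<^sub>R v + (1 - s / ?r) *\<^sub>R (x - (x + ?r *\<^sub>R v)) = x + s *\<^sub>R v"
    by (simp only: point_towards)
  ultimately show ?thesis by (simp only:)
qed

lemma less_ray_param:
  assumes "x \<in> D" "v \<in> V" "v \<noteq> 0" "x + s *\<^sub>R v \<in> D"
  shows "s < ray_param D x v"
proof (rule ccontr)
  assume "\<not> ?thesis"
  then have l: "ray_param D x v \<le> s" by simp
  have r: "ray_param D x v > 0" using ray_param_pos assms by blast
  have "ray_param D x v = s"
    using ray_unique[OF assms(1) r ray_param_bdry[OF assms(1-3)], of s] D_closure assms l r by force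
  then show False using ray_param_bdry[OF assms(1-3)] assms bdry_D_closure by force
qed

lemma ray_param_scale:
  assumes "x \<in> D" "v \<in> V" "v \<noteq> 0" "c > 0"
  shows "ray_param D x (c *\<^sub>R v) = ray_param D x v / c"
  using assms ray_param_pos[OF assms(1-3)] ray_param_bdry[OF assms(1-3)]
  by (intro ray_param_eqI) auto

lemma ray_end_scale:
  assumes "x \<in> D" "v \<in> V" "v \<noteq> 0" "c > 0"
  shows "ray_end D x (c *\<^sub>R v) = ray_end D x v"
  using assms by (simp add: ray_end_eq ray_param_scale)

text \<open>Ray ends of a convergent sequence of rays lie in the compact boundary, and every cluster
point lies on the limit ray, which meets the boundary only once.\<close>
lemma continuous_on_ray_end:
  "continuous_on (D \<times> (V - {0})) (\<lambda>(x, v). ray_end D x v)"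
  unfolding continuous_on_sequentially
proof (intro allI ballI impI, elim conjE)
  fix w a assume a: "a \<in> D \<times> (V - {0})" and w: "\<forall>n. w n \<in> D \<times> (V - {0})" and lim: "w \<longlonglongrightarrow> a"
  let ?f = "\<lambda>(x, v). ray_end D x v"
  obtain x v where xv: "a = (x, v)" "x \<in> D" "v \<in> V" "v \<noteq> 0" using a by auto
  show "(?f \<circ> w) \<longlonglongrightarrow> ?f a"
  proof (rule tendsto_of_unique_cluster_point[OF compact_bdry])
    fix n show "(?f \<circ> w) n \<in> bdry D"
      using w[rule_format, of n] by (auto simp: split_def intro!: ray_end_bdry)
  next
    fix r l assume r: "strict_mono r" and l: "(?f \<circ> w \<circ> r) \<longlonglongrightarrow> l"
    let ?x = "\<lambda>n. fst (w (r n))" and ?v = "\<lambda>n. snd (w (r n))" and ?e = "\<lambda>n. ?f (w (r n))"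
    have x: "?x \<longlonglongrightarrow> x" using tendsto_fst[OF LIMSEQ_subseq_LIMSEQ[OF lim r]] xv by (simp add: o_def)
    have v: "?v \<longlonglongrightarrow> v" using tendsto_snd[OF LIMSEQ_subseq_LIMSEQ[OF lim r]] xv by (simp add: o_def)
    have l': "?e \<longlonglongrightarrow> l" using l by (simp add: o_def)
    have wr: "?x n \<in> D" "?v n \<in> V" "?v n \<noteq> 0" for n using w[rule_format, of "r n"] by auto
    have eb: "?e n \<in> bdry D" for n using ray_end_bdry wr by (simp add: split_def)
    have lb: "l \<in> bdry D"
      using closed_sequentially[OF compact_imp_closed[OF compact_bdry] eb l'] .
    have s: "ray_param D (?x n) (?v n) = norm (?e n - ?x n) / norm (?v n)" for n
      using wr[of n] ray_param_pos[OF wr[of n]] by (simp add: ray_end_eq split_def)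
    have slim: "(\<lambda>n. ray_param D (?x n) (?v n)) \<longlonglongrightarrow> norm (l - x) / norm v"
      unfolding s by (intro tendsto_intros l' x v) (use xv in auto)
    have "(\<lambda>n. ?x n + ray_param D (?x n) (?v n) *\<^sub>R ?v n) \<longlonglongrightarrow> x + (norm (l - x) / norm v) *\<^sub>R v"
      by (intro tendsto_intros slim x v)
    then have "?e \<longlonglongrightarrow> x + (norm (l - x) / norm v) *\<^sub>R v"
      by (simp add: ray_end_eq split_def)
    then have le: "l = x + (norm (l - x) / norm v) *\<^sub>R v"
      using l' LIMSEQ_unique by blast
    have "l \<noteq> x" using lb xv bdry_D_closure by blast
    then have "ray_param D x v = norm (l - x) / norm v"
      using le lb xv by (intro ray_param_eqI) auto
    then show "l = ?f a" using le xv by (simp add: ray_end_eq)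
  qed
qed

lemma continuous_on_ray_param:
  "continuous_on (D \<times> (V - {0})) (\<lambda>(x, v). ray_param D x v)"
proof -
  have "continuous_on (D \<times> (V - {0})) (\<lambda>w. norm ((case w of (x, v) \<Rightarrow> ray_end D x v) - fst w) / norm (snd w))"
    by (intro continuous_intros continuous_on_ray_end) auto
  then show ?thesis
    by (rule continuous_on_eq) (auto simp: ray_end_eq dest!: ray_param_pos split: if_splits)
qed

text \<open>The cross ratio in terms of the parameters of the two boundary points on the line, with
\<open>x\<close> at parameter 0 and \<open>y\<close> at parameter 1.\<close>
lemma hilbert_dist_eq:
  assumes x: "x \<in> D" and y: "y \<in> D" and xy: "x \<noteq> y"
  defines "P \<equiv> ray_param D x (y - x)" and "Q \<equiv> ray_param D x (x - y)"
  shows "hilbert_dist D x y = 1/2 * ln (((Q + 1) * P) / (Q * (P - 1)))" "1 < P" "0 < Q"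
proof -
  have V: "y - x \<in> V" "x - y \<in> V" "y - x \<noteq> 0" "x - y \<noteq> 0" using assms diff_in_V by auto
  show P: "1 < P" unfolding P_def using less_ray_param[of x "y - x" 1] x y V by simp
  show Q: "0 < Q" unfolding Q_def using ray_param_pos x V by blast
  let ?d = "norm (y - x)"
  have q: "ray_end D x (x - y) - y = (Q + 1) *\<^sub>R (x - y)"
    and q': "ray_end D x (x - y) - x = Q *\<^sub>R (x - y)"
    and p: "ray_end D x (y - x) - x = P *\<^sub>R (y - x)"
    and p': "ray_end D x (y - x) - y = (P - 1) *\<^sub>R (y - x)"
    by (simp_all add: ray_end_eq P_def Q_def algebra_simps)
  have "dist (ray_end D x (x - y)) y = (Q + 1) * ?d" "dist (ray_end D x (x - y)) x = Q * ?d"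
    "dist (ray_end D x (y - x)) x = P * ?d" "dist (ray_end D x (y - x)) y = (P - 1) * ?d"
    unfolding dist_norm q q' p p' using P Q by (simp_all add: norm_minus_commute)
  then show "hilbert_dist D x y = 1/2 * ln (((Q + 1) * P) / (Q * (P - 1)))"
    using xy by (simp add: hilbert_dist_def Let_def)
qed

end

section \<open>Geodesic flow, normals and Busemann functions of smooth convex domains\<close>

context convex_domain
begin

lemma hilbert_dist_line:
  fixes s :: real
  assumes x: "x \<in> D" and u: "u \<in> V" "u \<noteq> 0" and s: "x + s *\<^sub>R u \<in> D"
  defines "a \<equiv> ray_param D x u" and "b \<equiv> ray_param D x (- u)"
  defines "L \<equiv> 1/2 * ln (((b + s) * a) / (b * (a - s)))"
  shows "- b < s" "s < a" "hilbert_dist D x (x + s *\<^sub>R u) = \<bar>L\<bar>" "sgn L = sgn s"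
proof -
  have u': "- u \<in> V" "- u \<noteq> 0" using u V_intros by auto
  have a: "a > 0" and b: "b > 0" unfolding a_def b_def using ray_param_pos x u u' by auto
  show sa: "s < a" unfolding a_def using less_ray_param x u s by blast
  show sb: "- b < s" unfolding b_def using less_ray_param[OF x u', of "- s"] s by simp
  show sg: "sgn L = sgn s"
  proof -
    consider "s > 0" | "s = 0" | "s < 0" by linarith
    then show ?thesis
    proof cases
      case 1
      then have "b * (a - s) < (b + s) * a" using a b by (simp add: algebra_simps add_pos_pos)
      moreover have "0 < b * (a - s)" using sa b by simp
      ultimately have "1 < ((b + s) * a) / (b * (a - s))" by (simp only: less_divide_eq_1_pos)
      then have "L > 0" unfolding L_def by simp
      then show ?thesis using 1 by simp
    next
      case 2
      then show ?thesis using a b by (simp add: L_def)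
    next
      case 3
      then have "a * s < 0" "b * s < 0" using a b by (auto intro: mult_pos_neg)
      then have "(b + s) * a < b * (a - s)" by (simp add: algebra_simps)
      moreover have "0 < (b + s) * a" using sb a by simp
      moreover have "0 < b * (a - s)" using sa b by simp
      ultimately have "L < 0" unfolding L_def by simp
      then show ?thesis using 3 by simp
    qed
  qed
  show "hilbert_dist D x (x + s *\<^sub>R u) = \<bar>L\<bar>"
  proof -
    consider "s > 0" | "s = 0" | "s < 0" by linarith
    then show ?thesis
    proof cases
      case 1
      have P: "ray_param D x (s *\<^sub>R u) = a / s" unfolding a_def using x u 1 by (rule ray_param_scale)
      have Q: "ray_param D x (s *\<^sub>R (- u)) = b / s" unfolding b_def using x u' 1 by (rule ray_param_scale)
      have "hilbert_dist D x (x + s *\<^sub>R u) = 1/2 * ln (((b/s + 1) * (a/s)) / (b/s * (a/s - 1)))"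
        using hilbert_dist_eq(1)[OF x s] 1 u P Q by simp
      also have "((b/s + 1) * (a/s)) / (b/s * (a/s - 1)) = ((b + s) * a) / (b * (a - s))"
        using 1 a b sa by (auto simp: divide_simps algebra_simps)
      finally show ?thesis using sg 1 by (metis L_def abs_of_pos sgn_greater)
    next
      case 2
      then show ?thesis using a b by (simp add: L_def hilbert_dist_def)
    next
      case 3
      have s3: "- s > 0" using 3 by simp
      have P: "ray_param D x (- s *\<^sub>R u) = a / - s" unfolding a_def using x u s3 by (rule ray_param_scale)
      have Q: "ray_param D x (- s *\<^sub>R (- u)) = b / - s" unfolding b_def using x u' s3 by (rule ray_param_scale)
      have "hilbert_dist D x (x + s *\<^sub>R u) = 1/2 * ln (((a/-s + 1) * (b/-s)) / (a/-s * (b/-s - 1)))"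
        using hilbert_dist_eq(1)[OF x s] 3 u P Q by simp
      also have "((a/-s + 1) * (b/-s)) / (a/-s * (b/-s - 1)) = inverse (((b + s) * a) / (b * (a - s)))"
      proof -
        define r where "r = - s"
        have r: "r > 0" "r < b" "s = - r" using 3 sb by (auto simp: r_def)
        have "((a/r + 1) * (b/r)) / (a/r * (b/r - 1)) = ((a + r) * b) / (a * (b - r))"
          using r a b by (auto simp: divide_simps algebra_simps)
        then show ?thesis unfolding r(3) by (simp add: mult.commute)
      qed
      also have "1/2 * ln \<dots> = - L"
        using a b sa sb by (simp add: L_def ln_inverse del: inverse_divide)
      finally show ?thesis using sg 3 by (metis abs_of_neg sgn_less)
    qed
  qed
qed

end

text \<open>The Euclidean displacement after Hilbert time \<open>t\<close> on a chord whose ends are at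
distance \<open>a\<close> ahead and \<open>b\<close> behind. It solves \<open>(b + s) a / (b (a - s)) =
exp (2 t)\<close> for \<open>s\<close>.\<close>
definition flow_shift :: "real \<Rightarrow> real \<Rightarrow> real \<Rightarrow> real" where
  "flow_shift a b t = a * b * (exp (2 * t) - 1) / (a + exp (2 * t) * b)"

context convex_domain
begin

lemma flow_eq:
  fixes t :: real
  assumes x: "x \<in> D" and u: "u \<in> V" "u \<noteq> 0"
  defines "s \<equiv> flow_shift (ray_param D x u) (ray_param D x (- u)) t"
  shows "x + s *\<^sub>R u \<in> D" "flow D t (x, u) = (x + s *\<^sub>R u, u)"
proof -
  define a where "a = ray_param D x u"
  define b where "b = ray_param D x (- u)"
  define E where "E = exp (2 * t)"
  have u': "- u \<in> V" "- u \<noteq> 0" using u V_intros by auto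
  have a: "a > 0" and b: "b > 0" unfolding a_def b_def using ray_param_pos x u u' by auto
  have E: "E > 0" by (simp add: E_def)
  have den: "a + E * b > 0" using a b E by (simp add: add_pos_pos)
  have s: "s = a * b * (E - 1) / (a + E * b)"
    by (simp add: s_def flow_shift_def a_def b_def E_def)
  have sa: "s < a"
  proof -
    have "a * b * (E - 1) < a * (a + E * b)" using a b by (simp add: algebra_simps add_pos_pos)
    then show ?thesis unfolding s using den by (simp add: divide_less_eq)
  qed
  have sb: "- b < s"
  proof -
    have "0 < E * (a * b)" "0 < E * (b * b)" using a b E by auto
    then have "- b * (a + E * b) < a * b * (E - 1)" by (simp add: algebra_simps)
    then show ?thesis unfolding s using den by (simp add: less_divide_eq)
  qed
  show sD: "x + s *\<^sub>R u \<in> D"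
  proof (cases "s \<ge> 0")
    case True
    then show ?thesis using in_D_if_less_ray_param x u sa by (simp add: a_def)
  next
    case False
    then show ?thesis using in_D_if_less_ray_param[OF x u', of "- s"] sb by (simp add: b_def)
  qed
  have char: "(x + r *\<^sub>R u \<in> D \<and> sgn r = sgn t \<and> hilbert_dist D x (x + r *\<^sub>R u) = \<bar>t\<bar>) \<longleftrightarrow> r = s" for r
  proof (cases "x + r *\<^sub>R u \<in> D")
    case True
    define L where "L = 1/2 * ln (((b + r) * a) / (b * (a - r)))"
    have r: "- b < r" "r < a" "hilbert_dist D x (x + r *\<^sub>R u) = \<bar>L\<bar>" "sgn L = sgn r"
      using hilbert_dist_line[OF x u True] unfolding a_def b_def L_def by auto
    have "(x + r *\<^sub>R u \<in> D \<and> sgn r = sgn t \<and> hilbert_dist D x (x + r *\<^sub>R u) = \<bar>t\<bar>) \<longleftrightarrow> L = t"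
      using True r by (metis abs_sgn abs_eq_iff sgn_minus sgn_0_0 mult.commute mult_sgn_abs)
    also have "\<dots> \<longleftrightarrow> ln (((b + r) * a) / (b * (a - r))) = 2 * t" by (auto simp: L_def)
    also have "\<dots> \<longleftrightarrow> ((b + r) * a) / (b * (a - r)) = E"
      using r a b unfolding E_def by (metis (no_types, opaque_lifting) add.commute diff_gt_0_iff_gt divide_pos_pos exp_ln ln_exp mult_pos_pos neg_less_iff_less real_0_less_add_iff)
    also have "\<dots> \<longleftrightarrow> (b + r) * a = E * (b * (a - r))"
      using r a b by (simp add: divide_eq_eq)
    also have "\<dots> \<longleftrightarrow> r * (a + E * b) = a * b * (E - 1)" by (auto simp: algebra_simps)
    also have "\<dots> \<longleftrightarrow> r = s" using den unfolding s by (simp add: eq_divide_eq)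
    finally show ?thesis .
  next
    case False
    then show ?thesis using sD by auto
  qed
  show "flow D t (x, u) = (x + s *\<^sub>R u, u)"
    unfolding flow_def by (simp add: char)
qed

lemma finsler_eq:
  assumes x: "x \<in> D" and v: "v \<in> V" "v \<noteq> 0"
  shows "finsler D x v = 1/2 * (1 / ray_param D x (- v) + 1 / ray_param D x v)"
proof -
  have v': "- v \<in> V" "- v \<noteq> 0" using v V_intros by auto
  show ?thesis
    using v ray_param_pos[OF x v] ray_param_pos[OF x v']
    by (simp add: finsler_def ray_end_eq dist_norm field_simps)
qed

end

text \<open>A subgradient that depends continuously on the point is a derivative, because the two
subgradient inequalities at \<open>x\<close> and \<open>y\<close> enclose the error by \<open>inner (G y
- G x) (y - x)\<close>.\<close>
lemma has_derivative_of_subgradient: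
  fixes f :: "'a::real_inner \<Rightarrow> real"
  assumes G: "continuous_on U G"
    and sub: "\<And>x y. \<lbrakk>x \<in> U; y \<in> U\<rbrakk> \<Longrightarrow> inner (G x) (y - x) \<le> f y - f x"
    and x: "x \<in> U"
  shows "(f has_derivative (\<lambda>h. inner (G x) h)) (at x within U)"
  unfolding has_derivative_within_alt
proof (intro conjI allI impI)
  show "bounded_linear (inner (G x))" by (rule bounded_linear_inner_right)
  fix e :: real assume e: "e > 0"
  then obtain d where d: "d > 0" "\<And>y. y \<in> U \<Longrightarrow> dist y x < d \<Longrightarrow> dist (G y) (G x) < e"
    using G x unfolding continuous_on_iff by blast
  show "\<exists>d>0. \<forall>y\<in>U. norm (y - x) < d \<longrightarrow> norm (f y - f x - inner (G x) (y - x)) \<le> e * norm (y - x)"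
  proof (intro exI[of _ d] conjI ballI impI d(1))
    fix y assume y: "y \<in> U" "norm (y - x) < d"
    have 1: "inner (G x) (y - x) \<le> f y - f x" using sub x y by blast
    have "inner (G y) (x - y) \<le> f x - f y" using sub x y by blast
    then have "f y - f x - inner (G x) (y - x) \<le> inner (G y - G x) (y - x)"
      by (simp add: inner_diff)
    also have "\<dots> \<le> norm (G y - G x) * norm (y - x)" by (rule norm_cauchy_schwarz)
    also have "\<dots> \<le> e * norm (y - x)"
      using d(2)[OF y(1)] y(2) by (intro mult_right_mono) (auto simp: dist_norm)
    finally show "norm (f y - f x - inner (G x) (y - x)) \<le> e * norm (y - x)" using 1 by simp
  qed
qed

text \<open>The boundary has exactly one supporting hyperplane at every point. For a convex set this
already makes the boundary continuously differentiable.\<close>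
locale smooth_convex_domain = convex_domain V D for V D :: "'v::real_inner set" +
  assumes support_exists: "\<xi> \<in> bdry D \<Longrightarrow> \<exists>n\<in>V. norm n = 1 \<and> (\<forall>y\<in>D. 0 \<le> inner n (y - \<xi>))"
    and support_unique: "\<lbrakk>\<xi> \<in> bdry D; n \<in> V; norm n = 1; \<And>y. y \<in> D \<Longrightarrow> 0 \<le> inner n (y - \<xi>);
      m \<in> V; norm m = 1; \<And>y. y \<in> D \<Longrightarrow> 0 \<le> inner m (y - \<xi>)\<rbrakk> \<Longrightarrow> n = m"
begin

text \<open>The unit normal pointing into \<open>D\<close>.\<close>
definition nrm :: "'v \<Rightarrow> 'v" where
  "nrm \<xi> = (SOME n. n \<in> V \<and> norm n = 1 \<and> (\<forall>y\<in>D. 0 \<le> inner n (y - \<xi>)))"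

lemma
  assumes "\<xi> \<in> bdry D"
  shows nrm_V: "nrm \<xi> \<in> V" and norm_nrm: "norm (nrm \<xi>) = 1"
    and nrm_nonneg_D: "y \<in> D \<Longrightarrow> 0 \<le> inner (nrm \<xi>) (y - \<xi>)"
proof -
  have "nrm \<xi> \<in> V \<and> norm (nrm \<xi>) = 1 \<and> (\<forall>y\<in>D. 0 \<le> inner (nrm \<xi>) (y - \<xi>))"
    unfolding nrm_def by (rule someI_ex) (use support_exists[OF assms] in blast)
  then show "nrm \<xi> \<in> V" "norm (nrm \<xi>) = 1" "y \<in> D \<Longrightarrow> 0 \<le> inner (nrm \<xi>) (y - \<xi>)" by auto
qed

lemma nrm_eqI:
  assumes "\<xi> \<in> bdry D" "n \<in> V" "norm n = 1" "\<And>y. y \<in> D \<Longrightarrow> 0 \<le> inner n (y - \<xi>)"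
  shows "nrm \<xi> = n"
  using support_unique[of \<xi> "nrm \<xi>" n] assms nrm_V norm_nrm nrm_nonneg_D by blast

lemma nrm_nonneg:
  assumes "\<xi> \<in> bdry D" "y \<in> closure D"
  shows "0 \<le> inner (nrm \<xi>) (y - \<xi>)"
proof -
  have "closed {y. 0 \<le> inner (nrm \<xi>) (y - \<xi>)}"
    by (intro closed_Collect_le continuous_intros)
  then have "closure D \<subseteq> {y. 0 \<le> inner (nrm \<xi>) (y - \<xi>)}"
    using nrm_nonneg_D[OF assms(1)] by (intro closure_minimal) auto
  then show ?thesis using assms by blast
qed

lemma nrm_pos:
  assumes "\<xi> \<in> bdry D" "y \<in> D"
  shows "0 < inner (nrm \<xi>) (y - \<xi>)"
proof -
  obtain e where e: "e > 0" "\<And>v. v \<in> V \<Longrightarrow> norm v < e \<Longrightarrow> y + v \<in> D" using rel_open[OF assms(2)] by blast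
  have "y + (- (e/2)) *\<^sub>R nrm \<xi> \<in> D"
    using e norm_nrm[OF assms(1)] nrm_V[OF assms(1)] by (intro e(2)) (auto intro: V_intros)
  then have "0 \<le> inner (nrm \<xi>) (y + (- (e/2)) *\<^sub>R nrm \<xi> - \<xi>)" using nrm_nonneg_D assms by blast
  also have "\<dots> = inner (nrm \<xi>) (y - \<xi>) - e/2"
    using norm_nrm[OF assms(1)] by (simp add: inner_diff inner_add norm_eq_1)
  finally show ?thesis using e by simp
qed

text \<open>A limit of supporting normals is a supporting normal at the limit point, so uniqueness turns
compactness of the unit sphere of \<open>V\<close> into continuity.\<close>
lemma continuous_on_nrm: "continuous_on (bdry D) nrm"
  unfolding continuous_on_sequentially
proof (intro allI ballI impI, elim conjE)
  fix x \<xi> assume \<xi>: "\<xi> \<in> bdry D" and x: "\<forall>n. x n \<in> bdry D" and lim: "x \<longlonglongrightarrow> \<xi>"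
  show "(nrm \<circ> x) \<longlonglongrightarrow> nrm \<xi>"
  proof (rule tendsto_of_unique_cluster_point[OF compact_V])
    fix n show "(nrm \<circ> x) n \<in> V \<inter> cball 0 1" using nrm_V norm_nrm x by simp
  next
    fix r l assume r: "strict_mono r" and l: "(nrm \<circ> x \<circ> r) \<longlonglongrightarrow> l"
    have l': "(\<lambda>n. nrm (x (r n))) \<longlonglongrightarrow> l" using l by (simp add: o_def)
    have xr: "(\<lambda>n. x (r n)) \<longlonglongrightarrow> \<xi>" using LIMSEQ_subseq_LIMSEQ[OF lim r] by (simp add: o_def)
    have "l \<in> V" using closed_sequentially[OF closed_V _ l'] nrm_V x by blast
    moreover have "norm l = 1"
    proof -
      have "(\<lambda>n. norm (nrm (x (r n)))) \<longlonglongrightarrow> norm l" by (intro tendsto_intros l')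
      then show ?thesis using norm_nrm x by (simp add: LIMSEQ_const_iff)
    qed
    moreover have "0 \<le> inner l (y - \<xi>)" if "y \<in> D" for y
    proof (rule LIMSEQ_le_const)
      show "(\<lambda>n. inner (nrm (x (r n))) (y - x (r n))) \<longlonglongrightarrow> inner l (y - \<xi>)"
        by (intro tendsto_intros l' xr)
      show "\<exists>N. \<forall>n\<ge>N. 0 \<le> inner (nrm (x (r n))) (y - x (r n))" using nrm_nonneg_D x that by blast
    qed
    ultimately show "l = nrm \<xi>" using nrm_eqI[OF \<xi>] by simp
  qed
qed

text \<open>The supporting inequalities at \<open>\<xi>\<close> and at a nearby boundary point
\<open>y\<close> bound the distance from \<open>y\<close> to the tangent hyperplane by the variation of
the normal times the distance from \<open>y\<close> to \<open>\<xi>\<close>.\<close>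
lemma bdry_tangent:
  assumes \<xi>: "\<xi> \<in> bdry D" and e: "e > 0"
  obtains d where "d > 0" "\<And>y. \<lbrakk>y \<in> bdry D; dist y \<xi> < d\<rbrakk> \<Longrightarrow> \<bar>inner (nrm \<xi>) (y - \<xi>)\<bar> \<le> e * norm (y - \<xi>)"
proof -
  obtain d where d: "d > 0" "\<And>y. y \<in> bdry D \<Longrightarrow> dist y \<xi> < d \<Longrightarrow> dist (nrm y) (nrm \<xi>) < e"
    using continuous_on_nrm \<xi> e unfolding continuous_on_iff by blast
  show ?thesis
  proof (rule that[OF d(1)])
    fix y assume y: "y \<in> bdry D" "dist y \<xi> < d"
    have "0 \<le> inner (nrm y) (\<xi> - y)" using nrm_nonneg y \<xi> bdry_D_closure by blast
    then have "inner (nrm \<xi>) (y - \<xi>) \<le> inner (nrm \<xi> - nrm y) (y - \<xi>)"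
      by (simp add: inner_diff)
    also have "\<dots> \<le> norm (nrm \<xi> - nrm y) * norm (y - \<xi>)" by (rule norm_cauchy_schwarz)
    also have "\<dots> \<le> e * norm (y - \<xi>)"
      using d(2)[OF y] by (intro mult_right_mono) (auto simp: dist_norm norm_minus_commute)
    finally show "\<bar>inner (nrm \<xi>) (y - \<xi>)\<bar> \<le> e * norm (y - \<xi>)"
      using nrm_nonneg[OF \<xi>, of y] y bdry_D_closure by simp
  qed
qed

lemma tendsto_nrm_compose:
  assumes "(g \<longlongrightarrow> \<xi>) F" "\<xi> \<in> bdry D" "\<forall>\<^sub>F z in F. g z \<in> bdry D"
  shows "((\<lambda>z. nrm (g z)) \<longlongrightarrow> nrm \<xi>) F"
  by (rule continuous_on_tendsto_compose[OF continuous_on_nrm]) (use assms in auto)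

text \<open>To first order the boundary can be replaced by its tangent hyperplane at the end of the ray,
and for the hyperplane the parameter is the given quotient.\<close>
lemma has_derivative_ray_param:
  assumes x0: "x0 \<in> D" and v0: "v0 \<in> V" "v0 \<noteq> 0"
  defines "\<xi> \<equiv> ray_end D x0 v0"
  assumes Q': "((\<lambda>(x, v). inner (nrm \<xi>) (\<xi> - x) / inner (nrm \<xi>) v) has_derivative Q')
    (at (x0, v0) within D \<times> (V - {0}))"
  shows "((\<lambda>(x, v). ray_param D x v) has_derivative Q') (at (x0, v0) within D \<times> (V - {0}))"
proof -
  let ?S = "D \<times> (V - {0})" and ?w0 = "(x0, v0)"
  let ?F = "at ?w0 within ?S"
  let ?n = "nrm \<xi>"
  define R where "R = (\<lambda>(x, v). ray_param D x v)"
  define Q where "Q = (\<lambda>(x, v). inner ?n (\<xi> - x) / inner ?n v)"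
  define e where "e = (\<lambda>(x, v). ray_end D x v)"
  have w0S: "?w0 \<in> ?S" using x0 v0 by simp
  have \<xi>: "\<xi> \<in> bdry D" using ray_end_bdry x0 v0 by (simp add: \<xi>_def)
  have R0: "R ?w0 > 0" using ray_param_pos x0 v0 by (simp add: R_def)
  have \<xi>eq: "\<xi> = x0 + R ?w0 *\<^sub>R v0" by (simp add: R_def \<xi>_def ray_end_eq)
  have nv0: "inner ?n v0 < 0"
  proof -
    have "0 < inner ?n (x0 - \<xi>)" using nrm_pos \<xi> x0 by blast
    then have "0 < - (R ?w0 * inner ?n v0)" by (simp add: \<xi>eq)
    then show ?thesis using R0 by (simp add: mult_less_0_iff)
  qed
  have Q0: "Q ?w0 = R ?w0" using nv0 by (simp add: Q_def \<xi>eq)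
  have inS: "\<forall>\<^sub>F w in ?F. w \<in> ?S" by (simp add: eventually_at_filter)
  have contR: "(R \<longlongrightarrow> R ?w0) ?F"
    using continuous_on_ray_param w0S unfolding continuous_on_def R_def by blast
  have conte: "(e \<longlongrightarrow> \<xi>) ?F"
    using continuous_on_ray_end w0S unfolding continuous_on_def e_def \<xi>_def by force
  have Qd: "(Q has_derivative Q') ?F" using Q' by (simp add: Q_def)
  have snd: "((\<lambda>w. inner ?n (snd w)) \<longlongrightarrow> inner ?n v0) ?F"
    using tendsto_snd[OF tendsto_ident_at[of ?w0 ?S]] by (intro tendsto_intros) simp
  define c where "c = - inner ?n v0 / 2"
  have c: "c > 0" using nv0 by (simp add: c_def)
  obtain K where K: "K > 0" "\<forall>\<^sub>F w in ?F. \<bar>Q w - Q ?w0\<bar> \<le> K * norm (w - ?w0)"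
  proof -
    obtain K where K: "K > 0" "\<And>h. norm (Q' h) \<le> norm h * K"
      using bounded_linear.pos_bounded[OF has_derivative_bounded_linear[OF Qd]] by blast
    obtain d where d: "d > 0" "\<And>w. w \<in> ?S \<Longrightarrow> norm (w - ?w0) < d \<Longrightarrow>
        norm (Q w - Q ?w0 - Q' (w - ?w0)) \<le> 1 * norm (w - ?w0)"
      using Qd[unfolded has_derivative_within_alt, THEN conjunct2, rule_format, of 1] by auto
    have "\<forall>\<^sub>F w in ?F. \<bar>Q w - Q ?w0\<bar> \<le> (K + 1) * norm (w - ?w0)"
      unfolding eventually_at
    proof (intro exI[of _ d] conjI ballI impI d(1))
      fix w assume "w \<in> ?S" "w \<noteq> ?w0 \<and> dist w ?w0 < d"
      then have "norm (Q w - Q ?w0 - Q' (w - ?w0)) \<le> norm (w - ?w0)" using d(2)[of w] by (simp add: dist_norm)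
      moreover have "norm (Q' (w - ?w0)) \<le> norm (w - ?w0) * K" by (rule K)
      ultimately show "\<bar>Q w - Q ?w0\<bar> \<le> (K + 1) * norm (w - ?w0)" by (simp add: algebra_simps)
    qed
    then show ?thesis using K by (intro that[of "K + 1"]) auto
  qed
  define M where "M = 1 + (R ?w0 + 1) + K * norm v0"
  have M: "M > 0" using R0 K(1) by (simp add: M_def add_pos_nonneg)
  have main: "\<forall>\<^sub>F w in ?F. norm (R w - Q w) \<le> \<epsilon> * norm (w - ?w0)" if \<epsilon>: "\<epsilon> > 0" for \<epsilon>
  proof -
    define \<eta> where "\<eta> = min (c / (2 * norm v0)) (\<epsilon> * c / (2 * M))"
    have \<eta>: "\<eta> > 0" using c v0 \<epsilon> M by (simp add: \<eta>_def)
    obtain d where d: "d > 0" "\<And>y. \<lbrakk>y \<in> bdry D; dist y \<xi> < d\<rbrakk> \<Longrightarrow> \<bar>inner ?n (y - \<xi>)\<bar> \<le> \<eta> * norm (y - \<xi>)"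
      using bdry_tangent[OF \<xi> \<eta>] by blast
    have ev1: "\<forall>\<^sub>F w in ?F. dist (e w) \<xi> < d" using tendstoD[OF conte d(1)] .
    have ev2: "\<forall>\<^sub>F w in ?F. R w < R ?w0 + 1" using order_tendstoD(2)[OF contR, of "R ?w0 + 1"] by simp
    have ev3: "\<forall>\<^sub>F w in ?F. inner ?n (snd w) < - c"
      using order_tendstoD(2)[OF snd, of "- c"] nv0 by (simp add: c_def)
    show ?thesis
      using ev1 ev2 ev3 K(2) inS
    proof eventually_elim
      case (elim w)
      obtain x v where w: "w = (x, v)" by fastforce
      have xv: "x \<in> D" "v \<in> V" "v \<noteq> 0" using elim(5) w by auto
      have Rp: "R w > 0" using ray_param_pos xv by (simp add: R_def w)
      let ?y = "e w" and ?h = "norm (w - ?w0)"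
      have y: "?y \<in> bdry D" using ray_end_bdry xv by (simp add: e_def w)
      have yeq: "?y = x + R w *\<^sub>R v" by (simp add: e_def w ray_end_eq R_def)
      have bnd: "\<bar>inner ?n (?y - \<xi>)\<bar> \<le> \<eta> * norm (?y - \<xi>)" using d(2) y elim(1) by blast
      have nv: "inner ?n v < - c" using elim(3) w by simp
      have RQ: "R w - Q w = inner ?n (?y - \<xi>) / inner ?n v"
        using nv c by (simp add: Q_def w yeq[unfolded w] field_simps inner_diff inner_add)
      have "norm (x - x0) \<le> ?h" using norm_fst_le[of "x - x0" "v - v0"] by (simp add: w)
      moreover have "norm (v - v0) \<le> ?h" using norm_snd_le[of "v - v0" "x - x0"] by (simp add: w)
      moreover have "?y - \<xi> = (x - x0) + R w *\<^sub>R (v - v0) + (R w - R ?w0) *\<^sub>R v0"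
        by (simp add: yeq \<xi>eq algebra_simps)
      then have "norm (?y - \<xi>) \<le> norm (x - x0) + R w * norm (v - v0) + \<bar>R w - R ?w0\<bar> * norm v0"
        using Rp by (metis (no_types, lifting) abs_of_pos norm_scaleR norm_triangle_mono norm_triangle_ineq order_refl)
      moreover have "R w * norm (v - v0) \<le> (R ?w0 + 1) * ?h"
        using elim(2) Rp calculation by (intro mult_mono) auto
      moreover have "\<bar>R w - R ?w0\<bar> * norm v0 \<le> (\<bar>R w - Q w\<bar> + K * ?h) * norm v0"
        using elim(4) Q0 by (intro mult_right_mono) auto
      ultimately have y1: "norm (?y - \<xi>) \<le> M * ?h + norm v0 * \<bar>R w - Q w\<bar>"
        by (simp add: M_def algebra_simps)
      have "\<bar>R w - Q w\<bar> * c \<le> \<bar>R w - Q w\<bar> * \<bar>inner ?n v\<bar>" using nv c by (intro mult_left_mono) auto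
      also have "\<dots> = \<bar>inner ?n (?y - \<xi>)\<bar>" using nv c by (simp add: RQ)
      also have "\<dots> \<le> \<eta> * (M * ?h + norm v0 * \<bar>R w - Q w\<bar>)"
        using bnd y1 \<eta> by (meson less_imp_le mult_left_mono order_trans)
      also have "\<dots> = \<eta> * M * ?h + (\<eta> * norm v0) * \<bar>R w - Q w\<bar>" by (simp add: algebra_simps)
      also have "\<dots> \<le> (\<epsilon> * c / 2) * ?h + (c / 2) * \<bar>R w - Q w\<bar>"
      proof (intro add_mono mult_right_mono)
        have "\<eta> * M \<le> \<epsilon> * c / (2 * M) * M" using M by (intro mult_right_mono) (auto simp: \<eta>_def)
        then show "\<eta> * M \<le> \<epsilon> * c / 2" using M by simp
        have "\<eta> * norm v0 \<le> c / (2 * norm v0) * norm v0" by (intro mult_right_mono) (auto simp: \<eta>_def)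
        then show "\<eta> * norm v0 \<le> c / 2" using v0 by simp
      qed auto
      finally have "c * \<bar>R w - Q w\<bar> \<le> c * (\<epsilon> * ?h)" by (simp add: algebra_simps)
      then show ?case using c by simp
    qed
  qed
  have "((\<lambda>w. R w - Q w) has_derivative (\<lambda>_. 0)) ?F"
    unfolding has_derivative_iff_norm
  proof (intro conjI)
    show "((\<lambda>w. norm (R w - Q w - (R ?w0 - Q ?w0) - 0) / norm (w - ?w0)) \<longlongrightarrow> 0) ?F"
    proof (rule tendstoI)
      fix \<epsilon> :: real assume "\<epsilon> > 0"
      then have "\<forall>\<^sub>F w in ?F. norm (R w - Q w) \<le> (\<epsilon>/2) * norm (w - ?w0)" using main[of "\<epsilon>/2"] by simp
      moreover have "\<forall>\<^sub>F w in ?F. w \<noteq> ?w0" by (simp add: eventually_at_filter)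
      ultimately show "\<forall>\<^sub>F w in ?F. dist (norm (R w - Q w - (R ?w0 - Q ?w0) - 0) / norm (w - ?w0)) 0 < \<epsilon>"
      proof eventually_elim
        case (elim w)
        have p: "norm (w - ?w0) > 0" using elim by simp
        have "norm (R w - Q w) / norm (w - ?w0) \<le> \<epsilon> / 2" using elim(1) p by (subst pos_divide_le_eq) auto
        then have "norm (R w - Q w) / norm (w - ?w0) < \<epsilon>" using \<open>\<epsilon> > 0\<close> by linarith
        then show ?case using Q0 by simp
      qed
    qed
  qed simp
  then have "((\<lambda>w. Q w + (R w - Q w)) has_derivative (\<lambda>h. Q' h + 0)) ?F"
    by (intro has_derivative_add Qd)
  then show ?thesis by (simp add: R_def)
qed


text \<open>Its logarithm is, up to a constant, twice the Busemann function at \<open>\<xi>\<close> (see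
\<open>busemann_eq\<close>). The first factor is the height above the tangent hyperplane, the second one
comes from the opposite end of the chord through \<open>\<xi>\<close>.\<close>
definition horo :: "'v \<Rightarrow> 'v \<Rightarrow> real" where
  "horo \<xi> x = inner (nrm \<xi>) (x - \<xi>) * (1 + 1 / ray_param D x (x - \<xi>))"

lemma at_bdry_nontrivial: "\<xi> \<in> bdry D \<Longrightarrow> at \<xi> within D \<noteq> bot"
  using trivial_limit_within[of \<xi> D] by (auto simp: bdry_def closure_def)

lemma bdry_diff:
  assumes "\<xi> \<in> bdry D" "x \<in> D"
  shows "x - \<xi> \<in> V" "\<xi> - x \<in> V" "x \<noteq> \<xi>"
  using assms closure_diff_in_V bdry_D_closure D_closure by blast+

lemma horo_pos:
  assumes "\<xi> \<in> bdry D" "x \<in> D"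
  shows "horo \<xi> x > 0"
  using nrm_pos[OF assms] ray_param_pos[OF assms(2), of "x - \<xi>"] bdry_diff[OF assms]
  by (simp add: horo_def add_pos_pos)

text \<open>As \<open>z\<close> tends to \<open>\<xi>\<close>, the rays from \<open>x\<close> and from
\<open>y\<close> through \<open>z\<close> leave \<open>D\<close> near \<open>\<xi>\<close>, where the
boundary is close to the tangent hyperplane. The ratio of the remaining lengths therefore tends to the
inverse ratio of the heights of \<open>x\<close> and \<open>y\<close>; the other ends contribute
continuously.\<close>
lemma busemann_tendsto:
  assumes \<xi>: "\<xi> \<in> bdry D" and x: "x \<in> D" and y: "y \<in> D"
  shows "((\<lambda>z. hilbert_dist D y z - hilbert_dist D x z) \<longlongrightarrow> 1/2 * ln (horo \<xi> y / horo \<xi> x)) (at \<xi> within D)"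
proof -
  let ?F = "at \<xi> within D"
  define P where "P = (\<lambda>x z. ray_param D x (z - x))"
  define Q where "Q = (\<lambda>x z. ray_param D x (x - z))"
  define e where "e = (\<lambda>x z. ray_end D x (z - x))"
  define l where "l = (\<lambda>x. inner (nrm \<xi>) (x - \<xi>))"
  have id: "((\<lambda>z. z) \<longlongrightarrow> \<xi>) ?F" by (rule tendsto_ident_at)
  have inD: "\<forall>\<^sub>F z in ?F. z \<in> D" by (simp add: eventually_at_filter)
  have ne: "\<forall>\<^sub>F z in ?F. z \<noteq> x" if "x \<in> D" for x
    using tendsto_imp_eventually_ne[OF id] bdry_diff(3)[OF \<xi> that] by metis
  have ray1: "ray_param D x (\<xi> - x) = 1" if "x \<in> D" for x
    using that \<xi> by (intro ray_param_eqI) auto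
  have S: "(x, \<xi> - x) \<in> D \<times> (V - {0})" "(x, x - \<xi>) \<in> D \<times> (V - {0})" if "x \<in> D" for x
    using bdry_diff[OF \<xi> that] that by auto
  have evS: "\<forall>\<^sub>F z in ?F. (x, z - x) \<in> D \<times> (V - {0})" "\<forall>\<^sub>F z in ?F. (x, x - z) \<in> D \<times> (V - {0})"
    if x: "x \<in> D" for x
    using inD ne[OF x] by (eventually_elim, use x diff_in_V in auto)+
  have P: "((\<lambda>z. P x z) \<longlongrightarrow> 1) ?F" if x: "x \<in> D" for x
  proof -
    have "((\<lambda>z. (\<lambda>(x, v). ray_param D x v) (x, z - x)) \<longlongrightarrow> (\<lambda>(x, v). ray_param D x v) (x, \<xi> - x)) ?F"
      by (rule continuous_on_tendsto_compose[OF continuous_on_ray_param _ S(1)[OF x] evS(1)[OF x]])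
        (intro tendsto_intros id)
    then show ?thesis by (simp add: P_def ray1[OF x])
  qed
  have Q: "((\<lambda>z. Q x z) \<longlongrightarrow> Q x \<xi>) ?F" if x: "x \<in> D" for x
  proof -
    have "((\<lambda>z. (\<lambda>(x, v). ray_param D x v) (x, x - z)) \<longlongrightarrow> (\<lambda>(x, v). ray_param D x v) (x, x - \<xi>)) ?F"
      by (rule continuous_on_tendsto_compose[OF continuous_on_ray_param _ S(2)[OF x] evS(2)[OF x]])
        (intro tendsto_intros id)
    then show ?thesis by (simp add: Q_def)
  qed
  have e: "((\<lambda>z. e x z) \<longlongrightarrow> \<xi>) ?F" if x: "x \<in> D" for x
  proof -
    have "((\<lambda>z. (\<lambda>(x, v). ray_end D x v) (x, z - x)) \<longlongrightarrow> (\<lambda>(x, v). ray_end D x v) (x, \<xi> - x)) ?F"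
      by (rule continuous_on_tendsto_compose[OF continuous_on_ray_end _ S(1)[OF x] evS(1)[OF x]])
        (intro tendsto_intros id)
    then show ?thesis by (simp add: e_def ray_end_eq ray1[OF x])
  qed
  have eb: "\<forall>\<^sub>F z in ?F. e x z \<in> bdry D" if x: "x \<in> D" for x
    using inD ne[OF x] by eventually_elim (use x diff_in_V in \<open>auto simp: e_def intro!: ray_end_bdry\<close>)
  have n: "((\<lambda>z. nrm (e x z)) \<longlongrightarrow> nrm \<xi>) ?F" if x: "x \<in> D" for x
    using tendsto_nrm_compose[OF e[OF x] \<xi> eb[OF x]] .
  have lpos: "l x > 0" if "x \<in> D" for x using nrm_pos[OF \<xi> that] by (simp add: l_def)
  have P1: "P x z > 1" "Q x z > 0" if "x \<in> D" "z \<in> D" "z \<noteq> x" for x z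
    using hilbert_dist_eq(2,3)[of x z] that by (auto simp: P_def Q_def)
  \<comment> \<open>the support at the end of the ray from \<open>x\<close> through \<open>z\<close> separates the end of the ray from \<open>y\<close>\<close>
  have cmp: "(P y z - 1) * inner (nrm (e x z)) (y - z) \<le> (P x z - 1) * inner (nrm (e x z)) (x - z)"
    if "x \<in> D" "y \<in> D" "z \<in> D" "z \<noteq> x" "z \<noteq> y" for x y z
  proof -
    have b: "e x z \<in> bdry D" "e y z \<in> bdry D"
      using that diff_in_V by (auto simp: e_def intro!: ray_end_bdry)
    have "0 \<le> inner (nrm (e x z)) (e y z - e x z)" using nrm_nonneg b bdry_D_closure by blast
    also have "e y z - e x z = (P x z - 1) *\<^sub>R (x - z) - (P y z - 1) *\<^sub>R (y - z)"
      by (simp add: e_def P_def ray_end_eq algebra_simps)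
    finally show ?thesis by (simp add: inner_diff_right)
  qed
  have ratio: "((\<lambda>z. (P x z - 1) / (P y z - 1)) \<longlongrightarrow> l y / l x) ?F"
  proof (rule tendsto_sandwich)
    let ?a = "\<lambda>z. inner (nrm (e x z)) (y - z) / inner (nrm (e x z)) (x - z)"
    let ?b = "\<lambda>z. inner (nrm (e y z)) (y - z) / inner (nrm (e y z)) (x - z)"
    have pos: "\<forall>\<^sub>F z in ?F. inner (nrm (e u z)) (v - z) > 0" if "u \<in> D" "v \<in> D" for u v
    proof -
      have "((\<lambda>z. inner (nrm (e u z)) (v - z)) \<longlongrightarrow> l v) ?F"
        unfolding l_def by (intro tendsto_intros id n that)
      then show ?thesis using lpos[OF that(2)] order_tendstoD(1) by blast
    qed
    show "(?a \<longlongrightarrow> l y / l x) ?F" "(?b \<longlongrightarrow> l y / l x) ?F"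
      unfolding l_def by (intro tendsto_intros id n x y; use lpos[OF x] in \<open>simp add: l_def\<close>)+
    show "\<forall>\<^sub>F z in ?F. ?a z \<le> (P x z - 1) / (P y z - 1)"
      using inD ne[OF x] ne[OF y] pos[OF x x]
    proof eventually_elim
      case (elim z)
      then show ?case using cmp[OF x y, of z] P1[OF y, of z] by (simp add: divide_simps mult.commute)
    qed
    show "\<forall>\<^sub>F z in ?F. (P x z - 1) / (P y z - 1) \<le> ?b z"
      using inD ne[OF x] ne[OF y] pos[OF y x]
    proof eventually_elim
      case (elim z)
      then show ?case using cmp[OF y x, of z] P1[OF y, of z] by (simp add: divide_simps mult.commute)
    qed
  qed
  let ?G = "\<lambda>z. ((Q y z + 1) / Q y z) * (P y z / P x z) * (Q x z / (Q x z + 1)) * ((P x z - 1) / (P y z - 1))"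
  have Qpos: "Q x \<xi> > 0" if "x \<in> D" for x
    using ray_param_pos[OF that] bdry_diff[OF \<xi> that] by (simp add: Q_def)
  have G: "(?G \<longlongrightarrow> ((Q y \<xi> + 1) / Q y \<xi>) * (1 / 1) * (Q x \<xi> / (Q x \<xi> + 1)) * (l y / l x)) ?F"
    by (intro tendsto_intros P Q x y ratio) (use Qpos[OF x] Qpos[OF y] in auto)
  have lim: "((Q y \<xi> + 1) / Q y \<xi>) * (1 / 1) * (Q x \<xi> / (Q x \<xi> + 1)) * (l y / l x) = horo \<xi> y / horo \<xi> x"
  proof -
    have "horo \<xi> w = l w * (1 + 1 / Q w \<xi>)" for w by (simp add: horo_def l_def Q_def)
    then show ?thesis using Qpos[OF x] Qpos[OF y] lpos[OF x] by (simp add: divide_simps)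
  qed
  have "((\<lambda>z. 1/2 * ln (?G z)) \<longlongrightarrow> 1/2 * ln (horo \<xi> y / horo \<xi> x)) ?F"
    using G horo_pos[OF \<xi>] x y unfolding lim by (intro tendsto_intros) (auto simp: less_imp_neq[symmetric])
  moreover have "\<forall>\<^sub>F z in ?F. 1/2 * ln (?G z) = hilbert_dist D y z - hilbert_dist D x z"
    using inD ne[OF x] ne[OF y]
  proof eventually_elim
    case (elim z)
    have px: "P x z > 1" "Q x z > 0" and py: "P y z > 1" "Q y z > 0" using P1 x y elim by auto
    have h: "hilbert_dist D w z = 1/2 * ln (((Q w z + 1) * P w z) / (Q w z * (P w z - 1)))"
      if "w \<in> D" "z \<noteq> w" for w
      using hilbert_dist_eq(1)[OF that(1) elim(1)] that by (auto simp: P_def Q_def)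
    have "?G z = (((Q y z + 1) * P y z) / (Q y z * (P y z - 1))) / (((Q x z + 1) * P x z) / (Q x z * (P x z - 1)))"
      using px py by (simp add: divide_simps)
    then have "ln (?G z) = ln (((Q y z + 1) * P y z) / (Q y z * (P y z - 1))) - ln (((Q x z + 1) * P x z) / (Q x z * (P x z - 1)))"
      using px py by (simp only:) (subst ln_div, auto)
    then show ?case using h[OF x] h[OF y] elim by simp
  qed
  ultimately show ?thesis by (rule Lim_transform_eventually)
qed

lemma busemann_eq:
  assumes "\<xi> \<in> bdry D" "x \<in> D" "y \<in> D"
  shows "busemann D \<xi> x y = 1/2 * ln (horo \<xi> y / horo \<xi> x)"
  unfolding busemann_def
  using tendsto_Lim[OF at_bdry_nontrivial[OF assms(1)] busemann_tendsto[OF assms]] .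

lemma horosphere_eq:
  assumes "\<xi> \<in> bdry D" "x \<in> D"
  shows "horosphere D \<xi> x = {y \<in> D. horo \<xi> y = horo \<xi> x}"
  unfolding horosphere_def using assms horo_pos[OF assms(1)]
  by (auto simp: busemann_eq less_imp_neq[symmetric] ln_eq_zero_iff)

lemma horoball_eq:
  assumes "\<xi> \<in> bdry D" "x \<in> D"
  shows "horoball D \<xi> x = {y \<in> D. horo \<xi> y < horo \<xi> x}"
  unfolding horoball_def using assms horo_pos[OF assms(1)]
  by (auto simp: busemann_eq ln_less_zero_iff)

text \<open>The gauge of \<open>D\<close> with respect to an interior point \<open>p\<close> is convex,
and the normalised normals are continuous subgradients of it. It defines the boundary away from
\<open>p\<close>.\<close>
lemma exists_C1_defining_function:
  assumes o: "p \<in> D"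
  defines "U \<equiv> {x. x - p \<in> V \<and> x \<noteq> p}"
  obtains f :: "'v \<Rightarrow> real" and G where
    "\<And>x. x \<in> U \<Longrightarrow> G x \<in> V \<and> G x \<noteq> 0 \<and> (f has_derivative (\<lambda>h. inner (G x) h)) (at x within U)"
    "continuous_on U G" "bdry D \<inter> U = {x \<in> U. f x = 0}"
proof -
  define e where "e = (\<lambda>x. ray_end D p (x - p))"
  define f where "f = (\<lambda>x. 1 / ray_param D p (x - p) - 1)"
  define c where "c = (\<lambda>x. inner (nrm (e x)) (p - e x))"
  define G where "G = (\<lambda>x. (- 1 / c x) *\<^sub>R nrm (e x))"
  have xV: "x - p \<in> V" "x - p \<noteq> 0" if "x \<in> U" for x using that by (auto simp: U_def)
  have eb: "e x \<in> bdry D" if "x \<in> U" for x using ray_end_bdry[OF o xV[OF that]] by (simp add: e_def)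
  have r: "ray_param D p (x - p) > 0" if "x \<in> U" for x using ray_param_pos[OF o xV[OF that]] .
  have c: "c x > 0" if "x \<in> U" for x using nrm_pos[OF eb[OF that] o] by (simp add: c_def)
  have xe: "x - p = (1 / ray_param D p (x - p)) *\<^sub>R (e x - p)" if "x \<in> U" for x
    using r[OF that] by (simp add: e_def ray_end_eq)
  have ce: "continuous_on U e"
  proof -
    have "continuous_on U (\<lambda>x. (\<lambda>(x, v). ray_end D x v) (p, x - p))"
      by (rule continuous_on_compose2[OF continuous_on_ray_end])
        (use o xV in \<open>auto intro!: continuous_intros\<close>)
    then show ?thesis by (simp add: e_def)
  qed
  have cn: "continuous_on U (\<lambda>x. nrm (e x))"
    by (rule continuous_on_compose2[OF continuous_on_nrm ce]) (use eb in auto)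
  have cG: "continuous_on U G"
    unfolding G_def c_def by (intro continuous_intros cn ce) (use c in \<open>force simp: c_def\<close>)
  have sub: "inner (G x) (y - x) \<le> f y - f x" if x: "x \<in> U" and y: "y \<in> U" for x y
  proof -
    let ?n = "nrm (e x)" and ?g = "\<lambda>x. 1 / ray_param D p (x - p)"
    have "inner ?n (e x - p) = - c x" by (simp add: c_def inner_diff)
    then have 1: "inner ?n (x - p) = - ?g x * c x"
      by (subst xe[OF x]) simp
    have "0 \<le> inner ?n (e y - e x)" using nrm_nonneg eb x y bdry_D_closure by blast
    then have "- c x \<le> inner ?n (e y - p)" by (simp add: c_def inner_diff)
    then have "?g y * - c x \<le> ?g y * inner ?n (e y - p)" using r[OF y] by (intro mult_left_mono) auto
    also have "\<dots> = inner ?n (y - p)" by (subst (2) xe[OF y]) simp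
    finally have "- ?g y * c x \<le> inner ?n (y - p)" by simp
    with 1 have "(?g x - ?g y) * c x \<le> inner ?n (y - x)" by (simp add: algebra_simps inner_diff)
    then have "?g x - ?g y \<le> inner ?n (y - x) / c x" using c[OF x] by (simp add: pos_le_divide_eq)
    then show ?thesis by (simp add: G_def f_def)
  qed
  show ?thesis
  proof (rule that[of G f])
    fix x assume x: "x \<in> U"
    show "G x \<in> V \<and> G x \<noteq> 0 \<and> (f has_derivative (\<lambda>h. inner (G x) h)) (at x within U)"
      using has_derivative_of_subgradient[OF cG sub x] nrm_V[OF eb[OF x]] norm_nrm[OF eb[OF x]] c[OF x]
      by (auto simp: G_def intro: V_intros)
  next
    show "bdry D \<inter> U = {x \<in> U. f x = 0}"
    proof (intro equalityI subsetI)
      fix x assume "x \<in> bdry D \<inter> U"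
      then have x: "x \<in> bdry D" "x \<in> U" by auto
      have "ray_param D p (x - p) = 1" using o x by (intro ray_param_eqI) auto
      then show "x \<in> {x \<in> U. f x = 0}" using x by (simp add: f_def)
    next
      fix x assume "x \<in> {x \<in> U. f x = 0}"
      then have x: "x \<in> U" and "ray_param D p (x - p) = 1" by (auto simp: f_def)
      then show "x \<in> bdry D \<inter> U" using eb[OF x] by (simp add: e_def ray_end_eq)
    qed
  qed (rule cG)
qed

end

section \<open>Geodesics that meet the boundary orthogonally\<close>

lemma tangent_space_mono: "S \<subseteq> T \<Longrightarrow> tangent_space S w \<subseteq> tangent_space T w"
  unfolding tangent_space_def by (auto elim!: eventually_mono)

lemma tangent_space_image_linear:
  assumes f: "bounded_linear f" and Z: "Z \<in> tangent_space S w"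
  shows "f Z \<in> tangent_space (f ` S) (f w)"
proof -
  obtain c where c: "c 0 = w" "\<forall>\<^sub>F t in nhds 0. c t \<in> S" "(c has_vector_derivative Z) (at 0)"
    using Z by (auto simp: tangent_space_def)
  have "((\<lambda>t. f (c t)) has_vector_derivative f Z) (at 0)"
    by (rule bounded_linear.has_vector_derivative[OF f c(3)])
  then show ?thesis
    unfolding tangent_space_def using c(1,2)
    by (intro CollectI exI[of _ "\<lambda>t. f (c t)"]) (auto elim!: eventually_mono)
qed

text \<open>Derivatives within a set need not be unique, but all of them agree on velocities of curves
in the set by the chain rule. The chosen one can therefore be evaluated with any known
derivative.\<close>
lemma frechet_derivative_on_tangent_space:
  assumes F: "(F has_derivative L) (at w within S)" and Z: "Z \<in> tangent_space S w"
  shows "frechet_derivative F (at w within S) Z = L Z"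
proof -
  obtain c where c: "c 0 = w" "\<forall>\<^sub>F t in nhds 0. c t \<in> S" "(c has_vector_derivative Z) (at 0)"
    using Z by (auto simp: tangent_space_def)
  obtain T where T: "open T" "0 \<in> T" "\<And>t. t \<in> T \<Longrightarrow> c t \<in> S"
    using c(2) unfolding eventually_nhds by auto
  have "((\<lambda>t. F (c t)) has_vector_derivative L' Z) (at 0)"
    if "(F has_derivative L') (at w within S)" for L'
  proof -
    have F': "(F has_derivative L') (at (c 0) within c ` T)"
      using that T(3) c(1) by (auto intro: has_derivative_subset)
    have "(c has_derivative (\<lambda>x. x *\<^sub>R Z)) (at 0 within T)"
      using c(3) unfolding has_vector_derivative_def by (rule has_derivative_at_withinI)
    then have "((\<lambda>t. F (c t)) has_derivative (\<lambda>x. L' (x *\<^sub>R Z))) (at 0 within T)"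
      using has_derivative_in_compose[OF _ F'] by blast
    then show ?thesis
      using at_within_open[OF T(2,1)] linear_cmul[OF has_derivative_linear[OF that]]
      by (simp add: has_vector_derivative_def)
  qed
  moreover have "(F has_derivative frechet_derivative F (at w within S)) (at w within S)"
    using F frechet_derivative_works differentiable_def by blast
  ultimately show ?thesis using F vector_derivative_unique_at by blast
qed

lemma has_vector_derivative_in_closed_subspace:
  fixes c :: "real \<Rightarrow> 'a::real_normed_vector"
  assumes V: "subspace V" "closed V" and c: "\<forall>\<^sub>F t in nhds 0. c t - c 0 \<in> V"
    and Z: "(c has_vector_derivative Z) (at 0)"
  shows "Z \<in> V"
proof -
  have "((\<lambda>t. (c t - c 0) /\<^sub>R (t - 0)) \<longlongrightarrow> Z) (at 0)"
    using Z unfolding has_vector_derivative_def has_derivative_iff_norm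
  proof -
    assume "bounded_linear (\<lambda>x. x *\<^sub>R Z) \<and> ((\<lambda>y. norm (c y - c 0 - (y - 0) *\<^sub>R Z) / norm (y - 0)) \<longlongrightarrow> 0) (at 0)"
    then have l: "((\<lambda>y. norm (c y - c 0 - (y - 0) *\<^sub>R Z) / norm (y - 0)) \<longlongrightarrow> 0) (at 0)" by blast
    show ?thesis
    proof (rule Lim_null[THEN iffD2], rule tendsto_norm_zero_cancel, rule Lim_transform_eventually[OF l])
      show "\<forall>\<^sub>F y in at 0. norm (c y - c 0 - (y - 0) *\<^sub>R Z) / norm (y - 0) = norm ((c y - c 0) /\<^sub>R (y - 0) - Z)"
        unfolding eventually_at_filter
      proof (intro always_eventually allI impI)
        fix y :: real assume "y \<noteq> 0"
        then have "(c y - c 0) /\<^sub>R (y - 0) - Z = (c y - c 0 - (y - 0) *\<^sub>R Z) /\<^sub>R y"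
          by (simp add: algebra_simps)
        then show "norm (c y - c 0 - (y - 0) *\<^sub>R Z) / norm (y - 0) = norm ((c y - c 0) /\<^sub>R (y - 0) - Z)"
          by (simp add: divide_inverse mult.commute)
      qed
    qed
  qed
  moreover have "\<forall>\<^sub>F t in at 0. (c t - c 0) /\<^sub>R (t - 0) \<in> V"
    using c unfolding eventually_at_filter by (auto elim!: eventually_mono intro: subspace_scale[OF V(1)])
  ultimately show ?thesis by (intro Lim_in_closed_set[OF V(2)]) auto
qed

text \<open>To first order an orthogonal motion does not change the norm.\<close>
lemma has_derivative_sgn_orthogonal:
  fixes f :: "real \<Rightarrow> 'a::real_inner"
  assumes f: "(f has_vector_derivative v) (at t)" and ft: "f t \<noteq> 0" and orth: "inner (f t) v = 0"
  shows "((\<lambda>t. sgn (f t)) has_vector_derivative (1 / norm (f t)) *\<^sub>R v) (at t)"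
proof -
  have fd: "(f has_derivative (\<lambda>h. h *\<^sub>R v)) (at t)" using f by (simp add: has_vector_derivative_def)
  have n: "((\<lambda>t. norm (f t)) has_derivative (\<lambda>h. 0)) (at t)"
    using has_derivative_compose[OF fd has_derivative_norm[OF ft]] orth
    by (simp add: inner_commute sgn_div_norm)
  have "((\<lambda>t. inverse (norm (f t)) *\<^sub>R f t) has_derivative (\<lambda>h. h *\<^sub>R (1 / norm (f t)) *\<^sub>R v)) (at t)"
    by (rule derivative_eq_intros refl n fd | use ft in \<open>simp add: field_simps\<close>)+
  then show ?thesis by (simp add: has_vector_derivative_def sgn_div_norm)
qed

context smooth_convex_domain
begin

text \<open>The derivative of the quotient in \<open>has_derivative_ray_param\<close>.\<close>
lemma has_derivative_ray_param_formula:
  fixes x0 v0 :: 'v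
  assumes x0: "x0 \<in> D" and v0: "v0 \<in> V" "v0 \<noteq> 0" and n: "nrm (ray_end D x0 v0) = n"
  shows "((\<lambda>(x, v). ray_param D x v) has_derivative
    (\<lambda>(dx, dv). - (inner n dx + ray_param D x0 v0 * inner n dv) / inner n v0))
    (at (x0, v0) within D \<times> (V - {0}))"
proof -
  let ?\<xi> = "ray_end D x0 v0" and ?r = "ray_param D x0 v0"
  have \<xi>: "?\<xi> \<in> bdry D" using ray_end_bdry x0 v0 by simp
  have r: "?r > 0" using ray_param_pos x0 v0 by simp
  have "0 < inner n (x0 - ?\<xi>)" using nrm_pos[OF \<xi> x0] n by simp
  then have nv: "inner n v0 < 0" using r by (simp add: ray_end_eq mult_less_0_iff)
  have nx: "inner n (?\<xi> - x0) = ?r * inner n v0" by (simp add: ray_end_eq)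
  have "((\<lambda>w. inner n (?\<xi> - fst w) / inner n (snd w)) has_derivative
    (\<lambda>h. - (inner n (fst h) + ?r * inner n (snd h)) / inner n v0)) (at (x0, v0) within D \<times> (V - {0}))"
    apply (rule derivative_eq_intros refl)+
    using nv nx by (auto simp: field_simps power2_eq_square)
  then have "((\<lambda>(x, v). inner (nrm ?\<xi>) (?\<xi> - x) / inner (nrm ?\<xi>) v) has_derivative
    (\<lambda>(dx, dv). - (inner n dx + ?r * inner n dv) / inner n v0)) (at (x0, v0) within D \<times> (V - {0}))"
    by (simp add: n split_def)
  then show ?thesis by (rule has_derivative_ray_param[OF x0 v0])
qed

end

lemma has_derivative_flow_shift:
  assumes "a + exp (2 * t) * b \<noteq> 0"
  shows "((\<lambda>w. flow_shift (fst w) (snd w) t) has_derivative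
    (\<lambda>h. (exp (2 * t) - 1) * (exp (2 * t) * b\<^sup>2 * fst h + a\<^sup>2 * snd h) / (a + exp (2 * t) * b)\<^sup>2)) (at (a, b))"
  unfolding flow_shift_def
  apply (rule derivative_eq_intros refl)+
  using assms by (auto simp: divide_simps power2_eq_square) (simp add: algebra_simps)

text \<open>A chord from \<open>q\<close> to \<open>p\<close> that is orthogonal to the boundary at both
ends. Then the horospheres at both ends are orthogonal to the chord at every point, so that the stable
and unstable spaces along it are copies of one fixed space \<open>W\<close>.\<close>
locale flat_line = smooth_convex_domain V D for V D :: "'v::real_inner set" +
  fixes p q u :: 'v and l :: real
  assumes p_bdry: "p \<in> bdry D" and q_bdry: "q \<in> bdry D"
    and l_pos: "l > 0" and u_V: "u \<in> V" and norm_u: "norm u = 1"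
    and p_eq: "p = q + l *\<^sub>R u"
    and nrm_p: "nrm p = - u" and nrm_q: "nrm q = u"
    and line_in_D: "\<lbrakk>0 < s; s < l\<rbrakk> \<Longrightarrow> q + s *\<^sub>R u \<in> D"
begin

definition W :: "'v set" where "W = {v \<in> V. inner u v = 0}"

definition pt :: "real \<Rightarrow> 'v" where "pt s = q + s *\<^sub>R u"

definition HV :: "('v \<times> 'v) set" where "HV = {(x, v). x \<in> D \<and> v \<in> V \<and> norm v = 1}"

lemma flat_line_reverse: "flat_line V D q p (- u) l"
  using p_bdry q_bdry l_pos u_V norm_u p_eq nrm_p nrm_q line_in_D[of "l - _"]
  by unfold_locales (auto simp: algebra_simps intro: V_intros)

lemma inner_uu: "inner u u = 1" using norm_u by (simp add: norm_eq_1)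

lemma u_nonzero: "u \<noteq> 0" "- u \<noteq> 0" "- u \<in> V" using norm_u u_V V_intros by auto

context
  fixes s :: real
  assumes s: "0 < s" "s < l"
begin

lemma pt_D: "pt s \<in> D" using line_in_D s by (simp add: pt_def)

lemma ray_param_pt: "ray_param D (pt s) u = l - s" "ray_param D (pt s) (- u) = s"
proof -
  have "pt s + (l - s) *\<^sub>R u = p" "pt s + s *\<^sub>R (- u) = q"
    by (auto simp: pt_def p_eq algebra_simps)
  then show "ray_param D (pt s) u = l - s" "ray_param D (pt s) (- u) = s"
    using pt_D s p_bdry q_bdry by (auto intro!: ray_param_eqI)
qed

lemma ray_end_pt: "ray_end D (pt s) u = p" "ray_end D (pt s) (- u) = q"
  by (auto simp: ray_end_eq ray_param_pt) (auto simp: pt_def p_eq algebra_simps)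

lemma pt_minus: "pt s - p = (l - s) *\<^sub>R (- u)" "p - pt s = (l - s) *\<^sub>R u"
  "pt s - q = s *\<^sub>R u" "q - pt s = s *\<^sub>R (- u)"
  by (auto simp: pt_def p_eq algebra_simps)

lemma ray_param_away_from_p: "ray_param D (pt s) (pt s - p) = s / (l - s)"
  unfolding pt_minus using ray_param_scale[OF pt_D u_nonzero(3,2), of "l - s"] s ray_param_pt by simp

lemma ray_end_away_from_p: "ray_end D (pt s) (pt s - p) = q"
  unfolding pt_minus using ray_end_scale[OF pt_D u_nonzero(3,2), of "l - s"] s ray_end_pt by simp

lemma horo_pt: "horo p (pt s) = (l - s) * l / s"
proof -
  have "inner (nrm p) (pt s - p) = l - s" unfolding pt_minus by (simp add: nrm_p inner_uu)
  then have "horo p (pt s) = (l - s) * (1 + 1 / (s / (l - s)))"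
    unfolding horo_def ray_param_away_from_p by simp
  also have "\<dots> = (l - s) * l / s" using s by (simp add: field_simps)
  finally show ?thesis .
qed

lemma has_derivative_horo:
  "(horo p has_derivative (\<lambda>h. - (l\<^sup>2 / s\<^sup>2) * inner u h)) (at (pt s) within D)"
proof -
  have xp: "x - p \<in> V - {0}" if "x \<in> D" for x using bdry_diff[OF p_bdry that] by auto
  have i: "inner u (pt s - p) = - (l - s)" unfolding pt_minus by (simp add: inner_uu)
  have R: "((\<lambda>(x, v). ray_param D x v) has_derivative
    (\<lambda>(dx, dv). - (inner u dx + s / (l - s) * inner u dv) / inner u (pt s - p)))
    (at (pt s, pt s - p) within D \<times> (V - {0}))"
    using has_derivative_ray_param_formula[OF pt_D, of "pt s - p" u] xp[OF pt_D]
    by (simp add: ray_end_away_from_p ray_param_away_from_p nrm_q)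
  have g: "((\<lambda>x. (x, x - p)) has_derivative (\<lambda>h. (h, h))) (at (pt s) within D)"
    by (auto intro!: derivative_eq_intros)
  have sub: "(\<lambda>x. (x, x - p)) ` D \<subseteq> D \<times> (V - {0})" using xp by auto
  have "((\<lambda>x. ray_param D x (x - p)) has_derivative
    (\<lambda>h. - (inner u h + s / (l - s) * inner u h) / inner u (pt s - p))) (at (pt s) within D)"
    using has_derivative_in_compose[OF g has_derivative_subset[OF R sub]] by simp
  then have R': "((\<lambda>x. ray_param D x (x - p)) has_derivative (\<lambda>h. l / (l - s)\<^sup>2 * inner u h)) (at (pt s) within D)"
  proof (rule has_derivative_eq_rhs, intro ext)
    fix h
    have "inner u h + s / (l - s) * inner u h = l / (l - s) * inner u h"
      using s by (simp add: field_simps)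
    then show "- (inner u h + s / (l - s) * inner u h) / inner u (pt s - p) = l / (l - s)\<^sup>2 * inner u h"
      unfolding i minus_divide_divide by (simp add: power2_eq_square)
  qed
  have r: "ray_param D (pt s) (pt s - p) \<noteq> 0" using s ray_param_away_from_p by simp
  have i1: "((\<lambda>x. inner (- u) (x - p)) has_derivative (\<lambda>h. - inner u h)) (at (pt s) within D)"
    by (auto intro!: derivative_eq_intros)
  have i2: "((\<lambda>x. 1 + inverse (ray_param D x (x - p))) has_derivative
      (\<lambda>h. 0 + - (inverse (s / (l - s)) * (l / (l - s)\<^sup>2 * inner u h) * inverse (s / (l - s))))) (at (pt s) within D)"
    using has_derivative_add[OF has_derivative_const Deriv.has_derivative_inverse[OF r R']]
    unfolding ray_param_away_from_p .
  have "((\<lambda>x. inner (- u) (x - p) * (1 + inverse (ray_param D x (x - p)))) has_derivative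
     (\<lambda>h. - (l\<^sup>2 / s\<^sup>2) * inner u h)) (at (pt s) within D)"
  proof (rule has_derivative_eq_rhs[OF has_derivative_mult[OF i1 i2]], intro ext)
    fix h
    define d where "d = l - s"
    have d: "d > 0" "l = s + d" using s by (auto simp: d_def)
    have 1: "inner (- u) (pt s - p) = d" using i by (simp add: d_def)
    show "inner (- u) (pt s - p) * (0 + - (inverse (s / (l - s)) * (l / (l - s)\<^sup>2 * inner u h) * inverse (s / (l - s)))) +
      - inner u h * (1 + inverse (ray_param D (pt s) (pt s - p))) = - (l\<^sup>2 / s\<^sup>2) * inner u h"
      unfolding ray_param_away_from_p 1 unfolding d(2) using s d(1)
      by (simp add: field_simps power2_eq_square)
  qed
  then show ?thesis unfolding horo_def nrm_p by (simp add: inverse_eq_divide)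
qed

text \<open>The horosphere based at \<open>p\<close> is a level set of \<open>horo p\<close>, whose
derivative at \<open>pt s\<close> has kernel \<open>W\<close>. A vector \<open>v\<close> of
\<open>W\<close> turns the direction towards \<open>p\<close> by \<open>- v / (l - s)\<close>.
Conversely, the horosphere meets the chords from \<open>p\<close> to boundary points near
\<open>q\<close> in points that form curves with every velocity in \<open>W\<close>.\<close>
lemma E_stable_eq: "E_stable D (pt s, u) = {(v, (- 1 / (l - s)) *\<^sub>R v) | v. v \<in> W}"
proof -
  have fe: "fwd_end D (pt s, u) = p" by (simp add: fwd_end_def ray_end_pt)
  have sm: "stable_manifold D (pt s, u) = {(y, sgn (p - y)) | y. y \<in> D \<and> horo p y = horo p (pt s)}"
    by (auto simp: stable_manifold_def fe horosphere_eq[OF p_bdry pt_D])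
  have pn: "p - pt s \<noteq> 0" "norm (p - pt s) = l - s" unfolding pt_minus using s norm_u by auto
  have sg: "sgn (p - pt s) = u" unfolding pt_minus using s norm_u by (simp add: sgn_scaleR sgn_div_norm)
  have sgn_deriv: "((\<lambda>t. sgn (p - y t)) has_vector_derivative (- 1 / (l - s)) *\<^sub>R v) (at 0)"
    if "(y has_vector_derivative v) (at 0)" "y 0 = pt s" "inner u v = 0" for y v
  proof -
    have "((\<lambda>t. p - y t) has_vector_derivative - v) (at 0)"
      using that(1) by (auto intro!: derivative_eq_intros)
    moreover have "inner (p - y 0) (- v) = 0" using that unfolding that(2) pt_minus by simp
    ultimately show ?thesis
      using has_derivative_sgn_orthogonal[of "\<lambda>t. p - y t" "- v" 0] that(2) pn by simp
  qed
  show ?thesis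
  proof (intro equalityI subsetI)
    fix Z assume "Z \<in> E_stable D (pt s, u)"
    then obtain c where c: "c 0 = (pt s, u)" "\<forall>\<^sub>F t in nhds 0. c t \<in> stable_manifold D (pt s, u)"
      "(c has_vector_derivative Z) (at 0)"
      by (auto simp: E_stable_def tangent_space_def)
    define y where "y = (\<lambda>t. fst (c t))"
    define v where "v = fst Z"
    have y0: "y 0 = pt s" by (simp add: y_def c)
    have y': "(y has_vector_derivative v) (at 0)"
      unfolding y_def v_def by (rule bounded_linear.has_vector_derivative[OF bounded_linear_fst c(3)])
    obtain T where T: "open T" "0 \<in> T" "\<And>t. t \<in> T \<Longrightarrow> c t \<in> stable_manifold D (pt s, u)"
      using c(2) unfolding eventually_nhds by auto
    have yT: "y t \<in> D" "horo p (y t) = horo p (pt s)" "c t = (y t, sgn (p - y t))" if "t \<in> T" for t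
      using T(3)[OF that] by (auto simp: y_def sm)
    have "\<forall>\<^sub>F t in nhds 0. y t - y 0 \<in> V"
      unfolding eventually_nhds using T yT pt_D y0 diff_in_V by (metis)
    then have vV: "v \<in> V"
      using has_vector_derivative_in_closed_subspace[OF subspace_V closed_V _ y'] by blast
    have "(y has_derivative (\<lambda>h. h *\<^sub>R v)) (at 0 within T)"
      using y' unfolding has_vector_derivative_def by (rule has_derivative_at_withinI)
    moreover have "(horo p has_derivative (\<lambda>h. - (l\<^sup>2 / s\<^sup>2) * inner u h)) (at (y 0) within y ` T)"
      using has_derivative_subset[OF has_derivative_horo, of "y ` T"] yT y0 by auto
    ultimately have "((\<lambda>t. horo p (y t)) has_derivative (\<lambda>h. - (l\<^sup>2 / s\<^sup>2) * inner u (h *\<^sub>R v))) (at 0 within T)"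
      by (rule has_derivative_in_compose)
    then have 1: "((\<lambda>t. horo p (y t)) has_derivative (\<lambda>h. - (l\<^sup>2 / s\<^sup>2) * inner u (h *\<^sub>R v))) (at 0)"
      using at_within_open[OF T(2,1)] by simp
    have 2: "((\<lambda>t. horo p (y t)) has_derivative (\<lambda>h. 0)) (at 0)"
      by (rule has_derivative_transform_within_open[of "\<lambda>t. horo p (pt s)" _ _ UNIV T])
        (use T yT in auto)
    have "(\<lambda>h. - (l\<^sup>2 / s\<^sup>2) * inner u (h *\<^sub>R v)) = (\<lambda>h. 0)"
      using has_derivative_unique[OF 1 2] .
    then have "- (l\<^sup>2 / s\<^sup>2) * inner u (1 *\<^sub>R v) = 0" by meson
    then have uv: "inner u v = 0" using s by simp
    have "((\<lambda>t. sgn (p - y t)) has_vector_derivative (- 1 / (l - s)) *\<^sub>R v) (at 0)"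
      using sgn_deriv y' y0 uv by blast
    moreover have "((\<lambda>t. sgn (p - y t)) has_vector_derivative snd Z) (at 0)"
    proof (rule has_vector_derivative_transform_within_open[of "\<lambda>t. snd (c t)" _ _ T])
      show "((\<lambda>t. snd (c t)) has_vector_derivative snd Z) (at 0)"
        by (rule bounded_linear.has_vector_derivative[OF bounded_linear_snd c(3)])
    qed (use T yT in auto)
    ultimately have "snd Z = (- 1 / (l - s)) *\<^sub>R v" using vector_derivative_unique_at by blast
    then show "Z \<in> {(v, (- 1 / (l - s)) *\<^sub>R v) | v. v \<in> W}"
      using vV uv by (auto simp: W_def v_def intro!: exI[of _ "fst Z"] prod_eqI)
  next
    fix Z assume "Z \<in> {(v, (- 1 / (l - s)) *\<^sub>R v) | v. v \<in> W}"
    then obtain v where v: "v \<in> V" "inner u v = 0" and Z: "Z = (v, (- 1 / (l - s)) *\<^sub>R v)"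
      by (auto simp: W_def)
    define \<kappa> where "\<kappa> = l / (l - s)"
    define d where "d = (\<lambda>t::real. (q - pt s) + t *\<^sub>R \<kappa> *\<^sub>R v)"
    define e where "e = (\<lambda>t. ray_end D (pt s) (d t))"
    define g where "g = (\<lambda>t. inner (- u) (e t - p))"
    define H where "H = horo p (pt s)"
    define \<theta> where "\<theta> = (\<lambda>t. H / (H + g t))"
    define y where "y = (\<lambda>t. p + \<theta> t *\<^sub>R (e t - p))"
    have H: "H > 0" using horo_pos[OF p_bdry pt_D] by (simp add: H_def)
    have d0: "d 0 = s *\<^sub>R (- u)" by (simp add: d_def pt_minus)
    have du: "inner u (d t) = - s" for t unfolding d_def pt_minus using v by (simp add: inner_add inner_diff inner_uu)
    have dV: "d t \<in> V - {0}" for t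
    proof -
      have "d t \<in> V" unfolding d_def pt_minus using v u_V by (intro V_intros)
      moreover have "d t \<noteq> 0" using du[of t] s by auto
      ultimately show ?thesis by simp
    qed
    have e0: "e 0 = q" and r0: "ray_param D (pt s) (d 0) = 1"
      unfolding e_def d0 using s ray_end_scale[OF pt_D u_nonzero(3,2)] ray_param_scale[OF pt_D u_nonzero(3,2)]
      by (auto simp: ray_end_pt ray_param_pt)
    have eb: "e t \<in> bdry D" for t unfolding e_def using dV[of t] pt_D by (intro ray_end_bdry) auto
    have dd: "(d has_derivative (\<lambda>h. h *\<^sub>R \<kappa> *\<^sub>R v)) (at 0)"
      unfolding d_def by (auto intro!: derivative_eq_intros)
    have "((\<lambda>t. (\<lambda>(x, v). ray_param D x v) (pt s, d t)) has_derivative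
      (\<lambda>h. (\<lambda>(dx, dv). - (inner u dx + 1 * inner u dv) / inner u (d 0)) (0, h *\<^sub>R \<kappa> *\<^sub>R v))) (at 0)"
    proof (rule has_derivative_in_compose[where f = "\<lambda>t. (pt s, d t)" and s = UNIV])
      show "((\<lambda>t. (pt s, d t)) has_derivative (\<lambda>h. (0, h *\<^sub>R \<kappa> *\<^sub>R v))) (at 0)"
        using dd by (auto intro!: derivative_eq_intros)
      have "((\<lambda>(x, v). ray_param D x v) has_derivative (\<lambda>(dx, dv). - (inner u dx + 1 * inner u dv) / inner u (d 0)))
        (at (pt s, d 0) within D \<times> (V - {0}))"
        using has_derivative_ray_param_formula[OF pt_D, of "d 0" u] dV[of 0] e0 r0 nrm_q by (simp add: e_def)
      then show "((\<lambda>(x, v). ray_param D x v) has_derivative (\<lambda>(dx, dv). - (inner u dx + 1 * inner u dv) / inner u (d 0)))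
        (at (pt s, d 0) within range (\<lambda>t. (pt s, d t)))"
        by (rule has_derivative_subset) (use pt_D dV in auto)
    qed
    then have rd: "((\<lambda>t. ray_param D (pt s) (d t)) has_derivative (\<lambda>h. 0)) (at 0)"
      using v by simp
    have ed: "(e has_derivative (\<lambda>h. h *\<^sub>R \<kappa> *\<^sub>R v)) (at 0)"
      unfolding e_def ray_end_eq by (rule derivative_eq_intros rd dd refl)+ (simp add: r0)
    have ld: "(g has_derivative (\<lambda>h. 0)) (at 0)"
      unfolding g_def by (rule derivative_eq_intros ed refl)+ (simp add: v)
    have l0: "g 0 = l" by (simp add: g_def e0 p_eq inner_uu)
    have lnn: "g t \<ge> 0" for t
      using nrm_nonneg[OF p_bdry, of "e t"] eb bdry_D_closure by (simp add: g_def nrm_p)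
    have td: "(\<theta> has_derivative (\<lambda>h. 0)) (at 0)"
      unfolding \<theta>_def by (rule derivative_eq_intros ld refl)+ (use H l0 l_pos in auto)
    have t0: "\<theta> 0 = (l - s) / l"
      unfolding \<theta>_def l0 H_def horo_pt using s l_pos by (simp add: field_simps)
    have y0: "y 0 = pt s"
      unfolding y_def e0 t0 using l_pos by (simp add: pt_def p_eq algebra_simps diff_divide_distrib)
    have "(y has_derivative (\<lambda>h. h *\<^sub>R v)) (at 0)"
      unfolding y_def by (rule derivative_eq_intros td ed refl)+ (use t0 s l_pos in \<open>simp add: \<kappa>_def\<close>)
    then have yd: "(y has_vector_derivative v) (at 0)" by (simp add: has_vector_derivative_def)
    have ylim: "(y \<longlongrightarrow> pt s) (nhds 0)"
      using has_vector_derivative_continuous[OF yd] y0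
      by (metis continuous_within tendsto_at_iff_tendsto_nhds)
    have llim: "(g \<longlongrightarrow> l) (nhds 0)"
      using has_derivative_continuous[OF ld] l0
      by (metis continuous_within tendsto_at_iff_tendsto_nhds)
    obtain \<epsilon> where \<epsilon>: "\<epsilon> > 0" "\<And>v. v \<in> V \<Longrightarrow> norm v < \<epsilon> \<Longrightarrow> pt s + v \<in> D" using rel_open[OF pt_D] by blast
    have yV: "y t - pt s \<in> V" for t
    proof -
      have "e t - p \<in> V" "p - pt s \<in> V" using closure_diff_in_V eb p_bdry bdry_D_closure pt_D D_closure by blast+
      then have "(p - pt s) + \<theta> t *\<^sub>R (e t - p) \<in> V"
        by (metis V_intros(1) V_intros(3))
      then show ?thesis by (simp add: y_def algebra_simps)
    qed
    have "\<forall>\<^sub>F t in nhds 0. (y t, sgn (p - y t)) \<in> stable_manifold D (pt s, u)"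
      using tendstoD[OF ylim \<epsilon>(1)] order_tendstoD(1)[OF llim, of 0, OF l_pos]
    proof eventually_elim
      case (elim t)
      have "pt s + (y t - pt s) \<in> D" using elim(1) yV by (intro \<epsilon>) (auto simp: dist_norm)
      then have yD: "y t \<in> D" by simp
      have th: "0 < \<theta> t" "\<theta> t < 1" using H elim(2) by (auto simp: \<theta>_def)
      have "ray_param D (y t) (y t - p) = 1 / \<theta> t - 1"
      proof (rule ray_param_eqI[OF yD])
        show "0 < 1 / \<theta> t - 1" using th by simp
        have "y t + (1 / \<theta> t - 1) *\<^sub>R (y t - p) = e t"
        proof -
          have "y t + (1 / \<theta> t - 1) *\<^sub>R (y t - p) = p + (1 + (1 / \<theta> t - 1)) *\<^sub>R (\<theta> t *\<^sub>R (e t - p))"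
            unfolding scaleR_add_left by (simp add: y_def)
          also have "\<dots> = p + (e t - p)" using th by simp
          finally show ?thesis by simp
        qed
        then show "y t + (1 / \<theta> t - 1) *\<^sub>R (y t - p) \<in> bdry D" using eb by simp
      qed
      moreover have "inner (nrm p) (y t - p) = \<theta> t * g t" by (simp add: nrm_p y_def g_def)
      ultimately have "horo p (y t) = \<theta> t * g t * (1 + 1 / (1 / \<theta> t - 1))" by (simp add: horo_def)
      also have "1 + 1 / (1 / \<theta> t - 1) = 1 / (1 - \<theta> t)" using th by (simp add: divide_simps)
      also have "\<theta> t * g t * (1 / (1 - \<theta> t)) = H"
      proof -
        have "1 - \<theta> t = g t / (H + g t)" unfolding \<theta>_def using H elim(2) by (simp add: divide_simps)
        then show ?thesis using H elim(2) by (simp add: \<theta>_def)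
      qed
      finally show ?case using yD by (auto simp: sm H_def)
    qed
    moreover have "((\<lambda>t. (y t, sgn (p - y t))) has_vector_derivative Z) (at 0)"
      unfolding Z by (intro has_vector_derivative_Pair yd sgn_deriv y0 v)
    ultimately show "Z \<in> E_stable D (pt s, u)"
      unfolding E_stable_def tangent_space_def
      by (intro CollectI exI[of _ "\<lambda>t. (y t, sgn (p - y t))"]) (auto simp: y0 sg)
  qed
qed



text \<open>Reversing the chord exchanges stable and unstable spaces.\<close>
lemma E_unstable_eq: "E_unstable D (pt s, u) = {(v, (1 / s) *\<^sub>R v) | v. v \<in> W}"
proof -
  interpret rev: flat_line V D q p "- u" l by (rule flat_line_reverse)
  have pt': "rev.pt (l - s) = pt s" by (subst rev.pt_def) (simp add: pt_def p_eq algebra_simps)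
  have W': "rev.W = W" by (simp add: rev.W_def W_def)
  define f where "f = (\<lambda>w :: 'v \<times> 'v. (fst w, - snd w))"
  have bl: "bounded_linear f" unfolding f_def
    by (intro bounded_linear_Pair bounded_linear_fst bounded_linear_minus bounded_linear_snd)
  have ff: "f (f w) = w" for w by (simp add: f_def)
  have sgn': "sgn (y - b) = - sgn (b - y)" for y b :: 'v by (metis minus_diff_eq sgn_minus)
  have img: "stable_manifold D (pt s, - u) = f ` unstable_manifold D (pt s, u)"
    "unstable_manifold D (pt s, u) = f ` stable_manifold D (pt s, - u)"
    unfolding stable_manifold_def unstable_manifold_def fwd_end_def bwd_end_def f_def
    by (auto simp: image_iff sgn'[of _ "ray_end D (pt s) (- u)"] intro: sym)
  have fu: "f (pt s, u) = (pt s, - u)" "f (pt s, - u) = (pt s, u)" by (auto simp: f_def)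
  have "E_unstable D (pt s, u) = f ` E_stable D (pt s, - u)"
  proof (intro equalityI subsetI)
    fix Z assume "Z \<in> E_unstable D (pt s, u)"
    then have "f Z \<in> tangent_space (f ` unstable_manifold D (pt s, u)) (f (pt s, u))"
      unfolding E_unstable_def by (rule tangent_space_image_linear[OF bl])
    then have "f Z \<in> E_stable D (pt s, - u)" unfolding E_stable_def fu(1) img(1)[symmetric] .
    then show "Z \<in> f ` E_stable D (pt s, - u)" by (rule image_eqI[rotated]) (simp add: ff)
  next
    fix Z assume "Z \<in> f ` E_stable D (pt s, - u)"
    then obtain Y where Y: "Y \<in> E_stable D (pt s, - u)" "Z = f Y" by blast
    from Y(1) have "f Y \<in> tangent_space (f ` stable_manifold D (pt s, - u)) (f (pt s, - u))"
      unfolding E_stable_def by (rule tangent_space_image_linear[OF bl])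
    then show "Z \<in> E_unstable D (pt s, u)" unfolding E_unstable_def fu(2) img(2)[symmetric] Y(2) .
  qed
  also have "E_stable D (pt s, - u) = {(v, (- 1 / s) *\<^sub>R v) | v. v \<in> W}"
    using rev.E_stable_eq[of "l - s"] s by (simp add: pt' W')
  finally show ?thesis by (auto simp: f_def image_iff)
qed

end

text \<open>The parameter reached after time \<open>t\<close> by the geodesic that starts at parameter
\<open>s\<close>.\<close>
definition pos :: "real \<Rightarrow> real \<Rightarrow> real" where
  "pos t s = l * (exp (2 * t) * s) / (l - s + exp (2 * t) * s)"

lemma
  assumes s: "0 < s" "s < l"
  shows pos_bounds: "0 < pos t s" "pos t s < l"
    and flow_pt: "flow D t (pt s, u) = (pt (pos t s), u)"
    and l_minus_pos: "l - pos t s = l * (l - s) / (l - s + exp (2 * t) * s)"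
    and pos_eq: "pos t s = s + flow_shift (l - s) s t"
proof -
  have den: "l - s + exp (2 * t) * s > 0" using s by (simp add: add_pos_pos)
  have "0 < exp (2 * t) * s" using s by simp
  then show "0 < pos t s" unfolding pos_def using den l_pos by simp
  show lm: "l - pos t s = l * (l - s) / (l - s + exp (2 * t) * s)"
    unfolding pos_def using den by (simp add: field_simps)
  have "0 < l * (l - s) / (l - s + exp (2 * t) * s)" using den s l_pos by simp
  then show "pos t s < l" unfolding lm[symmetric] by simp
  show pe: "pos t s = s + flow_shift (l - s) s t"
    unfolding pos_def flow_shift_def using den by (simp add: field_simps)
  have "flow D t (pt s, u) = (pt s + flow_shift (l - s) s t *\<^sub>R u, u)"
    using flow_eq(2)[OF pt_D[OF s] u_V u_nonzero(1)] by (simp add: ray_param_pt[OF s])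
  then show "flow D t (pt s, u) = (pt (pos t s), u)"
    by (simp add: pe pt_def algebra_simps)
qed

text \<open>The Euclidean speed of the geodesic flow at parameter \<open>s\<close>.\<close>
definition speed :: "real \<Rightarrow> real" where "speed s = 2 * s * (l - s) / l"

text \<open>The tangent vector with coordinate \<open>\<alpha>\<close> along the flow, stable component
given by \<open>a\<close> and unstable component given by \<open>b\<close>.\<close>
definition tan_vec :: "real \<Rightarrow> real \<Rightarrow> 'v \<Rightarrow> 'v \<Rightarrow> 'v \<times> 'v" where
  "tan_vec s \<alpha> a b = ((\<alpha> * speed s) *\<^sub>R u + a + b, (- 1 / (l - s)) *\<^sub>R a + (1 / s) *\<^sub>R b)"

lemma speed_pos: "0 < s \<Longrightarrow> s < l \<Longrightarrow> 0 < speed s"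
  by (simp add: speed_def)

lemma subspace_W: "subspace W"
  unfolding W_def using subspace_V
  by (auto simp: subspace_def inner_add)

lemma flow_field_pt:
  assumes s: "0 < s" "s < l"
  shows "flow_field D (pt s, u) = (speed s *\<^sub>R u, 0)"
proof -
  have "((\<lambda>t. (pt (pos t s), u)) has_vector_derivative (speed s *\<^sub>R u, 0)) (at 0)"
  proof -
    have "((\<lambda>t. pos t s) has_real_derivative speed s) (at 0)"
      unfolding pos_def
      apply (rule derivative_eq_intros refl)+
      using s l_pos by (auto simp: speed_def field_simps power2_eq_square)
    then have "((\<lambda>t. pos t s) has_vector_derivative speed s) (at 0)"
      by (simp add: has_real_derivative_iff_has_vector_derivative)
    from has_vector_derivative_add[OF has_vector_derivative_const
        bounded_linear.has_vector_derivative[OF bounded_linear_scaleR_left this]]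
    have "((\<lambda>t. pt (pos t s)) has_vector_derivative speed s *\<^sub>R u) (at 0)"
      by (simp add: pt_def)
    then show ?thesis by (intro has_vector_derivative_Pair) auto
  qed
  then show ?thesis
    unfolding flow_field_def using flow_pt[OF s] by (simp add: vector_derivative_at)
qed

lemma tan_vec_eqD:
  assumes s: "0 < s" "s < l" and W: "a \<in> W" "b \<in> W" "a' \<in> W" "b' \<in> W"
    and eq: "tan_vec s \<alpha> a b = tan_vec s \<alpha>' a' b'"
  shows "\<alpha> = \<alpha>'" "a = a'" "b = b'"
proof -
  have orth: "inner u a = 0" "inner u b = 0" "inner u a' = 0" "inner u b' = 0" using W by (auto simp: W_def)
  have 1: "(\<alpha> * speed s) *\<^sub>R u + a + b = (\<alpha>' * speed s) *\<^sub>R u + a' + b'"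
    and 2: "(- 1 / (l - s)) *\<^sub>R a + (1 / s) *\<^sub>R b = (- 1 / (l - s)) *\<^sub>R a' + (1 / s) *\<^sub>R b'"
    using eq by (auto simp: tan_vec_def)
  have "inner u ((\<alpha> * speed s) *\<^sub>R u + a + b) = inner u ((\<alpha>' * speed s) *\<^sub>R u + a' + b')" using 1 by simp
  then show al: "\<alpha> = \<alpha>'" using orth speed_pos[OF s] by (simp add: inner_add inner_uu)
  have 3: "a - a' = b' - b" using 1 al by (simp add: algebra_simps)
  have "(1 / s) *\<^sub>R (b - b') = (1 / (l - s)) *\<^sub>R (a - a')"
    using 2 by (simp add: scaleR_diff_right algebra_simps)
  also have "\<dots> = (- 1 / (l - s)) *\<^sub>R (b - b')" unfolding 3 by (simp add: scaleR_diff_right)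
  finally have "(1 / s + 1 / (l - s)) *\<^sub>R (b - b') = 0" by (simp add: scaleR_add_left)
  moreover have "1 / s + 1 / (l - s) > 0" using s by (simp add: add_pos_pos)
  ultimately show "b = b'" by simp
  then show "a = a'" using 3 by simp
qed

text \<open>The coordinates \<open>\<alpha>, a, b\<close> are determined by the vector, hence the
description that defines the norm has a unique solution.\<close>
lemma hnorm_tan_vec:
  assumes s: "0 < s" "s < l" and W: "a \<in> W" "b \<in> W"
  shows "hnorm D (pt s, u) (tan_vec s \<alpha> a b) = sqrt (\<alpha>\<^sup>2 + (finsler D (pt s) a)\<^sup>2 + (finsler D (pt s) b)\<^sup>2)"
proof -
  have dec: "\<beta> *\<^sub>R flow_field D (pt s, u) + (a', (- 1 / (l - s)) *\<^sub>R a') + (b', (1 / s) *\<^sub>R b') = tan_vec s \<beta> a' b'"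
    for \<beta> a' b' by (simp add: flow_field_pt[OF s] tan_vec_def)
  show ?thesis
    unfolding hnorm_def E_stable_eq[OF s] E_unstable_eq[OF s]
  proof (rule the_equality)
    show "\<exists>\<beta>. \<exists>Zs\<in>{(v, (- 1 / (l - s)) *\<^sub>R v) |v. v \<in> W}. \<exists>Zu\<in>{(v, (1 / s) *\<^sub>R v) |v. v \<in> W}.
       tan_vec s \<alpha> a b = \<beta> *\<^sub>R flow_field D (pt s, u) + Zs + Zu \<and>
       sqrt (\<alpha>\<^sup>2 + (finsler D (pt s) a)\<^sup>2 + (finsler D (pt s) b)\<^sup>2) =
       sqrt (\<beta>\<^sup>2 + (finsler D (fst (pt s, u)) (fst Zs))\<^sup>2 + (finsler D (fst (pt s, u)) (fst Zu))\<^sup>2)"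
      using W by (intro exI[of _ \<alpha>] bexI[of _ "(a, (- 1 / (l - s)) *\<^sub>R a)"] bexI[of _ "(b, (1 / s) *\<^sub>R b)"])
        (auto simp only: dec fst_conv)
  next
    fix r assume "\<exists>\<beta>. \<exists>Zs\<in>{(v, (- 1 / (l - s)) *\<^sub>R v) |v. v \<in> W}. \<exists>Zu\<in>{(v, (1 / s) *\<^sub>R v) |v. v \<in> W}.
       tan_vec s \<alpha> a b = \<beta> *\<^sub>R flow_field D (pt s, u) + Zs + Zu \<and>
       r = sqrt (\<beta>\<^sup>2 + (finsler D (fst (pt s, u)) (fst Zs))\<^sup>2 + (finsler D (fst (pt s, u)) (fst Zu))\<^sup>2)"
    then obtain \<beta> a' b' where *: "a' \<in> W" "b' \<in> W"
      "tan_vec s \<alpha> a b = \<beta> *\<^sub>R flow_field D (pt s, u) + (a', (- 1 / (l - s)) *\<^sub>R a') + (b', (1 / s) *\<^sub>R b')"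
      "r = sqrt (\<beta>\<^sup>2 + (finsler D (pt s) a')\<^sup>2 + (finsler D (pt s) b')\<^sup>2)"
      by auto
    have "tan_vec s \<alpha> a b = tan_vec s \<beta> a' b'" using *(3) unfolding dec .
    then show "r = sqrt (\<alpha>\<^sup>2 + (finsler D (pt s) a)\<^sup>2 + (finsler D (pt s) b)\<^sup>2)"
      using tan_vec_eqD[OF s W *(1,2), of \<alpha> \<beta>] *(4) by simp
  qed
qed

text \<open>Velocities of curves of unit directions are orthogonal to \<open>u\<close>, which leaves
exactly the flow direction and two copies of \<open>W\<close>; the two copies are separated by solving a
linear system with determinant \<open>1 / s + 1 / (l - s)\<close>.\<close>
lemma tangent_space_HV:
  assumes s: "0 < s" "s < l" and Z: "Z \<in> tangent_space HV (pt s, u)"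
  obtains \<alpha> a b where "a \<in> W" "b \<in> W" "Z = tan_vec s \<alpha> a b"
proof -
  obtain c where c: "c 0 = (pt s, u)" "\<forall>\<^sub>F t in nhds 0. c t \<in> HV" "(c has_vector_derivative Z) (at 0)"
    using Z by (auto simp: tangent_space_def)
  define x where "x = fst Z"
  define v where "v = snd Z"
  have c1: "((\<lambda>t. fst (c t)) has_vector_derivative x) (at 0)"
    unfolding x_def by (rule bounded_linear.has_vector_derivative[OF bounded_linear_fst c(3)])
  have c2: "((\<lambda>t. snd (c t)) has_vector_derivative v) (at 0)"
    unfolding v_def by (rule bounded_linear.has_vector_derivative[OF bounded_linear_snd c(3)])
  have ev: "\<forall>\<^sub>F t in nhds 0. fst (c t) - fst (c 0) \<in> V" "\<forall>\<^sub>F t in nhds 0. snd (c t) - snd (c 0) \<in> V"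
    using c(2) by (eventually_elim, use c(1) pt_D[OF s] diff_in_V u_V in \<open>auto simp: HV_def intro: V_intros\<close>)+
  have V: "x \<in> V" "v \<in> V"
    using has_vector_derivative_in_closed_subspace[OF subspace_V closed_V ev(1) c1]
      has_vector_derivative_in_closed_subspace[OF subspace_V closed_V ev(2) c2] by auto
  obtain T where T: "open T" "0 \<in> T" "\<And>t. t \<in> T \<Longrightarrow> c t \<in> HV"
    using c(2) unfolding eventually_nhds by auto
  have "((\<lambda>t. inner (snd (c t)) (snd (c t))) has_derivative (\<lambda>h. 2 * h * inner u v)) (at 0)"
    using has_derivative_inner[OF c2[unfolded has_vector_derivative_def] c2[unfolded has_vector_derivative_def]]
    by (rule has_derivative_eq_rhs) (simp add: c(1) inner_commute fun_eq_iff)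
  moreover have "((\<lambda>t. inner (snd (c t)) (snd (c t))) has_derivative (\<lambda>h. 0)) (at 0)"
    by (rule has_derivative_transform_within_open[of "\<lambda>t. 1" _ _ UNIV T])
      (use T in \<open>auto simp: HV_def split_def norm_eq_1\<close>)
  ultimately have "(\<lambda>h. 2 * h * inner u v) = (\<lambda>h. 0)" by (rule has_derivative_unique)
  then have "2 * 1 * inner u v = 0" by meson
  then have vW: "v \<in> W" using V by (simp add: W_def)
  define \<alpha> where "\<alpha> = inner u x / speed s"
  define y where "y = x - inner u x *\<^sub>R u"
  have yW: "y \<in> W" using V u_V by (auto simp: W_def y_def inner_diff inner_uu intro: V_intros)
  define b where "b = (s * (l - s) / l) *\<^sub>R (v + (1 / (l - s)) *\<^sub>R y)"
  have bW: "b \<in> W" "y - b \<in> W" unfolding b_def using vW yW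
    by (auto intro!: subspace_add[OF subspace_W] subspace_scale[OF subspace_W] subspace_diff[OF subspace_W])
  have "(\<alpha> * speed s) *\<^sub>R u + (y - b) + b = x" using speed_pos[OF s] by (simp add: \<alpha>_def y_def)
  moreover have "(- 1 / (l - s)) *\<^sub>R (y - b) + (1 / s) *\<^sub>R b = v"
  proof -
    have "(- 1 / (l - s)) *\<^sub>R (y - b) + (1 / s) *\<^sub>R b = (1 / (l - s) + 1 / s) *\<^sub>R b - (1 / (l - s)) *\<^sub>R y"
      by (simp add: algebra_simps)
    also have "(1 / (l - s) + 1 / s) *\<^sub>R b = v + (1 / (l - s)) *\<^sub>R y"
    proof -
      have "(1 / (l - s) + 1 / s) * (s * (l - s) / l) = 1" using s l_pos by (simp add: field_simps)
      then show ?thesis unfolding b_def scaleR_scaleR by simp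
    qed
    finally show ?thesis by simp
  qed
  ultimately have "Z = tan_vec s \<alpha> (y - b) b" by (simp add: tan_vec_def x_def v_def prod_eq_iff)
  then show ?thesis using that bW by blast
qed

lemma stable_in_tangent_space:
  assumes s: "0 < s" "s < l" and a: "a \<in> W"
  shows "tan_vec s 0 a 0 \<in> tangent_space HV (pt s, u)"
proof -
  have "stable_manifold D (pt s, u) \<subseteq> HV"
  proof -
    have "sgn (p - y) \<in> V \<and> norm (sgn (p - y)) = 1" if "y \<in> D" for y
      using bdry_diff(2,3)[OF p_bdry that] V_intros(3) by (simp add: norm_sgn sgn_div_norm)
    then show ?thesis
      by (auto simp: stable_manifold_def fwd_end_def ray_end_pt[OF s] HV_def horosphere_def)
  qed
  then have "E_stable D (pt s, u) \<subseteq> tangent_space HV (pt s, u)"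
    unfolding E_stable_def by (rule tangent_space_mono)
  then show ?thesis using a by (auto simp: E_stable_eq[OF s] tan_vec_def)
qed

text \<open>The flow moves \<open>x\<close> along its direction by \<open>flow_shift\<close> of the
distances to the boundary, whose derivatives are known because the normals at both ends are
\<open>u\<close> and \<open>- u\<close>.\<close>
lemma has_derivative_flow_pt:
  fixes s t :: real
  assumes s: "0 < s" "s < l"
  defines "e \<equiv> exp (2 * t)"
  shows "(flow D t has_derivative (\<lambda>h. (fst h + (pos t s - s) *\<^sub>R snd h +
      ((e - 1) * (e * s\<^sup>2 * (- inner u (fst h) - (l - s) * inner u (snd h)) +
        (l - s)\<^sup>2 * (inner u (fst h) - s * inner u (snd h))) / (l - s + e * s)\<^sup>2) *\<^sub>R u, snd h)))
    (at (pt s, u) within HV)"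
proof -
  let ?F = "at (pt s, u) within HV"
  have HVS: "HV \<subseteq> D \<times> (V - {0})" by (auto simp: HV_def)
  have wHV: "(pt s, u) \<in> HV" using pt_D[OF s] u_V norm_u by (simp add: HV_def)
  have den: "l - s + exp (2 * t) * s \<noteq> 0" using s by (simp add: add_pos_pos less_imp_neq[symmetric])
  have Rp: "((\<lambda>w. ray_param D (fst w) (snd w)) has_derivative (\<lambda>h. - inner u (fst h) - (l - s) * inner u (snd h))) ?F"
    using has_derivative_subset[OF has_derivative_ray_param_formula[OF pt_D[OF s] u_V u_nonzero(1), of "- u"] HVS]
    by (simp add: ray_end_pt[OF s] ray_param_pt[OF s] nrm_p inner_uu split_def algebra_simps)
  have Rm: "((\<lambda>w. ray_param D (fst w) (- snd w)) has_derivative (\<lambda>h. inner u (fst h) - s * inner u (snd h))) ?F"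
  proof -
    have g: "((\<lambda>w. (fst w, - snd w)) has_derivative (\<lambda>h. (fst h, - snd h))) ?F"
      by (auto intro!: derivative_eq_intros)
    have sub: "(\<lambda>w. (fst w, - snd w)) ` HV \<subseteq> D \<times> (V - {0})" using V_intros(4) by (auto simp: HV_def)
    have R: "((\<lambda>w. ray_param D (fst w) (snd w)) has_derivative (\<lambda>h. inner u (fst h) + s * inner u (snd h)))
      (at (pt s, - u) within D \<times> (V - {0}))"
      using has_derivative_ray_param_formula[OF pt_D[OF s] u_nonzero(3,2), of u]
      by (simp add: ray_end_pt[OF s] ray_param_pt[OF s] nrm_q inner_uu split_def algebra_simps)
    then have "((\<lambda>w. ray_param D (fst w) (snd w)) has_derivative (\<lambda>h. inner u (fst h) + s * inner u (snd h)))
      (at ((\<lambda>w. (fst w, - snd w)) (pt s, u)) within (\<lambda>w. (fst w, - snd w)) ` HV)"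
      using has_derivative_subset[OF R sub] by simp
    from has_derivative_in_compose[OF g this] show ?thesis by simp
  qed
  have fs: "((\<lambda>w. flow_shift (ray_param D (fst w) (snd w)) (ray_param D (fst w) (- snd w)) t) has_derivative
     (\<lambda>h. (e - 1) * (e * s\<^sup>2 * (- inner u (fst h) - (l - s) * inner u (snd h)) +
        (l - s)\<^sup>2 * (inner u (fst h) - s * inner u (snd h))) / (l - s + e * s)\<^sup>2)) ?F"
  proof -
    have "((\<lambda>w. flow_shift (fst w) (snd w) t) has_derivative
      (\<lambda>h. (e - 1) * (e * s\<^sup>2 * fst h + (l - s)\<^sup>2 * snd h) / (l - s + e * s)\<^sup>2))
      (at (ray_param D (fst (pt s, u)) (snd (pt s, u)), ray_param D (fst (pt s, u)) (- snd (pt s, u))))"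
      using has_derivative_flow_shift[of "l - s" t s, OF den] by (simp add: ray_param_pt[OF s] e_def)
    from has_derivative_compose[OF has_derivative_Pair[OF Rp Rm] this] show ?thesis by simp
  qed
  have "((\<lambda>w. (fst w + flow_shift (ray_param D (fst w) (snd w)) (ray_param D (fst w) (- snd w)) t *\<^sub>R snd w, snd w))
     has_derivative (\<lambda>h. (fst h + (pos t s - s) *\<^sub>R snd h +
      ((e - 1) * (e * s\<^sup>2 * (- inner u (fst h) - (l - s) * inner u (snd h)) +
        (l - s)\<^sup>2 * (inner u (fst h) - s * inner u (snd h))) / (l - s + e * s)\<^sup>2) *\<^sub>R u, snd h))) ?F"
    apply (rule derivative_eq_intros fs refl)+
    by (simp add: ray_param_pt[OF s] pos_eq[OF s] add_ac)
  then show ?thesis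
  proof (rule has_derivative_transform[OF wHV, rotated])
    fix w assume "w \<in> HV"
    then show "flow D t w = (fst w + flow_shift (ray_param D (fst w) (snd w)) (ray_param D (fst w) (- snd w)) t *\<^sub>R snd w, snd w)"
      using flow_eq(2)[of "fst w" "snd w" t] by (cases "snd w = 0") (auto simp: HV_def)
  qed
qed

text \<open>Stable vectors shrink like the distance to \<open>p\<close> and unstable vectors grow like
the distance to \<open>q\<close>, because straight lines through a common end point stay straight lines
through that point.\<close>
lemma dflow_tan_vec:
  assumes s: "0 < s" "s < l" and W: "a \<in> W" "b \<in> W"
    and Z: "tan_vec s \<alpha> a b \<in> tangent_space HV (pt s, u)"
  shows "frechet_derivative (flow D t) (at (pt s, u) within HV) (tan_vec s \<alpha> a b) =
    tan_vec (pos t s) \<alpha> (((l - pos t s) / (l - s)) *\<^sub>R a) ((pos t s / s) *\<^sub>R b)"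
proof -
  define e where "e = exp (2 * t)"
  define r where "r = pos t s"
  have e: "e > 0" by (simp add: e_def)
  have den: "l - s + e * s > 0" using s e by (simp add: add_pos_pos)
  have r: "r = l * (e * s) / (l - s + e * s)" "l - r = l * (l - s) / (l - s + e * s)" "0 < r" "r < l"
    unfolding r_def e_def using l_minus_pos[OF s] pos_bounds[OF s] by (auto simp: pos_def)
  have i1: "inner u (fst (tan_vec s \<alpha> a b)) = \<alpha> * speed s"
    using W by (simp add: tan_vec_def W_def inner_add inner_uu)
  have i2: "inner u (snd (tan_vec s \<alpha> a b)) = 0"
    using W by (simp add: tan_vec_def W_def inner_add inner_diff)
  have sp: "speed s + ((e - 1) * (e * s\<^sup>2 * (- speed s) + (l - s)\<^sup>2 * speed s)) / (l - s + e * s)\<^sup>2 = speed r"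
  proof -
    have "speed r = 2 * (l * (e * s) / (l - s + e * s)) * (l * (l - s) / (l - s + e * s)) / l"
      unfolding speed_def r(2) by (simp only: r(1))
    also have "\<dots> = speed s * (e * l\<^sup>2) / (l - s + e * s)\<^sup>2"
      using den l_pos by (simp add: speed_def power2_eq_square)
    also have "e * l\<^sup>2 = (l - s + e * s)\<^sup>2 + (e - 1) * ((l - s)\<^sup>2 - e * s\<^sup>2)"
      by (simp add: power2_eq_square algebra_simps)
    also have "speed s * \<dots> / (l - s + e * s)\<^sup>2 =
      speed s + ((e - 1) * (e * s\<^sup>2 * (- speed s) + (l - s)\<^sup>2 * speed s)) / (l - s + e * s)\<^sup>2"
      using den by (simp add: field_simps)
    finally show ?thesis by simp
  qed
  have "frechet_derivative (flow D t) (at (pt s, u) within HV) (tan_vec s \<alpha> a b) =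
    (fst (tan_vec s \<alpha> a b) + (r - s) *\<^sub>R snd (tan_vec s \<alpha> a b) +
      ((e - 1) * (e * s\<^sup>2 * (- (\<alpha> * speed s)) + (l - s)\<^sup>2 * (\<alpha> * speed s)) / (l - s + e * s)\<^sup>2) *\<^sub>R u,
      snd (tan_vec s \<alpha> a b))"
    using frechet_derivative_on_tangent_space[OF has_derivative_flow_pt[OF s] Z, of t] i1 i2
    by (simp add: e_def r_def)
  also have "\<dots> = tan_vec r \<alpha> (((l - r) / (l - s)) *\<^sub>R a) ((r / s) *\<^sub>R b)"
  proof (rule prod_eqI)
    have "fst (tan_vec s \<alpha> a b) + (r - s) *\<^sub>R snd (tan_vec s \<alpha> a b) = (\<alpha> * speed s) *\<^sub>R u +
      (1 + (r - s) * (- 1 / (l - s))) *\<^sub>R a + (1 + (r - s) * (1 / s)) *\<^sub>R b"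
      by (simp add: tan_vec_def algebra_simps)
    also have "1 + (r - s) * (- 1 / (l - s)) = (l - r) / (l - s)" using s by (simp add: field_simps)
    also have "1 + (r - s) * (1 / s) = r / s" using s by (simp add: field_simps)
    finally have "fst (tan_vec s \<alpha> a b) + (r - s) *\<^sub>R snd (tan_vec s \<alpha> a b) +
      ((e - 1) * (e * s\<^sup>2 * (- (\<alpha> * speed s)) + (l - s)\<^sup>2 * (\<alpha> * speed s)) / (l - s + e * s)\<^sup>2) *\<^sub>R u =
      (\<alpha> * (speed s + ((e - 1) * (e * s\<^sup>2 * (- speed s) + (l - s)\<^sup>2 * speed s)) / (l - s + e * s)\<^sup>2)) *\<^sub>R u +
      ((l - r) / (l - s)) *\<^sub>R a + (r / s) *\<^sub>R b"
      by (simp add: algebra_simps add_divide_distrib diff_divide_distrib)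
    then show "fst (fst (tan_vec s \<alpha> a b) + (r - s) *\<^sub>R snd (tan_vec s \<alpha> a b) +
      ((e - 1) * (e * s\<^sup>2 * (- (\<alpha> * speed s)) + (l - s)\<^sup>2 * (\<alpha> * speed s)) / (l - s + e * s)\<^sup>2) *\<^sub>R u,
      snd (tan_vec s \<alpha> a b)) = fst (tan_vec r \<alpha> (((l - r) / (l - s)) *\<^sub>R a) ((r / s) *\<^sub>R b))"
      unfolding sp by (simp add: tan_vec_def)
    show "snd (fst (tan_vec s \<alpha> a b) + (r - s) *\<^sub>R snd (tan_vec s \<alpha> a b) +
      ((e - 1) * (e * s\<^sup>2 * (- (\<alpha> * speed s)) + (l - s)\<^sup>2 * (\<alpha> * speed s)) / (l - s + e * s)\<^sup>2) *\<^sub>R u,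
      snd (tan_vec s \<alpha> a b)) = snd (tan_vec r \<alpha> (((l - r) / (l - s)) *\<^sub>R a) ((r / s) *\<^sub>R b))"
      using r(3,4) by (simp add: tan_vec_def)
  qed
  finally show ?thesis by (simp add: r_def)
qed


lemma hnorm_dflow_stable:
  assumes s: "0 < s" "s < l" and a: "a \<in> W"
  shows "hnorm D (flow D t (pt s, u)) (frechet_derivative (flow D t) (at (pt s, u) within HV) (tan_vec s 0 a 0)) =
    finsler D (pt (pos t s)) (((l - pos t s) / (l - s)) *\<^sub>R a)"
proof -
  have 0: "0 \<in> W" using subspace_0[OF subspace_W] .
  have f0: "finsler D x 0 = 0" for x by (simp add: finsler_def)
  have "0 \<le> finsler D x v" for x v
    by (auto simp: finsler_def)
  then show ?thesis
    using dflow_tan_vec[OF s a 0 stable_in_tangent_space[OF s a]] flow_pt[OF s]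
    by (simp add: hnorm_tan_vec[OF pos_bounds[OF s]] subspace_scale[OF subspace_W] a 0 f0)
qed

end

lemma nonpos_if_le_exp_decay:
  fixes x K b :: real
  assumes b: "b > 0" and le: "\<And>t. t \<ge> 0 \<Longrightarrow> x \<le> K * exp (- b * t)"
  shows "x \<le> 0"
proof (rule ccontr)
  assume "\<not> x \<le> 0"
  then have x: "x > 0" by simp
  have K: "K > 0" using le[of 0] x by simp
  \<comment> \<open>\<open>exp (b * t) \<ge> 1 + b * t\<close> makes the left-hand side at least \<open>x + K\<close> at this time\<close>
  define t where "t = K / (b * x)"
  have t: "t \<ge> 0" using K b x by (simp add: t_def)
  have "x * exp (b * t) \<le> K * exp (- b * t) * exp (b * t)" by (intro mult_right_mono le t) simp
  also have "\<dots> = K" by (simp add: mult.assoc flip: exp_add)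
  finally have 1: "x * exp (b * t) \<le> K" .
  have "x * (1 + b * t) \<le> x * exp (b * t)" using x by (intro mult_left_mono exp_ge_add_one_self) auto
  then have "x + x * b * t \<le> K" using 1 by (simp add: algebra_simps)
  moreover have "x * b * t = K" using b x by (simp add: t_def)
  ultimately show False using x by simp
qed

context convex_domain
begin

lemma finsler_scale:
  assumes x: "x \<in> D" and v: "v \<in> V" and c: "c > 0"
  shows "finsler D x (c *\<^sub>R v) = c * finsler D x v"
proof (cases "v = 0")
  case True
  then show ?thesis by (simp add: finsler_def)
next
  case False
  then have v': "- v \<in> V" "- v \<noteq> 0" "c *\<^sub>R v \<in> V" "c *\<^sub>R v \<noteq> 0" using v c by (auto intro: V_intros)
  show ?thesis
    using finsler_eq[OF x v False] finsler_eq[OF x v'(3,4)] ray_param_scale[OF x v False c]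
      ray_param_scale[OF x v'(1,2) c] c by (simp add: algebra_simps)
qed

text \<open>In a bounded set every ray has bounded length.\<close>
lemma finsler_lower_bound:
  obtains B where "B > 0" "\<And>x v. \<lbrakk>x \<in> D; v \<in> V\<rbrakk> \<Longrightarrow> norm v \<le> B * finsler D x v"
proof -
  obtain r where r: "r > 0" "\<And>y. y \<in> closure D \<Longrightarrow> norm y \<le> r"
    using compact_imp_bounded[OF compact_closure_D] by (auto simp: bounded_pos)
  show ?thesis
  proof (rule that[of "2 * r"])
    show "2 * r > 0" using r by simp
    fix x v assume x: "x \<in> D" and v: "v \<in> V"
    show "norm v \<le> 2 * r * finsler D x v"
    proof (cases "v = 0")
      case False
      have le: "1 / ray_param D x w \<ge> norm w / (2 * r)" if w: "w \<in> V" "w \<noteq> 0" for w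
      proof -
        have "norm (ray_param D x w *\<^sub>R w) = norm (ray_end D x w - x)" by (simp add: ray_end_eq)
        also have "\<dots> \<le> norm (ray_end D x w) + norm x" by (rule norm_triangle_ineq4)
        also have "\<dots> \<le> 2 * r" using r(2)[of "ray_end D x w"] r(2)[of x] ray_end_bdry[OF x w] bdry_D_closure D_closure x by force
        finally show ?thesis using ray_param_pos[OF x w] r(1) by (simp add: field_simps)
      qed
      have v': "- v \<in> V" "- v \<noteq> 0" using v False by (auto intro: V_intros)
      have "norm v / (2 * r) \<le> finsler D x v"
        using finsler_eq[OF x v False] le[OF v False] le[OF v'] by simp
      then show ?thesis using r(1) by (simp add: field_simps)
    qed (simp add: finsler_def)
  qed
qed

end

context flat_line
begin

text \<open>The cone from \<open>p\<close> over a chord through \<open>pt s\<close> lies in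
\<open>D\<close>, so the chords through \<open>pt r\<close> shrink at most linearly with the distance to
\<open>p\<close>. Thus stable vectors never grow in the Finsler norm.\<close>
lemma finsler_stable_le:
  assumes s: "0 < s" "s \<le> r" "r < l" and a: "a \<in> W"
  shows "finsler D (pt r) (((l - r) / (l - s)) *\<^sub>R a) \<le> finsler D (pt s) a"
proof (cases "a = 0")
  case False
  define k where "k = (l - r) / (l - s)"
  have k: "0 < k" "k \<le> 1" using s by (auto simp: k_def)
  have xs: "pt s \<in> D" "pt r \<in> D" using s by (auto intro!: pt_D)
  have ptr: "pt r = p + k *\<^sub>R (pt s - p)"
  proof -
    have "k * (l - s) = l - r" using s by (simp add: k_def)
    then show ?thesis
      using s by (simp add: pt_def p_eq flip: scaleR_diff_left)
        (simp add: algebra_simps flip: scaleR_add_left scaleR_diff_left)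
  qed
  have aV: "a \<in> V" "- a \<in> V" using a by (auto simp: W_def intro: V_intros)
  have le: "ray_param D (pt s) w \<le> ray_param D (pt r) (k *\<^sub>R w)" if w: "w \<in> V" "w \<noteq> 0" for w
  proof -
    let ?R = "ray_param D (pt s) w"
    have kw: "k *\<^sub>R w \<in> V" "k *\<^sub>R w \<noteq> 0" using w k by (auto intro: V_intros)
    have e: "pt s + ?R *\<^sub>R w \<in> closure D" using ray_param_bdry[OF xs(1) w] bdry_D_closure by blast
    have "(1 - k) *\<^sub>R p + k *\<^sub>R (pt s + ?R *\<^sub>R w) \<in> closure D"
      using convex_closure[OF convex_D] e p_bdry bdry_D_closure k by (intro convexD) auto
    also have "(1 - k) *\<^sub>R p + k *\<^sub>R (pt s + ?R *\<^sub>R w) = pt r + ?R *\<^sub>R (k *\<^sub>R w)"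
      unfolding ptr by (simp add: algebra_simps)
    finally show ?thesis
      using ray_unique[OF xs(2) ray_param_pos[OF xs(2) kw] ray_param_bdry[OF xs(2) kw]] ray_param_pos[OF xs(1) w]
      by simp
  qed
  have "1 / ray_param D (pt r) (k *\<^sub>R w) \<le> 1 / ray_param D (pt s) w" if w: "w \<in> V" "w \<noteq> 0" for w
    using le[OF w] ray_param_pos[OF xs(1) w] by (intro divide_left_mono) auto
  note inv_le = this
  have "k *\<^sub>R a \<noteq> 0" using False k by simp
  then show ?thesis
    using inv_le[of a] inv_le[of "- a"] False aV k finsler_eq[OF xs(1) aV(1) False] finsler_eq[OF xs(2), of "k *\<^sub>R a"] V_intros(3)[OF aV(1), of k]
    by (simp flip: k_def)
qed (simp add: finsler_def)

lemma pos_inverse: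
  assumes s: "0 < s" "s < l"
  shows "pos (- t) (pos t s) = s" "pos 0 s = s" "t \<ge> 0 \<Longrightarrow> s \<le> pos t s"
proof -
  define e where "e = exp (2 * t)"
  have e: "e > 0" by (simp add: e_def)
  have den: "l - s + e * s > 0" using s e by (simp add: add_pos_pos)
  have r: "pos t s = l * (e * s) / (l - s + e * s)" by (simp add: pos_def e_def)
  have r': "l - pos t s = l * (l - s) / (l - s + e * s)" using l_minus_pos[OF s] by (simp add: e_def)
  have 1: "exp (- (2 * t)) * pos t s = l * s / (l - s + e * s)"
    unfolding r by (simp add: e_def exp_minus)
  have "pos (- t) (pos t s) = l * (l * s / (l - s + e * s)) / (l * (l - s) / (l - s + e * s) + l * s / (l - s + e * s))"
    unfolding pos_def[of "- t"] by (simp add: 1 r')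
  also have "l * (l - s) / (l - s + e * s) + l * s / (l - s + e * s) = l * l / (l - s + e * s)"
    by (simp add: algebra_simps flip: add_divide_distrib)
  also have "l * (l * s / (l - s + e * s)) / (l * l / (l - s + e * s)) = s" using den l_pos by simp
  finally show "pos (- t) (pos t s) = s" .
  show "pos 0 s = s" using l_pos by (simp add: pos_def)
  assume "t \<ge> 0"
  then have "e \<ge> 1" by (simp add: e_def)
  then have "0 \<le> (e - 1) * (l - s) * s" using s by simp
  then have "s * (l - s + e * s) \<le> l * (e * s)" by (simp add: algebra_simps)
  then show "s \<le> pos t s" unfolding r using den by (simp add: pos_le_divide_eq)
qed

text \<open>The stable vector that decays slowly is decomposed along the supposed splitting at time 0.
The contracted summand cannot have an unstable component, since that one grows; hence neither can the
expanded summand, and then it does not grow in the future although backward time should contract it, so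
it vanishes. The slow vector therefore differs from a contracted one only along the flow, which
contradicts its slow decay.\<close>
lemma no_hyperbolic_splitting:
  fixes As Au :: "'v \<times> 'v \<Rightarrow> ('v \<times> 'v) set"
  assumes s: "0 < s" "s < l" and a0: "a0 \<in> W"
    and slow: "\<And>b C. b > 0 \<Longrightarrow>
      \<exists>t\<ge>0. C * exp (- b * t) < finsler D (pt (pos t s)) (((l - pos t s) / (l - s)) *\<^sub>R a0)"
    and NW: "\<And>t. (pt (pos t s), u) \<in> NW"
    and split: "\<And>w. w \<in> NW \<Longrightarrow> subspace (As w) \<and> subspace (Au w) \<and>
       bij_betw (\<lambda>(\<alpha>, Zs, Zu). \<alpha> *\<^sub>R flow_field D w + Zs + Zu)
         (UNIV \<times> As w \<times> Au w) (tangent_space HV w)"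
    and inv: "\<And>w t. w \<in> NW \<Longrightarrow> frechet_derivative (flow D t) (at w within HV) ` Au w = Au (flow D t w)"
    and bC: "b > 0" "C > 0"
    and hyp_s: "\<And>w t Z. \<lbrakk>w \<in> NW; t \<ge> 0; Z \<in> As w\<rbrakk> \<Longrightarrow>
      hnorm D (flow D t w) (frechet_derivative (flow D t) (at w within HV) Z) \<le> C * exp (- b * t) * hnorm D w Z"
    and hyp_u: "\<And>w t Z. \<lbrakk>w \<in> NW; t \<ge> 0; Z \<in> Au w\<rbrakk> \<Longrightarrow>
      hnorm D (flow D (- t) w) (frechet_derivative (flow D (- t)) (at w within HV) Z) \<le> C * exp (- b * t) * hnorm D w Z"
  shows False
proof -
  let ?y = "\<lambda>t. (pt (pos t s), u)" and ?ini = "(pt s, u)"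
  define dfl where "dfl = (\<lambda>t w. frechet_derivative (flow D t) (at w within HV))"
  define F where "F = (\<lambda>s. finsler D (pt s))"
  define k where "k = (\<lambda>t. (l - pos t s) / (l - s))"
  note b = pos_bounds[OF s]
  have w0: "?ini \<in> NW" using NW[of 0] pos_inverse(2)[OF s] by simp
  have fl: "flow D t ?ini = ?y t" "flow D (- t) (?y t) = ?ini" for t
    using flow_pt[OF s] flow_pt[OF b] pos_inverse(1)[OF s] by auto
  have F0: "F r 0 = 0" and Fnn: "F r v \<ge> 0" for r v by (auto simp: F_def finsler_def)
  have tan: "Z \<in> tangent_space HV w" if "w \<in> NW" "Z \<in> As w \<or> Z \<in> Au w" for w Z
  proof -
    have sub: "subspace (As w)" "subspace (Au w)"
      and img: "(\<lambda>(\<alpha>, Zs, Zu). \<alpha> *\<^sub>R flow_field D w + Zs + Zu) ` (UNIV \<times> As w \<times> Au w) = tangent_space HV w"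
      using split[OF that(1)] by (auto simp: bij_betw_def)
    have "(0::real, Z, 0) \<in> UNIV \<times> As w \<times> Au w \<or> (0::real, 0, Z) \<in> UNIV \<times> As w \<times> Au w"
      using that(2) subspace_0 sub by auto
    then show ?thesis
    proof
      assume "(0::real, Z, 0) \<in> UNIV \<times> As w \<times> Au w"
      then show ?thesis unfolding img[symmetric] by (rule image_eqI[rotated]) simp
    next
      assume "(0::real, 0, Z) \<in> UNIV \<times> As w \<times> Au w"
      then show ?thesis unfolding img[symmetric] by (rule image_eqI[rotated]) simp
    qed
  qed
  obtain B where B: "B > 0" "\<And>x v. \<lbrakk>x \<in> D; v \<in> V\<rbrakk> \<Longrightarrow> norm v \<le> B * finsler D x v"
    using finsler_lower_bound by blast
  have WV: "v \<in> V" if "v \<in> W" for v using that by (simp add: W_def)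
  have img0: "(\<lambda>(\<alpha>, Zs, Zu). \<alpha> *\<^sub>R flow_field D ?ini + Zs + Zu) ` (UNIV \<times> As ?ini \<times> Au ?ini) = tangent_space HV ?ini"
    using split[OF w0] by (auto simp: bij_betw_def)
  have "tan_vec s 0 a0 0 \<in> tangent_space HV ?ini" by (rule stable_in_tangent_space[OF s a0])
  then obtain y where y: "y \<in> UNIV \<times> As ?ini \<times> Au ?ini"
    "tan_vec s 0 a0 0 = (\<lambda>(\<alpha>, Zs, Zu). \<alpha> *\<^sub>R flow_field D ?ini + Zs + Zu) y"
    unfolding img0[symmetric] by (rule imageE)
  obtain \<alpha> A U where "y = (\<alpha>, A, U)" by (rule prod_cases3)
  with y have AU: "A \<in> As ?ini" "U \<in> Au ?ini"
    and dec: "tan_vec s 0 a0 0 = \<alpha> *\<^sub>R flow_field D ?ini + A + U" by simp_all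
  obtain \<alpha>1 a1 b1 where 1: "a1 \<in> W" "b1 \<in> W" "A = tan_vec s \<alpha>1 a1 b1"
    using tangent_space_HV[OF s tan[OF w0]] AU by blast
  obtain \<alpha>2 a2 b2 where 2: "a2 \<in> W" "b2 \<in> W" "U = tan_vec s \<alpha>2 a2 b2"
    using tangent_space_HV[OF s tan[OF w0]] AU by blast
  note W = subspace_add[OF subspace_W] subspace_scale[OF subspace_W] subspace_0[OF subspace_W]
  have "tan_vec s 0 a0 0 = tan_vec s (\<alpha> + \<alpha>1 + \<alpha>2) (a1 + a2) (b1 + b2)"
    unfolding dec flow_field_pt[OF s] 1 2 by (simp add: tan_vec_def algebra_simps)
  note eqs = tan_vec_eqD[OF s a0 W(3) W(1)[OF 1(1) 2(1)] W(1)[OF 1(2) 2(2)] this]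
  define N where "N = hnorm D ?ini A"
  have A: "sqrt (\<alpha>1\<^sup>2 + (F (pos t s) (k t *\<^sub>R a1))\<^sup>2 + (F (pos t s) ((pos t s / s) *\<^sub>R b1))\<^sup>2) \<le> C * N * exp (- b * t)"
    if t: "t \<ge> 0" for t
  proof -
    have "hnorm D (?y t) (dfl t ?ini A) \<le> C * exp (- b * t) * N"
      using hyp_s[OF w0 t AU(1)] by (simp add: dfl_def N_def fl)
    moreover have "dfl t ?ini A = tan_vec (pos t s) \<alpha>1 (k t *\<^sub>R a1) ((pos t s / s) *\<^sub>R b1)"
      using dflow_tan_vec[OF s 1(1,2)] tan[OF w0] AU(1) 1(3) by (simp add: dfl_def k_def)
    ultimately show ?thesis
      using hnorm_tan_vec[OF b W(2)[OF 1(1)] W(2)[OF 1(2)]] by (simp add: F_def mult_ac)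
  qed
  \<comment> \<open>the unstable coordinate of \<open>A\<close> does not shrink, hence vanishes\<close>
  have "norm b1 \<le> B * (C * N) * exp (- b * t)" if t: "t \<ge> 0" for t
  proof -
    let ?r = "pos t s"
    have "norm b1 \<le> ?r / s * norm b1"
      using pos_inverse(3)[OF s t] s mult_right_mono[of 1 "?r / s" "norm b1"] by simp
    also have "\<dots> = norm ((?r / s) *\<^sub>R b1)" using b[of t] s by simp
    also have "\<dots> \<le> B * F ?r ((?r / s) *\<^sub>R b1)"
      unfolding F_def by (intro B pt_D[OF b] WV W 1)
    also have "\<dots> \<le> B * sqrt (\<alpha>1\<^sup>2 + (F ?r (k t *\<^sub>R a1))\<^sup>2 + (F ?r ((?r / s) *\<^sub>R b1))\<^sup>2)"
      using B(1) by (intro mult_left_mono real_le_rsqrt) auto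
    also have "\<dots> \<le> B * (C * N * exp (- b * t))" using A[OF t] B(1) by (intro mult_left_mono) auto
    finally show ?thesis by simp
  qed
  then have "norm b1 \<le> 0" using nonpos_if_le_exp_decay[OF bC(1), of "norm b1" "B * (C * N)"] by blast
  then have b1: "b1 = 0" by simp
  then have b2: "b2 = 0" using eqs(3) by simp
  \<comment> \<open>so \<open>U\<close> has no unstable coordinate and stays bounded in the future, which forces it to vanish\<close>
  define N2 where "N2 = sqrt (\<alpha>2\<^sup>2 + (F s a2)\<^sup>2)"
  have "N2 \<le> (C * N2) * exp (- b * t)" if t: "t \<ge> 0" for t
  proof -
    let ?r = "pos t s"
    have U1: "dfl t ?ini U = tan_vec ?r \<alpha>2 (k t *\<^sub>R a2) 0"
      using dflow_tan_vec[OF s 2(1,2)] tan[OF w0] AU(2) 2(3) b2 by (simp add: dfl_def k_def)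
    have Ut: "tan_vec ?r \<alpha>2 (k t *\<^sub>R a2) 0 \<in> Au (?y t)"
      using inv[OF w0, of t] AU(2) unfolding U1[symmetric] fl dfl_def by blast
    have ret: "dfl (- t) (?y t) (tan_vec ?r \<alpha>2 (k t *\<^sub>R a2) 0) = tan_vec s \<alpha>2 a2 0"
    proof -
      have 1: "(l - s) / (l - ?r) * k t = 1" using s b[of t] by (simp add: k_def)
      have "tan_vec ?r \<alpha>2 (k t *\<^sub>R a2) 0 \<in> tangent_space HV (?y t)"
        using tan[OF NW] Ut by blast
      from dflow_tan_vec[OF b W(2)[OF 2(1)] W(3) this, of "- t"] show ?thesis
        unfolding dfl_def pos_inverse(1)[OF s] scaleR_scaleR 1 scaleR_zero_right scaleR_one .
    qed
    have "hnorm D ?ini (tan_vec s \<alpha>2 a2 0) \<le> C * exp (- b * t) * hnorm D (?y t) (tan_vec ?r \<alpha>2 (k t *\<^sub>R a2) 0)"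
      using hyp_u[OF NW t Ut] ret by (simp add: dfl_def fl)
    then have "N2 \<le> C * exp (- b * t) * sqrt (\<alpha>2\<^sup>2 + (F ?r (k t *\<^sub>R a2))\<^sup>2)"
      using hnorm_tan_vec[OF s 2(1) W(3)] hnorm_tan_vec[OF b W(2)[OF 2(1)] W(3)] F0
      by (simp add: N2_def F_def)
    also have "\<dots> \<le> C * exp (- b * t) * N2"
    proof -
      have "F ?r (k t *\<^sub>R a2) \<le> F s a2"
        unfolding F_def k_def using finsler_stable_le[OF s(1) pos_inverse(3)[OF s t] b(2) 2(1)] .
      then show ?thesis unfolding N2_def using bC Fnn
        by (intro mult_left_mono real_sqrt_le_mono add_left_mono power_mono) auto
    qed
    finally show ?thesis by (simp add: mult_ac)
  qed
  then have "N2 \<le> 0" using nonpos_if_le_exp_decay[OF bC(1), of N2 "C * N2"] by blast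
  then have "\<alpha>2\<^sup>2 + (F s a2)\<^sup>2 \<le> 0" by (simp add: N2_def)
  then have "(F s a2)\<^sup>2 \<le> 0" using zero_le_power2[of \<alpha>2] by linarith
  then have "F s a2 = 0" by simp
  then have "a2 = 0" using B(2)[OF pt_D[OF s] WV[OF 2(1)]] by (simp add: F_def)
  then have a1: "a1 = a0" using eqs(2) by simp
  obtain t where t: "t \<ge> 0" "C * N * exp (- b * t) < F (pos t s) (k t *\<^sub>R a0)"
    using slow[OF bC(1), of "C * N"] by (auto simp: F_def k_def)
  have "F (pos t s) (k t *\<^sub>R a0) \<le> sqrt (\<alpha>1\<^sup>2 + (F (pos t s) (k t *\<^sub>R a1))\<^sup>2 + (F (pos t s) ((pos t s / s) *\<^sub>R b1))\<^sup>2)"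
    unfolding a1 by (intro real_le_rsqrt) auto
  then show False using A[OF t(1)] t(2) by simp
qed

end

section \<open>Coordinates of the chart\<close>

abbreviation lk :: "rseq \<Rightarrow> nat \<Rightarrow> real" where "lk \<equiv> Poly_Mapping.lookup"

lemma inner_single: "inner v (Poly_Mapping.single i (1::real)) = lk v i"
proof -
  have "inner (Poly_Mapping.single i (1::real)) v = lk v i"
    by (simp add: inner_poly_mapping_def)
  then show ?thesis by (simp add: inner_commute)
qed

lemma bounded_linear_lookup: "bounded_linear (\<lambda>v::rseq. lk v i)"
  using bounded_linear_inner_left[of "Poly_Mapping.single i (1::real)"] by (simp add: inner_single)

lemmas tendsto_lookup [tendsto_intros] = bounded_linear.tendsto[OF bounded_linear_lookup]
lemmas continuous_on_lookup [continuous_intros] = bounded_linear.continuous_on[OF bounded_linear_lookup]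

definition v4 :: "real \<Rightarrow> real \<Rightarrow> real \<Rightarrow> real \<Rightarrow> rseq" where
  "v4 a b c d = Poly_Mapping.single 0 a + Poly_Mapping.single 1 b + Poly_Mapping.single 2 c + Poly_Mapping.single 3 d"

lemma lookup_v4: "lk (v4 a b c d) i = (if i = 0 then a else if i = 1 then b else if i = 2 then c else if i = 3 then d else 0)"
  by (simp add: v4_def lookup_add lookup_single when_def)

lemma lookup_v4_simps [simp]:
  "lk (v4 a b c d) 0 = a" "lk (v4 a b c d) (Suc 0) = b" "lk (v4 a b c d) 2 = c" "lk (v4 a b c d) 3 = d"
  by (simp_all add: lookup_v4)

lemma Rn4_iff: "v \<in> Rn 4 \<longleftrightarrow> (\<forall>i\<ge>4. lk v i = 0)"
  by (auto simp: Rn_def in_keys_iff subset_iff) (meson not_less)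

lemma v4_Rn4 [simp]: "v4 a b c d \<in> Rn 4"
  by (simp add: Rn4_iff lookup_v4)

lemma Rn4_intros:
  "v \<in> Rn 4 \<Longrightarrow> w \<in> Rn 4 \<Longrightarrow> v + w \<in> Rn 4" "v \<in> Rn 4 \<Longrightarrow> w \<in> Rn 4 \<Longrightarrow> v - w \<in> Rn 4"
  "v \<in> Rn 4 \<Longrightarrow> c *\<^sub>R v \<in> Rn 4" "v \<in> Rn 4 \<Longrightarrow> - v \<in> Rn 4" "0 \<in> Rn 4"
  by (auto simp: Rn4_iff lookup_add lookup_minus)

lemma Rn4_eqI:
  assumes "v \<in> Rn 4" "w \<in> Rn 4" "lk v 0 = lk w 0" "lk v 1 = lk w 1" "lk v 2 = lk w 2" "lk v 3 = lk w 3"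
  shows "v = w"
proof (rule poly_mapping_eqI)
  fix i :: nat
  consider "i = 0" | "i = 1" | "i = 2" | "i = 3" | "i \<ge> 4" by linarith
  then show "lk v i = lk w i" by cases (use assms in \<open>auto simp: Rn4_iff\<close>)
qed

lemma inner_Rn4:
  assumes "x \<in> Rn 4"
  shows "inner x y = lk x 0 * lk y 0 + lk x 1 * lk y 1 + lk x 2 * lk y 2 + lk x 3 * lk y 3"
proof -
  have "inner x y = (\<Sum>i<4. lk x i * lk y i)"
    using inner_poly_mapping_superset[of "{..<4}" x y] assms by (simp add: Rn_def)
  also have "{..<4::nat} = {0, 1, 2, 3}" by auto
  finally show ?thesis by simp
qed

lemma closed_Rn4: "closed (Rn 4)"
proof -
  have "Rn 4 = (\<Inter>i\<in>{4..}. {v. lk v i = 0})" by (auto simp: Rn4_iff)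
  moreover have "closed {v. lk v i = 0}" for i
    by (intro closed_Collect_eq continuous_intros)
  ultimately show ?thesis by (metis (no_types, lifting) closed_INT)
qed

definition tr_vec :: rseq where "tr_vec = v4 1 0 1 0"

lemma tr_vec_Rn4 [simp]: "tr_vec \<in> Rn 4" by (simp add: tr_vec_def)

lemma inner_tr_vec: "inner tr_vec v = lk v 0 + lk v 2"
  by (simp add: inner_Rn4 tr_vec_def)

definition V0 :: "rseq set" where "V0 = {v \<in> Rn 4. lk v 0 + lk v 2 = 0}"

lemma chart_dirs_eq: "chart_dirs 3 tr_vec = V0"
  by (simp add: chart_dirs_def V0_def inner_tr_vec)

lemma affine_chart_eq: "affine_chart 3 tr_vec = {v \<in> Rn 4. lk v 0 + lk v 2 = 1}"
  by (simp add: affine_chart_def inner_tr_vec)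

lemma subspace_V0: "subspace V0"
  by (auto simp: subspace_def V0_def Rn4_intros lookup_add simp flip: distrib_left)

lemma compact_V0: "compact (V0 \<inter> cball 0 1)"
proof -
  define f where "f = (\<lambda>(a, b, c, d). a *\<^sub>R v4 1 0 0 0 + b *\<^sub>R v4 0 1 0 0 + c *\<^sub>R v4 0 0 1 0 + d *\<^sub>R v4 0 0 0 1)"
  let ?I = "{-1..1::real}"
  have "compact (f ` (?I \<times> ?I \<times> ?I \<times> ?I))"
    unfolding f_def split_def
    by (intro compact_continuous_image continuous_intros compact_Times) auto
  moreover have "closed (V0 \<inter> cball 0 1)"
  proof -
    have "V0 = Rn 4 \<inter> {v. lk v 0 + lk v 2 = 0}" by (auto simp: V0_def)
    moreover have "closed (Rn 4 \<inter> {v. lk v 0 + lk v 2 = 0})"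
      by (intro closed_Int closed_Rn4 closed_Collect_eq continuous_intros)
    ultimately show ?thesis by auto
  qed
  moreover have "V0 \<inter> cball 0 1 \<subseteq> f ` (?I \<times> ?I \<times> ?I \<times> ?I)"
  proof
    fix v assume v: "v \<in> V0 \<inter> cball 0 1"
    have "\<bar>lk v i\<bar> \<le> 1" for i
    proof -
      have "\<bar>lk v i\<bar> \<le> norm v * norm (Poly_Mapping.single i (1::real))"
        using Cauchy_Schwarz_ineq2[of v "Poly_Mapping.single i (1::real)"] by (simp add: inner_single)
      also have "norm (Poly_Mapping.single i (1::real)) = 1"
        by (simp add: norm_eq_1 inner_single)
      finally show ?thesis using v by simp
    qed
    then have "(lk v 0, lk v 1, lk v 2, lk v 3) \<in> ?I \<times> ?I \<times> ?I \<times> ?I" by (simp add: abs_le_iff)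
    moreover have "v = f (lk v 0, lk v 1, lk v 2, lk v 3)"
      using v by (intro Rn4_eqI) (auto simp: V0_def f_def lookup_add Rn4_intros)
    ultimately show "v \<in> f ` (?I \<times> ?I \<times> ?I \<times> ?I)" by blast
  qed
  ultimately show ?thesis by (metis closed_Int_compact inf.absorb_iff1)
qed

section \<open>Symmetric matrices\<close>

text \<open>The first three coordinates are the entries of a symmetric matrix with diagonal
\<open>v\<^sub>0, v\<^sub>2\<close> and off-diagonal entry \<open>v\<^sub>1\<close>; this is its
determinant.\<close>
definition dt :: "rseq \<Rightarrow> real" where "dt v = lk v 0 * lk v 2 - (lk v 1)\<^sup>2"

definition pd :: "rseq \<Rightarrow> bool" where "pd v \<longleftrightarrow> 0 < lk v 0 \<and> 0 < dt v"

definition psd :: "rseq \<Rightarrow> bool" where "psd v \<longleftrightarrow> 0 \<le> lk v 0 \<and> 0 \<le> lk v 2 \<and> 0 \<le> dt v"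

text \<open>The value at \<open>(m, n)\<close> of the quadratic form of the matrix. At an integer vector
it is small, relative to the square root of the determinant, exactly inside a horoball at the
corresponding cusp.\<close>
definition qf :: "real \<Rightarrow> real \<Rightarrow> rseq \<Rightarrow> real" where
  "qf m n v = m\<^sup>2 * lk v 0 + 2 * m * n * lk v 1 + n\<^sup>2 * lk v 2"

text \<open>The polarisation of the determinant.\<close>
definition mixed :: "rseq \<Rightarrow> rseq \<Rightarrow> real" where
  "mixed v w = lk v 0 * lk w 2 + lk v 2 * lk w 0 - 2 * lk v 1 * lk w 1"

definition rt :: "rseq \<Rightarrow> real" where "rt v = sqrt (dt v)"

lemma pd_lookup2: "pd v \<Longrightarrow> 0 < lk v 2"
proof -
  assume "pd v"
  then have v: "(lk v 1)\<^sup>2 < lk v 0 * lk v 2" "0 < lk v 0" by (auto simp: pd_def dt_def)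
  have "0 < lk v 0 * lk v 2" using v(1) zero_le_power2[of "lk v 1"] by linarith
  from this v(2) show ?thesis by (rule zero_less_mult_pos)
qed

lemma pd_imp_psd: "pd v \<Longrightarrow> psd v"
  using pd_lookup2[of v] by (auto simp: pd_def psd_def)

lemma rt_pos: "pd v \<Longrightarrow> 0 < rt v" by (simp add: pd_def rt_def)

lemma rt_sq: "psd v \<Longrightarrow> (rt v)\<^sup>2 = dt v" by (simp add: psd_def rt_def)

lemma rt_nonneg: "psd v \<Longrightarrow> 0 \<le> rt v" by (simp add: psd_def rt_def)

lemma qf_add: "qf m n (v + w) = qf m n v + qf m n w"
  and qf_scale: "qf m n (c *\<^sub>R v) = c * qf m n v"
  by (auto simp: qf_def lookup_add algebra_simps)

lemma dt_add: "dt (v + w) = dt v + mixed v w + dt w"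
  by (simp add: dt_def mixed_def lookup_add power2_eq_square algebra_simps)

lemma dt_scale: "dt (c *\<^sub>R v) = c\<^sup>2 * dt v"
  by (simp add: dt_def power2_eq_square algebra_simps)

lemma rt_scale: "c \<ge> 0 \<Longrightarrow> rt (c *\<^sub>R v) = c * rt v"
  by (simp add: rt_def dt_scale real_sqrt_mult)

lemma mixed_scale: "mixed v (c *\<^sub>R w) = c * mixed v w"
  and mixed_self: "mixed v v = 2 * dt v"
  by (auto simp: mixed_def dt_def lookup_add power2_eq_square algebra_simps)

lemma pd_scale: "pd v \<Longrightarrow> c > 0 \<Longrightarrow> pd (c *\<^sub>R v)"
  by (simp add: pd_def dt_scale)

lemma qf_psd_nonneg:
  assumes "psd v" shows "0 \<le> qf m n v"
proof (cases "lk v 0 = 0")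
  case True
  then have "(lk v 1)\<^sup>2 \<le> 0" using assms by (simp add: psd_def dt_def)
  then have "lk v 1 = 0" by simp
  then show ?thesis using True assms by (simp add: qf_def psd_def)
next
  case False
  then have v0: "lk v 0 > 0" using assms by (simp add: psd_def)
  have "lk v 0 * qf m n v = (m * lk v 0 + n * lk v 1)\<^sup>2 + n\<^sup>2 * dt v"
    by (simp add: qf_def dt_def power2_eq_square algebra_simps)
  also have "\<dots> \<ge> 0" using assms by (simp add: psd_def)
  finally show ?thesis using v0 by (simp add: zero_le_mult_iff)
qed

lemma qf_pos:
  assumes v: "pd v" and mn: "m \<noteq> 0 \<or> n \<noteq> 0" shows "0 < qf m n v"
proof -
  have v0: "lk v 0 > 0" "dt v > 0" using v by (auto simp: pd_def)
  have eq: "lk v 0 * qf m n v = (m * lk v 0 + n * lk v 1)\<^sup>2 + n\<^sup>2 * dt v"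
    by (simp add: qf_def dt_def power2_eq_square algebra_simps)
  have "0 < (m * lk v 0 + n * lk v 1)\<^sup>2 + n\<^sup>2 * dt v"
  proof (cases "n = 0")
    case True then show ?thesis using mn v0 by simp
  next
    case False then show ?thesis using v0 by (intro add_nonneg_pos) auto
  qed
  then have "0 < lk v 0 * qf m n v" unfolding eq .
  then show ?thesis using v0 by (simp add: zero_less_mult_iff)
qed

text \<open>The identity \<open>\<bar>x\<bar>\<^sup>2 \<bar>y\<bar>\<^sup>2 = (x \<bullet> y)\<^sup>2 +
det(x, y)\<^sup>2\<close> for the bilinear form of \<open>v\<close>, whose area form is scaled by the
determinant.\<close>
lemma lagrange_identity:
  "qf m n v * qf r s v = (m * r * lk v 0 + (m * s + n * r) * lk v 1 + n * s * lk v 2)\<^sup>2 + dt v * (m * s - n * r)\<^sup>2"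
  by (simp add: qf_def dt_def power2_eq_square algebra_simps)

text \<open>Reversed Cauchy-Schwarz inequality for the Lorentzian form \<open>dt\<close> on its positive
cone, with the case of equality.\<close>
lemma mixed_lower:
  assumes v: "pd v" and w: "psd w"
  shows mixed_ge: "2 * rt v * rt w \<le> mixed v w"
    and mixed_eqD: "mixed v w = 2 * rt v * rt w \<Longrightarrow>
      \<exists>r\<ge>0. lk w 0 = r * lk v 0 \<and> lk w 1 = r * lk v 1 \<and> lk w 2 = r * lk v 2"
proof -
  define r where "r = lk w 0 / lk v 0"
  have v0: "lk v 0 > 0" "lk v 2 > 0" using v pd_lookup2 by (auto simp: pd_def)
  have r: "r \<ge> 0" "lk w 0 = r * lk v 0" using v0 w by (auto simp: r_def psd_def)
  have key: "r * mixed v w = (rt w)\<^sup>2 + r\<^sup>2 * (rt v)\<^sup>2 + (lk w 1 - r * lk v 1)\<^sup>2"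
    unfolding rt_sq[OF w] rt_sq[OF pd_imp_psd[OF v]] by (simp add: mixed_def dt_def r power2_eq_square algebra_simps)
  have key': "r * (mixed v w - 2 * rt v * rt w) = (rt w - r * rt v)\<^sup>2 + (lk w 1 - r * lk v 1)\<^sup>2"
    using key by (simp add: power2_eq_square algebra_simps)
  have w1: "lk w 1 = 0 \<and> rt w = 0 \<and> mixed v w = lk v 0 * lk w 2" if "r = 0"
  proof -
    have "(lk w 1)\<^sup>2 \<le> 0" using w that r by (simp add: psd_def dt_def)
    then show ?thesis using that r by (simp add: mixed_def rt_def dt_def)
  qed
  show "2 * rt v * rt w \<le> mixed v w"
  proof (cases "r = 0")
    case True
    then show ?thesis using w1 w v0 by (simp add: psd_def)
  next
    case False
    then have "r > 0" using r by simp
    moreover have "0 \<le> r * (mixed v w - 2 * rt v * rt w)" unfolding key' by simp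
    ultimately show ?thesis by (simp add: zero_le_mult_iff)
  qed
  show "\<exists>r\<ge>0. lk w 0 = r * lk v 0 \<and> lk w 1 = r * lk v 1 \<and> lk w 2 = r * lk v 2"
    if eq: "mixed v w = 2 * rt v * rt w"
  proof (cases "r = 0")
    case True
    then have "lk v 0 * lk w 2 = 0" using w1 eq by (metis mult_zero_right)
    then show ?thesis using True w1 v0 r by (intro exI[of _ 0]) auto
  next
    case False
    have "(rt w - r * rt v)\<^sup>2 + (lk w 1 - r * lk v 1)\<^sup>2 = 0" using key' eq by simp
    then have a: "rt w = r * rt v" "lk w 1 = r * lk v 1"
      by (auto simp: sum_power2_eq_zero_iff)
    have "dt w = r\<^sup>2 * dt v" using a(1) rt_sq[OF w] rt_sq[OF pd_imp_psd[OF v]] by (metis power_mult_distrib)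
    then have "r * lk v 0 * lk w 2 = r * lk v 0 * (r * lk v 2)"
      using a(2) r by (simp add: dt_def power2_eq_square algebra_simps)
    then have "lk w 2 = r * lk v 2" using False v0 by simp
    then show ?thesis using r a by blast
  qed
qed

lemma psd_add_pd: "pd v \<Longrightarrow> psd w \<Longrightarrow> pd (v + w)"
proof -
  assume v: "pd v" and w: "psd w"
  have "0 \<le> 2 * rt v * rt w" using rt_nonneg[OF w] rt_pos[OF v] by simp
  then have "0 \<le> mixed v w" using mixed_ge[OF v w] by linarith
  then show "pd (v + w)" using v w by (auto simp: pd_def dt_add psd_def lookup_add)
qed

text \<open>Minkowski's inequality for determinants of \<open>2 \<times> 2\<close> matrices.\<close>
lemma rt_superadditive:
  assumes v: "pd v" and w: "psd w"
  shows "rt v + rt w \<le> rt (v + w)"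
    and "rt v + rt w = rt (v + w) \<Longrightarrow> \<exists>r\<ge>0. lk w 0 = r * lk v 0 \<and> lk w 1 = r * lk v 1 \<and> lk w 2 = r * lk v 2"
proof -
  note s = psd_add_pd[OF v w]
  have eq: "(rt (v + w))\<^sup>2 = (rt v + rt w)\<^sup>2 + (mixed v w - 2 * rt v * rt w)"
    unfolding rt_sq[OF pd_imp_psd[OF s]] dt_add using rt_sq[OF w] rt_sq[OF pd_imp_psd[OF v]]
    by (simp add: power2_sum)
  have "(rt v + rt w)\<^sup>2 \<le> (rt (v + w))\<^sup>2" using eq mixed_ge[OF v w] by linarith
  then show "rt v + rt w \<le> rt (v + w)"
    using rt_pos[OF s] power2_le_imp_le less_imp_le by blast
  assume "rt v + rt w = rt (v + w)"
  then have "mixed v w = 2 * rt v * rt w" using eq by simp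
  then show "\<exists>r\<ge>0. lk w 0 = r * lk v 0 \<and> lk w 1 = r * lk v 1 \<and> lk w 2 = r * lk v 2"
    by (rule mixed_eqD[OF v w])
qed

section \<open>The profile and the width function\<close>

text \<open>The logarithmic growth is what slows down the flow in the cusps. The two pieces have the
same derivative at 2, so the function is continuously differentiable.\<close>
definition prof :: "real \<Rightarrow> real" where
  "prof r = (if r \<le> 2 then r else 2 + 2 * ln (r / 2))"

definition prof_deriv :: "real \<Rightarrow> real" where "prof_deriv r = min 1 (2 / r)"

lemma prof_deriv_pos: "r > 0 \<Longrightarrow> prof_deriv r > 0"
  by (simp add: prof_deriv_def)

text \<open>Concavity, in the form that the graph lies below each of its tangents. It reduces to
\<open>ln x \<le> x - 1\<close>.\<close>
lemma prof_tangent: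
  assumes r: "r > 0" and r0: "r0 > 0"
  shows "prof r \<le> prof r0 + prof_deriv r0 * (r - r0)"
proof -
  have le: "prof x \<le> x" if "x > 0" for x
    using that ln_le_minus_one[of "x / 2"] by (auto simp: prof_def)
  show ?thesis
  proof (cases "r0 \<le> 2")
    case True
    then have "prof_deriv r0 = 1" using r0 by (simp add: prof_deriv_def field_simps)
    then show ?thesis using True le[OF r] by (simp add: prof_def)
  next
    case False
    then have d: "prof_deriv r0 = 2 / r0" by (simp add: prof_deriv_def field_simps)
    have "prof r \<le> 2 + 2 * ln (r / 2)" if "r > 2" using that by (simp add: prof_def)
    show ?thesis
    proof (cases "r \<le> 2")
      case True
      have "ln (2 / r0) \<le> 2 / r0 - 1" using r0 by (intro ln_le_minus_one) simp
      moreover have "ln (2 / r0) = - ln (r0 / 2)" using r0 by (simp add: ln_div)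
      ultimately have "1 - 2 / r0 \<le> ln (r0 / 2)" by simp
      moreover have "r * (1 - 2 / r0) \<le> 2 * (1 - 2 / r0)" using True False by (intro mult_right_mono) auto
      ultimately have "r \<le> 2 * ln (r0 / 2) + r * (2 / r0)" by (simp add: algebra_simps)
      then show ?thesis using True False r0 by (simp add: prof_def d algebra_simps diff_divide_distrib)
    next
      case F: False
      have "ln (r / r0) \<le> r / r0 - 1" using r r0 by (intro ln_le_minus_one) simp
      moreover have "ln (r / r0) = ln (r / 2) - ln (r0 / 2)" using r r0 by (simp add: ln_div)
      ultimately show ?thesis using F False r0 by (simp add: prof_def d field_simps)
    qed
  qed
qed

lemma prof_le: "r > 0 \<Longrightarrow> prof r \<le> r"
  using ln_le_minus_one[of "r / 2"] by (auto simp: prof_def)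

lemma prof_pos: "r > 0 \<Longrightarrow> prof r > 0"
  by (auto simp: prof_def add_pos_pos)

text \<open>The tangents meet the vertical axis at or above 0, which makes \<open>hgt\<close>
nondecreasing in its first argument.\<close>
lemma prof_intercept_nonneg:
  assumes "r > 0" shows "0 \<le> prof r - r * prof_deriv r"
proof (cases "r \<le> 2")
  case True
  then have "prof_deriv r = 1" using assms by (simp add: prof_deriv_def field_simps)
  then show ?thesis using True by (simp add: prof_def)
next
  case False
  then have "prof_deriv r = 2 / r" by (simp add: prof_deriv_def field_simps)
  then show ?thesis using False by (simp add: prof_def)
qed

lemma prof_has_derivative:
  assumes "r > 0" shows "(prof has_real_derivative prof_deriv r) (at r)"
proof -
  have "continuous_on {0<..} prof_deriv"
    unfolding prof_deriv_def by (intro continuous_intros) auto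
  then have "((\<lambda>r. - prof r) has_derivative (\<lambda>h. inner (- prof_deriv r) h)) (at r within {0<..})"
    using assms prof_tangent
    by (intro has_derivative_of_subgradient[where G = "\<lambda>r. - prof_deriv r"])
      (auto intro!: continuous_intros simp: algebra_simps)
  then have "((\<lambda>r. - prof r) has_real_derivative - prof_deriv r) (at r)"
  proof -
    assume "((\<lambda>r. - prof r) has_derivative (\<lambda>h. inner (- prof_deriv r) h)) (at r within {0<..})"
    moreover have "(\<lambda>h. inner (- prof_deriv r) h) = (*) (- prof_deriv r)" by (simp add: fun_eq_iff)
    ultimately show ?thesis
      unfolding has_field_derivative_def using assms at_within_open[of r "{0<..}"] by simp
  qed
  from DERIV_minus[OF this] show ?thesis by simp
qed

lemma continuous_on_prof: "continuous_on {0<..} prof"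
  using prof_has_derivative by (metis DERIV_isCont continuous_at_imp_continuous_on greaterThan_iff)

text \<open>The perspective of \<open>prof\<close>: homogeneous of degree 1 and jointly concave.\<close>
definition hgt :: "real \<Rightarrow> real \<Rightarrow> real" where "hgt a b = a * prof (b / a)"

text \<open>The supporting linear functionals of the concave function \<open>hgt\<close>, one for each
ratio \<open>r\<close>; both coefficients are nonnegative.\<close>
lemma hgt_tangent:
  assumes "a > 0" "b > 0" "r > 0"
  shows "hgt a b \<le> (prof r - r * prof_deriv r) * a + prof_deriv r * b"
proof -
  have "a * prof (b / a) \<le> a * (prof r + prof_deriv r * (b / a - r))"
    using assms by (intro mult_left_mono prof_tangent) auto
  then show ?thesis using assms by (simp add: hgt_def algebra_simps)
qed

lemma hgt_eq:
  assumes "a > 0"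
  shows "hgt a b = (prof (b / a) - b / a * prof_deriv (b / a)) * a + prof_deriv (b / a) * b"
  using assms by (simp add: hgt_def algebra_simps)

lemma hgt_mono:
  assumes "0 < a" "a \<le> a'" "0 < b" "b \<le> b'"
  shows "hgt a b \<le> hgt a' b'"
proof -
  let ?r = "b' / a'"
  have r: "?r > 0" using assms by simp
  have "hgt a b \<le> (prof ?r - ?r * prof_deriv ?r) * a + prof_deriv ?r * b"
    using assms r by (intro hgt_tangent) auto
  also have "\<dots> \<le> (prof ?r - ?r * prof_deriv ?r) * a' + prof_deriv ?r * b'"
    using assms prof_intercept_nonneg[OF r] prof_deriv_pos[OF r] by (intro add_mono mult_left_mono) auto
  also have "\<dots> = hgt a' b'" using hgt_eq[of a' b'] assms by simp
  finally show ?thesis .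
qed

lemma hgt_le: "a > 0 \<Longrightarrow> b > 0 \<Longrightarrow> hgt a b \<le> b"
  using prof_le[of "b / a"] by (simp add: hgt_def field_simps)

lemma hgt_pos: "a > 0 \<Longrightarrow> b > 0 \<Longrightarrow> 0 < hgt a b"
  by (simp add: hgt_def prof_pos)

text \<open>Far from the cusp the profile is the identity, so the cusp leaves no trace in the
width.\<close>
lemma hgt_inactive: "a > 0 \<Longrightarrow> b \<le> 2 * a \<Longrightarrow> hgt a b = b"
  by (simp add: hgt_def prof_def field_simps)

text \<open>This is equivalent to coprimality; the witnesses complete \<open>(m, n)\<close> to a matrix
of determinant 1.\<close>
definition prim :: "int \<Rightarrow> int \<Rightarrow> bool" where "prim m n \<longleftrightarrow> (\<exists>r s. m * s - n * r = 1)"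

text \<open>Invariant under integral changes of basis, since these permute the primitive vectors. Only
the primitive vectors with \<open>qf m n v < rt v / 2\<close> lower the value below \<open>rt
v\<close>.\<close>
definition width :: "rseq \<Rightarrow> real" where
  "width v = Inf ((\<lambda>(m, n). hgt (qf (of_int m) (of_int n) v) (rt v)) ` {(m, n). prim m n})"

lemma prim_nonzero: "prim m n \<Longrightarrow> real_of_int m \<noteq> 0 \<or> real_of_int n \<noteq> 0"
  by (auto simp: prim_def)

lemma prim_dependent:
  assumes p: "prim m n" and p': "prim m' n'" and dep: "m * n' = n * m'"
  shows "(m' = m \<and> n' = n) \<or> (m' = - m \<and> n' = - n)"
proof -
  obtain r s where rs: "m * s - n * r = 1" using p by (auto simp: prim_def)
  obtain r' s' where rs': "m' * s' - n' * r' = 1" using p' by (auto simp: prim_def)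
  define l where "l = m' * s - n' * r"
  have "m * l = m' * (m * s - n * r)" "n * l = n' * (m * s - n * r)"
    using dep by (auto simp: l_def algebra_simps)
  then have eq: "m' = l * m" "n' = l * n" using rs by (auto simp: mult.commute)
  have "l * (m * s' - n * r') = 1" using rs' by (simp add: eq algebra_simps)
  then have "l = 1 \<or> l = - 1" using zmult_eq_1_iff by blast
  then show ?thesis using eq by auto
qed


text \<open>By the Lagrange identity, the product of the values at two independent integer vectors is at
least the determinant. Hence at most one pair \<open>\<plusminus>(m, n)\<close> has a value below
\<open>rt v\<close>, in other words, the horoballs at different cusps are disjoint.\<close>
lemma qf_disjoint:
  assumes v: "pd v" and p: "prim m n" and p': "prim m' n'" and small: "qf m n v < rt v"
  shows "qf m' n' v = qf m n v \<or> rt v < qf m' n' v"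
proof (cases "m * n' = n * m'")
  case True
  then show ?thesis using prim_dependent[OF p p'] by (auto simp: qf_def)
next
  case False
  then have "1 \<le> (m * n' - n * m')\<^sup>2" by (simp add: int_one_le_iff_zero_less)
  then have "1 \<le> (real_of_int m * real_of_int n' - real_of_int n * real_of_int m')\<^sup>2"
    by (metis (no_types, lifting) of_int_1_le_iff of_int_diff of_int_mult of_int_power)
  then have "dt v * 1 \<le> dt v * (real_of_int m * real_of_int n' - real_of_int n * real_of_int m')\<^sup>2"
    using v by (intro mult_left_mono) (auto simp: pd_def)
  then have "dt v \<le> qf m n v * qf m' n' v" unfolding lagrange_identity by (simp add: add_increasing)
  moreover have "dt v = rt v * rt v" using rt_sq[OF pd_imp_psd[OF v]] by (simp add: power2_eq_square)
  moreover have "qf m n v * qf m' n' v < rt v * qf m' n' v"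
    using small qf_pos[OF v prim_nonzero[OF p']] by simp
  ultimately have "rt v * rt v < rt v * qf m' n' v" by simp
  then show ?thesis using rt_pos[OF v] by simp
qed

text \<open>A short vector realises the infimum, because all other vectors are inactive.\<close>
lemma active_min:
  assumes v: "pd v" and p: "prim m n" and p': "prim m' n'" and small: "qf m n v < rt v"
  shows "hgt (qf m n v) (rt v) \<le> hgt (qf m' n' v) (rt v)"
  using qf_disjoint[OF assms]
proof
  assume "rt v < qf m' n' v"
  then have "hgt (qf m' n' v) (rt v) = rt v" using rt_pos[OF v] by (intro hgt_inactive) auto
  then show ?thesis using hgt_le[OF qf_pos[OF v prim_nonzero[OF p]] rt_pos[OF v]] by simp
qed simp

lemma min_attained:
  assumes v: "pd v"
  obtains m n where "prim m n" "\<And>m' n'. prim m' n' \<Longrightarrow> hgt (qf m n v) (rt v) \<le> hgt (qf m' n' v) (rt v)"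
proof (cases "\<exists>m n. prim m n \<and> qf m n v < rt v")
  case True
  then show ?thesis using that active_min[OF v] by blast
next
  case False
  have p: "prim 1 0" by (auto simp: prim_def)
  have "hgt (qf m n v) (rt v) = rt v" if "prim m n" for m n
  proof -
    have "rt v \<le> qf m n v" using False that by (auto simp: not_less)
    then show ?thesis using rt_pos[OF v] by (intro hgt_inactive) auto
  qed
  then show ?thesis using that[OF p] p by force
qed

lemma
  assumes v: "pd v"
  shows width_le: "prim m n \<Longrightarrow> width v \<le> hgt (qf m n v) (rt v)"
    and width_attained: "\<exists>m n. prim m n \<and> width v = hgt (qf m n v) (rt v)"
proof -
  obtain m0 n0 where p: "prim m0 n0"
    and le: "\<And>m' n'. prim m' n' \<Longrightarrow> hgt (qf m0 n0 v) (rt v) \<le> hgt (qf m' n' v) (rt v)"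
    by (rule min_attained[OF v]) blast
  have "width v = hgt (qf m0 n0 v) (rt v)"
    unfolding width_def by (rule cInf_eq_minimum) (use p le in auto)
  then show "\<exists>m n. prim m n \<and> width v = hgt (qf m n v) (rt v)" "prim m n \<Longrightarrow> width v \<le> hgt (qf m n v) (rt v)"
    using p le by auto
qed

lemma width_eqI:
  assumes "pd v" "prim m n" "\<And>m' n'. prim m' n' \<Longrightarrow> hgt (qf m n v) (rt v) \<le> hgt (qf m' n' v) (rt v)"
  shows "width v = hgt (qf m n v) (rt v)"
  using width_attained[OF assms(1)] width_le[OF assms(1,2)] assms(3) by fastforce

lemma width_le_rt: "pd v \<Longrightarrow> width v \<le> rt v"
  using width_le[of v 1 0] hgt_le[of "qf 1 0 v" "rt v"] rt_pos[of v] qf_pos[of v 1 0]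
  by (force simp: prim_def)

lemma width_pos: "pd v \<Longrightarrow> 0 < width v"
  using width_attained[of v] hgt_pos qf_pos prim_nonzero rt_pos by metis

text \<open>At the minimiser for \<open>v + w\<close> the supporting functional of \<open>hgt\<close>
dominates the widths of \<open>v\<close> and of \<open>w\<close>, while \<open>rt\<close> is
superadditive. The strict versions use strict superadditivity of \<open>rt\<close> on matrices that are
not proportional.\<close>
lemma width_add:
  assumes v: "pd v" and w: "psd w"
  shows width_add_psd: "width v \<le> width (v + w)"
    and width_add_pd: "pd w \<Longrightarrow> width v + width w \<le> width (v + w)"
    and width_add_pd_strict: "pd w \<Longrightarrow> \<not> (\<exists>r\<ge>0. lk w 0 = r * lk v 0 \<and> lk w 1 = r * lk v 1 \<and> lk w 2 = r * lk v 2) \<Longrightarrow>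
       width v + width w < width (v + w)"
    and width_add_psd_strict: "\<not> (\<exists>r\<ge>0. lk w 0 = r * lk v 0 \<and> lk w 1 = r * lk v 1 \<and> lk w 2 = r * lk v 2) \<Longrightarrow>
       width v < width (v + w)"
proof -
  let ?P = "\<exists>r\<ge>0. lk w 0 = r * lk v 0 \<and> lk w 1 = r * lk v 1 \<and> lk w 2 = r * lk v 2"
  note s = psd_add_pd[OF v w]
  obtain m n where p: "prim m n" and eq: "width (v + w) = hgt (qf m n (v + w)) (rt (v + w))"
    using width_attained[OF s] by blast
  define r where "r = rt (v + w) / qf m n (v + w)"
  define \<alpha> where "\<alpha> = prof r - r * prof_deriv r"
  define \<beta> where "\<beta> = prof_deriv r"
  have q: "qf m n (v + w) > 0" "qf m n v > 0" using qf_pos s v prim_nonzero[OF p] by auto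
  have r: "r > 0" using q rt_pos[OF s] by (simp add: r_def)
  have \<alpha>: "\<alpha> \<ge> 0" and \<beta>: "\<beta> > 0" using prof_intercept_nonneg prof_deriv_pos r by (auto simp: \<alpha>_def \<beta>_def)
  have e: "width (v + w) = (\<alpha> * qf m n v + \<beta> * rt v) + (\<alpha> * qf m n w + \<beta> * rt w) + \<beta> * (rt (v + w) - (rt v + rt w))"
  proof -
    have "hgt (qf m n (v + w)) (rt (v + w)) = \<alpha> * qf m n (v + w) + \<beta> * rt (v + w)"
      using hgt_eq[OF q(1)] by (simp only: \<alpha>_def \<beta>_def r_def)
    then show ?thesis unfolding eq qf_add by (simp add: algebra_simps)
  qed
  have 1: "width v \<le> \<alpha> * qf m n v + \<beta> * rt v"
    using width_le[OF v p] hgt_tangent[OF q(2) rt_pos[OF v] r] by (simp add: \<alpha>_def \<beta>_def)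
  have 2: "0 \<le> \<alpha> * qf m n w + \<beta> * rt w"
    using \<alpha> \<beta> qf_psd_nonneg[OF w] rt_nonneg[OF w] by simp
  have 3: "width w \<le> \<alpha> * qf m n w + \<beta> * rt w" if "pd w"
    using width_le[OF that p] hgt_tangent[OF qf_pos[OF that prim_nonzero[OF p]] rt_pos[OF that] r] by (simp add: \<alpha>_def \<beta>_def)
  have 4: "0 \<le> \<beta> * (rt (v + w) - (rt v + rt w))" using \<beta> rt_superadditive(1)[OF v w] by simp
  have 5: "0 < \<beta> * (rt (v + w) - (rt v + rt w))" if "\<not> ?P"
    using \<beta> rt_superadditive[OF v w] that by (metis diff_gt_0_iff_gt mult_pos_pos order_le_less)
  show "width v \<le> width (v + w)" using e 1 2 4 by linarith
  show "width v + width w \<le> width (v + w)" if "pd w" using e 1 3[OF that] 4 by linarith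
  show "width v + width w < width (v + w)" if "pd w" "\<not> ?P" using e 1 3[OF that(1)] 5[OF that(2)] by linarith
  show "width v < width (v + w)" if "\<not> ?P" using e 1 2 5[OF that] by linarith
qed

lemma width_scale:
  assumes v: "pd v" and c: "c > 0"
  shows "width (c *\<^sub>R v) = c * width v"
proof -
  have h: "hgt (qf m n (c *\<^sub>R v)) (rt (c *\<^sub>R v)) = c * hgt (qf m n v) (rt v)" for m n
    using c by (simp add: qf_scale rt_scale hgt_def)
  obtain m n where p: "prim m n" and eq: "width v = hgt (qf m n v) (rt v)"
    using width_attained[OF v] by blast
  show ?thesis
    unfolding eq h[symmetric]
    by (rule width_eqI[OF pd_scale[OF v c] p]) (use eq width_le[OF v] c h in auto)
qed

section \<open>The lens and its supporting functionals\<close>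

lemma width_cong:
  assumes "lk v 0 = lk w 0" "lk v 1 = lk w 1" "lk v 2 = lk w 2"
  shows "width v = width w" "pd v \<longleftrightarrow> pd w" "rt v = rt w" "qf m n v = qf m n w"
  using assms by (auto simp: width_def qf_def rt_def dt_def pd_def)

lemma continuous_on_dt [continuous_intros]: "continuous_on S dt"
  unfolding dt_def by (intro continuous_intros)

lemma continuous_on_qf [continuous_intros]: "continuous_on S (qf m n)"
  unfolding qf_def by (intro continuous_intros)

lemma continuous_on_rt [continuous_intros]: "continuous_on S rt"
  unfolding rt_def by (intro continuous_intros)

lemma tendsto_of_continuous_UNIV: "continuous_on UNIV F \<Longrightarrow> (g \<longlongrightarrow> l) G \<Longrightarrow> ((\<lambda>x. F (g x)) \<longlongrightarrow> F l) G"
  by (rule continuous_on_tendsto_compose[of UNIV]) auto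

lemma open_Collect_pd: "open {v. pd v}"
  unfolding pd_def by (intro open_Collect_conj open_Collect_less continuous_intros)

lemma pdI: "0 \<le> lk v 0 \<Longrightarrow> 0 < dt v \<Longrightarrow> pd v"
  using zero_le_power2[of "lk v 1"] by (cases "lk v 0 = 0") (auto simp: pd_def dt_def)

text \<open>The cone over the domain in the vector space; the trace normalises it to the affine
chart.\<close>
definition lens_cone :: "rseq set" where "lens_cone = {v \<in> Rn 4. pd v \<and> \<bar>lk v 3\<bar> < width v}"

definition lens :: "rseq set" where "lens = {v \<in> lens_cone. lk v 0 + lk v 2 = 1}"

lemma lens_cone_add: "v \<in> lens_cone \<Longrightarrow> w \<in> lens_cone \<Longrightarrow> v + w \<in> lens_cone"
  using width_add_pd[of v w] pd_imp_psd[of w] psd_add_pd[of v w]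
  by (auto simp: lens_cone_def Rn4_intros lookup_add)

lemma lens_cone_scale: "v \<in> lens_cone \<Longrightarrow> c > 0 \<Longrightarrow> c *\<^sub>R v \<in> lens_cone"
  using pd_scale[of v c] width_scale[of v c] by (auto simp: lens_cone_def Rn4_intros abs_mult)

lemma lens_cone_normalise:
  assumes "v \<in> lens_cone" shows "lk v 0 + lk v 2 > 0" "(1 / (lk v 0 + lk v 2)) *\<^sub>R v \<in> lens"
proof -
  show p: "lk v 0 + lk v 2 > 0" using assms pd_lookup2[of v] by (auto simp: lens_cone_def pd_def)
  show "(1 / (lk v 0 + lk v 2)) *\<^sub>R v \<in> lens"
    using lens_cone_scale[OF assms, of "1 / (lk v 0 + lk v 2)"] p by (auto simp: lens_def add_divide_distrib[symmetric])
qed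

text \<open>A multiple \<open>a v\<close> with \<open>a < 1\<close> still has enough width, and the rest
of \<open>v\<close> absorbs a small perturbation in the positive definite cone, where width does not
decrease.\<close>
lemma lens_cone_open:
  assumes v: "v \<in> lens_cone"
  shows "\<exists>e>0. \<forall>w\<in>Rn 4. norm w < e \<longrightarrow> v + w \<in> lens_cone"
proof -
  have pv: "pd v" "\<bar>lk v 3\<bar> < width v" "v \<in> Rn 4" using v by (auto simp: lens_cone_def)
  \<comment> \<open>the mean of 1 and the ratio of the height to the width, which is less than 1\<close>
  define a where "a = (\<bar>lk v 3\<bar> / width v + 1) / 2"
  have wp: "width v > 0" using width_pos pv by blast
  have q: "0 \<le> \<bar>lk v 3\<bar> / width v" "\<bar>lk v 3\<bar> / width v < 1" using pv wp by auto
  have a1: "a < 1" using q(2) by (simp add: a_def)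
  have a2: "\<bar>lk v 3\<bar> / width v < a" 
  proof -
    have "z < (z + 1) / 2" if "z < 1" for z :: real using that by simp
    then show ?thesis using q(2) by (simp only: a_def)
  qed
  have a: "0 < a" "a < 1" "\<bar>lk v 3\<bar> / width v < a" using a1 a2 q(1) by auto
  have av: "\<bar>lk v 3\<bar> < a * width v" using a(3) wp by (simp add: pos_divide_less_eq)
  let ?S = "{w. pd (w + (1 - a) *\<^sub>R v)} \<inter> {w. \<bar>lk (v + w) 3\<bar> < a * width v}"
  have "open {w. pd (w + (1 - a) *\<^sub>R v)}"
  proof -
    have "open ((\<lambda>w. w + (1 - a) *\<^sub>R v) -` {v. pd v})"
      by (intro open_vimage open_Collect_pd continuous_intros)
    then show ?thesis by (simp add: vimage_def)
  qed
  then have "open ?S" by (intro open_Int open_Collect_less continuous_intros)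
  moreover have "0 \<in> ?S" using pd_scale[OF pv(1), of "1 - a"] a av by simp
  ultimately obtain e where e: "e > 0" "ball 0 e \<subseteq> ?S" using open_contains_ball by blast
  show ?thesis
  proof (intro exI[of _ e] conjI ballI impI e(1))
    fix w :: rseq assume w: "w \<in> Rn 4" "norm w < e"
    then have S: "pd (w + (1 - a) *\<^sub>R v)" "\<bar>lk (v + w) 3\<bar> < a * width v" using e(2) by (auto simp: subset_iff)
    have eq: "v + w = a *\<^sub>R v + (w + (1 - a) *\<^sub>R v)" by (simp add: algebra_simps)
    have pa: "pd (a *\<^sub>R v)" using pd_scale[OF pv(1) a(1)] .
    have "pd (v + w)" unfolding eq using psd_add_pd[OF pa pd_imp_psd[OF S(1)]] .
    moreover have "a * width v \<le> width (v + w)"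
      unfolding eq using width_add_psd[OF pa pd_imp_psd[OF S(1)]] width_scale[OF pv(1) a(1)] by simp
    ultimately show "v + w \<in> lens_cone" using w pv S by (auto simp: lens_cone_def Rn4_intros)
  qed
qed

lemma lens_base: "v4 (1/2) 0 (1/2) 0 \<in> lens"
proof -
  have "pd (v4 (1/2) 0 (1/2) 0)" by (simp add: pd_def dt_def)
  then show ?thesis using width_pos by (simp add: lens_def lens_cone_def)
qed

lemma lensD: "v \<in> lens \<Longrightarrow> v \<in> Rn 4 \<and> pd v \<and> \<bar>lk v 3\<bar> < width v \<and> lk v 0 + lk v 2 = 1"
  by (auto simp: lens_def lens_cone_def)

lemma closed_Collect_chart: "closed {v \<in> Rn 4. lk v 0 + lk v 2 = 1 \<and> psd v \<and> \<bar>lk v 3\<bar> \<le> rt v}"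
proof -
  have "{v \<in> Rn 4. lk v 0 + lk v 2 = 1 \<and> psd v \<and> \<bar>lk v 3\<bar> \<le> rt v} =
    Rn 4 \<inter> {v. lk v 0 + lk v 2 = 1} \<inter> {v. 0 \<le> lk v 0} \<inter> {v. 0 \<le> lk v 2} \<inter> {v. 0 \<le> dt v} \<inter> {v. \<bar>lk v 3\<bar> \<le> rt v}"
    by (auto simp: psd_def)
  also have "closed \<dots>"
    by (intro closed_Int closed_Rn4 closed_Collect_eq closed_Collect_le continuous_intros)
  finally show ?thesis .
qed

text \<open>The width is an infimum, so near a positive definite limit point it is bounded above by the
continuous function that belongs to a minimiser at that point.\<close>
lemma lens_closure:
  assumes "v \<in> closure lens"
  shows "v \<in> Rn 4" "lk v 0 + lk v 2 = 1" "psd v" "\<bar>lk v 3\<bar> \<le> rt v" "pd v \<Longrightarrow> \<bar>lk v 3\<bar> \<le> width v"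
proof -
  have sub: "lens \<subseteq> {v \<in> Rn 4. lk v 0 + lk v 2 = 1 \<and> psd v \<and> \<bar>lk v 3\<bar> \<le> rt v}"
    using width_le_rt pd_imp_psd by (fastforce dest!: lensD)
  have "closure lens \<subseteq> {v \<in> Rn 4. lk v 0 + lk v 2 = 1 \<and> psd v \<and> \<bar>lk v 3\<bar> \<le> rt v}"
    using closed_Collect_chart sub by (rule closure_minimal[rotated])
  then show "v \<in> Rn 4" "lk v 0 + lk v 2 = 1" "psd v" "\<bar>lk v 3\<bar> \<le> rt v" using assms by auto
  assume v: "pd v"
  obtain m n where p: "prim m n" "width v = hgt (qf m n v) (rt v)" using width_attained[OF v] by blast
  obtain x where x: "\<And>k. x k \<in> lens" "x \<longlonglongrightarrow> v" using assms closure_sequential by blast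
  have q: "((\<lambda>k. qf m n (x k)) \<longlonglongrightarrow> qf m n v)" and r: "((\<lambda>k. rt (x k)) \<longlonglongrightarrow> rt v)"
    using tendsto_of_continuous_UNIV[OF continuous_on_qf x(2)] tendsto_of_continuous_UNIV[OF continuous_on_rt x(2)] .
  have qp: "qf m n v > 0" "rt v > 0" using qf_pos[OF v prim_nonzero[OF p(1)]] rt_pos[OF v] by auto
  have "(\<lambda>k. prof (rt (x k) / qf m n (x k))) \<longlonglongrightarrow> prof (rt v / qf m n v)"
  proof (rule continuous_on_tendsto_compose[OF continuous_on_prof])
    show "(\<lambda>k. rt (x k) / qf m n (x k)) \<longlonglongrightarrow> rt v / qf m n v" using q r qp by (intro tendsto_intros) auto
    have "0 < qf m n (x k)" "0 < rt (x k)" for k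
      using lensD[OF x(1)[of k]] qf_pos prim_nonzero[OF p(1)] rt_pos by blast+
    then show "\<forall>\<^sub>F k in sequentially. rt (x k) / qf m n (x k) \<in> {0<..}" by simp
  qed (use qp in auto)
  then have "(\<lambda>k. hgt (qf m n (x k)) (rt (x k))) \<longlonglongrightarrow> hgt (qf m n v) (rt v)"
    unfolding hgt_def by (intro tendsto_intros q)
  moreover have "(\<lambda>k. \<bar>lk (x k) 3\<bar>) \<longlonglongrightarrow> \<bar>lk v 3\<bar>" by (intro tendsto_intros x)
  moreover have "\<bar>lk (x k) 3\<bar> \<le> hgt (qf m n (x k)) (rt (x k))" for k
    using lensD[OF x(1)[of k]] width_le[of "x k" m n] p(1) by linarith
  ultimately show "\<bar>lk v 3\<bar> \<le> width v" unfolding p(2) by (auto intro: LIMSEQ_le)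
qed

lemma lens_bdry:
  assumes "v \<in> bdry lens"
  shows "v \<in> Rn 4" "lk v 0 + lk v 2 = 1" "psd v"
    and "(pd v \<and> \<bar>lk v 3\<bar> = width v) \<or> (dt v = 0 \<and> lk v 3 = 0)"
proof -
  have v: "v \<in> closure lens" "v \<notin> lens" using assms by (auto simp: bdry_def)
  note c = lens_closure[OF v(1)]
  show "v \<in> Rn 4" "lk v 0 + lk v 2 = 1" "psd v" using c by auto
  show "(pd v \<and> \<bar>lk v 3\<bar> = width v) \<or> (dt v = 0 \<and> lk v 3 = 0)"
  proof (cases "pd v")
    case True
    then show ?thesis using c v(2) by (auto simp: lens_def lens_cone_def)
  next
    case False
    have "dt v = 0"
    proof (rule ccontr)
      assume "dt v \<noteq> 0"
      then have "dt v > 0" "lk v 0 = 0" using c(3) False by (auto simp: psd_def pd_def)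
      then show False by (simp add: dt_def)
    qed
    then show ?thesis using c(4) by (simp add: rt_def)
  qed
qed

lemma convex_lens: "convex lens"
  unfolding convex_alt
proof (intro ballI allI impI)
  fix x y and u :: real assume x: "x \<in> lens" and y: "y \<in> lens" and u: "0 \<le> u \<and> u \<le> 1"
  show "(1 - u) *\<^sub>R x + u *\<^sub>R y \<in> lens"
  proof (cases "u = 0 \<or> u = 1")
    case True then show ?thesis using x y by auto
  next
    case False
    then have "(1 - u) *\<^sub>R x + u *\<^sub>R y \<in> lens_cone"
      using x y u by (intro lens_cone_add lens_cone_scale) (auto simp: lens_def)
    moreover have "lk ((1 - u) *\<^sub>R x + u *\<^sub>R y) 0 + lk ((1 - u) *\<^sub>R x + u *\<^sub>R y) 2 =
      (1 - u) * (lk x 0 + lk x 2) + u * (lk y 0 + lk y 2)"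
      by (simp add: lookup_add distrib_left)
    ultimately show ?thesis using x y by (simp add: lens_def)
  qed
qed

lemma bounded_lens: "bounded lens"
proof -
  have "norm v \<le> 2" if "v \<in> lens" for v
  proof -
    have v: "v \<in> Rn 4" "pd v" "lk v 0 + lk v 2 = 1" "\<bar>lk v 3\<bar> \<le> rt v" using lensD[OF that] width_le_rt[of v] by auto
    have p: "0 < lk v 0" "0 < lk v 2" "0 < dt v" using v(2) pd_lookup2 by (auto simp: pd_def)
    have le: "lk v 0 \<le> 1" "lk v 2 \<le> 1" using p v(3) by auto
    have "lk v 0 * lk v 2 \<le> 1" using p le mult_le_one[of "lk v 0" "lk v 2"] by simp
    then have 1: "(lk v 1)\<^sup>2 \<le> 1" "dt v \<le> 1" using p(3) zero_le_power2[of "lk v 1"] unfolding dt_def by linarith+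
    have "\<bar>lk v 3\<bar>\<^sup>2 \<le> (rt v)\<^sup>2" using v(4) by (intro power_mono) auto
    then have 2: "(lk v 3)\<^sup>2 \<le> 1" using 1(2) rt_sq[OF pd_imp_psd[OF v(2)]] by simp
    have "(lk v 0)\<^sup>2 \<le> 1" "(lk v 2)\<^sup>2 \<le> 1" using p le by (auto simp: power_le_one)
    then have "inner v v \<le> 4" using 1 2 unfolding inner_Rn4[OF v(1)] by (simp add: power2_eq_square)
    then have "(norm v)\<^sup>2 \<le> 2\<^sup>2" by (simp add: power2_norm_eq_inner)
    then show ?thesis by (rule power2_le_imp_le) simp
  qed
  then show ?thesis unfolding bounded_iff by blast
qed

lemma convex_domain_lens: "convex_domain V0 lens"
proof
  show "subspace V0" "compact (V0 \<inter> cball 0 1)" "lens \<noteq> {}" "convex lens" "bounded lens"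
    using subspace_V0 compact_V0 lens_base convex_lens bounded_lens by auto
  show "x - y \<in> V0" if "x \<in> lens" "y \<in> lens" for x y
    using lensD[OF that(1)] lensD[OF that(2)] by (auto simp: V0_def Rn4_intros lookup_minus)
  show "\<exists>e>0. \<forall>v\<in>V0. norm v < e \<longrightarrow> x + v \<in> lens" if x: "x \<in> lens" for x
  proof -
    obtain e where e: "e > 0" "\<And>w. w \<in> Rn 4 \<Longrightarrow> norm w < e \<Longrightarrow> x + w \<in> lens_cone"
      using lens_cone_open[of x] x by (auto simp: lens_def)
    then show ?thesis using x by (intro exI[of _ e]) (auto simp: lens_def V0_def lookup_add algebra_simps)
  qed
qed

interpretation lens: convex_domain V0 lens by (rule convex_domain_lens)

lemma rank_one_bdry:
  assumes "v \<in> Rn 4" "lk v 0 + lk v 2 = 1" "psd v" "dt v = 0" "lk v 3 = 0"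
  shows "v \<in> bdry lens"
proof -
  let ?b = "v4 (1/2) 0 (1/2) 0"
  have nD: "v \<notin> lens" using assms by (auto simp: lens_def lens_cone_def pd_def)
  have pb: "pd ?b" by (simp add: pd_def dt_def)
  have in_lens: "v + t *\<^sub>R (?b - v) \<in> lens" if t: "0 < t" "t \<le> 1" for t
  proof -
    have eq: "v + t *\<^sub>R (?b - v) = t *\<^sub>R ?b + (1 - t) *\<^sub>R v" by (simp add: algebra_simps)
    have "psd ((1 - t) *\<^sub>R v)" using assms t by (auto simp: psd_def dt_scale)
    then have "pd (v + t *\<^sub>R (?b - v))" unfolding eq by (intro psd_add_pd pd_scale pb t)
    moreover have "lk (v + t *\<^sub>R (?b - v)) 3 = 0" using assms by (simp add: lookup_add lookup_minus)
    moreover have "lk (v + t *\<^sub>R (?b - v)) 0 + lk (v + t *\<^sub>R (?b - v)) 2 = 1"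
    proof -
      have "lk (v + t *\<^sub>R (?b - v)) 0 + lk (v + t *\<^sub>R (?b - v)) 2 = t + (1 - t) * (lk v 0 + lk v 2)"
        by (simp add: lookup_add lookup_minus algebra_simps)
      then show ?thesis using assms(2) by simp
    qed
    ultimately show ?thesis using assms width_pos by (auto simp: lens_def lens_cone_def Rn4_intros)
  qed
  have "(\<lambda>n. v + (1 / real (Suc n)) *\<^sub>R (?b - v)) \<longlonglongrightarrow> v + 0 *\<^sub>R (?b - v)"
    by (intro tendsto_intros LIMSEQ_Suc[OF lim_1_over_n])
  then have "v \<in> closure lens"
    using in_lens by (intro closure_sequential[THEN iffD2] exI[of _ "\<lambda>n. v + (1 / real (Suc n)) *\<^sub>R (?b - v)"]) auto
  then show ?thesis using nD by (simp add: bdry_def)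
qed

text \<open>If some vector is short at \<open>X\<close>, it stays short nearby and is the minimiser.
Otherwise all vectors are inactive at \<open>X\<close> with a uniform margin, hence inactive nearby, and
any primitive vector may be used.\<close>
lemma width_locally_active:
  assumes X: "pd X"
  obtains m n where "prim m n"
    "\<And>w. \<forall>\<^sub>F t in nhds 0. pd (X + t *\<^sub>R w) \<and> width (X + t *\<^sub>R w) = hgt (qf m n (X + t *\<^sub>R w)) (rt (X + t *\<^sub>R w))"
proof -
  have line: "((\<lambda>t. F (X + t *\<^sub>R w)) \<longlongrightarrow> F X) (nhds 0)" if "continuous_on UNIV F" for w and F :: "rseq \<Rightarrow> real"
  proof -
    have "((\<lambda>t::real. X + t *\<^sub>R w) \<longlongrightarrow> X + 0 *\<^sub>R w) (nhds 0)" by (intro tendsto_intros filterlim_ident)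
    then show ?thesis using tendsto_of_continuous_UNIV[OF that] by simp
  qed
  have pdl: "\<forall>\<^sub>F t in nhds 0. pd (X + t *\<^sub>R w)" for w
    unfolding pd_def
    using order_tendstoD(1)[OF line[OF continuous_on_lookup[OF continuous_on_id]], of 0 0 w]
      order_tendstoD(1)[OF line[OF continuous_on_dt], of 0 w] X
    by (auto simp: pd_def intro: eventually_conj)
  show ?thesis
  proof (cases "\<exists>m n. prim m n \<and> qf m n X < rt X")
    case True
    then obtain m n where p: "prim m n" "qf m n X < rt X" by blast
    show ?thesis
    proof (rule that[OF p(1)])
      fix w
      have "((\<lambda>t. rt (X + t *\<^sub>R w) - qf m n (X + t *\<^sub>R w)) \<longlongrightarrow> rt X - qf m n X) (nhds 0)"
        by (intro tendsto_diff line continuous_intros)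
      then have "\<forall>\<^sub>F t in nhds 0. 0 < rt (X + t *\<^sub>R w) - qf m n (X + t *\<^sub>R w)"
        using p(2) by (intro order_tendstoD(1)) auto
      with pdl[of w] show "\<forall>\<^sub>F t in nhds 0. pd (X + t *\<^sub>R w) \<and>
          width (X + t *\<^sub>R w) = hgt (qf m n (X + t *\<^sub>R w)) (rt (X + t *\<^sub>R w))"
        by eventually_elim (use p(1) active_min in \<open>auto intro!: width_eqI\<close>)
    qed
  next
    case False
    have p: "prim 1 0" by (auto simp: prim_def)
    show ?thesis
    proof (rule that[OF p])
      fix w
      have "((\<lambda>t. rt (X + t *\<^sub>R w)) \<longlongrightarrow> rt X) (nhds 0)" by (intro line continuous_intros)
      then have "\<forall>\<^sub>F t in nhds 0. rt (X + t *\<^sub>R w) < 3/2 * rt X"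
        using rt_pos[OF X] by (intro order_tendstoD(2)) auto
      moreover have "\<forall>\<^sub>F t in nhds 0. pd ((1/4) *\<^sub>R X + t *\<^sub>R w)"
      proof -
        have "((\<lambda>t::real. (1/4) *\<^sub>R X + t *\<^sub>R w) \<longlongrightarrow> (1/4) *\<^sub>R X + 0 *\<^sub>R w) (nhds 0)"
          by (intro tendsto_intros filterlim_ident)
        then show ?thesis
          using topological_tendstoD[OF _ open_Collect_pd] pd_scale[OF X, of "1/4"] by auto
      qed
      ultimately show "\<forall>\<^sub>F t in nhds 0. pd (X + t *\<^sub>R w) \<and>
          width (X + t *\<^sub>R w) = hgt (qf (real_of_int 1) (real_of_int 0) (X + t *\<^sub>R w)) (rt (X + t *\<^sub>R w))"
        using pdl[of w]
      proof eventually_elim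
        case (elim t)
        let ?Y = "X + t *\<^sub>R w"
        have inactive: "hgt (qf m n ?Y) (rt ?Y) = rt ?Y" if mn: "prim m n" for m n
        proof (rule hgt_inactive)
          show "0 < qf m n ?Y" using qf_pos[OF elim(3) prim_nonzero[OF mn]] .
          have "rt X \<le> qf m n X" using False mn by (auto simp: not_less)
          moreover have "qf m n ?Y = 3/4 * qf m n X + qf m n ((1/4) *\<^sub>R X + t *\<^sub>R w)"
            by (simp add: qf_add qf_scale)
          moreover have "0 \<le> qf m n ((1/4) *\<^sub>R X + t *\<^sub>R w)" using qf_psd_nonneg pd_imp_psd elim(2) by blast
          ultimately show "rt ?Y \<le> 2 * qf m n ?Y" using elim(1) by linarith
        qed
        have "width ?Y = hgt (qf (real_of_int 1) (real_of_int 0) ?Y) (rt ?Y)"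
          by (rule width_eqI[OF elim(3) p]) (simp only: inactive p order_refl)
        then show ?case using elim(3) by blast
      qed
    qed
  qed
qed

lemma hgt_line_derivative:
  assumes X: "pd X" and mn: "m \<noteq> 0 \<or> n \<noteq> 0"
  defines "r \<equiv> rt X / qf m n X"
  shows "((\<lambda>t. hgt (qf m n (X + t *\<^sub>R w)) (rt (X + t *\<^sub>R w))) has_real_derivative
    (prof r - r * prof_deriv r) * qf m n w + prof_deriv r * (mixed X w / (2 * rt X))) (at 0)"
proof -
  have q: "qf m n X > 0" and B: "rt X > 0" using qf_pos[OF X mn] rt_pos[OF X] by auto
  have dX: "dt X > 0" using X by (simp add: pd_def)
  have r: "r > 0" using q B by (simp add: r_def)
  have qd: "((\<lambda>t. qf m n (X + t *\<^sub>R w)) has_real_derivative qf m n w) (at 0)"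
    unfolding qf_add qf_scale by (auto intro!: derivative_eq_intros)
  have dd: "((\<lambda>t. dt (X + t *\<^sub>R w)) has_real_derivative mixed X w) (at 0)"
    unfolding dt_add dt_scale mixed_scale by (auto intro!: derivative_eq_intros)
  have rd: "((\<lambda>t. rt (X + t *\<^sub>R w)) has_real_derivative mixed X w / (2 * rt X)) (at 0)"
    unfolding rt_def using DERIV_chain2[OF DERIV_real_sqrt dd] dX by (simp add: field_simps)
  have rqd: "((\<lambda>t. rt (X + t *\<^sub>R w) / qf m n (X + t *\<^sub>R w)) has_real_derivative
     ((mixed X w / (2 * rt X)) * qf m n X - rt X * qf m n w) / (qf m n X * qf m n X)) (at 0)"
    using DERIV_divide[OF rd qd] q by simp
  have pr: "((\<lambda>t. prof (rt (X + t *\<^sub>R w) / qf m n (X + t *\<^sub>R w))) has_real_derivative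
     prof_deriv r * (((mixed X w / (2 * rt X)) * qf m n X - rt X * qf m n w) / (qf m n X * qf m n X))) (at 0)"
    using DERIV_chain2[OF prof_has_derivative rqd] r by (simp add: r_def)
  show ?thesis
    unfolding hgt_def
  proof (rule DERIV_cong[OF DERIV_mult[OF qd pr]])
    define b where "b = mixed X w / (2 * rt X)"
    show "qf m n w * prof (rt (X + 0 *\<^sub>R w) / qf m n (X + 0 *\<^sub>R w)) +
      prof_deriv r * ((mixed X w / (2 * rt X) * qf m n X - rt X * qf m n w) / (qf m n X * qf m n X)) * qf m n (X + 0 *\<^sub>R w) =
      (prof r - r * prof_deriv r) * qf m n w + prof_deriv r * (mixed X w / (2 * rt X))"
      unfolding b_def[symmetric] using q by (simp add: r_def[symmetric]) (simp add: r_def field_simps)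
  qed
qed

lemma functional_nonneg_lens_cone:
  assumes l: "l \<in> Rn 4" "\<And>y. y \<in> lens \<Longrightarrow> 0 \<le> inner l y" and y: "y \<in> lens_cone"
  shows "0 \<le> inner l y"
proof -
  have "0 \<le> inner l ((1 / (lk y 0 + lk y 2)) *\<^sub>R y)" using l lens_cone_normalise[OF y] by blast
  then show ?thesis using lens_cone_normalise(1)[OF y] by (simp add: zero_le_divide_iff)
qed

text \<open>A linear functional that is nonnegative on the lens is nonnegative on its roof and floor,
the graphs of \<open>\<plusminus>width\<close>.\<close>
lemma functional_width:
  assumes l: "l \<in> Rn 4" "\<And>y. y \<in> lens \<Longrightarrow> 0 \<le> inner l y" and Y: "pd Y" and e: "\<bar>e\<bar> = 1"
  shows "0 \<le> lk l 0 * lk Y 0 + lk l 1 * lk Y 1 + lk l 2 * lk Y 2 + e * lk l 3 * width Y"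
proof (rule LIMSEQ_le_const)
  let ?P = "lk l 0 * lk Y 0 + lk l 1 * lk Y 1 + lk l 2 * lk Y 2"
  have "(\<lambda>n. ?P + (1 - 1 / real (Suc n)) * (e * lk l 3 * width Y)) \<longlonglongrightarrow> ?P + (1 - 0) * (e * lk l 3 * width Y)"
    by (intro tendsto_intros LIMSEQ_Suc[OF lim_1_over_n])
  then show "(\<lambda>n. ?P + (1 - 1 / real (Suc n)) * (e * lk l 3 * width Y)) \<longlonglongrightarrow> ?P + e * lk l 3 * width Y" by simp
  show "\<exists>N. \<forall>n\<ge>N. 0 \<le> ?P + (1 - 1 / real (Suc n)) * (e * lk l 3 * width Y)"
  proof (intro exI allI impI)
    fix n :: nat
    let ?c = "1 - 1 / real (Suc n)"
    let ?y = "v4 (lk Y 0) (lk Y 1) (lk Y 2) (?c * e * width Y)"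
    have c: "0 \<le> ?c" "?c < 1" by auto
    have wp: "width Y > 0" using width_pos[OF Y] .
    have "\<bar>?c * e * width Y\<bar> = ?c * width Y" using c e wp by (simp add: abs_mult del: of_nat_Suc)
    also have "\<dots> < width Y" using c wp by simp
    finally have "?y \<in> lens_cone" using Y width_cong[of ?y Y] by (simp add: lens_cone_def)
    then have "0 \<le> inner l ?y" using functional_nonneg_lens_cone[OF l(1), of ?y] l(2) by blast
    then show "0 \<le> ?P + ?c * (e * lk l 3 * width Y)" by (simp add: inner_Rn4[OF l(1)] mult_ac)
  qed
qed

text \<open>On the roof of the lens the width agrees near \<open>\<xi>\<close> with one differentiable
function. A functional that vanishes at \<open>\<xi>\<close> and is nonnegative on the lens has a
minimum there along the roof, so its derivative vanishes, and this determines it up to a factor.\<close>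
lemma bdry_normal_rank2:
  assumes X: "\<xi> \<in> Rn 4" "pd \<xi>" "\<bar>lk \<xi> 3\<bar> = width \<xi>"
  shows "\<exists>c\<in>Rn 4. inner c \<xi> = 0 \<and> (\<forall>y\<in>lens. 0 < inner c y) \<and>
    (\<forall>l\<in>Rn 4. inner l \<xi> = 0 \<and> (\<forall>y\<in>lens. 0 \<le> inner l y) \<longrightarrow> (\<exists>\<mu>. l = \<mu> *\<^sub>R c))"
proof -
  define e where "e = sgn (lk \<xi> 3)"
  have wp: "width \<xi> > 0" using width_pos X(2) .
  have e: "\<bar>e\<bar> = 1" "e * e = 1" and \<xi>3: "lk \<xi> 3 = e * width \<xi>"
    using X(3) wp by (auto simp: e_def sgn_if split: if_splits)
  obtain m n where p: "prim m n" and act: "\<And>w. \<forall>\<^sub>F t in nhds 0. pd (\<xi> + t *\<^sub>R w) \<and>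
      width (\<xi> + t *\<^sub>R w) = hgt (qf m n (\<xi> + t *\<^sub>R w)) (rt (\<xi> + t *\<^sub>R w))"
    using width_locally_active[OF X(2)] by blast
  note mn = prim_nonzero[OF p]
  define r where "r = rt \<xi> / qf m n \<xi>"
  define \<alpha> where "\<alpha> = prof r - r * prof_deriv r"
  define \<beta> where "\<beta> = prof_deriv r"
  define f where "f = (\<lambda>w. \<alpha> * qf m n w + \<beta> * (mixed \<xi> w / (2 * rt \<xi>)))"
  define c where "c = v4 (f (v4 1 0 0 0)) (f (v4 0 1 0 0)) (f (v4 0 0 1 0)) (- e)"
  have B: "rt \<xi> > 0" and q: "qf m n \<xi> > 0" using rt_pos X(2) qf_pos[OF X(2) mn] by auto
  have r: "r > 0" using B q by (simp add: r_def)
  have \<beta>: "\<beta> > 0" using prof_deriv_pos[OF r] by (simp add: \<beta>_def)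
  have ic: "inner c y = f y - e * lk y 3" for y
    by (simp add: inner_Rn4 c_def f_def qf_def mixed_def add_divide_distrib diff_divide_distrib algebra_simps)
  have w\<xi>: "width \<xi> = hgt (qf m n \<xi>) (rt \<xi>)" using eventually_nhds_x_imp_x[OF act[of 0]] by simp
  have f\<xi>: "f \<xi> = width \<xi>"
  proof -
    have "mixed \<xi> \<xi> / (2 * rt \<xi>) = rt \<xi>"
      using B rt_sq[OF pd_imp_psd[OF X(2)]] by (simp add: mixed_self power2_eq_square flip: rt_sq[OF pd_imp_psd[OF X(2)]])
    then show ?thesis unfolding w\<xi> f_def using hgt_eq[OF q, of "rt \<xi>"] by (simp add: r_def \<alpha>_def \<beta>_def)
  qed
  have 1: "inner c \<xi> = 0" unfolding ic f\<xi> \<xi>3 using e(2) by (simp flip: mult.assoc)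
  have 2: "0 < inner c y" if y: "y \<in> lens" for y
  proof -
    note y = lensD[OF y]
    have "rt y \<le> mixed \<xi> y / (2 * rt \<xi>)"
      using mixed_ge[OF X(2) pd_imp_psd, of y] y B by (simp add: pos_le_divide_eq mult_ac)
    then have "\<alpha> * qf m n y + \<beta> * rt y \<le> f y"
      unfolding f_def using \<beta> by (intro add_left_mono mult_left_mono) auto
    moreover have "hgt (qf m n y) (rt y) \<le> \<alpha> * qf m n y + \<beta> * rt y"
      unfolding \<alpha>_def \<beta>_def using y r by (intro hgt_tangent qf_pos rt_pos mn) auto
    moreover have "width y \<le> hgt (qf m n y) (rt y)" using width_le y p by blast
    moreover have "e * lk y 3 \<le> \<bar>lk y 3\<bar>" using e(1) by (metis abs_ge_self abs_mult mult_1)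
    ultimately show ?thesis unfolding ic using y by linarith
  qed
  have 3: "\<exists>\<mu>. l = \<mu> *\<^sub>R c" if l: "l \<in> Rn 4" "inner l \<xi> = 0" "\<forall>y\<in>lens. 0 \<le> inner l y" for l
  proof -
    have D: "lk l 0 * lk w 0 + lk l 1 * lk w 1 + lk l 2 * lk w 2 + e * lk l 3 * f w = 0" for w
    proof -
      let ?P = "\<lambda>Y. lk l 0 * lk Y 0 + lk l 1 * lk Y 1 + lk l 2 * lk Y 2"
      define g where "g = (\<lambda>t. ?P \<xi> + t * ?P w + e * lk l 3 * hgt (qf m n (\<xi> + t *\<^sub>R w)) (rt (\<xi> + t *\<^sub>R w)))"
      have g': "(g has_real_derivative ?P w + e * lk l 3 * f w) (at 0)"
        unfolding g_def f_def \<alpha>_def \<beta>_def r_def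
        by (rule derivative_eq_intros hgt_line_derivative[OF X(2) mn] refl)+ simp
      have g0: "g 0 = 0"
        using l(2) w\<xi> unfolding g_def inner_Rn4[OF l(1)] \<xi>3 by (simp add: algebra_simps)
      have "\<forall>\<^sub>F t in nhds 0. 0 \<le> g t"
        using act[of w]
      proof eventually_elim
        case (elim t)
        have "0 \<le> ?P (\<xi> + t *\<^sub>R w) + e * lk l 3 * width (\<xi> + t *\<^sub>R w)"
          using functional_width[OF l(1) _ _ e(1)] l(3) elim by blast
        also have "\<dots> = g t" unfolding g_def using elim by (simp add: lookup_add algebra_simps)
        finally show ?case .
      qed
      then obtain d where d: "d > 0" "\<And>t. \<bar>0 - t\<bar> < d \<Longrightarrow> 0 \<le> g t"
        unfolding eventually_nhds_metric by (auto simp: dist_real_def)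
      have "?P w + e * lk l 3 * f w = 0"
        by (rule DERIV_local_min[OF g' d(1)]) (use d(2) g0 in auto)
      then show ?thesis .
    qed
    have "l = (- (e * lk l 3)) *\<^sub>R c"
    proof (rule Rn4_eqI)
      show "l \<in> Rn 4" "(- (e * lk l 3)) *\<^sub>R c \<in> Rn 4" using l v4_Rn4 Rn4_intros(3) unfolding c_def by blast+
      show "lk l 0 = lk ((- (e * lk l 3)) *\<^sub>R c) 0" using D[of "v4 1 0 0 0"] by (simp add: c_def)
      show "lk l 1 = lk ((- (e * lk l 3)) *\<^sub>R c) 1" using D[of "v4 0 1 0 0"] by (simp add: c_def)
      show "lk l 2 = lk ((- (e * lk l 3)) *\<^sub>R c) 2" using D[of "v4 0 0 1 0"] by (simp add: c_def)
      show "lk l 3 = lk ((- (e * lk l 3)) *\<^sub>R c) 3" using e(2) by (simp add: c_def)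
    qed
    then show ?thesis by blast
  qed
  show ?thesis using 1 2 3 by (intro bexI[of _ c]) (auto simp: c_def)
qed

text \<open>A polynomial that is nonnegative near its zero \<open>t = 0\<close> has no linear
term.\<close>
lemma linear_coefficient_zero:
  fixes b c :: real
  assumes "\<And>t. 0 \<le> t * b + t\<^sup>2 * c"
  shows "b = 0"
proof (rule ccontr)
  assume b: "b \<noteq> 0"
  define M where "M = \<bar>c\<bar> + 1"
  have M: "M > 0" by (simp add: M_def)
  have "0 \<le> (- b / M) * b + (- b / M)\<^sup>2 * c" by (rule assms)
  also have "\<dots> \<le> (- b / M) * b + (- b / M)\<^sup>2 * \<bar>c\<bar>" by (intro add_left_mono mult_left_mono) auto
  also have "\<dots> = (b\<^sup>2 / M) * (\<bar>c\<bar> / M - 1)" using M by (simp add: power2_eq_square field_simps)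
  also have "\<dots> < 0" using b M by (intro mult_pos_neg) (auto simp: M_def)
  finally show False by simp
qed

lemma rank_one_eq:
  assumes v: "v \<in> Rn 4" "lk v 0 + lk v 2 = 1" "psd v" "dt v = 0" "lk v 3 = 0"
  obtains x y where "x\<^sup>2 + y\<^sup>2 = 1" "v = v4 (x\<^sup>2) (x * y) (y\<^sup>2) 0"
proof -
  have nn: "0 \<le> lk v 0" "0 \<le> lk v 2" and d: "(lk v 1)\<^sup>2 = lk v 0 * lk v 2" using v by (auto simp: psd_def dt_def)
  define x where "x = sqrt (lk v 0)"
  define y where "y = (if lk v 1 \<ge> 0 then sqrt (lk v 2) else - sqrt (lk v 2))"
  have xy2: "x\<^sup>2 = lk v 0" "y\<^sup>2 = lk v 2" using nn by (auto simp: x_def y_def)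
  have "\<bar>lk v 1\<bar> = sqrt (lk v 0) * sqrt (lk v 2)"
    using d by (metis real_sqrt_abs real_sqrt_mult)
  then have "lk v 1 = x * y" by (auto simp: x_def y_def)
  then have "v = v4 (x\<^sup>2) (x * y) (y\<^sup>2) 0" using v xy2 by (intro Rn4_eqI) auto
  then show ?thesis using that xy2 v(2) by metis
qed

text \<open>This is why the supporting planes at the rim of the lens are vertical.\<close>
lemma prof_unbounded: "\<exists>r>1. K < prof r"
proof -
  define a where "a = 1 + \<bar>K\<bar>"
  have a: "a > 0" "K < 2 + 2 * a" by (auto simp: a_def)
  then have "prof (2 * exp a) = 2 + 2 * a" by (simp add: prof_def)
  moreover have "2 * exp a > 1" using exp_gt_one[OF a(1)] by linarith
  ultimately show ?thesis using a by (intro exI[of _ "2 * exp a"]) auto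
qed

text \<open>Restricted to matrices, a nonnegative functional that vanishes at a rank one matrix is a
nonnegative quadratic form with a zero, which fixes it up to a factor. Its vertical component must be 0,
because near the rim the width exceeds every multiple of the distance to the rim.\<close>
lemma bdry_normal_rank1:
  assumes xy: "x\<^sup>2 + y\<^sup>2 = 1" and \<xi>: "\<xi> = v4 (x\<^sup>2) (x * y) (y\<^sup>2) 0"
  shows "\<exists>c\<in>Rn 4. inner c \<xi> = 0 \<and> (\<forall>y\<in>lens. 0 < inner c y) \<and>
    (\<forall>l\<in>Rn 4. inner l \<xi> = 0 \<and> (\<forall>y\<in>lens. 0 \<le> inner l y) \<longrightarrow> (\<exists>\<mu>. l = \<mu> *\<^sub>R c))"
proof -
  define c where "c = v4 (y\<^sup>2) (- 2 * x * y) (x\<^sup>2) 0"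
  have ic: "inner c v = qf (- y) x v" for v by (simp add: inner_Rn4 c_def qf_def)
  have nz: "- y \<noteq> 0 \<or> x \<noteq> 0" using xy by auto
  have 1: "inner c \<xi> = 0" by (simp add: ic \<xi> qf_def power2_eq_square)
  have 2: "0 < inner c v" if "v \<in> lens" for v unfolding ic using lensD[OF that] qf_pos[OF _ nz] by blast
  have 3: "\<exists>\<mu>. l = \<mu> *\<^sub>R c" if l: "l \<in> Rn 4" "inner l \<xi> = 0" "\<forall>y\<in>lens. 0 \<le> inner l y" for l
  proof -
    have pos: "0 \<le> lk l 0 * lk Y 0 + lk l 1 * lk Y 1 + lk l 2 * lk Y 2 + e * lk l 3 * width Y"
      if "pd Y" "\<bar>e\<bar> = 1" for Y e
      using functional_width[OF l(1) _ that] l(3) by blast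
    define F where "F = (\<lambda>p q. lk l 0 * p\<^sup>2 + lk l 1 * (p * q) + lk l 2 * q\<^sup>2)"
    have Fnn: "0 \<le> F p q" for p q
    proof (rule LIMSEQ_le_const)
      have "(\<lambda>n. F p q + (1 / real (Suc n)) * (lk l 0 + lk l 2)) \<longlonglongrightarrow> F p q + 0 * (lk l 0 + lk l 2)"
        by (intro tendsto_intros LIMSEQ_Suc[OF lim_1_over_n])
      then show "(\<lambda>n. F p q + (1 / real (Suc n)) * (lk l 0 + lk l 2)) \<longlonglongrightarrow> F p q" by simp
      show "\<exists>N. \<forall>n\<ge>N. 0 \<le> F p q + (1 / real (Suc n)) * (lk l 0 + lk l 2)"
      proof (intro exI allI impI)
        fix n :: nat
        define t where "t = 1 / real (Suc n)"
        have t: "t > 0" by (simp add: t_def)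
        let ?Y = "v4 (p\<^sup>2 + t) (p * q) (q\<^sup>2 + t) 0"
        have "dt ?Y = t * (p\<^sup>2 + q\<^sup>2) + t\<^sup>2" by (simp add: dt_def power2_eq_square algebra_simps)
        then have "pd ?Y" using t by (simp add: pd_def add_nonneg_pos add_pos_nonneg)
        from pos[OF this, of 1] pos[OF this, of "- 1"]
        show "0 \<le> F p q + (1 / real (Suc n)) * (lk l 0 + lk l 2)"
          unfolding t_def[symmetric] by (simp add: F_def algebra_simps)
      qed
    qed
    have F0: "F x y = 0" using l(2) unfolding inner_Rn4[OF l(1)] by (simp add: \<xi> F_def)
    have lin: "2 * lk l 0 * x * p + lk l 1 * (x * q + y * p) + 2 * lk l 2 * y * q = 0" for p q
    proof (rule linear_coefficient_zero)
      fix t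
      have "0 \<le> F (x + t * p) (y + t * q)" by (rule Fnn)
      also have "\<dots> = F x y + t * (2 * lk l 0 * x * p + lk l 1 * (x * q + y * p) + 2 * lk l 2 * y * q) + t\<^sup>2 * F p q"
        by (simp add: F_def power2_eq_square algebra_simps)
      finally show "0 \<le> t * (2 * lk l 0 * x * p + lk l 1 * (x * q + y * p) + 2 * lk l 2 * y * q) + t\<^sup>2 * F p q"
        using F0 by simp
    qed
    define \<kappa> where "\<kappa> = lk l 0 + lk l 2"
    have e1: "2 * lk l 0 * x + lk l 1 * y = 0" using lin[of 1 0] by simp
    have e2: "lk l 1 * x + 2 * lk l 2 * y = 0" using lin[of 0 1] by simp
    have a: "lk l 0 * x\<^sup>2 = lk l 2 * y\<^sup>2"
    proof -
      have "2 * (lk l 0 * x\<^sup>2) = (2 * lk l 0 * x) * x" by (simp add: power2_eq_square)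
      also have "2 * lk l 0 * x = - (lk l 1 * y)" using e1 by linarith
      also have "- (lk l 1 * y) * x = - (lk l 1 * x) * y" by simp
      also have "- (lk l 1 * x) = 2 * lk l 2 * y" using e2 by linarith
      finally show ?thesis by (simp add: power2_eq_square)
    qed
    have l0: "lk l 0 = \<kappa> * y\<^sup>2"
    proof -
      have "lk l 0 = lk l 0 * (x\<^sup>2 + y\<^sup>2)" using xy by simp
      then show ?thesis using a by (simp add: \<kappa>_def algebra_simps)
    qed
    have l2: "lk l 2 = \<kappa> * x\<^sup>2"
    proof -
      have "lk l 2 = lk l 2 * (x\<^sup>2 + y\<^sup>2)" using xy by simp
      then show ?thesis using a by (simp add: \<kappa>_def algebra_simps)
    qed
    have l1: "lk l 1 = \<kappa> * (- 2 * x * y)"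
    proof -
      have "lk l 1 = (lk l 1 * x) * x + (lk l 1 * y) * y" using xy by (simp add: power2_eq_square mult.assoc flip: distrib_left)
      also have "lk l 1 * x = - (2 * lk l 2 * y)" using e2 by linarith
      also have "lk l 1 * y = - (2 * lk l 0 * x)" using e1 by linarith
      finally show ?thesis by (simp add: \<kappa>_def algebra_simps)
    qed
    have l3: "lk l 3 = 0"
    proof (rule ccontr)
      assume ne: "lk l 3 \<noteq> 0"
      obtain r where r: "r > 1" "\<kappa> / \<bar>lk l 3\<bar> < prof r" using prof_unbounded by blast
      \<comment> \<open>The form \<open>?Y\<close> below has eigenvalues 1 on \<open>(x, y)\<close> and \<open>s\<close> on the orthogonal line. Its values at
        integer vectors are at least \<open>s\<close>, so its width is at least \<open>s * prof r\<close>, whereas the horizontal part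
        of \<open>l\<close> is only \<open>\<kappa> * s\<close> there.\<close>
      define s where "s = 1 / r\<^sup>2"
      have s: "0 < s" "s < 1" using r(1) by (auto simp: s_def)
      have sqs: "sqrt s = 1 / r" using r(1) by (simp add: s_def real_sqrt_divide)
      let ?Y = "v4 (x\<^sup>2 + s * y\<^sup>2) (x * y - s * x * y) (y\<^sup>2 + s * x\<^sup>2) 0"
      have "dt ?Y = s * (x\<^sup>2 + y\<^sup>2)\<^sup>2" by (simp add: dt_def power2_eq_square algebra_simps)
      then have dY: "dt ?Y = s" using xy by simp
      have "x\<^sup>2 + s * y\<^sup>2 > 0"
      proof (cases "x = 0")
        case True then show ?thesis using xy s by simp
      next
        case False then show ?thesis using s by (intro add_pos_nonneg) auto
      qed
      then have pdY: "pd ?Y" using dY s by (simp add: pd_def)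
      obtain m n where p: "prim m n" and w: "width ?Y = hgt (qf m n ?Y) (rt ?Y)" using width_attained[OF pdY] by blast
      have "1 \<le> m\<^sup>2 + n\<^sup>2" using p by (auto simp: prim_def int_one_le_iff_zero_less sum_power2_gt_zero_iff)
      then have mn1: "1 \<le> (real_of_int m)\<^sup>2 + (real_of_int n)\<^sup>2" by (metis of_int_1_le_iff of_int_add of_int_power)
      have "qf m n ?Y = (m * x + n * y)\<^sup>2 + s * (n * x - m * y)\<^sup>2"
        by (simp add: qf_def power2_eq_square algebra_simps)
      also have "\<dots> \<ge> s * (m * x + n * y)\<^sup>2 + s * (n * x - m * y)\<^sup>2"
        using s by (intro add_right_mono mult_left_le_one_le) auto
      also have "s * (m * x + n * y)\<^sup>2 + s * (n * x - m * y)\<^sup>2 = s * (((real_of_int m)\<^sup>2 + (real_of_int n)\<^sup>2) * (x\<^sup>2 + y\<^sup>2))"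
        by (simp add: power2_eq_square algebra_simps)
      finally have "s * ((real_of_int m)\<^sup>2 + (real_of_int n)\<^sup>2) \<le> qf m n ?Y" unfolding xy by simp
      moreover have "s * 1 \<le> s * ((real_of_int m)\<^sup>2 + (real_of_int n)\<^sup>2)" using s mn1 by (intro mult_left_mono) auto
      ultimately have "s \<le> qf m n ?Y" by linarith
      then have "hgt s (rt ?Y) \<le> width ?Y" unfolding w using s rt_pos[OF pdY] by (intro hgt_mono) auto
      moreover have "hgt s (rt ?Y) = s * prof r"
      proof -
        have "rt ?Y / s = r" using r(1) by (simp add: rt_def dY sqs) (simp add: s_def power2_eq_square)
        then show ?thesis by (simp add: hgt_def)
      qed
      ultimately have 1: "s * prof r \<le> width ?Y" by simp
      have "0 \<le> lk l 0 * lk ?Y 0 + lk l 1 * lk ?Y 1 + lk l 2 * lk ?Y 2 + (- sgn (lk l 3)) * lk l 3 * width ?Y"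
        using pos[OF pdY, of "- sgn (lk l 3)"] ne by (simp add: abs_sgn_eq)
      also have "lk l 0 * lk ?Y 0 + lk l 1 * lk ?Y 1 + lk l 2 * lk ?Y 2 = \<kappa> * s * (x\<^sup>2 + y\<^sup>2)\<^sup>2"
        unfolding l0 l1 l2 by (simp add: power2_eq_square algebra_simps)
      finally have "\<bar>lk l 3\<bar> * width ?Y \<le> \<kappa> * s" using xy by (simp add: abs_sgn mult.commute)
      then have "\<bar>lk l 3\<bar> * (s * prof r) \<le> \<kappa> * s" using 1 by (meson abs_ge_zero mult_left_mono order_trans)
      then have "\<bar>lk l 3\<bar> * prof r \<le> \<kappa>" using s by (simp add: mult.left_commute mult.commute)
      then show False using r(2) ne by (simp add: pos_divide_less_eq mult.commute)
    qed
    have "l = \<kappa> *\<^sub>R c" by (rule Rn4_eqI) (use l l0 l1 l2 l3 in \<open>auto simp: c_def Rn4_intros\<close>)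
    then show ?thesis by blast
  qed
  show ?thesis using 1 2 3 by (intro bexI[of _ c]) (auto simp: c_def)
qed

lemma bdry_normal:
  assumes "\<xi> \<in> bdry lens"
  shows "\<exists>c\<in>Rn 4. inner c \<xi> = 0 \<and> (\<forall>y\<in>lens. 0 < inner c y) \<and>
    (\<forall>l\<in>Rn 4. inner l \<xi> = 0 \<and> (\<forall>y\<in>lens. 0 \<le> inner l y) \<longrightarrow> (\<exists>\<mu>. l = \<mu> *\<^sub>R c))"
  using lens_bdry(4)[OF assms]
proof
  assume "pd \<xi> \<and> \<bar>lk \<xi> 3\<bar> = width \<xi>"
  then show ?thesis using bdry_normal_rank2 lens_bdry(1)[OF assms] by blast
next
  assume "dt \<xi> = 0 \<and> lk \<xi> 3 = 0"
  then obtain x y where "x\<^sup>2 + y\<^sup>2 = 1" "\<xi> = v4 (x\<^sup>2) (x * y) (y\<^sup>2) 0"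
    using rank_one_eq lens_bdry(1-3)[OF assms] by metis
  then show ?thesis by (rule bdry_normal_rank1)
qed

section \<open>Smoothness and strict convexity of the lens\<close>

text \<open>Orthogonal projection to the directions of the chart. Functionals on the cone are turned
into normals in the chart.\<close>
definition proj_V0 :: "rseq \<Rightarrow> rseq" where
  "proj_V0 l = l - (inner l tr_vec / 2) *\<^sub>R tr_vec"

lemma inner_tr_tr: "inner tr_vec tr_vec = 2" by (simp add: inner_tr_vec) (simp add: tr_vec_def)

lemma proj_V0_mem: "l \<in> Rn 4 \<Longrightarrow> proj_V0 l \<in> V0"
proof -
  assume l: "l \<in> Rn 4"
  have "inner tr_vec (proj_V0 l) = 0"
    by (simp add: proj_V0_def inner_diff_right inner_tr_tr inner_commute[of tr_vec l])
  then show "proj_V0 l \<in> V0"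
    using l by (simp add: V0_def inner_tr_vec) (simp add: proj_V0_def Rn4_intros)
qed

lemma inner_proj_V0:
  assumes "inner tr_vec y = inner tr_vec \<xi>"
  shows "inner (proj_V0 l) (y - \<xi>) = inner l y - inner l \<xi>"
  using assms by (simp add: proj_V0_def inner_diff)

lemma smooth_convex_domain_lens: "smooth_convex_domain V0 lens"
proof (unfold_locales)
  fix \<xi> assume \<xi>: "\<xi> \<in> bdry lens"
  have tr: "inner tr_vec y = inner tr_vec \<xi>" if "y \<in> lens" for y
    using lensD[OF that] lens_bdry[OF \<xi>] by (simp add: inner_tr_vec)
  have tr\<xi>: "inner tr_vec \<xi> = 1" using lens_bdry[OF \<xi>] by (simp add: inner_tr_vec)
  obtain c where c: "c \<in> Rn 4" "inner c \<xi> = 0" "\<And>y. y \<in> lens \<Longrightarrow> 0 < inner c y"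
    and uni: "\<And>l. \<lbrakk>l \<in> Rn 4; inner l \<xi> = 0; \<forall>y\<in>lens. 0 \<le> inner l y\<rbrakk> \<Longrightarrow> \<exists>\<mu>. l = \<mu> *\<^sub>R c"
    using bdry_normal[OF \<xi>] by blast
  define n0 where "n0 = proj_V0 c"
  have n0: "0 < inner n0 (y - \<xi>)" if "y \<in> lens" for y
    using inner_proj_V0[OF tr[OF that]] c that by (simp add: n0_def)
  then have n0z: "n0 \<noteq> 0" using lens_base by force
  show "\<exists>n\<in>V0. norm n = 1 \<and> (\<forall>y\<in>lens. 0 \<le> inner n (y - \<xi>))"
  proof (intro bexI[of _ "(1 / norm n0) *\<^sub>R n0"] conjI ballI)
    show "(1 / norm n0) *\<^sub>R n0 \<in> V0"
      using subspace_scale[OF subspace_V0] proj_V0_mem[OF c(1)] n0_def by blast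
    show "norm ((1 / norm n0) *\<^sub>R n0) = 1" using n0z by simp
    show "0 \<le> inner ((1 / norm n0) *\<^sub>R n0) (y - \<xi>)" if "y \<in> lens" for y
      using n0[OF that] by simp
  qed
  have mult: "n = (1 / norm n0) *\<^sub>R n0"
    if n: "n \<in> V0" "norm n = 1" "\<And>y. y \<in> lens \<Longrightarrow> 0 \<le> inner n (y - \<xi>)" for n
  proof -
    define l where "l = n - (inner n \<xi>) *\<^sub>R tr_vec"
    have ntr: "inner n tr_vec = 0" using n(1) by (simp add: inner_commute[of n] inner_tr_vec V0_def)
    have "inner l y = inner n (y - \<xi>)" if "y \<in> lens" for y
      using tr[OF that] tr\<xi> by (simp add: l_def inner_diff)
    then have "\<forall>y\<in>lens. 0 \<le> inner l y" using n(3) by simp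
    moreover have "l \<in> Rn 4" using n(1) by (auto simp: l_def V0_def Rn4_intros)
    moreover have "inner l \<xi> = 0" using tr\<xi> by (simp add: l_def inner_diff)
    ultimately obtain \<mu> where \<mu>: "l = \<mu> *\<^sub>R c" using uni by blast
    have "n = proj_V0 l"
      by (simp add: proj_V0_def l_def inner_diff ntr inner_tr_tr)
    then have n\<mu>: "n = \<mu> *\<^sub>R n0" by (simp add: \<mu> n0_def proj_V0_def algebra_simps)
    obtain y where y: "y \<in> lens" using lens_base by blast
    have "0 \<le> \<mu> * inner n0 (y - \<xi>)" using n(3)[OF y] by (simp add: n\<mu>)
    then have "0 \<le> \<mu>" using n0[OF y] by (simp add: zero_le_mult_iff)
    moreover have "\<bar>\<mu>\<bar> * norm n0 = 1" using n(2) by (simp add: n\<mu>)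
    ultimately have "\<mu> = 1 / norm n0" using n0z by (simp add: field_simps)
    then show ?thesis using n\<mu> by simp
  qed
  fix n m
  assume "n \<in> V0" "norm n = 1" "\<And>y. y \<in> lens \<Longrightarrow> 0 \<le> inner n (y - \<xi>)"
    "m \<in> V0" "norm m = 1" "\<And>y. y \<in> lens \<Longrightarrow> 0 \<le> inner m (y - \<xi>)"
  then show "n = m" using mult[of n] mult[of m] by simp
qed

interpretation lens: smooth_convex_domain V0 lens by (rule smooth_convex_domain_lens)

text \<open>It suffices that midpoints of different boundary points lie inside. If the matrices are
proportional, hence equal, the two points are on opposite sides, roof and floor; otherwise the width of
the sum is strictly larger than the sum of the absolute heights.\<close>
lemma strictly_convex_lens: "strictly_convex lens"
proof -
  have half: "(1/2) *\<^sub>R (x + y) \<in> lens"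
    if "x \<in> Rn 4" "y \<in> Rn 4" "lk x 0 + lk x 2 = 1" "lk y 0 + lk y 2 = 1"
      "pd (x + y)" "\<bar>lk x 3 + lk y 3\<bar> < width (x + y)" for x y
  proof -
    have "x + y \<in> lens_cone" using that by (simp add: lens_cone_def Rn4_intros lookup_add)
    then have "(1/2) *\<^sub>R (x + y) \<in> lens_cone" by (rule lens_cone_scale) simp
    moreover have "lk ((1/2) *\<^sub>R (x + y)) 0 + lk ((1/2) *\<^sub>R (x + y)) 2 = 1"
    proof -
      have "lk ((1/2) *\<^sub>R (x + y)) 0 + lk ((1/2) *\<^sub>R (x + y)) 2 = (1/2) * ((lk x 0 + lk x 2) + (lk y 0 + lk y 2))"
        by (simp only: lookup_scaleR lookup_add real_scaleR_def distrib_left ac_simps)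
      then show ?thesis using that(3,4) by simp
    qed
    ultimately show ?thesis unfolding lens_def by blast
  qed
  have r2: "(1/2) *\<^sub>R (x + y) \<in> lens"
    if x: "x \<in> bdry lens" "pd x" and y: "y \<in> bdry lens" and ne: "x \<noteq> y" for x y
  proof (rule half)
    note bx = lens_bdry[OF x(1)] and cy = lens_bdry[OF y]
    show "x \<in> Rn 4" "y \<in> Rn 4" "lk x 0 + lk x 2 = 1" "lk y 0 + lk y 2 = 1" by (rule bx(1) cy(1) bx(2) cy(2))+
    show pxy: "pd (x + y)" using psd_add_pd[OF x(2) cy(3)] .
    have x3: "\<bar>lk x 3\<bar> = width x" using bx(4) x(2) by (auto simp: pd_def)
    show "\<bar>lk x 3 + lk y 3\<bar> < width (x + y)"
    proof (cases "\<exists>r\<ge>0. lk y 0 = r * lk x 0 \<and> lk y 1 = r * lk x 1 \<and> lk y 2 = r * lk x 2")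
      case True
      then obtain r where r: "lk y 0 = r * lk x 0" "lk y 1 = r * lk x 1" "lk y 2 = r * lk x 2" by blast
      have "r * (lk x 0 + lk x 2) = 1" using cy(2) r by (simp add: algebra_simps)
      then have "r = 1" using bx(2) by simp
      then have eq: "lk y 0 = lk x 0" "lk y 1 = lk x 1" "lk y 2 = lk x 2" using r by auto
      then have "\<bar>lk y 3\<bar> = width x" using cy(4) x(2) width_cong[of y x] by (auto simp: pd_def)
      moreover have "lk y 3 \<noteq> lk x 3" using ne eq bx(1) cy(1) Rn4_eqI by metis
      ultimately have "lk x 3 + lk y 3 = 0" using x3 by linarith
      then show ?thesis using width_pos[OF pxy] by simp
    next
      case False
      show ?thesis
      proof (cases "pd y")
        case True
        then have "\<bar>lk y 3\<bar> = width y" using cy(4) by (auto simp: pd_def)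
        then show ?thesis using width_add_pd_strict[OF x(2) cy(3) True False] x3 by linarith
      next
        case F: False
        then have "lk y 3 = 0" using cy(4) by auto
        then show ?thesis using width_add_psd_strict[OF x(2) cy(3) False] x3 by simp
      qed
    qed
  qed
  have r1: "(1/2) *\<^sub>R (x + y) \<in> lens"
    if x: "x \<in> bdry lens" "\<not> pd x" and y: "y \<in> bdry lens" "\<not> pd y" and ne: "x \<noteq> y" for x y
  proof (rule half)
    note bx = lens_bdry[OF x(1)] and cy = lens_bdry[OF y(1)]
    show "x \<in> Rn 4" "y \<in> Rn 4" "lk x 0 + lk x 2 = 1" "lk y 0 + lk y 2 = 1" by (rule bx(1) cy(1) bx(2) cy(2))+
    have d: "dt x = 0" "lk x 3 = 0" "dt y = 0" "lk y 3 = 0" using bx(4) cy(4) x(2) y(2) by auto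
    obtain a b where ab: "a\<^sup>2 + b\<^sup>2 = 1" "x = v4 (a\<^sup>2) (a * b) (b\<^sup>2) 0" using rank_one_eq bx(1-3) d by metis
    obtain e f where ef: "e\<^sup>2 + f\<^sup>2 = 1" "y = v4 (e\<^sup>2) (e * f) (f\<^sup>2) 0" using rank_one_eq cy(1-3) d by metis
    have "mixed x y = (a * f - b * e)\<^sup>2" by (simp add: mixed_def ab ef power2_eq_square algebra_simps)
    moreover have "a * f - b * e \<noteq> 0"
    proof
      assume "a * f - b * e = 0"
      then have p: "a * f = b * e" by simp
      have "a\<^sup>2 = a\<^sup>2 * (e\<^sup>2 + f\<^sup>2)" using ef by simp
      also have "\<dots> = a\<^sup>2 * e\<^sup>2 + (a * f)\<^sup>2" by (simp add: power2_eq_square algebra_simps)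
      also have "\<dots> = e\<^sup>2 * (a\<^sup>2 + b\<^sup>2)" unfolding p by (simp add: power2_eq_square algebra_simps)
      finally have 1: "a\<^sup>2 = e\<^sup>2" using ab by simp
      then have 2: "b\<^sup>2 = f\<^sup>2" using ab ef by simp
      have "a * b = a * b * (e\<^sup>2 + f\<^sup>2)" using ef by simp
      also have "\<dots> = a * e * (b * e) + b * f * (a * f)" by (simp add: power2_eq_square algebra_simps)
      also have "\<dots> = a * e * (a * f) + b * f * (b * e)" by (simp only: p)
      also have "\<dots> = e * f * (a\<^sup>2 + b\<^sup>2)" by (simp add: power2_eq_square algebra_simps)
      finally have "a * b = e * f" using ab by simp
      then show False using ne 1 2 ab ef by simp
    qed
    ultimately have "dt (x + y) > 0" using d by (simp add: dt_add)
    moreover have "0 \<le> lk (x + y) 0" using bx(3) cy(3) by (simp add: psd_def lookup_add)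
    ultimately show pxy: "pd (x + y)" by (simp add: pdI)
    show "\<bar>lk x 3 + lk y 3\<bar> < width (x + y)" using d width_pos[OF pxy] by simp
  qed
  show ?thesis
    unfolding strictly_convex_def
  proof (intro ballI impI notI)
    fix x y assume x: "x \<in> bdry lens" and y: "y \<in> bdry lens" and ne: "x \<noteq> y"
      and sub: "closed_segment x y \<subseteq> bdry lens"
    have "(1/2) *\<^sub>R (x + y) \<in> lens"
    proof (cases "pd x")
      case True
      show ?thesis by (rule r2[OF x True y ne])
    next
      case False
      show ?thesis
      proof (cases "pd y")
        case True
        show ?thesis using r2[OF y True x ne[symmetric]] by (simp only: add.commute)
      next
        case F: False
        show ?thesis by (rule r1[OF x False y F ne])
      qed
    qed
    moreover have "(1/2) *\<^sub>R (x + y) \<in> closed_segment x y"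
      using midpoint_in_closed_segment[of x y] by (simp add: midpoint_def scaleR_add_right)
    ultimately show False using sub by (auto simp: bdry_def)
  qed
qed

lemma C1_boundary_lens: "C1_boundary 3 tr_vec lens"
  unfolding C1_boundary_def
proof
  fix \<xi> assume \<xi>: "\<xi> \<in> bdry lens"
  let ?p = "v4 (1/2) 0 (1/2) 0"
  obtain f :: "rseq \<Rightarrow> real" and G where
    fG: "\<And>x. x \<in> {x. x - ?p \<in> V0 \<and> x \<noteq> ?p} \<Longrightarrow> G x \<in> V0 \<and> G x \<noteq> 0 \<and>
       (f has_derivative (\<lambda>h. inner (G x) h)) (at x within {x. x - ?p \<in> V0 \<and> x \<noteq> ?p})"
    "continuous_on {x. x - ?p \<in> V0 \<and> x \<noteq> ?p} G"
    "bdry lens \<inter> {x. x - ?p \<in> V0 \<and> x \<noteq> ?p} = {x \<in> {x. x - ?p \<in> V0 \<and> x \<noteq> ?p}. f x = 0}"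
    by (rule lens.exists_C1_defining_function[OF lens_base]) (rule that)
  have U: "{x. x - ?p \<in> V0 \<and> x \<noteq> ?p} = affine_chart 3 tr_vec \<inter> - {?p}"
  proof -
    have "x - ?p \<in> V0 \<longleftrightarrow> x \<in> affine_chart 3 tr_vec" for x
    proof
      assume x: "x - ?p \<in> V0"
      then have "x - ?p \<in> Rn 4" by (simp add: V0_def)
      then have "(x - ?p) + ?p \<in> Rn 4" by (rule Rn4_intros(1)) simp
      then show "x \<in> affine_chart 3 tr_vec" using x by (simp add: affine_chart_eq V0_def lookup_minus)
    qed (auto simp: affine_chart_eq V0_def lookup_minus Rn4_intros)
    then show ?thesis by blast
  qed
  show "\<exists>U (f :: rseq \<Rightarrow> real) G. openin (top_of_set (affine_chart 3 tr_vec)) U \<and> \<xi> \<in> U \<and>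
        (\<forall>x\<in>U. G x \<in> chart_dirs 3 tr_vec \<and> G x \<noteq> 0 \<and>
           (f has_derivative (\<lambda>h. inner (G x) h)) (at x within U)) \<and>
        continuous_on U G \<and> bdry lens \<inter> U = {x \<in> U. f x = 0}"
  proof (intro exI[of _ "{x. x - ?p \<in> V0 \<and> x \<noteq> ?p}"] exI[of _ f] exI[of _ G] conjI)
    show "openin (top_of_set (affine_chart 3 tr_vec)) {x. x - ?p \<in> V0 \<and> x \<noteq> ?p}"
      unfolding U by (intro openin_open_Int open_Compl closed_singleton)
    show "\<xi> \<in> {x. x - ?p \<in> V0 \<and> x \<noteq> ?p}"
      using lens.bdry_diff[OF \<xi> lens_base] by (auto simp: eq_commute)
  qed (use fG in \<open>auto simp: chart_dirs_eq\<close>)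
qed

text \<open>The vertical chords of the lens have length \<open>2 width x\<close> by
construction.\<close>
lemma ray_param_vertical:
  assumes x: "x \<in> lens" "lk x 3 = 0" and e: "\<bar>e\<bar> = 1"
  shows "ray_param lens x (v4 0 0 0 e) = width x"
proof -
  have V: "v4 0 0 0 e \<in> V0" "v4 0 0 0 e \<noteq> 0"
  proof -
    show "v4 0 0 0 e \<in> V0" by (simp add: V0_def)
    show "v4 0 0 0 e \<noteq> 0" using e by (metis lookup_v4_simps(4) lookup_zero abs_zero zero_neq_one)
  qed
  have iff: "x + s *\<^sub>R v4 0 0 0 e \<in> lens \<longleftrightarrow> s < width x" if "s \<ge> 0" for s
  proof -
    let ?y = "x + s *\<^sub>R v4 0 0 0 e"
    have "lk ?y 0 = lk x 0" "lk ?y 1 = lk x 1" "lk ?y 2 = lk x 2" by (simp_all add: lookup_add)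
    note c = width_cong[OF this]
    have "\<bar>lk ?y 3\<bar> = s" using x(2) e that by (simp add: lookup_add abs_mult)
    then show ?thesis
      using x c lensD[OF x(1)] by (auto simp: lens_def lens_cone_def Rn4_intros lookup_add)
  qed
  have p: "0 < ray_param lens x (v4 0 0 0 e)" using lens.ray_param_pos[OF x(1) V] .
  have "\<not> ray_param lens x (v4 0 0 0 e) < width x"
    using iff[of "ray_param lens x (v4 0 0 0 e)"] lens.less_ray_param[OF x(1) V] p by fastforce
  moreover have "\<not> width x < ray_param lens x (v4 0 0 0 e)"
    using iff[of "width x"] lens.in_D_if_less_ray_param[OF x(1) V, of "width x"] width_pos[of x] lensD[OF x(1)] by auto
  ultimately show ?thesis by simp
qed

text \<open>Both ends of the vertical chord are at distance \<open>width x\<close>.\<close>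
lemma finsler_vertical:
  assumes x: "x \<in> lens" "lk x 3 = 0" and c: "c > 0"
  shows "finsler lens x (c *\<^sub>R v4 0 0 0 1) = c / width x"
proof -
  have V: "v4 0 0 0 1 \<in> V0" "v4 0 0 0 1 \<noteq> 0"
  proof -
    show "v4 0 0 0 1 \<in> V0" by (simp add: V0_def)
    show "v4 0 0 0 1 \<noteq> 0" by (metis lookup_v4_simps(4) lookup_zero zero_neq_one)
  qed
  have neg: "- v4 0 0 0 1 = v4 0 0 0 (- 1)"
    by (rule Rn4_eqI) (auto simp: Rn4_intros lookup_minus)
  show ?thesis
    using lens.finsler_scale[OF x(1) V(1) c] lens.finsler_eq[OF x(1) V]
      ray_param_vertical[OF x, of 1] ray_param_vertical[OF x, of "- 1"] by (simp add: neg)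
qed

section \<open>The symmetric square\<close>

text \<open>The action \<open>X \<mapsto> A X A\<^sup>T\<close> on symmetric matrices, extended by the
identity on the height.\<close>
definition rho :: "int \<Rightarrow> int \<Rightarrow> int \<Rightarrow> int \<Rightarrow> real mat" where
  "rho a b c d = mat 4 4 (\<lambda>(i, j). real_of_int (
     if i = 0 then (if j = 0 then a\<^sup>2 else if j = 1 then 2 * a * b else if j = 2 then b\<^sup>2 else 0)
     else if i = 1 then (if j = 0 then a * c else if j = 1 then a * d + b * c else if j = 2 then b * d else 0)
     else if i = 2 then (if j = 0 then c\<^sup>2 else if j = 1 then 2 * c * d else if j = 2 then d\<^sup>2 else 0)
     else (if j = 3 then 1 else 0)))"

lemma rho_carrier [simp]: "rho a b c d \<in> carrier_mat 4 4"
  and rho_dim [simp]: "dim_row (rho a b c d) = 4" "dim_col (rho a b c d) = 4"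
  by (auto simp: rho_def)

lemma less4_cases: "(i::nat) < 4 \<Longrightarrow> i = 0 \<or> i = 1 \<or> i = 2 \<or> i = 3" by auto

lemma sum_less4: "(\<Sum>i<4. f i) = f 0 + f 1 + f 2 + f (3::nat)" for f :: "nat \<Rightarrow> 'a::comm_monoid_add"
  by (simp add: numeral_eq_Suc)

lemma lookup_mat_act:
  "lk (mat_act g v) i = (if i < dim_row g then \<Sum>j<dim_col g. g $$ (i, j) * lk v j else 0)"
proof -
  have "lk (mat_act g v) i = (\<Sum>k<dim_row g. lk (Poly_Mapping.single k (\<Sum>j<dim_col g. g $$ (k, j) * lk v j)) i)"
    unfolding mat_act_def by (rule lookup_sum)
  also have "\<dots> = (\<Sum>k<dim_row g. if k = i then (\<Sum>j<dim_col g. g $$ (k, j) * lk v j) else 0)"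
    by (intro sum.cong) (auto simp: lookup_single when_def)
  finally show ?thesis by simp
qed

lemma mat_act_add: "mat_act g (v + w) = mat_act g v + mat_act g w"
  by (rule poly_mapping_eqI) (simp add: lookup_mat_act lookup_add algebra_simps sum.distrib)

lemma mat_act_scale: "mat_act g (c *\<^sub>R v) = c *\<^sub>R mat_act g v"
  by (rule poly_mapping_eqI) (simp add: lookup_mat_act sum_distrib_left algebra_simps)

lemma mat_act_zero: "mat_act g 0 = 0"
  by (rule poly_mapping_eqI) (simp add: lookup_mat_act)

lemma mat_act_mult:
  assumes "g \<in> carrier_mat 4 4" "h \<in> carrier_mat 4 4"
  shows "mat_act (g * h) v = mat_act g (mat_act h v)"
proof (rule poly_mapping_eqI)
  fix i
  show "lk (mat_act (g * h) v) i = lk (mat_act g (mat_act h v)) i"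
  proof (cases "i < 4")
    case True
    have "lk (mat_act (g * h) v) i = (\<Sum>j<4. (\<Sum>k<4. g $$ (i, k) * h $$ (k, j)) * lk v j)"
      using assms True by (simp add: lookup_mat_act scalar_prod_def lessThan_atLeast0)
    also have "\<dots> = (\<Sum>k<4. \<Sum>j<4. g $$ (i, k) * (h $$ (k, j) * lk v j))"
      unfolding sum_distrib_right by (subst sum.swap) (simp add: mult.assoc)
    also have "\<dots> = lk (mat_act g (mat_act h v)) i"
      using assms True by (simp add: lookup_mat_act sum_distrib_left)
    finally show ?thesis .
  qed (use assms in \<open>simp add: lookup_mat_act\<close>)
qed

lemma mat_act_Rn4: "g \<in> carrier_mat 4 4 \<Longrightarrow> mat_act g v \<in> Rn 4"
  by (simp add: Rn4_iff lookup_mat_act)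

lemma mat_act_rho:
  "mat_act (rho a b c d) v = v4 (a\<^sup>2 * lk v 0 + 2 * a * b * lk v 1 + b\<^sup>2 * lk v 2)
     (a * c * lk v 0 + (a * d + b * c) * lk v 1 + b * d * lk v 2)
     (c\<^sup>2 * lk v 0 + 2 * c * d * lk v 1 + d\<^sup>2 * lk v 2) (lk v 3)"
  by (rule Rn4_eqI) (simp_all add: mat_act_Rn4 lookup_mat_act sum_less4 rho_def)

lemma rho_mult:
  "rho a b c d * rho a' b' c' d' = rho (a * a' + b * c') (a * b' + b * d') (c * a' + d * c') (c * b' + d * d')"
proof (rule eq_matI)
  fix i j assume "i < dim_row (rho (a * a' + b * c') (a * b' + b * d') (c * a' + d * c') (c * b' + d * d'))"
    and "j < dim_col (rho (a * a' + b * c') (a * b' + b * d') (c * a' + d * c') (c * b' + d * d'))"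
  then have i: "i < 4" and j: "j < 4" by auto
  have "(rho a b c d * rho a' b' c' d') $$ (i, j) = (\<Sum>k<4. rho a b c d $$ (i, k) * rho a' b' c' d' $$ (k, j))"
    using i j by (simp add: scalar_prod_def lessThan_atLeast0)
  also have "\<dots> = rho (a * a' + b * c') (a * b' + b * d') (c * a' + d * c') (c * b' + d * d') $$ (i, j)"
    using less4_cases[OF i] less4_cases[OF j]
    by (elim disjE; simp add: sum_less4 rho_def power2_eq_square algebra_simps)
  finally show "(rho a b c d * rho a' b' c' d') $$ (i, j) =
    rho (a * a' + b * c') (a * b' + b * d') (c * a' + d * c') (c * b' + d * d') $$ (i, j)" .
qed auto

lemma rho_one: "rho 1 0 0 1 = 1\<^sub>m 4"
proof (rule eq_matI)
  fix i j assume "i < dim_row (1\<^sub>m 4 :: real mat)" "j < dim_col (1\<^sub>m 4 :: real mat)"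
  then have i: "i < 4" and j: "j < 4" by auto
  show "rho 1 0 0 1 $$ (i, j) = 1\<^sub>m 4 $$ (i, j)"
    using less4_cases[OF i] less4_cases[OF j] by (elim disjE; simp add: rho_def)
qed auto

lemma det_two:
  assumes "(A :: 'a::comm_ring_1 mat) \<in> carrier_mat 2 2"
  shows "Determinant.det A = A $$ (0, 0) * A $$ (1, 1) - A $$ (0, 1) * A $$ (1, 0)"
proof -
  have m: "mat_delete A 0 j \<in> carrier_mat 1 1" for j using assms by (auto simp: mat_delete_def)
  have "Determinant.det A = (\<Sum>j<2. A $$ (0, j) * cofactor A 0 j)"
    using laplace_expansion_row[OF assms, of 0] by simp
  also have "\<dots> = A $$ (0, 0) * cofactor A 0 0 + A $$ (0, 1) * cofactor A 0 1"
    by (simp add: numeral_eq_Suc)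
  finally show ?thesis
    using assms by (simp add: cofactor_def det_single[OF m]) (simp add: mat_delete_def)
qed

lemma det_three:
  assumes "(A :: 'a::comm_ring_1 mat) \<in> carrier_mat 3 3"
  shows "Determinant.det A =
    A $$ (0, 0) * (A $$ (1, 1) * A $$ (2, 2) - A $$ (1, 2) * A $$ (2, 1))
    - A $$ (0, 1) * (A $$ (1, 0) * A $$ (2, 2) - A $$ (1, 2) * A $$ (2, 0))
    + A $$ (0, 2) * (A $$ (1, 0) * A $$ (2, 1) - A $$ (1, 1) * A $$ (2, 0))"
proof -
  have m: "mat_delete A 0 j \<in> carrier_mat 2 2" for j using assms by (auto simp: mat_delete_def)
  have "Determinant.det A = (\<Sum>j<3. A $$ (0, j) * cofactor A 0 j)"
    using laplace_expansion_row[OF assms, of 0] by simp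
  also have "\<dots> = A $$ (0, 0) * cofactor A 0 0 + A $$ (0, 1) * cofactor A 0 1 + A $$ (0, 2) * cofactor A 0 2"
    by (simp add: numeral_eq_Suc)
  finally show ?thesis
    using assms by (simp add: cofactor_def det_two[OF m]) (simp add: mat_delete_def numeral_2_eq_2 algebra_simps)
qed

text \<open>Expansion along the last row leaves the symmetric square, whose determinant is \<open>(a d -
b c)\<^sup>3\<close>.\<close>
lemma det_rho:
  assumes "a * d - b * c = 1"
  shows "Determinant.det (rho a b c d) = 1"
proof -
  let ?A = "rho a b c d"
  have m: "mat_delete ?A 3 3 \<in> carrier_mat 3 3" by (auto simp: mat_delete_def)
  have "Determinant.det ?A = (\<Sum>j<4. ?A $$ (3, j) * cofactor ?A 3 j)"
    using laplace_expansion_row[OF rho_carrier, of 3] by simp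
  also have "\<dots> = cofactor ?A 3 3" by (simp add: sum_less4 rho_def)
  also have "\<dots> = Determinant.det (mat_delete ?A 3 3)" by (simp add: cofactor_def)
  also have "\<dots> = real_of_int ((a * d - b * c) ^ 3)"
    unfolding det_three[OF m] by (simp add: mat_delete_def) (simp add: rho_def power2_eq_square power3_eq_cube algebra_simps)
  finally show ?thesis using assms by simp
qed

lemma
  shows qf_rho: "qf m n (mat_act (rho a b c d) v) = qf (m * a + n * c) (m * b + n * d) v"
    and dt_rho: "a * d - b * c = 1 \<Longrightarrow> dt (mat_act (rho a b c d) v) = dt v"
    and lookup3_rho: "lk (mat_act (rho a b c d) v) 3 = lk v 3"
proof -
  show "qf m n (mat_act (rho a b c d) v) = qf (m * a + n * c) (m * b + n * d) v"
    by (simp add: mat_act_rho qf_def power2_eq_square algebra_simps)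
  show "lk (mat_act (rho a b c d) v) 3 = lk v 3" by (simp add: mat_act_rho)
  assume det: "a * d - b * c = 1"
  have "dt (mat_act (rho a b c d) v) = (real_of_int (a * d - b * c))\<^sup>2 * dt v"
    by (simp add: mat_act_rho dt_def power2_eq_square algebra_simps)
  then show "dt (mat_act (rho a b c d) v) = dt v" using det by simp
qed

lemma rho_inverse:
  assumes "a * d - b * c = 1"
  shows "rho a b c d * rho d (- b) (- c) a = 1\<^sub>m 4" "rho d (- b) (- c) a * rho a b c d = 1\<^sub>m 4"
  using assms by (simp_all add: rho_mult rho_one[symmetric] algebra_simps)

lemma pd_rho:
  assumes "a * d - b * c = 1" "pd v"
  shows "pd (mat_act (rho a b c d) v)"
proof -
  have "real_of_int a \<noteq> 0 \<or> real_of_int b \<noteq> 0" using assms(1) by auto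
  then have "0 < qf a b v" by (rule qf_pos[OF assms(2)])
  also have "qf a b v = lk (mat_act (rho a b c d) v) 0" by (simp add: mat_act_rho qf_def)
  finally show ?thesis using assms dt_rho[OF assms(1)] by (simp add: pd_def)
qed

lemma prim_rho:
  assumes "a * d - b * c = 1" "prim m n"
  shows "prim (m * a + n * c) (m * b + n * d)"
proof -
  obtain r s where rs: "m * s - n * r = 1" using assms(2) by (auto simp: prim_def)
  have "(m * a + n * c) * (r * b + s * d) - (m * b + n * d) * (r * a + s * c) = (m * s - n * r) * (a * d - b * c)"
    by (simp add: algebra_simps)
  then show ?thesis unfolding prim_def using assms(1) rs by (metis mult_1)
qed

text \<open>The infimum is only reindexed by the bijection of primitive vectors.\<close>
lemma width_rho:
  assumes det: "a * d - b * c = 1" and v: "pd v"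
  shows "width (mat_act (rho a b c d) v) = width v"
proof -
  have le: "width v \<le> width (mat_act (rho a b c d) v)" if det: "a * d - b * c = 1" and v: "pd v" for a b c d v
  proof -
    obtain m n where p: "prim m n"
      and w: "width (mat_act (rho a b c d) v) = hgt (qf m n (mat_act (rho a b c d) v)) (rt (mat_act (rho a b c d) v))"
      using width_attained[OF pd_rho[OF det v]] by blast
    have "rt (mat_act (rho a b c d) v) = rt v" by (simp add: rt_def dt_rho[OF det])
    then show ?thesis
      using width_le[OF v prim_rho[OF det p]] w by (simp add: qf_rho)
  qed
  have det': "d * a - (- b) * (- c) = 1" using det by (simp add: mult.commute)
  have ret: "mat_act (rho d (- b) (- c) a) (mat_act (rho a b c d) v) = v4 (lk v 0) (lk v 1) (lk v 2) (lk v 3)"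
    using mat_act_mult[OF rho_carrier rho_carrier, of d "- b" "- c" a a b c d v] rho_inverse(2)[OF det]
    by (simp flip: rho_one) (simp add: mat_act_rho)
  have "width (mat_act (rho a b c d) v) \<le> width (v4 (lk v 0) (lk v 1) (lk v 2) (lk v 3))"
    using le[OF det' pd_rho[OF det v]] unfolding ret .
  also have "\<dots> = width v" by (rule width_cong) auto
  finally show ?thesis using le[OF det v] by simp
qed

lemma lens_cone_rho:
  assumes "a * d - b * c = 1" "v \<in> lens_cone"
  shows "mat_act (rho a b c d) v \<in> lens_cone"
  using assms pd_rho[OF assms(1), of v] width_rho[OF assms(1), of v]
  by (simp add: lens_cone_def mat_act_Rn4 lookup3_rho)

section \<open>The congruence group of level 3\<close>

text \<open>The congruence group of level 3. It contains neither \<open>- 1\<close> nor nontrivial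
elements of finite order.\<close>
definition lev3 :: "int \<Rightarrow> int \<Rightarrow> int \<Rightarrow> int \<Rightarrow> bool" where
  "lev3 a b c d \<longleftrightarrow> a * d - b * c = 1 \<and> 3 dvd a - 1 \<and> 3 dvd b \<and> 3 dvd c \<and> 3 dvd d - 1"

definition Gam :: "real mat set" where "Gam = {rho a b c d | a b c d. lev3 a b c d}"

lemma lev3_det: "lev3 a b c d \<Longrightarrow> a * d - b * c = 1" by (simp add: lev3_def)

lemma lev3_one: "lev3 1 0 0 1" by (simp add: lev3_def)

lemma lev3_inverse: "lev3 a b c d \<Longrightarrow> lev3 d (- b) (- c) a"
  by (auto simp: lev3_def mult.commute)

lemma lev3E:
  assumes "lev3 a b c d"
  obtains x y z w where "a = 1 + 3 * x" "b = 3 * y" "c = 3 * z" "d = 1 + 3 * w"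
proof -
  obtain x y z w where "a - 1 = 3 * x" "b = 3 * y" "c = 3 * z" "d - 1 = 3 * w"
    using assms unfolding lev3_def dvd_def by blast
  then show ?thesis using that[of x y z w] by (simp add: algebra_simps)
qed

lemma lev3_mult:
  assumes "lev3 a b c d" "lev3 a' b' c' d'"
  shows "lev3 (a * a' + b * c') (a * b' + b * d') (c * a' + d * c') (c * b' + d * d')"
proof -
  obtain x y z w where e1: "a = 1 + 3 * x" "b = 3 * y" "c = 3 * z" "d = 1 + 3 * w"
    by (rule lev3E[OF assms(1)])
  obtain x' y' z' w' where e2: "a' = 1 + 3 * x'" "b' = 3 * y'" "c' = 3 * z'" "d' = 1 + 3 * w'"
    by (rule lev3E[OF assms(2)])
  note e = e1 e2
  have "(a * a' + b * c') * (c * b' + d * d') - (a * b' + b * d') * (c * a' + d * c') =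
    (a * d - b * c) * (a' * d' - b' * c')" by (simp add: algebra_simps)
  moreover have "3 dvd a * a' + b * c' - 1" unfolding e dvd_def
    by (intro exI[of _ "x + x' + 3 * x * x' + 3 * y * z'"]) (simp add: algebra_simps)
  moreover have "3 dvd a * b' + b * d'" unfolding e dvd_def
    by (intro exI[of _ "(1 + 3 * x) * y' + y * (1 + 3 * w')"]) (simp add: algebra_simps)
  moreover have "3 dvd c * a' + d * c'" unfolding e dvd_def
    by (intro exI[of _ "z * (1 + 3 * x') + (1 + 3 * w) * z'"]) (simp add: algebra_simps)
  moreover have "3 dvd c * b' + d * d' - 1" unfolding e dvd_def
    by (intro exI[of _ "w + w' + 3 * w * w' + 3 * z * y'"]) (simp add: algebra_simps)
  ultimately show ?thesis using assms by (simp add: lev3_def)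
qed

text \<open>Modulo 9 the trace of an element of level 3 is 2, so a trace of absolute value at most 2 is
equal to 2.\<close>
lemma lev3_trace:
  assumes "lev3 a b c d" shows "9 dvd a + d - 2"
proof -
  obtain x y z w where e: "a = 1 + 3 * x" "b = 3 * y" "c = 3 * z" "d = 1 + 3 * w"
    by (rule lev3E[OF assms])
  have "x + w = 3 * (y * z - x * w)" using lev3_det[OF assms] unfolding e by (simp add: algebra_simps)
  then have "a + d - 2 = 9 * (y * z - x * w)" unfolding e by simp
  then show ?thesis by simp
qed

text \<open>An element that fixes a positive definite form up to a factor is conjugate to a rotation, so
its trace has absolute value at most 2. By the congruence the trace is 2, and a rotation of trace 2 is
trivial.\<close>
lemma lev3_fix_pd:
  assumes g: "lev3 a b c d" and v: "pd v" and fix_v: "\<And>i. i < 3 \<Longrightarrow> lk (mat_act (rho a b c d) v) i = \<kappa> * lk v i"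
  shows "a = 1 \<and> b = 0 \<and> c = 0 \<and> d = 1"
proof -
  note det = lev3_det[OF g]
  let ?w = "mat_act (rho a b c d) v"
  have w: "lk ?w 0 = \<kappa> * lk v 0" "lk ?w 1 = \<kappa> * lk v 1" "lk ?w 2 = \<kappa> * lk v 2" using fix_v by auto
  have pw: "pd ?w" using pd_rho[OF det v] .
  have "\<kappa>\<^sup>2 * dt v = dt v" using dt_rho[OF det, of v] w by (simp add: dt_def power2_eq_square algebra_simps)
  then have "\<kappa>\<^sup>2 = 1" using v by (simp add: pd_def)
  moreover have "0 < \<kappa> * lk v 0" using pw w by (simp add: pd_def)
  then have "\<kappa> > 0" using v by (simp add: pd_def zero_less_mult_iff)
  ultimately have k1: "\<kappa> = 1" by (simp add: power2_eq_1_iff)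
  define x y z where "x = lk v 0" and "y = lk v 1" and "z = lk v 2"
  have x: "x > 0" and dv: "x * z - y\<^sup>2 > 0" using v by (auto simp: pd_def dt_def x_def y_def z_def)
  define A B C D where "A = real_of_int a" and "B = real_of_int b" and "C = real_of_int c" and "D = real_of_int d"
  have det': "A * D - B * C = 1" using det unfolding A_def B_def C_def D_def by (metis of_int_1 of_int_diff of_int_mult)
  have e1: "A\<^sup>2 * x + 2 * A * B * y + B\<^sup>2 * z = x" and e2: "A * C * x + (A * D + B * C) * y + B * D * z = y"
    using w unfolding k1 by (simp_all add: mat_act_rho x_def y_def z_def A_def B_def C_def D_def)
  have "D * (A\<^sup>2 * x + 2 * A * B * y + B\<^sup>2 * z) - B * (A * C * x + (A * D + B * C) * y + B * D * z)
    = (A * D - B * C) * (A * x + B * y)" by (simp add: power2_eq_square algebra_simps)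
  then have f1: "(A - D) * x = - 2 * B * y" unfolding e1 e2 det' by (simp add: algebra_simps)
  have "A * (A * C * x + (A * D + B * C) * y + B * D * z) - C * (A\<^sup>2 * x + 2 * A * B * y + B\<^sup>2 * z)
    = (A * D - B * C) * (A * y + B * z)" by (simp add: power2_eq_square algebra_simps)
  then have f2: "B * z = - C * x" unfolding e1 e2 det' by (simp add: algebra_simps)
  have "x\<^sup>2 * ((A + D)\<^sup>2 - 4) = x\<^sup>2 * ((A + D)\<^sup>2 - 4 * (A * D - B * C))" by (simp add: det')
  also have "\<dots> = ((A - D) * x)\<^sup>2 + 4 * B * x * (C * x)" by (simp add: power2_eq_square algebra_simps)
  also have "C * x = - B * z" using f2 by simp
  also have "((A - D) * x)\<^sup>2 + 4 * B * x * (- B * z) = - 4 * B\<^sup>2 * (x * z - y\<^sup>2)"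
    unfolding f1 by (simp add: power2_eq_square algebra_simps)
  finally have key: "x\<^sup>2 * ((A + D)\<^sup>2 - 4) = - 4 * B\<^sup>2 * (x * z - y\<^sup>2)" .
  have "- 4 * B\<^sup>2 * (x * z - y\<^sup>2) \<le> 0" using dv by (simp add: zero_le_mult_iff)
  then have "x\<^sup>2 * ((A + D)\<^sup>2 - 4) \<le> 0" unfolding key .
  then have "(A + D)\<^sup>2 \<le> 2\<^sup>2" using x by (simp add: mult_le_0_iff)
  then have "\<bar>A + D\<bar> \<le> 2" using abs_le_square_iff[of "A + D" 2] by simp
  then have "\<bar>a + d\<bar> \<le> 2" unfolding A_def D_def by linarith
  then have t: "a + d = 2" using lev3_trace[OF g] by presburger
  then have AD: "A + D = 2" unfolding A_def D_def by (metis of_int_add of_int_numeral)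
  then have "B = 0" using key dv by simp
  then have b: "b = 0" by (simp add: B_def)
  have "A = D" using f1 \<open>B = 0\<close> x by simp
  moreover have "C = 0" using f2 \<open>B = 0\<close> x by simp
  ultimately show ?thesis using AD b by (auto simp: A_def C_def D_def)
qed

lemma Gam_subset_SL: "Gam \<subseteq> carrier (SL 4)"
  using det_rho lev3_det by (auto simp: Gam_def SL_def)

lemma m_inv_matrix:
  fixes G :: "real mat monoid"
  assumes G: "carrier G \<subseteq> carrier_mat 4 4" "mult G = (*)" "one G = 1\<^sub>m 4"
    and x: "x \<in> carrier G" "y \<in> carrier G" "x * y = 1\<^sub>m 4" "y * x = 1\<^sub>m 4"
  shows "inv\<^bsub>G\<^esub> x = y"
  unfolding m_inv_def
proof (rule the_equality)
  show "y \<in> carrier G \<and> x \<otimes>\<^bsub>G\<^esub> y = \<one>\<^bsub>G\<^esub> \<and> y \<otimes>\<^bsub>G\<^esub> x = \<one>\<^bsub>G\<^esub>" using G x by simp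
  fix z assume z: "z \<in> carrier G \<and> x \<otimes>\<^bsub>G\<^esub> z = \<one>\<^bsub>G\<^esub> \<and> z \<otimes>\<^bsub>G\<^esub> x = \<one>\<^bsub>G\<^esub>"
  then have zc: "z \<in> carrier_mat 4 4" "x * z = 1\<^sub>m 4" using G by auto
  have xc: "x \<in> carrier_mat 4 4" "y \<in> carrier_mat 4 4" using G x by auto
  have "z = y * x * z" using x(4) zc by simp
  also have "\<dots> = y * (x * z)" using xc zc by (rule_tac assoc_mult_mat) auto
  also have "\<dots> = y" using zc xc by simp
  finally show "z = y" .
qed

text \<open>A set of matrices \<open>rho a b c d\<close> is a subgroup if the condition on \<open>(a, b,
c, d)\<close> is closed under the operations of \<open>SL\<^sub>2\<close>. It serves for the whole group
and for the stabilisers of cusps.\<close>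
lemma Gam_subgroupI:
  fixes G :: "real mat monoid"
  assumes G: "carrier G \<subseteq> carrier_mat 4 4" "mult G = (*)" "one G = 1\<^sub>m 4"
    and P: "\<And>a b c d. Q a b c d \<Longrightarrow> lev3 a b c d" "\<And>a b c d. Q a b c d \<Longrightarrow> rho a b c d \<in> carrier G"
      "Q 1 0 0 1" "\<And>a b c d. Q a b c d \<Longrightarrow> Q d (- b) (- c) a"
      "\<And>a b c d a' b' c' d'. Q a b c d \<Longrightarrow> Q a' b' c' d' \<Longrightarrow>
         Q (a * a' + b * c') (a * b' + b * d') (c * a' + d * c') (c * b' + d * d')"
  shows "subgroup {rho a b c d | a b c d. Q a b c d} G"
proof
  show "{rho a b c d | a b c d. Q a b c d} \<subseteq> carrier G" using P(2) by blast
  show "x \<otimes>\<^bsub>G\<^esub> y \<in> {rho a b c d | a b c d. Q a b c d}"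
    if "x \<in> {rho a b c d | a b c d. Q a b c d}" "y \<in> {rho a b c d | a b c d. Q a b c d}" for x y
    using that P(5) unfolding G(2) by (force simp: rho_mult)
  show "\<one>\<^bsub>G\<^esub> \<in> {rho a b c d | a b c d. Q a b c d}" unfolding G(3) using P(3) rho_one by force
  show "inv\<^bsub>G\<^esub> x \<in> {rho a b c d | a b c d. Q a b c d}" if x: "x \<in> {rho a b c d | a b c d. Q a b c d}" for x
  proof -
    obtain a b c d where q: "Q a b c d" "x = rho a b c d" using x by blast
    have "inv\<^bsub>G\<^esub> x = rho d (- b) (- c) a"
      unfolding q(2) using rho_inverse[OF lev3_det[OF P(1)[OF q(1)]]] q P
      by (intro m_inv_matrix[OF G]) auto
    then show ?thesis using P(4)[OF q(1)] by blast
  qed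
qed

definition Omega :: "rseq set set" where "Omega = (\<lambda>v. span {v}) ` lens_cone"

lemma mat_act_span: "mat_act g ` span {v} = span {mat_act g v}"
  unfolding span_singleton by (auto simp: mat_act_scale image_iff)

lemma Gam_subgroup: "subgroup Gam (Aut 3 Omega)"
proof -
  have sub: "(\<lambda>l. mat_act (rho a b c d) ` l) ` Omega \<subseteq> Omega" if "a * d - b * c = 1" for a b c d
    using lens_cone_rho[OF that] by (auto simp: Omega_def mat_act_span)
  have inv: "(\<lambda>l. mat_act (rho a b c d) ` l) ` Omega = Omega" if g: "lev3 a b c d" for a b c d
  proof
    show "(\<lambda>l. mat_act (rho a b c d) ` l) ` Omega \<subseteq> Omega" by (rule sub[OF lev3_det[OF g]])
    show "Omega \<subseteq> (\<lambda>l. mat_act (rho a b c d) ` l) ` Omega"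
    proof
      fix l assume l: "l \<in> Omega"
      then obtain v where v: "v \<in> lens_cone" "l = span {v}" by (auto simp: Omega_def)
      let ?h = "rho d (- b) (- c) a"
      have "mat_act (rho a b c d) (mat_act ?h v) = mat_act (rho 1 0 0 1) v"
        using mat_act_mult[OF rho_carrier rho_carrier, of a b c d d "- b" "- c" a v] rho_inverse(1)[OF lev3_det[OF g]]
        by (simp add: rho_one)
      also have "\<dots> = v" using v(1) by (intro Rn4_eqI) (auto simp: mat_act_rho lens_cone_def)
      finally have "l = mat_act (rho a b c d) ` (mat_act ?h ` l)" by (simp add: v(2) mat_act_span)
      moreover have "mat_act ?h ` l \<in> Omega" using sub[OF lev3_det[OF lev3_inverse[OF g]]] l by blast
      ultimately show "l \<in> (\<lambda>l. mat_act (rho a b c d) ` l) ` Omega" by blast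
    qed
  qed
  show ?thesis
    unfolding Gam_def
  proof (rule Gam_subgroupI)
    show "carrier (Aut 3 Omega) \<subseteq> carrier_mat 4 4" "mult (Aut 3 Omega) = (*)" "one (Aut 3 Omega) = 1\<^sub>m 4"
      by (auto simp: Aut_def SL_def)
    show "rho a b c d \<in> carrier (Aut 3 Omega)" if "lev3 a b c d" for a b c d
    proof -
      have "rho a b c d \<in> carrier (SL 4)" using Gam_subset_SL that unfolding Gam_def by blast
      then show ?thesis using inv[OF that] by (simp add: Aut_def)
    qed
  qed (use lev3_one lev3_inverse lev3_mult in auto)
qed

text \<open>The entries are integers.\<close>
lemma Gam_discrete: "discrete_mats 4 Gam"
  unfolding discrete_mats_def
proof
  fix g assume "g \<in> Gam"
  then obtain a b c d where g: "g = rho a b c d" by (auto simp: Gam_def)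
  have int: "\<exists>k::int. rho a b c d $$ (i, j) = of_int k" if "i < 4" "j < 4" for a b c d i j
    using that unfolding rho_def by (subst index_mat) auto
  show "\<exists>\<epsilon>>0. \<forall>h\<in>Gam. (\<forall>i<4. \<forall>j<4. \<bar>h $$ (i, j) - g $$ (i, j)\<bar> < \<epsilon>) \<longrightarrow> h = g"
  proof (intro exI[of _ 1] conjI ballI impI)
    fix h assume "h \<in> Gam" and close: "\<forall>i<4. \<forall>j<4. \<bar>h $$ (i, j) - g $$ (i, j)\<bar> < 1"
    then obtain a' b' c' d' where h: "h = rho a' b' c' d'" by (auto simp: Gam_def)
    show "h = g"
    proof (rule eq_matI)
      fix i j assume "i < dim_row g" "j < dim_col g"
      then have ij: "i < 4" "j < 4" by (auto simp: g)
      obtain k where k: "h $$ (i, j) = of_int k" using int[OF ij] unfolding h by blast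
      obtain k' where k': "g $$ (i, j) = of_int k'" using int[OF ij] unfolding g by blast
      have "\<bar>real_of_int k - real_of_int k'\<bar> < 1" using close ij k k' by metis
      then have "k = k'" by linarith
      then show "h $$ (i, j) = g $$ (i, j)" using k k' by simp
    qed (auto simp: g h)
  qed simp
qed

lemma mat_act_pow:
  assumes g: "g \<in> carrier_mat 4 4"
  shows "mat_act (g ^\<^sub>m k) v = (mat_act g ^^ k) (mat_act (1\<^sub>m 4) v)"
proof (induction k arbitrary: v)
  case 0
  then show ?case using g by simp
next
  case (Suc k)
  have one: "mat_act (1\<^sub>m 4) (mat_act g v) = mat_act g (mat_act (1\<^sub>m 4) v)"
    using g mat_act_mult[of "1\<^sub>m 4" g v] mat_act_mult[of g "1\<^sub>m 4" v] by simp
  have "mat_act (g ^\<^sub>m Suc k) v = mat_act (g ^\<^sub>m k) (mat_act g v)"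
    using g mat_act_mult[of "g ^\<^sub>m k" g v] by simp
  also have "\<dots> = (mat_act g ^^ k) (mat_act g (mat_act (1\<^sub>m 4) v))" by (simp add: Suc one)
  finally show ?case by (simp add: funpow_swap1)
qed

text \<open>The sum over the finite orbit of a positive definite form is a fixed positive definite
form.\<close>
lemma torsion_lev3:
  assumes g: "lev3 a b c d" and t: "torsion_mat (rho a b c d)"
  shows "rho a b c d = 1\<^sub>m 4"
proof -
  let ?g = "rho a b c d"
  obtain k where k: "k > 0" "?g ^\<^sub>m k = 1\<^sub>m 4" using t by (auto simp: torsion_mat_def)
  define e where "e = v4 1 0 1 0"
  define f where "f = (\<lambda>i. (mat_act ?g ^^ i) e)"
  have e1: "mat_act (1\<^sub>m 4) e = e" by (simp add: rho_one[symmetric] mat_act_rho e_def)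
  have fk: "f k = f 0"
    using mat_act_pow[OF rho_carrier, of a b c d k e] k(2) e1 by (simp add: f_def)
  define Y where "Y = (\<Sum>i<k. f i)"
  have lin: "mat_act ?g (\<Sum>i<n. f i) = (\<Sum>i<n. f (Suc i))" for n
    by (induction n) (auto simp: mat_act_zero mat_act_add f_def)
  have "(\<Sum>i<k. f (Suc i)) + f 0 = (\<Sum>i<k. f i) + f k"
    by (metis add.commute sum.lessThan_Suc sum.lessThan_Suc_shift)
  then have gY: "mat_act ?g Y = Y" using lin[of k] fk by (simp add: Y_def)
  have pe: "pd e" by (simp add: pd_def dt_def e_def)
  have pf: "pd (f i)" for i
    unfolding f_def by (induction i) (auto simp: pe pd_rho[OF lev3_det[OF g]])
  have "pd (\<Sum>i<Suc n. f i)" for n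
    by (induction n) (use pf pd_imp_psd in \<open>auto intro: psd_add_pd\<close>)
  then have "pd Y" using k(1) unfolding Y_def by (cases k) auto
  then have "a = 1 \<and> b = 0 \<and> c = 0 \<and> d = 1"
    using lev3_fix_pd[OF g, of Y 1] gY by simp
  then show ?thesis by (simp add: rho_one)
qed

lemma Gam_torsion_free: "torsion_free Gam"
  using torsion_lev3 by (auto simp: torsion_free_def Gam_def)

section \<open>Boundary circle, parabolic elements and stabilisers of cusps\<close>

text \<open>The rank one matrix \<open>(p, q)\<^sup>T (p, q)\<close> normalised to trace 1: the boundary
point of the disc in the direction \<open>(p, q)\<close>.\<close>
definition dirpt :: "real \<Rightarrow> real \<Rightarrow> rseq" where
  "dirpt p q = (1 / (p\<^sup>2 + q\<^sup>2)) *\<^sub>R v4 (p\<^sup>2) (p * q) (q\<^sup>2) 0"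

text \<open>The rim of the lens, where roof and floor meet; it turns out to be the limit set.\<close>
definition circle :: "rseq set" where
  "circle = {v \<in> Rn 4. lk v 0 + lk v 2 = 1 \<and> psd v \<and> dt v = 0 \<and> lk v 3 = 0}"

lemma sum_squares_pos: "p \<noteq> 0 \<or> q \<noteq> 0 \<Longrightarrow> 0 < p\<^sup>2 + (q::real)\<^sup>2"
  by (simp add: sum_power2_gt_zero_iff)

lemma dirpt_circle:
  assumes "p \<noteq> 0 \<or> q \<noteq> 0" shows "dirpt p q \<in> circle"
proof -
  let ?N = "p\<^sup>2 + q\<^sup>2"
  have N: "?N > 0" using sum_squares_pos[OF assms] .
  have "lk (dirpt p q) 0 + lk (dirpt p q) 2 = ?N / ?N"
    unfolding add_divide_distrib by (simp add: dirpt_def)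
  then have "lk (dirpt p q) 0 + lk (dirpt p q) 2 = 1" using N by (metis divide_self less_irrefl)
  moreover have "dt (dirpt p q) = 0" by (simp add: dirpt_def dt_def power2_eq_square)
  ultimately show ?thesis using N by (simp add: circle_def psd_def dirpt_def Rn4_intros)
qed

lemma circle_bdry: "\<xi> \<in> circle \<Longrightarrow> \<xi> \<in> bdry lens"
  using rank_one_bdry by (simp add: circle_def)

lemma circle_eq_dirpt:
  assumes "\<xi> \<in> circle" obtains x y where "x\<^sup>2 + y\<^sup>2 = 1" "\<xi> = dirpt x y"
  using assms rank_one_eq[of \<xi>] by (auto simp: circle_def dirpt_def)

lemma dirpt_scale: "k \<noteq> 0 \<Longrightarrow> dirpt (k * p) (k * q) = dirpt p q"
proof -
  assume k: "k \<noteq> 0"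
  have "(k * p)\<^sup>2 + (k * q)\<^sup>2 = k\<^sup>2 * (p\<^sup>2 + q\<^sup>2)" by (simp add: power2_eq_square algebra_simps)
  then show ?thesis
    unfolding dirpt_def using k
    by (intro Rn4_eqI) (auto simp: Rn4_intros power2_eq_square)
qed

lemma dirpt_eq_iff:
  assumes "p \<noteq> 0 \<or> q \<noteq> 0" "p' \<noteq> 0 \<or> q' \<noteq> 0"
  shows "dirpt p q = dirpt p' q' \<longleftrightarrow> p * q' = q * p'"
proof
  define N N' where "N = p\<^sup>2 + q\<^sup>2" and "N' = p'\<^sup>2 + q'\<^sup>2"
  have N: "N > 0" "N' > 0" using assms sum_squares_pos by (auto simp: N_def N'_def)
  assume eq: "dirpt p q = dirpt p' q'"
  have "lk (dirpt p q) 0 = lk (dirpt p' q') 0" "lk (dirpt p q) 1 = lk (dirpt p' q') 1"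
    "lk (dirpt p q) 2 = lk (dirpt p' q') 2" by (simp_all only: eq)
  then have e: "p\<^sup>2 / N = p'\<^sup>2 / N'" "p * q / N = p' * q' / N'" "q\<^sup>2 / N = q'\<^sup>2 / N'"
    by (simp_all add: dirpt_def N_def[symmetric] N'_def[symmetric])
  define s m t where "s = p\<^sup>2 / N" and "m = p * q / N" and "t = q\<^sup>2 / N"
  have v: "p\<^sup>2 = N * s" "p * q = N * m" "q\<^sup>2 = N * t" using N by (auto simp: s_def m_def t_def)
  have v': "p'\<^sup>2 = N' * s" "p' * q' = N' * m" "q'\<^sup>2 = N' * t"
    using N e by (auto simp: s_def m_def t_def)
  have st: "s * t = m * m" by (simp add: s_def m_def t_def power2_eq_square)
  have "(p * q' - q * p')\<^sup>2 = p\<^sup>2 * q'\<^sup>2 - 2 * (p * q) * (p' * q') + q\<^sup>2 * p'\<^sup>2"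
    by (simp add: power2_eq_square algebra_simps)
  also have "\<dots> = N * N' * (2 * (s * t - m * m))" unfolding v v' by (simp add: algebra_simps)
  finally show "p * q' = q * p'" by (simp add: st)
next
  assume par: "p * q' = q * p'"
  let ?N = "p\<^sup>2 + q\<^sup>2"
  define k where "k = (p * p' + q * q') / ?N"
  have N: "?N > 0" using assms sum_squares_pos by auto
  have "k * p * ?N = p' * ?N" "k * q * ?N = q' * ?N"
  proof -
    have "k * ?N = p * p' + q * q'" using N by (simp add: k_def)
    then have k: "k * p * ?N = p * (p * p' + q * q')" "k * q * ?N = q * (p * p' + q * q')"
      by (simp_all add: mult.commute mult.left_commute)
    show "k * p * ?N = p' * ?N" unfolding k using par by (simp add: power2_eq_square algebra_simps)
    have "q * (p * p' + q * q') = p * (q * p') + q * q * q'" by (simp add: algebra_simps)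
    also have "\<dots> = p * (p * q') + q * q * q'" by (simp only: par)
    finally show "k * q * ?N = q' * ?N" unfolding k by (simp add: power2_eq_square algebra_simps)
  qed
  then have kp: "p' = k * p" "q' = k * q" using N by auto
  then have "k \<noteq> 0" using assms(2) by auto
  then show "dirpt p q = dirpt p' q'" unfolding kp by (simp add: dirpt_scale)
qed

lemma bdry_cases:
  assumes "\<xi> \<in> bdry lens"
  obtains "pd \<xi>" | "\<xi> \<in> circle"
  using lens_bdry[OF assms] by (auto simp: circle_def)

abbreviation cact :: "int \<Rightarrow> int \<Rightarrow> int \<Rightarrow> int \<Rightarrow> rseq \<Rightarrow> rseq" where
  "cact a b c d \<equiv> chart_act tr_vec (rho a b c d)"

lemma cact_eq: "cact a b c d x = (1 / (qf a b x + qf c d x)) *\<^sub>R mat_act (rho a b c d) x"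
  by (simp add: chart_act_def inner_tr_vec mat_act_rho qf_def divide_inverse)

text \<open>On the rim the action is the linear action on directions.\<close>
lemma cact_dirpt:
  assumes det: "a * d - b * c = 1" and pq: "p \<noteq> 0 \<or> q \<noteq> 0"
  shows "cact a b c d (dirpt p q) = dirpt (a * p + b * q) (c * p + d * q)"
    "a * p + b * q \<noteq> 0 \<or> c * p + d * q \<noteq> 0"
proof -
  have det': "real_of_int a * d - b * c = 1" using det by (metis of_int_1 of_int_diff of_int_mult)
  let ?P = "a * p + b * q" and ?Q = "c * p + d * q"
  show PQ: "?P \<noteq> 0 \<or> ?Q \<noteq> 0"
  proof (rule ccontr)
    assume "\<not> ?thesis"
    then have z: "?P = 0" "?Q = 0" by auto
    have "d * ?P - b * ?Q = (real_of_int a * d - b * c) * p" "a * ?Q - c * ?P = (real_of_int a * d - b * c) * q"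
      by (simp_all add: algebra_simps)
    then show False using z pq det' by simp
  qed
  define k M where "k = 1 / (p\<^sup>2 + q\<^sup>2)" and "M = ?P\<^sup>2 + ?Q\<^sup>2"
  have k: "k > 0" using sum_squares_pos[OF pq] by (simp add: k_def)
  have M: "M > 0" using sum_squares_pos[OF PQ] by (simp add: M_def)
  have m: "mat_act (rho a b c d) (dirpt p q) = k *\<^sub>R v4 (?P\<^sup>2) (?P * ?Q) (?Q\<^sup>2) 0"
    unfolding dirpt_def mat_act_scale k_def
    by (rule arg_cong[of _ _ "\<lambda>v. (1 / (p\<^sup>2 + q\<^sup>2)) *\<^sub>R v"]) (simp add: mat_act_rho power2_eq_square algebra_simps)
  have i: "inner tr_vec (mat_act (rho a b c d) (dirpt p q)) = k * M"
    unfolding m inner_scaleR_right inner_tr_vec by (simp add: M_def)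
  have "inverse (k * M) * k = 1 / M" using k M by (simp add: field_simps)
  then have "cact a b c d (dirpt p q) = (1 / M) *\<^sub>R v4 (?P\<^sup>2) (?P * ?Q) (?Q\<^sup>2) 0"
    unfolding chart_act_def i unfolding m scaleR_scaleR by simp
  then show "cact a b c d (dirpt p q) = dirpt ?P ?Q" by (simp only: dirpt_def M_def)
qed

lemma cact_lens:
  assumes det: "a * d - b * c = 1" and x: "x \<in> lens"
  shows "cact a b c d x \<in> lens" "0 < qf a b x + qf c d x"
proof -
  have "x \<in> lens_cone" using x by (simp add: lens_def)
  from lens_cone_normalise[OF lens_cone_rho[OF det this]]
  show "cact a b c d x \<in> lens" "0 < qf a b x + qf c d x"
    unfolding cact_eq by (simp_all add: mat_act_rho qf_def)
qed

lemma chart_act_scale: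
  assumes "k \<noteq> 0" shows "chart_act a g (k *\<^sub>R x) = chart_act a g x"
proof -
  have "inverse (k * i) * k = inverse i" for i :: real using assms by simp
  then show ?thesis unfolding chart_act_def mat_act_scale inner_scaleR_right scaleR_scaleR by simp
qed

lemma cact_mult:
  assumes det': "a' * d' - b' * c' = 1" and x: "x \<in> lens"
  shows "cact a b c d (cact a' b' c' d' x) = cact (a * a' + b * c') (a * b' + b * d') (c * a' + d * c') (c * b' + d * d') x"
proof -
  define k where "k = 1 / (qf a' b' x + qf c' d' x)"
  have k: "k > 0" using cact_lens(2)[OF det' x] by (simp add: k_def)
  have "cact a' b' c' d' x = k *\<^sub>R mat_act (rho a' b' c' d') x" by (simp add: cact_eq k_def)
  then have "cact a b c d (cact a' b' c' d' x) = chart_act tr_vec (rho a b c d) (mat_act (rho a' b' c' d') x)"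
    using chart_act_scale[of k] k by simp
  then show ?thesis
    by (simp add: chart_act_def mat_act_mult[OF rho_carrier rho_carrier, symmetric] rho_mult)
qed

lemma cact_one: "x \<in> lens \<Longrightarrow> cact 1 0 0 1 x = x"
proof -
  assume x: "x \<in> lens"
  have "mat_act (rho 1 0 0 1) x = x" using lensD[OF x] by (intro Rn4_eqI) (auto simp: mat_act_rho)
  then show ?thesis using lensD[OF x] by (simp add: chart_act_def inner_tr_vec)
qed

lemma cact_lookup3: "lk x 3 = 0 \<Longrightarrow> lk (cact a b c d x) 3 = 0"
  by (simp add: cact_eq lookup3_rho)

lemma lev3_no_fixed_pd:
  assumes g: "lev3 a b c d" and ne: "\<not> (a = 1 \<and> b = 0 \<and> c = 0 \<and> d = 1)" and x: "pd x"
  shows "cact a b c d x \<noteq> x"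
proof
  assume fix_x: "cact a b c d x = x"
  have "lk (mat_act (rho a b c d) x) 0 + lk (mat_act (rho a b c d) x) 2 > 0"
    using pd_rho[OF lev3_det[OF g] x] pd_lookup2 by (auto simp: pd_def add_pos_pos)
  then have N: "qf a b x + qf c d x > 0" by (simp add: mat_act_rho qf_def)
  have "mat_act (rho a b c d) x = (qf a b x + qf c d x) *\<^sub>R x"
  proof -
    have "mat_act (rho a b c d) x = (qf a b x + qf c d x) *\<^sub>R cact a b c d x"
      unfolding cact_eq scaleR_scaleR using N by simp
    then show ?thesis by (simp only: fix_x)
  qed
  then have "lk (mat_act (rho a b c d) x) i = (qf a b x + qf c d x) * lk x i" for i by simp
  then show False using lev3_fix_pd[OF g x] ne by blast
qed

text \<open>The two real eigenvectors give two fixed points on the rim.\<close>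
lemma not_parabolic_if_trace_large:
  assumes g: "lev3 a b c d" and tr: "\<bar>a + d\<bar> > 2"
  shows "\<not> parabolic tr_vec lens (rho a b c d)"
proof
  assume "parabolic tr_vec lens (rho a b c d)"
  then have uni: "\<exists>!\<xi>. \<xi> \<in> bdry lens \<and> cact a b c d \<xi> = \<xi>" by (simp add: parabolic_def)
  note det = lev3_det[OF g]
  have c: "c \<noteq> 0"
  proof
    assume "c = 0"
    then have "a * d = 1" using det by simp
    then have "\<bar>a\<bar> = 1 \<and> \<bar>d\<bar> = 1" using zmult_eq_1_iff by auto
    then show False using tr by linarith
  qed
  define A B C E where "A = real_of_int a" and "B = real_of_int b" and "C = real_of_int c" and "E = real_of_int d"
  have det': "A * E - B * C = 1" using det unfolding A_def B_def C_def E_def by (metis of_int_1 of_int_diff of_int_mult)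
  have C: "C \<noteq> 0" using c by (simp add: C_def)
  have "2 < \<bar>A + E\<bar>" using tr unfolding A_def E_def by linarith
  then have "2\<^sup>2 < (A + E)\<^sup>2" using abs_le_square_iff[of "A + E" 2] by (simp add: not_le[symmetric])
  then have disc: "0 < (A + E)\<^sup>2 - 4" by simp
  define r where "r = sqrt ((A + E)\<^sup>2 - 4)"
  have r: "r > 0" "r * r = (A + E)\<^sup>2 - 4" using disc by (auto simp: r_def)
  have fixed: "dirpt (L - E) C \<in> bdry lens \<and> cact a b c d (dirpt (L - E) C) = dirpt (L - E) C"
    if L: "L * L - (A + E) * L + 1 = 0" for L
  proof
    show "dirpt (L - E) C \<in> bdry lens" using C by (intro circle_bdry dirpt_circle) simp
    have "L \<noteq> 0" using L by auto
    have "A * (L - E) + B * C = L * (L - E)" "C * (L - E) + E * C = L * C"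
      using L det' by (simp_all add: algebra_simps)
    then show "cact a b c d (dirpt (L - E) C) = dirpt (L - E) C"
      using cact_dirpt(1)[OF det, of "L - E" C] C dirpt_scale[OF \<open>L \<noteq> 0\<close>]
      by (simp add: A_def B_def C_def E_def)
  qed
  define L1 L2 where "L1 = (A + E + r) / 2" and "L2 = (A + E - r) / 2"
  have "2 * L1 = A + E + r" "2 * L2 = A + E - r" by (simp_all add: L1_def L2_def)
  then have "4 * (L1 * L1 - (A + E) * L1 + 1) = r * r - ((A + E)\<^sup>2 - 4)"
    "4 * (L2 * L2 - (A + E) * L2 + 1) = r * r - ((A + E)\<^sup>2 - 4)"
    by (simp_all add: power2_eq_square L1_def L2_def field_simps)
  then have "L1 * L1 - (A + E) * L1 + 1 = 0" "L2 * L2 - (A + E) * L2 + 1 = 0" using r(2) by auto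
  then have "dirpt (L1 - E) C = dirpt (L2 - E) C" using fixed uni by blast
  then have "(L1 - E) * C = C * (L2 - E)" using C by (subst (asm) dirpt_eq_iff) auto
  then have "L1 = L2" using C by simp
  then show False using r(1) by (simp add: L1_def L2_def)
qed

text \<open>In a basis with first vector \<open>(m, n)\<close>, a matrix of determinant 1 that fixes the
first vector is \<open>(1 t; 0 1)\<close>.\<close>
lemma unipotent_param:
  fixes a b c d m n :: int
  assumes p: "prim m n" and det: "a * d - b * c = 1" and f: "a * m + b * n = m" "c * m + d * n = n"
  obtains t where "a = 1 - t * m * n" "b = t * m\<^sup>2" "c = - t * n\<^sup>2" "d = 1 + t * m * n"
proof -
  obtain r s where rs: "m * s - n * r = 1" using p by (auto simp: prim_def)
  define t where "t = (a * r + b * s) * s - (c * r + d * s) * r"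
  have y: "m * (c * r + d * s) - n * (a * r + b * s) = 1"
  proof -
    have "(a * m + b * n) * (c * r + d * s) - (c * m + d * n) * (a * r + b * s) = (a * d - b * c) * (m * s - n * r)"
      by (simp add: algebra_simps)
    then show ?thesis using det rs f by simp
  qed
  have u1: "a * r + b * s = r + t * m"
  proof -
    have "a * r + b * s = (a * r + b * s) * (m * s - n * r)" by (simp add: rs)
    also have "\<dots> = t * m + r * (m * (c * r + d * s) - n * (a * r + b * s))" by (simp add: t_def algebra_simps)
    finally show ?thesis by (simp add: y)
  qed
  have u2: "c * r + d * s = s + t * n"
  proof -
    have "c * r + d * s = (c * r + d * s) * (m * s - n * r)" by (simp add: rs)
    also have "\<dots> = t * n + s * (m * (c * r + d * s) - n * (a * r + b * s))" by (simp add: t_def algebra_simps)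
    finally show ?thesis by (simp add: y)
  qed
  have "a = s * (a * m + b * n) - n * (a * r + b * s)" "b = m * (a * r + b * s) - r * (a * m + b * n)"
    "c = s * (c * m + d * n) - n * (c * r + d * s)" "d = m * (c * r + d * s) - r * (c * m + d * n)"
  proof -
    have "x = x * (m * s - n * r)" for x by (simp add: rs)
    moreover have "a * (m * s - n * r) = s * (a * m + b * n) - n * (a * r + b * s)"
      "b * (m * s - n * r) = m * (a * r + b * s) - r * (a * m + b * n)"
      "c * (m * s - n * r) = s * (c * m + d * n) - n * (c * r + d * s)"
      "d * (m * s - n * r) = m * (c * r + d * s) - r * (c * m + d * n)"
      by (simp_all add: algebra_simps)
    ultimately show "a = s * (a * m + b * n) - n * (a * r + b * s)" "b = m * (a * r + b * s) - r * (a * m + b * n)"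
      "c = s * (c * m + d * n) - n * (c * r + d * s)" "d = m * (c * r + d * s) - r * (c * m + d * n)"
      by metis+
  qed
  note eqs = this
  have "a = s * m - n * (r + t * m)" "b = m * (r + t * m) - r * m"
    "c = s * n - n * (s + t * n)" "d = m * (s + t * n) - r * n"
    subgoal using eqs(1) unfolding f u1 u2 .
    subgoal using eqs(2) unfolding f u1 u2 .
    subgoal using eqs(3) unfolding f u1 u2 .
    subgoal using eqs(4) unfolding f u1 u2 .
    done
  moreover have "s * m - n * (r + t * m) = (m * s - n * r) - t * m * n" "m * (s + t * n) - r * n = (m * s - n * r) + t * m * n"
    "m * (r + t * m) - r * m = t * m\<^sup>2" "s * n - n * (s + t * n) = - t * n\<^sup>2"
    by (simp_all add: algebra_simps power2_eq_square)
  ultimately have "a = 1 - t * m * n" "b = t * m\<^sup>2" "c = - t * n\<^sup>2" "d = 1 + t * m * n"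
    unfolding rs by auto
  then show ?thesis by (rule that)
qed

text \<open>A nontrivial unipotent matrix has only one eigenline, and it has no fixed point over the
open disc by \<open>lev3_fix_pd\<close>, which excludes further fixed points on roof and floor as
well.\<close>
lemma parabolic_unipotent:
  assumes g: "lev3 a b c d" and ne: "rho a b c d \<noteq> 1\<^sub>m 4" and p: "prim m n"
    and f: "a * m + b * n = m" "c * m + d * n = n"
  shows "parabolic tr_vec lens (rho a b c d)"
  unfolding parabolic_def
proof (intro conjI)
  note det = lev3_det[OF g]
  have ne': "\<not> (a = 1 \<and> b = 0 \<and> c = 0 \<and> d = 1)" using ne rho_one by auto
  show "\<not> torsion_mat (rho a b c d)" using torsion_lev3[OF g] ne by blast
  show "\<forall>x\<in>lens. cact a b c d x \<noteq> x" using lev3_no_fixed_pd[OF g ne'] lensD by blast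
  obtain t where t: "a = 1 - t * m * n" "b = t * m\<^sup>2" "c = - t * n\<^sup>2" "d = 1 + t * m * n"
    using unipotent_param[OF p det f] .
  have t0: "t \<noteq> 0" using t ne' by auto
  have mn: "real_of_int m \<noteq> 0 \<or> real_of_int n \<noteq> 0" using prim_nonzero[OF p] .
  have f': "real_of_int a * m + b * n = m" "real_of_int c * m + d * n = n"
    using f by (metis of_int_add of_int_mult)+
  show "\<exists>!\<xi>. \<xi> \<in> bdry lens \<and> cact a b c d \<xi> = \<xi>"
  proof (rule ex1I[of _ "dirpt m n"])
    show "dirpt m n \<in> bdry lens \<and> cact a b c d (dirpt m n) = dirpt m n"
      using cact_dirpt(1)[OF det mn] f' circle_bdry[OF dirpt_circle[OF mn]] by simp
    fix \<xi> assume \<xi>: "\<xi> \<in> bdry lens \<and> cact a b c d \<xi> = \<xi>"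
    then have "\<not> pd \<xi>" using lev3_no_fixed_pd[OF g ne'] by blast
    then have "\<xi> \<in> circle" using \<xi> bdry_cases by blast
    then obtain x y where xy: "x\<^sup>2 + y\<^sup>2 = 1" "\<xi> = dirpt x y" by (rule circle_eq_dirpt)
    have nz: "x \<noteq> 0 \<or> y \<noteq> 0" using xy(1) by auto
    have "dirpt (a * x + b * y) (c * x + d * y) = dirpt x y" using cact_dirpt(1)[OF det nz] \<xi> xy by simp
    then have "(a * x + b * y) * y = (c * x + d * y) * x"
      using dirpt_eq_iff[OF cact_dirpt(2)[OF det nz] nz] by simp
    then have "t * (n * x - m * y)\<^sup>2 = 0"
      unfolding t by (simp add: power2_eq_square algebra_simps)
    then have "m * y = n * x" using t0 by simp
    then show "\<xi> = dirpt m n" unfolding xy using dirpt_eq_iff[OF nz mn] by (simp add: mult.commute)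
  qed
qed

text \<open>A primitive vector that is mapped into its line is mapped to itself or to its negative, and
the negative is excluded modulo 3.\<close>
lemma lev3_fix_direction:
  fixes a b c d m n :: int
  assumes g: "lev3 a b c d" and p: "prim m n" and par: "(a * m + b * n) * n = (c * m + d * n) * m"
  shows "a * m + b * n = m" "c * m + d * n = n"
proof -
  note det = lev3_det[OF g]
  obtain r s where rs: "m * s - n * r = 1" using p by (auto simp: prim_def)
  define P Q where "P = a * m + b * n" and "Q = c * m + d * n"
  define k where "k = P * s - Q * r"
  have par': "P * n = Q * m" using par by (simp add: P_def Q_def)
  have "P = P * (m * s - n * r)" by (simp add: rs)
  also have "\<dots> = m * (P * s) - (P * n) * r" by (simp add: algebra_simps)
  finally have Pk: "P = m * k" unfolding par' by (simp add: k_def algebra_simps)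
  have "Q = Q * (m * s - n * r)" by (simp add: rs)
  also have "\<dots> = (Q * m) * s - n * (Q * r)" by (simp add: algebra_simps)
  finally have Qk: "Q = n * k" unfolding par'[symmetric] by (simp add: k_def algebra_simps)
  have "P * (c * r + d * s) - Q * (a * r + b * s) = (a * d - b * c) * (m * s - n * r)"
    by (simp add: P_def Q_def algebra_simps)
  then have "k * (m * (c * r + d * s) - n * (a * r + b * s)) = 1"
    unfolding Pk Qk using det rs by (simp add: algebra_simps)
  then have k: "k = 1 \<or> k = - 1" using zmult_eq_1_iff by blast
  have "k \<noteq> - 1"
  proof
    assume "k = - 1"
    obtain x y z w where e: "a = 1 + 3 * x" "b = 3 * y" "c = 3 * z" "d = 1 + 3 * w" by (rule lev3E[OF g])
    have "2 * m = 3 * (- (x * m + y * n))" "2 * n = 3 * (- (z * m + w * n))"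
      using Pk Qk \<open>k = - 1\<close> unfolding P_def Q_def e by (simp_all add: algebra_simps)
    then have "3 dvd 2 * m" "3 dvd 2 * n" by (metis dvd_triv_left)+
    then have "3 dvd m" "3 dvd n" by presburger+
    then have "3 dvd m * s - n * r" by simp
    then show False using rs by simp
  qed
  then show "a * m + b * n = m" "c * m + d * n = n" using k Pk Qk by (auto simp: P_def Q_def)
qed

lemma stab_eq:
  assumes p: "prim m n"
  shows "stab tr_vec Gam (dirpt m n) =
    {rho a b c d | a b c d. lev3 a b c d \<and> a * m + b * n = m \<and> c * m + d * n = n}"
proof -
  have mn: "real_of_int m \<noteq> 0 \<or> real_of_int n \<noteq> 0" using prim_nonzero[OF p] .
  have iff: "cact a b c d (dirpt m n) = dirpt m n \<longleftrightarrow> a * m + b * n = m \<and> c * m + d * n = n"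
    if g: "lev3 a b c d" for a b c d
  proof
    assume "cact a b c d (dirpt m n) = dirpt m n"
    then have "dirpt (a * m + b * n) (c * m + d * n) = dirpt m n"
      using cact_dirpt(1)[OF lev3_det[OF g] mn] by simp
    then have "(a * real_of_int m + b * n) * n = (c * m + d * n) * real_of_int m"
      using dirpt_eq_iff[OF cact_dirpt(2)[OF lev3_det[OF g] mn] mn] by simp
    then have "(a * m + b * n) * n = (c * m + d * n) * m"
      by (metis of_int_add of_int_mult of_int_eq_iff)
    then show "a * m + b * n = m \<and> c * m + d * n = n" using lev3_fix_direction[OF g p] by blast
  next
    assume "a * m + b * n = m \<and> c * m + d * n = n"
    then have "real_of_int a * m + b * n = m" "real_of_int c * m + d * n = n"
      by (metis of_int_add of_int_mult)+
    then show "cact a b c d (dirpt m n) = dirpt m n" using cact_dirpt(1)[OF lev3_det[OF g] mn] by simp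
  qed
  show ?thesis
  proof (rule equalityI; rule subsetI)
    fix g assume "g \<in> stab tr_vec Gam (dirpt m n)"
    then have "g \<in> Gam" "chart_act tr_vec g (dirpt m n) = dirpt m n" by (simp_all add: stab_def)
    then show "g \<in> {rho a b c d | a b c d. lev3 a b c d \<and> a * m + b * n = m \<and> c * m + d * n = n}"
      unfolding Gam_def using iff by blast
  next
    fix g assume "g \<in> {rho a b c d | a b c d. lev3 a b c d \<and> a * m + b * n = m \<and> c * m + d * n = n}"
    then obtain a b c d where g: "g = rho a b c d" "lev3 a b c d" "a * m + b * n = m \<and> c * m + d * n = n" by blast
    then have "g \<in> Gam" unfolding Gam_def by blast
    moreover have "chart_act tr_vec g (dirpt m n) = dirpt m n" using iff[OF g(2)] g by blast
    ultimately show "g \<in> stab tr_vec Gam (dirpt m n)" by (simp add: stab_def)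
  qed
qed

text \<open>These elements show that the stabiliser of every cusp is nontrivial.\<close>
lemma lev3_unipotent:
  fixes m n t :: int
  shows "lev3 (1 - 3 * t * m * n) (3 * t * m\<^sup>2) (- 3 * t * n\<^sup>2) (1 + 3 * t * m * n)"
    "(1 - 3 * t * m * n) * m + 3 * t * m\<^sup>2 * n = m" "(- 3 * t * n\<^sup>2) * m + (1 + 3 * t * m * n) * n = n"
proof -
  have d: "(3::int) dvd 3 * t * m\<^sup>2" "(3::int) dvd - 3 * t * n\<^sup>2" "(3::int) dvd (1 - 3 * t * m * n) - 1" "(3::int) dvd (1 + 3 * t * m * n) - 1"
    by (simp_all add: mult.assoc)
  show "lev3 (1 - 3 * t * m * n) (3 * t * m\<^sup>2) (- 3 * t * n\<^sup>2) (1 + 3 * t * m * n)"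
    unfolding lev3_def using d by (simp add: power2_eq_square algebra_simps)
qed (simp_all add: power2_eq_square algebra_simps)

lemma rho_eq_oneD:
  assumes "rho a b c d = 1\<^sub>m 4" shows "a\<^sup>2 = 1" "b = 0" "c = 0" "d\<^sup>2 = 1"
proof -
  have e: "rho a b c d $$ (i, j) = 1\<^sub>m 4 $$ (i, j)" for i j using assms by simp
  have "real_of_int (a\<^sup>2) = 1" "real_of_int (b\<^sup>2) = 0" "real_of_int (c\<^sup>2) = 0" "real_of_int (d\<^sup>2) = 1"
    using e[of 0 0] e[of 0 2] e[of 2 0] e[of 2 2] by (simp_all add: rho_def)
  then show "a\<^sup>2 = 1" "b = 0" "c = 0" "d\<^sup>2 = 1"
    by (auto simp del: of_int_power)
qed

text \<open>An element \<open>h\<close> that moves the fixed point can be multiplied by a high power of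
a unipotent element of the stabiliser to get a large trace, so that no parabolic group contains
both.\<close>
lemma maximal_parabolic:
  assumes p: "prim m n"
  shows "maximal_parabolic_subgroup 3 tr_vec lens Gam (stab tr_vec Gam (dirpt m n))"
proof -
  let ?P = "stab tr_vec Gam (dirpt m n)"
  have four: "Suc 3 = 4" by simp
  have par: "parabolic_subgroup 3 tr_vec lens Gam ?P"
    unfolding parabolic_subgroup_def four
  proof (intro conjI ballI impI)
    show "subgroup ?P (SL 4)"
      unfolding stab_eq[OF p]
    proof (rule Gam_subgroupI)
      fix a b c d a' b' c' d'
      assume q: "lev3 a b c d \<and> a * m + b * n = m \<and> c * m + d * n = n"
        and q': "lev3 a' b' c' d' \<and> a' * m + b' * n = m \<and> c' * m + d' * n = n"
      have "(a * a' + b * c') * m + (a * b' + b * d') * n = a * (a' * m + b' * n) + b * (c' * m + d' * n)"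
        "(c * a' + d * c') * m + (c * b' + d * d') * n = c * (a' * m + b' * n) + d * (c' * m + d' * n)"
        by (simp_all add: algebra_simps)
      then show "lev3 (a * a' + b * c') (a * b' + b * d') (c * a' + d * c') (c * b' + d * d') \<and>
        (a * a' + b * c') * m + (a * b' + b * d') * n = m \<and> (c * a' + d * c') * m + (c * b' + d * d') * n = n"
        using q q' lev3_mult by simp
    next
      fix a b c d assume q: "lev3 a b c d \<and> a * m + b * n = m \<and> c * m + d * n = n"
      then have det: "a * d - b * c = 1" using lev3_det by blast
      have "d * (a * m + b * n) - b * (c * m + d * n) = (a * d - b * c) * m"
        "a * (c * m + d * n) - c * (a * m + b * n) = (a * d - b * c) * n"
        by (simp_all add: algebra_simps)
      then show "lev3 d (- b) (- c) a \<and> d * m + - b * n = m \<and> - c * m + a * n = n"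
        using q det lev3_inverse by (simp add: algebra_simps)
      show "lev3 a b c d" using q by blast
      show "rho a b c d \<in> carrier (SL 4)" using q Gam_subset_SL unfolding Gam_def by blast
    qed (use lev3_one in \<open>auto simp: SL_def\<close>)
    show "?P \<subseteq> Gam" by (auto simp: stab_def)
    show "parabolic tr_vec lens g" if "g \<in> ?P" "g \<noteq> 1\<^sub>m 4" for g
      using that parabolic_unipotent[OF _ _ p] unfolding stab_eq[OF p] by blast
  qed
  define U where "U = (\<lambda>t. rho (1 - 3 * t * m * n) (3 * t * m\<^sup>2) (- 3 * t * n\<^sup>2) (1 + 3 * t * m * n))"
  have U: "U t \<in> ?P" for t
    unfolding stab_eq[OF p] U_def
    using lev3_unipotent(1)[where t=t and m=m and n=n] lev3_unipotent(2)[where t=t and m=m and n=n]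
      lev3_unipotent(3)[where t=t and m=m and n=n]
    by blast
  have "U 1 \<noteq> 1\<^sub>m 4"
  proof
    assume "U 1 = 1\<^sub>m 4"
    from rho_eq_oneD(2,3)[OF this[unfolded U_def]] have "m = 0" "n = 0" by auto
    then show False using p by (simp add: prim_def)
  qed
  then have nontriv: "?P \<noteq> {1\<^sub>m 4}" using U[of 1] by auto
  have max: "Q = ?P" if Q: "parabolic_subgroup 3 tr_vec lens Gam Q" "?P \<subseteq> Q" for Q
  proof
    show "Q \<subseteq> ?P"
    proof
      fix h assume h: "h \<in> Q"
      then obtain a b c d where g: "lev3 a b c d" "h = rho a b c d"
        using Q(1) unfolding parabolic_subgroup_def Gam_def by blast
      define \<delta> where "\<delta> = m * (c * m + d * n) - n * (a * m + b * n)"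
      show "h \<in> ?P"
      proof (cases "\<delta> = 0")
        case True
        then have "(a * m + b * n) * n = (c * m + d * n) * m" by (simp add: \<delta>_def algebra_simps)
        then show ?thesis unfolding stab_eq[OF p] using g lev3_fix_direction[OF g(1) p] by blast
      next
        case False
        \<comment> \<open>the trace of \<open>U k * h\<close> is \<open>a + d + 3 * k * \<delta>\<close>\<close>
        define k where "k = \<bar>a + d\<bar> + 3"
        let ?x = "1 - 3 * k * m * n" and ?y = "3 * k * m\<^sup>2" and ?z = "- 3 * k * n\<^sup>2" and ?w = "1 + 3 * k * m * n"
        have prod: "U k * h = rho (?x * a + ?y * c) (?x * b + ?y * d) (?z * a + ?w * c) (?z * b + ?w * d)"
          unfolding U_def g(2) by (rule rho_mult)
        have lev: "lev3 (?x * a + ?y * c) (?x * b + ?y * d) (?z * a + ?w * c) (?z * b + ?w * d)"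
          by (rule lev3_mult[OF lev3_unipotent(1)[where t=k and m=m and n=n] g(1)])
        have tr: "(?x * a + ?y * c) + (?z * b + ?w * d) = (a + d) + 3 * k * \<delta>"
          by (simp add: \<delta>_def power2_eq_square algebra_simps)
        have big: "\<bar>(a + d) + 3 * k * \<delta>\<bar> > 2"
        proof -
          have "k * 1 \<le> k * \<bar>\<delta>\<bar>" using False by (intro mult_left_mono) (auto simp: k_def)
          moreover have "\<bar>3 * k * \<delta>\<bar> = 3 * (k * \<bar>\<delta>\<bar>)" by (simp add: abs_mult) (simp add: k_def)
          ultimately have "3 * k \<le> \<bar>3 * k * \<delta>\<bar>" by linarith
          moreover have "2 < \<bar>(a + d) + x\<bar>" if "3 * k \<le> \<bar>x\<bar>" for x using that unfolding k_def by (smt (verit))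
          ultimately show ?thesis by blast
        qed
        have "U k * h \<in> Q"
        proof -
          have "subgroup Q (SL 4)" using Q(1) unfolding parabolic_subgroup_def four by blast
          moreover have "U k \<in> Q" using U Q(2) by blast
          ultimately have "U k \<otimes>\<^bsub>SL 4\<^esub> h \<in> Q" using h by (rule subgroup.m_closed)
          then show ?thesis by (simp add: SL_def)
        qed
        moreover have "U k * h \<noteq> 1\<^sub>m 4"
        proof
          assume one: "U k * h = 1\<^sub>m 4"
          define s1 s2 where "s1 = ?x * a + ?y * c" and "s2 = ?z * b + ?w * d"
          have "s1\<^sup>2 = 1" "s2\<^sup>2 = 1" using rho_eq_oneD(1,4)[OF one[unfolded prod]] by (auto simp: s1_def s2_def)
          then have "\<bar>s1\<bar> = 1" "\<bar>s2\<bar> = 1" by (auto simp: power2_eq_1_iff)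
          then have "\<bar>s1 + s2\<bar> \<le> 2" by linarith
          then show False using big tr by (simp add: s1_def s2_def)
        qed
        ultimately have "parabolic tr_vec lens (U k * h)"
          using Q(1) by (simp add: parabolic_subgroup_def)
        then show ?thesis
          using not_parabolic_if_trace_large[OF lev] big unfolding prod tr by blast
      qed
    qed
  qed (rule Q(2))
  show ?thesis
    unfolding maximal_parabolic_subgroup_def four using par nontriv max by blast
qed

section \<open>Limit set, convex core and horoballs\<close>

lemma orbit_Gam: "orbit tr_vec Gam x = {cact a b c d x | a b c d. lev3 a b c d}"
  unfolding orbit_def Gam_def by blast

text \<open>The sum of the values at \<open>(m, n)\<close> and \<open>(- n, m)\<close> is
\<open>m\<^sup>2 + n\<^sup>2\<close> for trace 1, and their product is at least \<open>dt x (m\<^sup>2 +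
n\<^sup>2)\<^sup>2\<close>.\<close>
lemma qf_lower:
  assumes x: "x \<in> lens"
  shows "dt x * (m\<^sup>2 + n\<^sup>2) \<le> qf m n x"
proof (cases "m = 0 \<and> n = 0")
  case True
  then show ?thesis by (simp add: qf_def)
next
  case False
  have pd: "psd x" and tr: "lk x 0 + lk x 2 = 1" using lensD[OF x] pd_imp_psd by auto
  let ?A = "qf m n x" and ?B = "qf (- n) m x"
  have A: "?A \<ge> 0" "?B \<ge> 0" using qf_psd_nonneg[OF pd] by auto
  have "?A + ?B = (m\<^sup>2 + n\<^sup>2) * (lk x 0 + lk x 2)" by (simp add: qf_def algebra_simps)
  then have sum: "?A + ?B = m\<^sup>2 + n\<^sup>2" using tr by simp
  define L where "L = m * - n * lk x 0 + (m * m + n * - n) * lk x 1 + n * m * lk x 2"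
  have "?A * ?B = L\<^sup>2 + dt x * (m\<^sup>2 + n\<^sup>2)\<^sup>2"
    unfolding L_def lagrange_identity by (simp add: power2_eq_square)
  then have "dt x * (m\<^sup>2 + n\<^sup>2)\<^sup>2 \<le> ?A * ?B" by simp
  also have "\<dots> \<le> ?A * (m\<^sup>2 + n\<^sup>2)" using A sum by (intro mult_left_mono) linarith+
  finally have "(dt x * (m\<^sup>2 + n\<^sup>2)) * (m\<^sup>2 + n\<^sup>2) \<le> ?A * (m\<^sup>2 + n\<^sup>2)" by (simp add: power2_eq_square mult.assoc)
  then show ?thesis using sum_squares_pos[of m n] False by simp
qed

lemma bounded_int_quadruples:
  fixes K :: real
  shows "finite {(a, b, c, d). (real_of_int a)\<^sup>2 + (real_of_int b)\<^sup>2 + ((real_of_int c)\<^sup>2 + (real_of_int d)\<^sup>2) \<le> K}"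
proof -
  define M where "M = \<lceil>\<bar>K\<bar>\<rceil>"
  have bound: "x \<in> {-M..M}" if "(real_of_int x)\<^sup>2 \<le> K" for x
  proof -
    have "\<bar>x\<bar> \<le> x\<^sup>2" using self_le_power[of "\<bar>x\<bar>" 2] by (cases "x = 0") auto
    then have "real_of_int \<bar>x\<bar> \<le> (real_of_int x)\<^sup>2" by (metis of_int_le_iff of_int_power)
    then have "real_of_int \<bar>x\<bar> \<le> \<bar>K\<bar>" using that by linarith
    then have "\<bar>x\<bar> \<le> M" unfolding M_def by (rule le_ceiling_iff[THEN iffD2, OF less_le_trans[rotated]]) simp
    then show ?thesis by auto
  qed
  have "{(a, b, c, d). (real_of_int a)\<^sup>2 + (real_of_int b)\<^sup>2 + ((real_of_int c)\<^sup>2 + (real_of_int d)\<^sup>2) \<le> K}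
    \<subseteq> {-M..M} \<times> {-M..M} \<times> {-M..M} \<times> {-M..M}"
  proof
    fix t assume "t \<in> {(a, b, c, d). (real_of_int a)\<^sup>2 + (real_of_int b)\<^sup>2 + ((real_of_int c)\<^sup>2 + (real_of_int d)\<^sup>2) \<le> K}"
    then obtain a b c d where t: "t = (a, b, c, d)"
      and le: "(real_of_int a)\<^sup>2 + (real_of_int b)\<^sup>2 + ((real_of_int c)\<^sup>2 + (real_of_int d)\<^sup>2) \<le> K" by auto
    have nn: "0 \<le> (real_of_int a)\<^sup>2" "0 \<le> (real_of_int b)\<^sup>2" "0 \<le> (real_of_int c)\<^sup>2" "0 \<le> (real_of_int d)\<^sup>2" by auto
    show "t \<in> {-M..M} \<times> {-M..M} \<times> {-M..M} \<times> {-M..M}"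
      unfolding t by (intro SigmaI bound) (use le nn in linarith)+
  qed
  then show ?thesis by (rule finite_subset) auto
qed

lemma qf_one: "qf 1 0 x = lk x 0" "qf 0 1 x = lk x 2" by (simp_all add: qf_def)

text \<open>The invariants of an image point: the linear action preserves \<open>dt\<close> and the
height, and the return to the chart divides by the trace \<open>N\<close>.\<close>
lemma cact_data:
  assumes det: "a * d - b * c = 1" and x: "x \<in> lens"
  defines "N \<equiv> qf a b x + qf c d x"
  shows "dt (cact a b c d x) = dt x / N\<^sup>2" "lk (cact a b c d x) 3 = lk x 3 / N"
    "qf m n (cact a b c d x) = qf (m * a + n * c) (m * b + n * d) x / N"
    "rt (cact a b c d x) = rt x / N"
proof -
  have N: "0 < N" using cact_lens(2)[OF det x] by (simp add: N_def)
  show dt: "dt (cact a b c d x) = dt x / N\<^sup>2"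
    by (simp add: cact_eq dt_scale dt_rho[OF det] power_divide flip: N_def)
  show "lk (cact a b c d x) 3 = lk x 3 / N" by (simp add: cact_eq lookup3_rho flip: N_def)
  show "qf m n (cact a b c d x) = qf (m * a + n * c) (m * b + n * d) x / N"
    by (simp add: cact_eq qf_scale qf_rho flip: N_def)
  show "rt (cact a b c d x) = rt x / N" unfolding rt_def dt using N by (simp add: real_sqrt_divide)
qed

text \<open>All but finitely many group elements have a large trace factor, which makes both the
determinant and the height of the image small.\<close>
lemma closure_orbit_subset:
  assumes x: "x \<in> lens" and y: "y \<in> closure (orbit tr_vec Gam x)" "y \<notin> orbit tr_vec Gam x"
  shows "y \<in> circle"
proof -
  have pd: "pd x" using lensD[OF x] by blast
  then have dx: "0 < dt x" by (simp add: pd_def)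
  define K where "K = dt x + \<bar>lk x 3\<bar>"
  define NN where "NN = (\<lambda>a b c d. qf (real_of_int a) b x + qf (real_of_int c) d x)"
  have O_lens: "orbit tr_vec Gam x \<subseteq> lens" unfolding orbit_Gam using cact_lens(1)[OF lev3_det x] by blast
  then have yl: "y \<in> closure lens" using y(1) closure_mono by blast
  have bound: "dt y \<le> K / C \<and> \<bar>lk y 3\<bar> \<le> K / C" if C: "C \<ge> 1" for C
  proof -
    let ?small = "{cact a b c d x | a b c d. lev3 a b c d \<and> NN a b c d \<le> C}"
    let ?large = "{cact a b c d x | a b c d. lev3 a b c d \<and> C < NN a b c d}"
    have split: "orbit tr_vec Gam x = ?small \<union> ?large" 
    proof -
      have "NN a b c d \<le> C \<or> C < NN a b c d" for a b c d by linarith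
      then show ?thesis unfolding orbit_Gam by blast
    qed
    have "finite ?small"
    proof (rule finite_subset)
      show "finite ((\<lambda>(a, b, c, d). cact a b c d x) `
        {(a, b, c, d). (real_of_int a)\<^sup>2 + (real_of_int b)\<^sup>2 + ((real_of_int c)\<^sup>2 + (real_of_int d)\<^sup>2) \<le> C / dt x})"
        by (rule finite_imageI) (rule bounded_int_quadruples)
      show "?small \<subseteq> (\<lambda>(a, b, c, d). cact a b c d x) `
        {(a, b, c, d). (real_of_int a)\<^sup>2 + (real_of_int b)\<^sup>2 + ((real_of_int c)\<^sup>2 + (real_of_int d)\<^sup>2) \<le> C / dt x}"
      proof
        fix z assume "z \<in> ?small"
        then obtain a b c d where z: "z = cact a b c d x" "NN a b c d \<le> C" by blast
        have "dt x * ((real_of_int a)\<^sup>2 + (real_of_int b)\<^sup>2 + ((real_of_int c)\<^sup>2 + (real_of_int d)\<^sup>2)) \<le> C"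
          using qf_lower[OF x, of a b] qf_lower[OF x, of c d] z(2) unfolding NN_def distrib_left by linarith
        then have "(real_of_int a)\<^sup>2 + (real_of_int b)\<^sup>2 + ((real_of_int c)\<^sup>2 + (real_of_int d)\<^sup>2) \<le> C / dt x"
          using dx by (simp add: pos_le_divide_eq mult.commute)
        then show "z \<in> (\<lambda>(a, b, c, d). cact a b c d x) `
          {(a, b, c, d). (real_of_int a)\<^sup>2 + (real_of_int b)\<^sup>2 + ((real_of_int c)\<^sup>2 + (real_of_int d)\<^sup>2) \<le> C / dt x}"
          unfolding z(1) by (intro image_eqI[where x="(a, b, c, d)"]) auto
      qed
    qed
    then have "closure (orbit tr_vec Gam x) = ?small \<union> closure ?large"
      unfolding split closure_Un by (simp add: finite_imp_closed closure_closed)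
    then have "y \<in> closure ?large" using y unfolding split by blast
    moreover have "closure ?large \<subseteq> {v. dt v \<le> K / C} \<inter> {v. \<bar>lk v 3\<bar> \<le> K / C}"
    proof (rule closure_minimal)
      show "?large \<subseteq> {v. dt v \<le> K / C} \<inter> {v. \<bar>lk v 3\<bar> \<le> K / C}"
      proof
        fix z assume "z \<in> ?large"
        then obtain a b c d where z: "z = cact a b c d x" "C < NN a b c d" "lev3 a b c d" by blast
        define N where "N = NN a b c d"
        have N: "C < N" "1 < N" using z(2) C by (auto simp: N_def)
        have "N * 1 \<le> N * N" using N by (intro mult_left_mono) auto
        then have NN: "C \<le> N\<^sup>2" using N unfolding power2_eq_square by linarith
        have "dt z = dt x / N\<^sup>2" "lk z 3 = lk x 3 / N"
          unfolding z(1) N_def NN_def by (rule cact_data[OF lev3_det[OF z(3)] x])+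
        moreover have "dt x / N\<^sup>2 \<le> K / C" by (rule frac_le) (use NN C dx in \<open>auto simp: K_def\<close>)
        moreover have "\<bar>lk x 3\<bar> / N \<le> K / C" by (rule frac_le) (use N C dx in \<open>auto simp: K_def\<close>)
        ultimately show "z \<in> {v. dt v \<le> K / C} \<inter> {v. \<bar>lk v 3\<bar> \<le> K / C}"
          using N by (simp add: abs_divide)
      qed
      show "closed ({v. dt v \<le> K / C} \<inter> {v. \<bar>lk v 3\<bar> \<le> K / C})"
        by (intro closed_Int closed_Collect_le continuous_on_dt continuous_on_const continuous_on_rabs continuous_on_lookup continuous_on_id)
    qed
    ultimately show ?thesis by blast
  qed
  have null: "z \<le> 0" if z: "\<And>C. C \<ge> 1 \<Longrightarrow> z \<le> K / C" for z
  proof (rule ccontr)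
    assume "\<not> z \<le> 0"
    then have z0: "z > 0" by simp
    have K0: "K > 0" using dx by (simp add: K_def)
    have C: "1 + K / z \<ge> 1" using K0 z0 by simp
    have "z * (1 + K / z) \<le> K" using z[OF C] C by (simp add: pos_le_divide_eq del: distrib_left)
    moreover have "z * (1 + K / z) = z + K" using z0 by (simp add: distrib_left)
    ultimately show False using z0 by linarith
  qed
  have "dt y \<le> 0" "\<bar>lk y 3\<bar> \<le> 0" using null bound by blast+
  moreover have "dt y \<ge> 0" using lens_closure(3)[OF yl] by (simp add: psd_def)
  ultimately show ?thesis using lens_closure[OF yl] by (simp add: circle_def)
qed

lemma v4_expand: "v4 a b c d = a *\<^sub>R v4 1 0 0 0 + b *\<^sub>R v4 0 1 0 0 + c *\<^sub>R v4 0 0 1 0 + d *\<^sub>R v4 0 0 0 1"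
  by (rule Rn4_eqI) (auto intro!: Rn4_intros simp: lookup_add lookup_v4)

lemma tendsto_v4:
  assumes "(a \<longlongrightarrow> a') F" "(b \<longlongrightarrow> b') F" "(c \<longlongrightarrow> c') F" "(d \<longlongrightarrow> d') F"
  shows "((\<lambda>x. v4 (a x) (b x) (c x) (d x)) \<longlongrightarrow> v4 a' b' c' d') F"
proof -
  have "((\<lambda>x. a x *\<^sub>R v4 1 0 0 0 + b x *\<^sub>R v4 0 1 0 0 + c x *\<^sub>R v4 0 0 1 0 + d x *\<^sub>R v4 0 0 0 1) \<longlongrightarrow>
    a' *\<^sub>R v4 1 0 0 0 + b' *\<^sub>R v4 0 1 0 0 + c' *\<^sub>R v4 0 0 1 0 + d' *\<^sub>R v4 0 0 0 1) F"
    by (intro tendsto_add tendsto_scaleR tendsto_const assms)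
  then show ?thesis unfolding v4_expand[symmetric] .
qed

lemma tendsto_cact:
  assumes f: "(f \<longlongrightarrow> y) F" and N: "qf a b y + qf c d y \<noteq> 0"
  shows "((\<lambda>x. cact a b c d (f x)) \<longlongrightarrow> cact a b c d y) F"
  unfolding cact_eq mat_act_rho
  by (intro tendsto_scaleR tendsto_divide tendsto_const tendsto_add tendsto_mult tendsto_v4 tendsto_lookup f
      tendsto_of_continuous_UNIV[OF continuous_on_qf f] N)

lemma tendsto_dirpt:
  assumes f: "(f \<longlongrightarrow> \<theta>) F"
  shows "((\<lambda>x. dirpt (f x) 1) \<longlongrightarrow> dirpt \<theta> 1) F"
proof -
  have "\<theta>\<^sup>2 + 1 \<noteq> 0" using sum_squares_pos[of \<theta> 1] by simp
  then show ?thesis unfolding dirpt_def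
    by (intro tendsto_scaleR tendsto_divide tendsto_const tendsto_add tendsto_mult tendsto_v4 tendsto_power f) simp
qed

text \<open>After division by \<open>k\<^sup>2\<close> only the entry multiplied by \<open>9
k\<^sup>2\<close> survives.\<close>
lemma unipotent_orbit_tendsto:
  assumes x: "x \<in> lens"
  shows "(\<lambda>k. cact 1 (3 * int (Suc k)) 0 1 x) \<longlonglongrightarrow> dirpt 1 0"
proof -
  have x2: "lk x 2 > 0" using lensD[OF x] pd_lookup2 by blast
  define e where "e = (\<lambda>k. inverse (real (Suc k)))"
  have e: "e \<longlonglongrightarrow> 0" unfolding e_def by (rule LIMSEQ_inverse_real_of_nat)
  define P where "P = (\<lambda>k. (e k)\<^sup>2 * lk x 0 + 6 * e k * lk x 1 + 9 * lk x 2)"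
  have P: "P \<longlonglongrightarrow> 0\<^sup>2 * lk x 0 + 6 * 0 * lk x 1 + 9 * lk x 2"
    unfolding P_def by (intro tendsto_add tendsto_mult tendsto_power tendsto_const e)
  have "(\<lambda>k. (1 / (P k + (e k)\<^sup>2 * lk x 2)) *\<^sub>R
      v4 (P k) ((e k)\<^sup>2 * lk x 1 + 3 * e k * lk x 2) ((e k)\<^sup>2 * lk x 2) ((e k)\<^sup>2 * lk x 3)) \<longlonglongrightarrow>
    (1 / (0\<^sup>2 * lk x 0 + 6 * 0 * lk x 1 + 9 * lk x 2 + 0\<^sup>2 * lk x 2)) *\<^sub>R
      v4 (0\<^sup>2 * lk x 0 + 6 * 0 * lk x 1 + 9 * lk x 2) (0\<^sup>2 * lk x 1 + 3 * 0 * lk x 2) (0\<^sup>2 * lk x 2) (0\<^sup>2 * lk x 3)"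
    by (intro tendsto_scaleR tendsto_divide tendsto_add tendsto_mult tendsto_power tendsto_const tendsto_v4 e P)
      (use x2 in simp)
  moreover have "(1 / (P k + (e k)\<^sup>2 * lk x 2)) *\<^sub>R
      v4 (P k) ((e k)\<^sup>2 * lk x 1 + 3 * e k * lk x 2) ((e k)\<^sup>2 * lk x 2) ((e k)\<^sup>2 * lk x 3)
    = cact 1 (3 * int (Suc k)) 0 1 x" for k
  proof -
    define K where "K = real (Suc k)"
    have K: "K > 0" "e k = 1 / K" by (simp_all add: K_def e_def divide_inverse)
    define N where "N = lk x 0 + 6 * K * lk x 1 + 9 * K\<^sup>2 * lk x 2"
    have PN: "P k = N / K\<^sup>2" using K(1) by (simp add: P_def K(2) N_def field_simps power2_eq_square)
    have s: "P k + (e k)\<^sup>2 * lk x 2 = (N + lk x 2) / K\<^sup>2" "(e k)\<^sup>2 * lk x 1 + 3 * e k * lk x 2 = (lk x 1 + 3 * K * lk x 2) / K\<^sup>2"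
      unfolding PN using K(1) by (simp_all add: K(2) field_simps power2_eq_square)
    have ik: "real_of_int (3 * int (Suc k)) = 3 * K" by (simp add: K_def)
    have N': "qf (real_of_int 1) (real_of_int (3 * int (Suc k))) x + qf (real_of_int 0) (real_of_int 1) x = N + lk x 2"
      unfolding ik by (simp add: qf_def N_def power2_eq_square)
    have R: "mat_act (rho 1 (3 * int (Suc k)) 0 1) x = v4 N (lk x 1 + 3 * K * lk x 2) (lk x 2) (lk x 3)"
      unfolding mat_act_rho ik by (simp add: N_def power2_eq_square)
    show ?thesis
      unfolding cact_eq N' R s unfolding PN
      by (rule Rn4_eqI) (use K in \<open>auto intro!: Rn4_intros simp: power_divide\<close>)
  qed
  moreover have "(1 / (0\<^sup>2 * lk x 0 + 6 * 0 * lk x 1 + 9 * lk x 2 + 0\<^sup>2 * lk x 2)) *\<^sub>R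
      v4 (0\<^sup>2 * lk x 0 + 6 * 0 * lk x 1 + 9 * lk x 2) (0\<^sup>2 * lk x 1 + 3 * 0 * lk x 2) (0\<^sup>2 * lk x 2) (0\<^sup>2 * lk x 3) = dirpt 1 0"
    by (rule Rn4_eqI) (use x2 in \<open>auto intro!: Rn4_intros simp: dirpt_def\<close>)
  ultimately show ?thesis by simp
qed

lemma coprime_three: "coprime (3 * k + 1) (3 :: int)"
proof (rule coprimeI)
  fix c :: int assume "c dvd 3 * k + 1" "c dvd 3"
  then have "c dvd (3 * k + 1) - 3 * k" by (intro dvd_diff) auto
  then show "is_unit c" by simp
qed

text \<open>Solving \<open>p d - (3 q) v = 1\<close> instead of \<open>p d - q b = 1\<close> makes the
entry \<open>b\<close> divisible by 3, and then \<open>d\<close> is congruent to 1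
automatically.\<close>
lemma lev3_first_column:
  fixes p q :: int
  assumes "coprime p q" "3 dvd p - 1" "3 dvd q"
  obtains b d where "lev3 p b q d"
proof -
  obtain k where k: "p = 3 * k + 1" using assms(2) by (metis dvd_def diff_add_cancel)
  have "coprime p 3" unfolding k by (rule coprime_three)
  then have "coprime p (3 * q)" using assms(1) by simp
  then obtain u v where "u * p + v * (3 * q) = 1" using bezout_int[of p "3 * q"] by (metis coprime_iff_gcd_eq_1)
  then have one: "p * u - (- 3 * v) * q = 1" by (simp add: algebra_simps)
  have "u - 1 = 3 * (- (k * u) - v * q)" using one unfolding k by (simp add: algebra_simps)
  then have "3 dvd u - 1" by (metis dvd_triv_left)
  then have "lev3 p (- 3 * v) q u" using assms one by (simp add: lev3_def)
  then show ?thesis by (rule that)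
qed

text \<open>The group element with first column \<open>(a, c)\<close> moves the accumulation point
\<open>dirpt 1 0\<close> to \<open>dirpt a c\<close>, and the directions of first columns are
dense.\<close>
lemma dirpt_in_closure_orbit:
  assumes x: "x \<in> lens"
  shows "dirpt 1 0 \<in> closure (orbit tr_vec Gam x)" "dirpt \<theta> 1 \<in> closure (orbit tr_vec Gam x)"
proof -
  let ?O = "orbit tr_vec Gam x"
  have U: "lev3 1 (3 * int (Suc k)) 0 1" for k by (simp add: lev3_def)
  have inO: "cact 1 (3 * int (Suc k)) 0 1 x \<in> ?O" for k unfolding orbit_Gam using U by blast
  show "dirpt 1 0 \<in> closure ?O"
    unfolding closure_sequential using unipotent_orbit_tendsto[OF x] inO
    by (intro exI[of _ "\<lambda>k. cact 1 (3 * int (Suc k)) 0 1 x"]) blast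
  have column: "dirpt a c \<in> closure ?O" if g: "lev3 a b c d" for a b c d
  proof -
    have ac: "a \<noteq> 0 \<or> c \<noteq> 0" using lev3_det[OF g] by auto
    have im: "cact a b c d (dirpt 1 0) = dirpt a c" using cact_dirpt(1)[OF lev3_det[OF g], of 1 0] by simp
    have N: "qf a b (dirpt 1 0) + qf c d (dirpt 1 0) \<noteq> 0"
      using ac sum_squares_pos[of "real_of_int a" "real_of_int c"] by (simp add: dirpt_def qf_scale) (simp add: qf_def)
    have "(\<lambda>k. cact a b c d (cact 1 (3 * int (Suc k)) 0 1 x)) \<longlonglongrightarrow> dirpt a c"
      using tendsto_cact[OF unipotent_orbit_tendsto[OF x] N] unfolding im .
    moreover have "cact a b c d (cact 1 (3 * int (Suc k)) 0 1 x) \<in> ?O" for k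
      unfolding cact_mult[OF lev3_det[OF U] x] orbit_Gam using lev3_mult[OF g U] by blast
    ultimately show ?thesis unfolding closure_sequential
      by (intro exI[of _ "\<lambda>k. cact a b c d (cact 1 (3 * int (Suc k)) 0 1 x)"]) blast
  qed
  \<comment> \<open>first columns \<open>(p, 3 ^ k)\<close> with \<open>p\<close> congruent to 1 modulo 3 and \<open>p / 3 ^ k\<close> close to \<open>\<theta>\<close>\<close>
  define f where "f = (\<lambda>k::nat. \<lfloor>\<theta> * 3 ^ k / 3\<rfloor>)"
  define p where "p = (\<lambda>k::nat. 3 * f k + 1)"
  have lim: "(\<lambda>k. real_of_int (p k) / 3 ^ k) \<longlonglongrightarrow> \<theta>"
  proof (rule metric_tendsto_imp_tendsto[of "\<lambda>k. 2 * (1 / 3) ^ k :: real" 0])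
    have "(\<lambda>k. 2 * (1 / 3) ^ k :: real) \<longlonglongrightarrow> 2 * 0"
      by (intro tendsto_mult tendsto_const LIMSEQ_power_zero) simp
    then show "(\<lambda>k. 2 * (1 / 3) ^ k :: real) \<longlonglongrightarrow> 0" by simp
    have "dist (real_of_int (p k) / 3 ^ k) \<theta> \<le> dist (2 * (1 / 3) ^ k :: real) 0" for k
    proof -
      have fl: "real_of_int (f k) \<le> \<theta> * 3 ^ k / 3" "\<theta> * 3 ^ k / 3 < real_of_int (f k) + 1"
        unfolding f_def using floor_correct[of "\<theta> * 3 ^ k / 3"] by simp_all
      have pk: "real_of_int (p k) = 3 * real_of_int (f k) + 1" by (simp add: p_def)
      have fl': "real_of_int (f k) * 3 \<le> \<theta> * 3 ^ k" "\<theta> * 3 ^ k < (real_of_int (f k) + 1) * 3"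
        using fl by (simp_all only: pos_le_divide_eq pos_divide_less_eq zero_less_numeral)
      have "\<bar>3 * F + 1 - T\<bar> \<le> 2" if "F * 3 \<le> T" "T < (F + 1) * 3" for F T :: real
        using that by (simp add: abs_le_iff)
      then have "\<bar>real_of_int (p k) - \<theta> * 3 ^ k\<bar> \<le> 2" unfolding pk using fl' by blast
      moreover have "real_of_int (p k) / 3 ^ k - \<theta> = (real_of_int (p k) - \<theta> * 3 ^ k) / 3 ^ k" by (simp add: diff_divide_distrib)
      ultimately show ?thesis by (simp add: dist_real_def abs_divide power_divide divide_right_mono)
    qed
    then show "\<forall>\<^sub>F k in sequentially. dist (real_of_int (p k) / 3 ^ k) \<theta> \<le> dist (2 * (1 / 3) ^ k :: real) 0"
      by simp
  qed
  have "dirpt (real_of_int (p (Suc k)) / 3 ^ Suc k) 1 \<in> closure ?O" for k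
  proof -
    have "coprime (p (Suc k)) 3" unfolding p_def by (rule coprime_three)
    then have "coprime (p (Suc k)) (3 ^ Suc k)" by simp
    then obtain b d where "lev3 (p (Suc k)) b (3 ^ Suc k) d"
      by (rule lev3_first_column) (auto simp: p_def)
    then have "dirpt (p (Suc k)) (real_of_int (3 ^ Suc k)) \<in> closure ?O" by (rule column)
    moreover have "dirpt (p (Suc k)) (real_of_int (3 ^ Suc k)) = dirpt (real_of_int (p (Suc k)) / 3 ^ Suc k) 1"
      using dirpt_scale[of "3 ^ Suc k" "real_of_int (p (Suc k)) / 3 ^ Suc k" 1] by simp
    ultimately show ?thesis by metis
  qed
  moreover have "(\<lambda>k. dirpt (real_of_int (p (Suc k)) / 3 ^ Suc k) 1) \<longlonglongrightarrow> dirpt \<theta> 1"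
    by (rule tendsto_dirpt) (rule LIMSEQ_Suc[OF lim])
  ultimately have "dirpt \<theta> 1 \<in> closure (closure ?O)" unfolding closure_sequential[of _ "closure ?O"]
    by (intro exI[of _ "\<lambda>k. dirpt (real_of_int (p (Suc k)) / 3 ^ Suc k) 1"]) blast
  then show "dirpt \<theta> 1 \<in> closure ?O" by simp
qed

lemma limit_set_eq_circle: "limit_set tr_vec lens Gam = circle"
proof -
  define x where "x = (SOME x. x \<in> lens)"
  have x: "x \<in> lens" unfolding x_def using lens_base by (rule someI)
  have "closure (orbit tr_vec Gam x) - orbit tr_vec Gam x = circle"
  proof
    show "closure (orbit tr_vec Gam x) - orbit tr_vec Gam x \<subseteq> circle"
      using closure_orbit_subset[OF x] by blast
    show "circle \<subseteq> closure (orbit tr_vec Gam x) - orbit tr_vec Gam x"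
    proof
      fix \<xi> assume \<xi>: "\<xi> \<in> circle"
      then obtain u v where uv: "u\<^sup>2 + v\<^sup>2 = 1" "\<xi> = dirpt u v" by (rule circle_eq_dirpt)
      have "\<xi> \<in> closure (orbit tr_vec Gam x)"
      proof (cases "v = 0")
        case True
        then have "u \<noteq> 0" using uv(1) by auto
        then have "\<xi> = dirpt 1 0" using dirpt_scale[of u 1 0] uv(2) True by simp
        then show ?thesis using dirpt_in_closure_orbit(1)[OF x] by simp
      next
        case False
        then have "\<xi> = dirpt (u / v) 1" using dirpt_scale[of v "u / v" 1] uv(2) by simp
        then show ?thesis using dirpt_in_closure_orbit(2)[OF x] by simp
      qed
      moreover have "\<xi> \<notin> orbit tr_vec Gam x"
      proof
        assume "\<xi> \<in> orbit tr_vec Gam x"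
        then have "\<xi> \<in> lens" unfolding orbit_Gam using cact_lens(1)[OF lev3_det x] by blast
        then show False using lensD[of \<xi>] \<xi> by (simp add: circle_def pd_def)
      qed
      ultimately show "\<xi> \<in> closure (orbit tr_vec Gam x) - orbit tr_vec Gam x" by blast
    qed
  qed
  then show ?thesis by (simp add: limit_set_def x_def)
qed

definition flat_core :: "rseq set" where "flat_core = {y \<in> lens. lk y 3 = 0}"

text \<open>Every point of the disc lies on a chord between two points of the rim.\<close>
lemma core_lift_eq: "core_lift tr_vec lens Gam = flat_core"
proof -
  have sub: "flat_core \<subseteq> convex hull circle"
  proof
    fix y assume "y \<in> flat_core"
    then have y: "y \<in> Rn 4" "pd y" "lk y 0 + lk y 2 = 1" "lk y 3 = 0" using lensD[of y] by (auto simp: flat_core_def)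
    define y0 y1 y2 where "y0 = lk y 0" "y1 = lk y 1" "y2 = lk y 2"
    have y2: "y2 > 0" using pd_lookup2[OF y(2)] by (simp add: y0_y1_y2_def)
    \<comment> \<open>the largest multiple of \<open>dirpt 1 0\<close> that can be subtracted from \<open>y\<close>: the determinant of the rest is 0\<close>
    define \<mu> where "\<mu> = dt y / y2"
    have \<mu>: "0 < \<mu>" using y(2) y2 by (simp add: \<mu>_def pd_def)
    have \<mu>': "1 - \<mu> = (y1\<^sup>2 + y2\<^sup>2) / y2" 
    proof -
      have "y2 * (1 - \<mu>) = y2 - dt y" using y2 by (simp add: \<mu>_def right_diff_distrib)
      also have "dt y = y0 * y2 - y1\<^sup>2" by (simp add: dt_def y0_y1_y2_def)
      also have "y2 - (y0 * y2 - y1\<^sup>2) = y2 * (1 - y0) + y1\<^sup>2" by (simp add: algebra_simps)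
      also have "1 - y0 = y2" using y(3) by (simp add: y0_y1_y2_def)
      finally have "y2 * (1 - \<mu>) = y1\<^sup>2 + y2\<^sup>2" by (simp add: power2_eq_square)
      then show ?thesis using y2 by (simp add: eq_divide_eq mult.commute)
    qed
    have pos: "0 < y1\<^sup>2 + y2\<^sup>2" using sum_squares_pos[of y1 y2] y2 by simp
    have "y = \<mu> *\<^sub>R dirpt 1 0 + (1 - \<mu>) *\<^sub>R dirpt y1 y2"
    proof (rule Rn4_eqI)
      have c: "(1 - \<mu>) *\<^sub>R dirpt y1 y2 = (1 / y2) *\<^sub>R v4 (y1\<^sup>2) (y1 * y2) (y2\<^sup>2) 0"
        using pos by (simp add: \<mu>' dirpt_def)
      show "lk y 0 = lk (\<mu> *\<^sub>R dirpt 1 0 + (1 - \<mu>) *\<^sub>R dirpt y1 y2) 0"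
      proof -
        have "\<mu> + y1\<^sup>2 / y2 = (y0 * y2) / y2" unfolding \<mu>_def add_divide_distrib[symmetric] dt_def by (simp add: y0_y1_y2_def)
        then show ?thesis using y2 unfolding c by (simp add: lookup_add dirpt_def) (simp add: y0_y1_y2_def)
      qed
      show "lk y 1 = lk (\<mu> *\<^sub>R dirpt 1 0 + (1 - \<mu>) *\<^sub>R dirpt y1 y2) 1"
        "lk y 2 = lk (\<mu> *\<^sub>R dirpt 1 0 + (1 - \<mu>) *\<^sub>R dirpt y1 y2) 2"
        "lk y 3 = lk (\<mu> *\<^sub>R dirpt 1 0 + (1 - \<mu>) *\<^sub>R dirpt y1 y2) 3"
        unfolding c using y2 y(4) by (simp_all add: lookup_add dirpt_def power2_eq_square) (simp_all add: y0_y1_y2_def)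
      show "y \<in> Rn 4" by (rule y(1))
      show "\<mu> *\<^sub>R dirpt 1 0 + (1 - \<mu>) *\<^sub>R dirpt y1 y2 \<in> Rn 4" by (auto intro!: Rn4_intros simp: dirpt_def)
    qed
    moreover have "0 \<le> 1 - \<mu>" unfolding \<mu>' using pos y2 by simp
    ultimately show "y \<in> convex hull circle"
      using convexD[OF convex_convex_hull[of circle], of "dirpt 1 0" "dirpt y1 y2" \<mu> "1 - \<mu>"]
        hull_subset[of circle convex] dirpt_circle[of 1 0] dirpt_circle[of y1 y2] y2 \<mu> by auto
  qed
  have conv: "convex {v. lk v 3 = 0}"
    by (rule convexI) (simp add: lookup_add)
  have cl: "closed {v. lk v 3 = 0}"
    by (intro closed_Collect_eq continuous_on_lookup continuous_on_id continuous_on_const)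
  have "convex hull circle \<subseteq> {v. lk v 3 = 0}"
    by (rule hull_minimal) (use conv in \<open>auto simp: circle_def\<close>)
  then have "closure (convex hull circle \<inter> lens) \<subseteq> {v. lk v 3 = 0}"
    by (intro closure_minimal cl) blast
  moreover have "flat_core \<subseteq> closure (convex hull circle \<inter> lens)"
    using sub closure_subset[of "convex hull circle \<inter> lens"] unfolding flat_core_def by blast
  ultimately show ?thesis
    unfolding core_lift_def limit_set_eq_circle by (auto simp: flat_core_def)
qed

text \<open>The linear functional \<open>qf (- n) m\<close> vanishes at this rim point and is positive
on positive definite matrices, so it defines the supporting plane there.\<close>
lemma nrm_circle:
  assumes mn: "m \<noteq> 0 \<or> n \<noteq> 0"
  shows "\<exists>\<kappa>>0. \<forall>y\<in>lens. inner (lens.nrm (dirpt m n)) (y - dirpt m n) = \<kappa> * qf (- n) m y"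
proof -
  define c where "c = v4 (n\<^sup>2) (- 2 * m * n) (m\<^sup>2) 0"
  let ?\<xi> = "dirpt m n"
  have ci: "inner c v = qf (- n) m v" for v
    by (simp add: inner_Rn4 c_def qf_def)
  have c\<xi>: "inner c ?\<xi> = 0"
    unfolding ci by (simp add: dirpt_def qf_scale) (simp add: qf_def power2_eq_square)
  have \<xi>: "?\<xi> \<in> bdry lens" using circle_bdry[OF dirpt_circle[OF mn]] .
  have tr: "inner tr_vec y = inner tr_vec ?\<xi>" if "y \<in> lens" for y
    using lensD[OF that] dirpt_circle[OF mn] by (simp add: inner_tr_vec circle_def)
  have in0: "inner (proj_V0 c) (y - ?\<xi>) = qf (- n) m y" if "y \<in> lens" for y
    using inner_proj_V0[OF tr[OF that], of c] c\<xi> ci by simp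
  have pos: "0 < qf (- n) m y" if "y \<in> lens" for y
    using qf_pos[of y "- n" m] lensD[OF that] mn by auto
  have n0: "norm (proj_V0 c) > 0" using in0[OF lens_base] pos[OF lens_base] by auto
  have cR: "c \<in> Rn 4" by (simp add: c_def)
  have "lens.nrm ?\<xi> = (1 / norm (proj_V0 c)) *\<^sub>R proj_V0 c"
  proof (rule lens.nrm_eqI[OF \<xi>])
    show "(1 / norm (proj_V0 c)) *\<^sub>R proj_V0 c \<in> V0"
      by (rule subspace_scale[OF subspace_V0 proj_V0_mem[OF cR]])
    show "norm ((1 / norm (proj_V0 c)) *\<^sub>R proj_V0 c) = 1" using n0 by simp
    show "0 \<le> inner ((1 / norm (proj_V0 c)) *\<^sub>R proj_V0 c) (y - ?\<xi>)" if "y \<in> lens" for y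
      using in0[OF that] pos[OF that] n0 by simp
  qed
  then show ?thesis using in0 n0 by (intro exI[of _ "1 / norm (proj_V0 c)"]) simp
qed

text \<open>Inside the disc the chord from \<open>\<xi>\<close> through \<open>y\<close> ends at the
rim, where \<open>y\<close> has been stripped of the largest multiple of \<open>\<xi>\<close> that keeps
it positive semidefinite. Hence horoballs in the core are those of the hyperbolic plane.\<close>
lemma horo_flat_core:
  assumes mn: "m \<noteq> 0 \<or> n \<noteq> 0"
  shows "\<exists>\<kappa>>0. \<forall>y\<in>flat_core. lens.horo (dirpt m n) y = \<kappa> * (qf (- n) m y)\<^sup>2 / dt y"
proof -
  obtain \<kappa> where \<kappa>: "\<kappa> > 0" "\<And>y. y \<in> lens \<Longrightarrow> inner (lens.nrm (dirpt m n)) (y - dirpt m n) = \<kappa> * qf (- n) m y"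
    using nrm_circle[OF mn] by blast
  define S where "S = m\<^sup>2 + n\<^sup>2"
  have S: "S > 0" unfolding S_def by (rule sum_squares_pos[OF mn])
  have "lens.horo (dirpt m n) y = (\<kappa> / S) * (qf (- n) m y)\<^sup>2 / dt y" if y: "y \<in> flat_core" for y
  proof -
    let ?\<xi> = "dirpt m n"
    have yl: "y \<in> lens" "lk y 3 = 0" "y \<in> Rn 4" "pd y" "lk y 0 + lk y 2 = 1" using y lensD[of y] by (auto simp: flat_core_def)
    define Q where "Q = qf (- n) m y"
    have Q: "Q > 0" unfolding Q_def using qf_pos[OF yl(4), of "- n" m] mn by auto
    have dy: "dt y > 0" using yl(4) by (simp add: pd_def)
    \<comment> \<open>chosen such that \<open>y - \<mu> \<xi>\<close> has determinant 0\<close>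
    define \<mu> where "\<mu> = dt y * S / Q"
    have \<mu>: "\<mu> > 0" using Q dy S by (simp add: \<mu>_def)
    have \<xi>: "?\<xi> \<in> Rn 4" "dt ?\<xi> = 0" "lk ?\<xi> 0 + lk ?\<xi> 2 = 1" "lk ?\<xi> 3 = 0"
      using dirpt_circle[OF mn] by (auto simp: circle_def)
    have mix: "mixed y ?\<xi> = Q / S"
      using S by (simp add: mixed_def dirpt_def Q_def qf_def flip: S_def) (simp add: field_simps power2_eq_square)
    define w where "w = y + (- \<mu>) *\<^sub>R ?\<xi>"
    have dw: "dt w = 0"
      using Q S by (simp add: w_def dt_add dt_scale mixed_scale \<xi>(2) mix \<mu>_def del: scaleR_minus_left)
    have trw: "lk w 0 + lk w 2 = 1 - \<mu>"
    proof -
      have "lk w 0 + lk w 2 = (lk y 0 + lk y 2) - \<mu> * (lk ?\<xi> 0 + lk ?\<xi> 2)"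
        by (simp add: w_def lookup_add lookup_minus algebra_simps del: scaleR_minus_left)
      then show ?thesis using yl(5) \<xi>(3) by simp
    qed
    have \<mu>1: "\<mu> < 1"
    proof -
      have "qf m n y > 0" using qf_pos[OF yl(4) mn] .
      have sum: "qf m n y + Q = S"
      proof -
        have "qf m n y + Q = S * (lk y 0 + lk y 2)" by (simp add: Q_def qf_def S_def algebra_simps)
        then show ?thesis using yl(5) by simp
      qed
      define L where "L = m * - n * lk y 0 + (m * m + n * - n) * lk y 1 + n * m * lk y 2"
      have lag: "qf m n y * Q = L\<^sup>2 + dt y * S\<^sup>2"
        unfolding Q_def L_def lagrange_identity by (simp add: S_def power2_eq_square)
      have "\<mu> \<noteq> 1"
      proof
        assume one: "\<mu> = 1"
        have w02: "lk w 0 * lk w 2 - (lk w 1)\<^sup>2 = 0" "lk w 2 = - lk w 0" using dw trw one by (auto simp: dt_def)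
        moreover have "lk w 0 * lk w 2 = - (lk w 0)\<^sup>2" by (simp add: w02(2) power2_eq_square)
        ultimately have "(lk w 0)\<^sup>2 + (lk w 1)\<^sup>2 = 0" by linarith
        then have z: "lk w 0 = 0" "lk w 1 = 0" "lk w 2 = 0" using w02(2) by (auto simp: sum_power2_eq_zero_iff)
        have "y = ?\<xi>"
        proof (rule Rn4_eqI[OF yl(3) \<xi>(1)])
          show "lk y 0 = lk ?\<xi> 0" "lk y 1 = lk ?\<xi> 1" "lk y 2 = lk ?\<xi> 2"
            using z one by (simp_all add: w_def lookup_add lookup_minus)
          show "lk y 3 = lk ?\<xi> 3" using yl(2) \<xi>(4) by simp
        qed
        then show False using dy \<xi>(2) by simp
      qed
      moreover have "\<mu> \<le> 1"
      proof -
        have "dt y * S * S \<le> qf m n y * Q" unfolding lag by (simp add: power2_eq_square mult.assoc)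
        also have "\<dots> \<le> S * Q" using sum Q by (intro mult_right_mono) auto
        finally have "dt y * S \<le> Q" using S by (simp add: mult.commute)
        then show ?thesis using Q by (simp add: \<mu>_def)
      qed
      ultimately show ?thesis by simp
    qed
    have "lens.horo ?\<xi> y = inner (lens.nrm ?\<xi>) (y - ?\<xi>) * (1 + 1 / ray_param lens y (y - ?\<xi>))"
      by (simp add: lens.horo_def)
    moreover have "ray_param lens y (y - ?\<xi>) = \<mu> / (1 - \<mu>)"
    proof (rule lens.ray_param_eqI[OF yl(1)])
      show "0 < \<mu> / (1 - \<mu>)" using \<mu> \<mu>1 by simp
      have e: "y + (\<mu> / (1 - \<mu>)) *\<^sub>R (y - ?\<xi>) = (1 / (1 - \<mu>)) *\<^sub>R w"
      proof -
        have "1 + \<mu> / (1 - \<mu>) = 1 / (1 - \<mu>)" using \<mu>1 by (simp add: add_divide_eq_iff)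
        then have "(1 / (1 - \<mu>)) *\<^sub>R w = (1 + \<mu> / (1 - \<mu>)) *\<^sub>R y - (\<mu> / (1 - \<mu>)) *\<^sub>R ?\<xi>"
          by (simp add: w_def scaleR_diff_right)
        then show ?thesis by (simp add: scaleR_add_left scaleR_diff_right)
      qed
      show "y + (\<mu> / (1 - \<mu>)) *\<^sub>R (y - ?\<xi>) \<in> bdry lens"
        unfolding e
      proof (rule rank_one_bdry)
        let ?v = "(1 / (1 - \<mu>)) *\<^sub>R w"
        show "?v \<in> Rn 4" unfolding w_def using yl(3) \<xi>(1) by (intro Rn4_intros)
        show tr: "lk ?v 0 + lk ?v 2 = 1" using trw \<mu>1 by (simp flip: add_divide_distrib)
        show d: "dt ?v = 0" by (simp add: dt_scale dw)
        then have "lk ?v 0 * lk ?v 2 = (lk ?v 1)\<^sup>2" by (simp add: dt_def)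
        then have pr: "lk ?v 0 * lk ?v 2 \<ge> 0" by simp
        have "lk ?v 0 \<ge> 0 \<and> lk ?v 2 \<ge> 0"
          using pr tr unfolding zero_le_mult_iff by linarith
        then show "psd ?v" using d by (simp add: psd_def)
        show "lk ?v 3 = 0" by (simp add: w_def lookup_add lookup_minus yl(2) \<xi>(4))
      qed
    qed
    moreover have "1 + 1 / (\<mu> / (1 - \<mu>)) = 1 / \<mu>" using \<mu> by (simp add: diff_divide_distrib)
    ultimately have "lens.horo ?\<xi> y = \<kappa> * Q * (1 / \<mu>)" using \<kappa>(2)[OF yl(1)] by (simp add: Q_def)
    then show ?thesis using Q dy S by (simp add: \<mu>_def flip: Q_def) (simp add: power2_eq_square ac_simps)
  qed
  then show ?thesis using \<kappa>(1) S by (intro exI[of _ "\<kappa> / S"]) auto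
qed

text \<open>The horoball bounded by the level at which the vector \<open>(- n, m)\<close> dual to the
cusp becomes short.\<close>
lemma horoball_flat_core:
  assumes mn: "m \<noteq> 0 \<or> n \<noteq> 0" and x: "x \<in> flat_core" "qf (- n) m x = rt x"
  shows "horoball lens (dirpt m n) x \<inter> flat_core = {y \<in> flat_core. qf (- n) m y < rt y}"
proof -
  obtain \<kappa> where \<kappa>: "\<kappa> > 0" "\<And>y. y \<in> flat_core \<Longrightarrow> lens.horo (dirpt m n) y = \<kappa> * (qf (- n) m y)\<^sup>2 / dt y"
    using horo_flat_core[OF mn] by blast
  have \<xi>: "dirpt m n \<in> bdry lens" using circle_bdry[OF dirpt_circle[OF mn]] .
  have pd: "pd y" if "y \<in> flat_core" for y using that lensD[of y] by (simp add: flat_core_def)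
  have sq: "(rt y)\<^sup>2 = dt y" "dt y > 0" if "y \<in> flat_core" for y
    using pd[OF that] rt_sq[OF pd_imp_psd] by (auto simp: pd_def)
  have hx: "lens.horo (dirpt m n) x = \<kappa>" using \<kappa>(2)[OF x(1)] sq[OF x(1)] by (simp add: x(2))
  have "lens.horo (dirpt m n) y < lens.horo (dirpt m n) x \<longleftrightarrow> qf (- n) m y < rt y" if y: "y \<in> flat_core" for y
  proof -
    have q0: "0 \<le> qf (- n) m y" using qf_psd_nonneg[OF pd_imp_psd[OF pd[OF y]]] .
    have r0: "0 \<le> rt y" using rt_nonneg[OF pd_imp_psd[OF pd[OF y]]] .
    have "\<kappa> * (qf (- n) m y)\<^sup>2 / dt y < \<kappa> \<longleftrightarrow> (qf (- n) m y)\<^sup>2 < dt y"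
      using sq(2)[OF y] \<kappa>(1) by (simp add: pos_divide_less_eq)
    also have "\<dots> \<longleftrightarrow> (qf (- n) m y)\<^sup>2 < (rt y)\<^sup>2" using sq(1)[OF y] by simp
    also have "\<dots> \<longleftrightarrow> qf (- n) m y < rt y" using q0 r0 power_mono_iff[of "rt y" "qf (- n) m y" 2] by (simp flip: not_le)
    finally show ?thesis using \<kappa>(2)[OF y] hx by simp
  qed
  moreover have "x \<in> lens" using x(1) by (simp add: flat_core_def)
  ultimately show ?thesis
    unfolding lens.horoball_eq[OF \<xi> \<open>x \<in> lens\<close>] by (auto simp: flat_core_def)
qed

section \<open>Reduction theory and geometric finiteness\<close>

text \<open>Another form of the disjointness of horoballs, for vectors that are not assumed to be
primitive.\<close>
lemma short_dependent:
  fixes m n m' n' :: int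
  assumes v: "pd v" and s: "qf m n v < rt v" "qf m' n' v < rt v"
  shows "m * n' = n * m'"
proof (rule ccontr)
  assume ne: "m * n' \<noteq> n * m'"
  have sq: "(rt v)\<^sup>2 = dt v" using rt_sq[OF pd_imp_psd[OF v]] .
  have nn: "0 \<le> qf m n v" "0 \<le> qf m' n' v" using qf_psd_nonneg[OF pd_imp_psd[OF v]] by auto
  define L where "L = real_of_int m * m' * lk v 0 + (real_of_int m * n' + real_of_int n * m') * lk v 1 + real_of_int n * n' * lk v 2"
  have id: "qf m n v * qf m' n' v = L\<^sup>2 + dt v * (real_of_int m * n' - real_of_int n * m')\<^sup>2"
    unfolding L_def by (rule lagrange_identity)
  have "(m * n' - n * m')\<^sup>2 > 0" using ne by simp
  then have "(m * n' - n * m')\<^sup>2 \<ge> 1" by linarith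
  then have "real_of_int ((m * n' - n * m')\<^sup>2) \<ge> 1" by (simp only: of_int_1_le_iff)
  then have one: "(real_of_int m * n' - real_of_int n * m')\<^sup>2 \<ge> 1" by simp
  have "dt v * 1 \<le> dt v * (real_of_int m * n' - real_of_int n * m')\<^sup>2"
    using one v by (intro mult_left_mono) (auto simp: pd_def)
  moreover have "0 \<le> L\<^sup>2" by simp
  ultimately have "dt v \<le> qf m n v * qf m' n' v" unfolding id by linarith
  moreover have "qf m n v * qf m' n' v < rt v * rt v" using s nn by (intro mult_strict_mono') auto
  ultimately show False using sq by (simp add: power2_eq_square)
qed

lemma flat_core_cact:
  assumes "a * d - b * c = 1" "y \<in> flat_core" shows "cact a b c d y \<in> flat_core"
  using assms cact_lens(1) cact_lookup3 by (simp add: flat_core_def)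

text \<open>If \<open>y\<close> and its image lie in the horoball, then the dual vector of the cusp and
its pullback are both short at \<open>y\<close>, hence dependent.\<close>
lemma cusp_embedded:
  assumes p: "prim m n" and g: "lev3 a b c d" and y: "y \<in> flat_core" "qf (- n) m y < rt y"
    and gy: "qf (- n) m (cact a b c d y) < rt (cact a b c d y)"
  shows "rho a b c d \<in> stab tr_vec Gam (dirpt m n)"
proof -
  note det = lev3_det[OF g]
  have yl: "y \<in> lens" "pd y" using y(1) lensD[of y] by (auto simp: flat_core_def)
  define N where "N = qf a b y + qf c d y"
  have N: "N > 0" using cact_lens(2)[OF det yl(1)] by (simp add: N_def)
  have "qf (- real_of_int n * a + m * c) (- real_of_int n * b + m * d) y / N < rt y / N"
    using gy unfolding cact_data[OF det yl(1)] by (simp add: N_def)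
  then have "qf (- real_of_int n * a + m * c) (- real_of_int n * b + m * d) y < rt y"
    using N by (simp add: divide_less_cancel)
  then have 1: "qf (real_of_int (- n * a + m * c)) (real_of_int (- n * b + m * d)) y < rt y" by simp
  have 2: "qf (real_of_int (- n)) (real_of_int m) y < rt y" using y(2) by simp
  have "- n * (- n * b + m * d) = m * (- n * a + m * c)"
    by (rule short_dependent[OF yl(2) 2 1])
  then have "(a * m + b * n) * n = (c * m + d * n) * m" by (simp add: algebra_simps)
  then show ?thesis unfolding stab_eq[OF p] using lev3_fix_direction[OF g p] g by blast
qed

text \<open>Matrices of determinant 1 that agree modulo 3 differ by an element of level 3, and there are
finitely many residues.\<close>
lemma finite_coset_representatives:
  obtains R :: "(int \<times> int \<times> int \<times> int) set" where "finite R"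
    "\<And>a b c d. (a, b, c, d) \<in> R \<Longrightarrow> a * d - b * c = 1"
    "\<And>a b c d. a * d - b * c = 1 \<Longrightarrow> \<exists>a' b' c' d' p q r s. (a', b', c', d') \<in> R \<and> lev3 p q r s \<and>
       a = p * a' + q * c' \<and> b = p * b' + q * d' \<and> c = r * a' + s * c' \<and> d = r * b' + s * d'"
proof -
  define res where "res = (\<lambda>(a, b, c, d). (a mod 3 :: int, b mod 3 :: int, c mod 3 :: int, d mod 3 :: int))"
  define S where "S = {(a, b, c, d). a * d - b * c = (1 :: int)}"
  define f where "f = (\<lambda>e. SOME x. x \<in> S \<and> res x = e)"
  have f: "f (res x) \<in> S \<and> res (f (res x)) = res x" if "x \<in> S" for x
    unfolding f_def by (rule someI[of _ x]) (use that in simp)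
  show ?thesis
  proof (rule that[of "f ` res ` S"])
    have "res ` S \<subseteq> {0..<3} \<times> {0..<3} \<times> {0..<3} \<times> {0..<3}" by (auto simp: res_def)
    then have "finite (res ` S)" by (rule finite_subset) simp
    then show "finite (f ` res ` S)" by simp
  next
    fix a b c d assume "(a, b, c, d) \<in> f ` res ` S"
    then have "(a, b, c, d) \<in> S" using f by auto
    then show "a * d - b * c = 1" by (simp add: S_def)
  next
    fix a b c d :: int assume det: "a * d - b * c = 1"
    then have x: "(a, b, c, d) \<in> S" by (simp add: S_def)
    obtain a' b' c' d' where e: "f (res (a, b, c, d)) = (a', b', c', d')" by (metis prod_cases4)
    have R: "(a', b', c', d') \<in> f ` res ` S" unfolding e[symmetric] using x by blast
    have det': "a' * d' - b' * c' = 1" using f[OF x] e by (simp add: S_def)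
    have "a mod 3 = a' mod 3" "b mod 3 = b' mod 3" "c mod 3 = c' mod 3" "d mod 3 = d' mod 3"
      using f[OF x] unfolding e by (simp_all add: res_def)
    then have "3 dvd a - a'" "3 dvd b - b'" "3 dvd c - c'" "3 dvd d - d'"
      by (simp_all add: mod_eq_dvd_iff)
    then obtain x y z w where "a - a' = 3 * x" "b - b' = 3 * y" "c - c' = 3 * z" "d - d' = 3 * w"
      unfolding dvd_def by blast
    then have abcd: "a = a' + 3 * x" "b = b' + 3 * y" "c = c' + 3 * z" "d = d' + 3 * w" by linarith+
    define p q r s where "p = a * d' - b * c'" "q = b * a' - a * b'" "r = c * d' - d * c'" "s = d * a' - c * b'"
    have mult: "a = p * a' + q * c'" "b = p * b' + q * d'" "c = r * a' + s * c'" "d = r * b' + s * d'"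
    proof -
      have "p * a' + q * c' = a * (a' * d' - b' * c')" "p * b' + q * d' = b * (a' * d' - b' * c')"
        "r * a' + s * c' = c * (a' * d' - b' * c')" "r * b' + s * d' = d * (a' * d' - b' * c')"
        by (simp_all add: p_q_r_s_def algebra_simps)
      then show "a = p * a' + q * c'" "b = p * b' + q * d'" "c = r * a' + s * c'" "d = r * b' + s * d'"
        unfolding det' by simp_all
    qed
    have "p * s - q * r = (a * d - b * c) * (a' * d' - b' * c')" by (simp add: p_q_r_s_def algebra_simps)
    then have dd: "p * s - q * r = 1" using det det' by simp
    have "p - (a' * d' - b' * c') = 3 * (x * d' - y * c')" "q = 3 * (y * a' - x * b')" "r = 3 * (z * d' - w * c')"
      "s - (a' * d' - b' * c') = 3 * (w * a' - z * b')"
      unfolding p_q_r_s_def abcd by (simp_all add: algebra_simps)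
    then have "3 dvd p - 1" "3 dvd q" "3 dvd r" "3 dvd s - 1" unfolding det' by (metis dvd_triv_left)+
    then have "lev3 p q r s" using dd by (simp add: lev3_def)
    then show "\<exists>a' b' c' d' p q r s. (a', b', c', d') \<in> f ` res ` S \<and> lev3 p q r s \<and>
       a = p * a' + q * c' \<and> b = p * b' + q * d' \<and> c = r * a' + s * c' \<and> d = r * b' + s * d'"
      using R mult by blast
  qed
qed

lemma orbit_cact:
  assumes g: "lev3 a b c d" and x: "x \<in> lens"
  shows "orbit tr_vec Gam (cact a b c d x) = orbit tr_vec Gam x"
proof
  have sub: "orbit tr_vec Gam (cact a b c d x) \<subseteq> orbit tr_vec Gam x" if g: "lev3 a b c d" and x: "x \<in> lens" for a b c d x
  proof
    fix z assume "z \<in> orbit tr_vec Gam (cact a b c d x)"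
    then obtain a' b' c' d' where z: "z = cact a' b' c' d' (cact a b c d x)" "lev3 a' b' c' d'" unfolding orbit_Gam by blast
    show "z \<in> orbit tr_vec Gam x"
      unfolding z(1) cact_mult[OF lev3_det[OF g] x] orbit_Gam using lev3_mult[OF z(2) g] by blast
  qed
  show "orbit tr_vec Gam (cact a b c d x) \<subseteq> orbit tr_vec Gam x" by (rule sub[OF g x])
  have det: "a * d - b * c = 1" using lev3_det[OF g] .
  have "d * a + - b * c = 1" "d * b + - b * d = 0" "- c * a + a * c = 0" "- c * b + a * d = 1"
    using det by (simp_all add: algebra_simps)
  then have "cact d (- b) (- c) a (cact a b c d x) = cact 1 0 0 1 x"
    using cact_mult[OF det x, of d "- b" "- c" a] by simp
  then have "x = cact d (- b) (- c) a (cact a b c d x)" using cact_one[OF x] by simp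
  then show "orbit tr_vec Gam x \<subseteq> orbit tr_vec Gam (cact a b c d x)"
    using sub[OF lev3_inverse[OF g] cact_lens(1)[OF det x]] by simp
qed

text \<open>The Gauss-reduced forms whose shortest vector \<open>(1, 0)\<close> is not short in the
sense of the cusp. The bound \<open>5 / 4\<close> follows from \<open>v\<^sub>0\<^sup>2 \<ge> dt
v\<close> and \<open>\<bar>v\<^sub>1\<bar> \<le> v\<^sub>0 / 2\<close>.\<close>
definition reduced :: "rseq set" where
  "reduced = {z \<in> Rn 4. lk z 3 = 0 \<and> lk z 0 + lk z 2 = 1 \<and> lk z 0 \<le> lk z 2 \<and>
     4 * lk z 2 \<le> 5 * lk z 0 \<and> 2 * \<bar>lk z 1\<bar> \<le> lk z 0}"

lemma reduced_flat_core: "reduced \<subseteq> flat_core"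
proof
  fix z assume z: "z \<in> reduced"
  then have z0: "lk z 0 > 0" by (auto simp: reduced_def)
  have "\<bar>lk z 1\<bar> < lk z 0" using z z0 by (auto simp: reduced_def)
  then have "(lk z 1)\<^sup>2 < (lk z 0)\<^sup>2" using z0 by (intro abs_le_square_iff[THEN iffD1, THEN le_neq_trans] order.strict_implies_order) (auto simp: abs_square_eq_1 power2_eq_iff)
  moreover have "(lk z 0)\<^sup>2 \<le> lk z 0 * lk z 2" unfolding power2_eq_square using z z0 by (intro mult_left_mono) (auto simp: reduced_def)
  ultimately have "pd z" using z0 by (simp add: pd_def dt_def)
  then show "z \<in> flat_core" using z width_pos[of z] by (simp add: flat_core_def lens_def lens_cone_def reduced_def)
qed

lemma compact_reduced: "compact reduced"
proof -
  have "reduced = Rn 4 \<inter> {z. lk z 3 = 0} \<inter> {z. lk z 0 + lk z 2 = 1} \<inter> {z. lk z 0 \<le> lk z 2} \<inter>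
     {z. 4 * lk z 2 \<le> 5 * lk z 0} \<inter> {z. 2 * \<bar>lk z 1\<bar> \<le> lk z 0}"
    by (auto simp: reduced_def)
  moreover have "closed (Rn 4 \<inter> {z. lk z 3 = 0} \<inter> {z. lk z 0 + lk z 2 = 1} \<inter> {z. lk z 0 \<le> lk z 2} \<inter>
     {z. 4 * lk z 2 \<le> 5 * lk z 0} \<inter> {z. 2 * \<bar>lk z 1\<bar> \<le> lk z 0})"
    by (intro closed_Int closed_Rn4 closed_Collect_eq closed_Collect_le continuous_on_lookup continuous_on_id
        continuous_on_const continuous_on_add continuous_on_mult continuous_on_rabs)
  ultimately have "closed reduced" by simp
  moreover have "reduced \<subseteq> closure lens" using reduced_flat_core closure_subset[of lens] by (auto simp: flat_core_def)
  ultimately show ?thesis using lens.compact_closure_D by (metis compact_Int_closed inf.absorb_iff2)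
qed

lemma compactin_orbit_cact_reduced:
  assumes det: "a * d - b * c = 1"
  shows "compactin (quotient_topology (top_of_set lens) (orbit tr_vec Gam)) (orbit tr_vec Gam ` cact a b c d ` reduced)"
proof (rule image_compactin)
  have lens: "z \<in> lens" if "z \<in> reduced" for z using that reduced_flat_core by (auto simp: flat_core_def)
  have "continuous_on reduced (cact a b c d)"
    unfolding continuous_on_def
  proof
    fix z assume "z \<in> reduced"
    then show "(cact a b c d \<longlongrightarrow> cact a b c d z) (at z within reduced)"
      using tendsto_cact[OF tendsto_ident_at, of a b z c d reduced] cact_lens(2)[OF det lens] by force
  qed
  then have "compact (cact a b c d ` reduced)" using compact_reduced by (rule compact_continuous_image)
  then show "compactin (top_of_set lens) (cact a b c d ` reduced)"
    using cact_lens(1)[OF det lens] by (auto simp: compactin_subtopology)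
  show "continuous_map (top_of_set lens) (quotient_topology (top_of_set lens) (orbit tr_vec Gam)) (orbit tr_vec Gam)"
    using quotient_map_quotient_topology quotient_imp_continuous_map by blast
qed

text \<open>Positive definite forms take values below a given bound only finitely often.\<close>
lemma shortest_primitive:
  assumes y: "y \<in> lens"
  obtains m n where "prim m n" "\<And>m' n'. prim m' n' \<Longrightarrow> qf m n y \<le> qf m' n' y"
proof -
  have dy: "dt y > 0" using lensD[OF y] by (simp add: pd_def)
  define S where "S = {(m, n). prim m n \<and> qf m n y \<le> qf 1 0 y}"
  have "S \<subseteq> (\<lambda>(a, b, c, d). (a, b)) ` {(a, b, c, d). (real_of_int a)\<^sup>2 + (real_of_int b)\<^sup>2 +
      ((real_of_int c)\<^sup>2 + (real_of_int d)\<^sup>2) \<le> qf 1 0 y / dt y}"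
  proof
    fix e assume "e \<in> S"
    then obtain m n where e: "e = (m, n)" "qf m n y \<le> qf 1 0 y" by (auto simp: S_def)
    have "dt y * ((real_of_int m)\<^sup>2 + (real_of_int n)\<^sup>2) \<le> qf 1 0 y" using qf_lower[OF y, of m n] e(2) by linarith
    then have "(real_of_int m)\<^sup>2 + (real_of_int n)\<^sup>2 \<le> qf 1 0 y / dt y" using dy by (simp add: pos_le_divide_eq mult.commute)
    then show "e \<in> (\<lambda>(a, b, c, d). (a, b)) ` {(a, b, c, d). (real_of_int a)\<^sup>2 + (real_of_int b)\<^sup>2 +
      ((real_of_int c)\<^sup>2 + (real_of_int d)\<^sup>2) \<le> qf 1 0 y / dt y}"
      unfolding e(1) by (intro image_eqI[where x="(m, n, 0, 0)"]) auto
  qed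
  then have fin: "finite S" by (rule finite_subset) (rule finite_imageI[OF bounded_int_quadruples])
  have "prim 1 0" by (auto simp: prim_def intro: exI[of _ 1])
  then have ne: "(1, 0) \<in> S" by (simp add: S_def)
  define h where "h = (\<lambda>(m, n). qf (real_of_int m) (real_of_int n) y)"
  obtain m n where mn: "(m, n) \<in> S" "h (m, n) = Min (h ` S)"
    using Min_in[of "h ` S"] fin ne by (smt (verit) empty_iff finite_imageI image_iff surj_pair)
  show ?thesis
  proof (rule that[of m n])
    show "prim m n" using mn(1) by (simp add: S_def)
    fix m' n' assume p': "prim m' n'"
    show "qf m n y \<le> qf m' n' y"
    proof (cases "(m', n') \<in> S")
      case True
      then have "Min (h ` S) \<le> h (m', n')" using fin by (intro Min_le) auto
      then show ?thesis using mn(2) by (simp add: h_def)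
    next
      case False
      then have "qf 1 0 y < qf m' n' y" using p' by (simp add: S_def)
      then show ?thesis using mn(1) by (simp add: S_def)
    qed
  qed
qed

text \<open>Gauss reduction: the first row of the matrix is a shortest primitive vector, and the second
row is chosen so that the off-diagonal entry is at most half of the first diagonal entry.\<close>
lemma reduction:
  assumes y: "y \<in> flat_core"
  obtains a b c d where "a * d - b * c = 1"
    "qf 1 0 (cact a b c d y) < rt (cact a b c d y) \<or> cact a b c d y \<in> reduced"
proof -
  have yl: "y \<in> lens" "pd y" using y lensD[of y] by (auto simp: flat_core_def)
  obtain m n where p: "prim m n" and min: "\<And>m' n'. prim m' n' \<Longrightarrow> qf m n y \<le> qf m' n' y"
    using shortest_primitive[OF yl(1)] by blast
  obtain r s where rs: "m * s - n * r = 1" using p by (auto simp: prim_def)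
  have mn: "real_of_int m \<noteq> 0 \<or> real_of_int n \<noteq> 0" using prim_nonzero[OF p] .
  define A where "A = qf m n y"
  have A: "A > 0" unfolding A_def by (rule qf_pos[OF yl(2) mn])
  define B where "B = real_of_int m * r * lk y 0 + (real_of_int m * s + n * r) * lk y 1 + real_of_int n * s * lk y 2"
  \<comment> \<open>adding \<open>k\<close> times the first row to the second changes the off-diagonal entry \<open>B\<close> to \<open>B + k A\<close>\<close>
  define k where "k = - round (B / A)"
  define c d where "c = r + k * m" and "d = s + k * n"
  have det: "m * d - n * c = 1" using rs by (simp add: c_def d_def algebra_simps)
  define z where "z = cact m n c d y"
  define N where "N = qf m n y + qf c d y"
  have N: "N > 0" using cact_lens(2)[OF det yl(1)] by (simp add: N_def)
  have zc: "z \<in> flat_core" unfolding z_def by (rule flat_core_cact[OF det y])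
  then have zl: "z \<in> lens" "z \<in> Rn 4" "pd z" "lk z 0 + lk z 2 = 1" "lk z 3 = 0" using lensD[of z] by (auto simp: flat_core_def)
  have z0: "lk z 0 = A / N" and z2: "lk z 2 = qf c d y / N"
    using cact_data(3)[OF det yl(1), of 1 0] cact_data(3)[OF det yl(1), of 0 1]
    by (simp_all add: qf_one z_def N_def A_def)
  have z1: "lk z 1 = (B + k * A) / N"
  proof -
    have "lk z 1 = (m * c * lk y 0 + (m * d + n * c) * lk y 1 + n * d * lk y 2) / N"
      unfolding z_def cact_eq mat_act_rho by (simp flip: N_def)
    also have "m * c * lk y 0 + (m * d + n * c) * lk y 1 + n * d * lk y 2 = B + k * A"
      by (simp add: c_def d_def A_def B_def qf_def power2_eq_square algebra_simps)
    finally show ?thesis .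
  qed
  have le1: "2 * \<bar>lk z 1\<bar> \<le> lk z 0"
  proof -
    have "\<bar>of_int (round (B / A)) - B / A\<bar> \<le> 1 / 2" by (rule of_int_round_abs_le)
    then have "A * (2 * \<bar>of_int (round (B / A)) - B / A\<bar>) \<le> A * 1" using A by (intro mult_left_mono) auto
    also have "A * (2 * \<bar>of_int (round (B / A)) - B / A\<bar>) = 2 * \<bar>A * (of_int (round (B / A)) - B / A)\<bar>"
      using A by (simp add: abs_mult)
    also have "A * (of_int (round (B / A)) - B / A) = - (B + k * A)" using A by (simp add: k_def right_diff_distrib mult.commute)
    finally have "2 * \<bar>B + k * A\<bar> \<le> A" by (simp only: abs_minus_cancel mult_1_right)
    then show ?thesis unfolding z0 z1 using N by (simp add: abs_divide divide_right_mono)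
  qed
  have le2: "lk z 0 \<le> lk z 2"
  proof -
    have "prim c d" unfolding prim_def using det by (intro exI[of _ "- m"] exI[of _ "- n"]) (simp add: algebra_simps)
    then show ?thesis using min[of c d] N by (simp add: z0 z2 A_def divide_right_mono)
  qed
  show ?thesis
  proof (rule that[OF det])
    show "qf 1 0 (cact m n c d y) < rt (cact m n c d y) \<or> cact m n c d y \<in> reduced"
    proof (cases "qf 1 0 z < rt z")
      case True
      then show ?thesis by (simp add: z_def)
    next
      case False
      have z0p: "lk z 0 > 0" using zl(3) by (simp add: pd_def)
      have "rt z \<le> lk z 0" using False by (simp add: qf_one)
      then have "(rt z)\<^sup>2 \<le> (lk z 0)\<^sup>2" using rt_nonneg[OF pd_imp_psd[OF zl(3)]] by (intro power_mono)
      then have 1: "lk z 0 * lk z 2 - (lk z 1)\<^sup>2 \<le> (lk z 0)\<^sup>2" using rt_sq[OF pd_imp_psd[OF zl(3)]] by (simp add: dt_def)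
      have "(2 * \<bar>lk z 1\<bar>)\<^sup>2 \<le> (lk z 0)\<^sup>2" using le1 by (intro power_mono) auto
      then have "4 * (lk z 1)\<^sup>2 \<le> (lk z 0)\<^sup>2" by (simp add: power_mult_distrib)
      then have "4 * (lk z 0 * lk z 2) \<le> 5 * (lk z 0)\<^sup>2" using 1 by linarith
      then have "lk z 0 * (4 * lk z 2) \<le> lk z 0 * (5 * lk z 0)" by (simp add: power2_eq_square)
      then have "4 * lk z 2 \<le> 5 * lk z 0" using z0p by simp
      then have "z \<in> reduced" using zl le1 le2 by (simp add: reduced_def)
      then show ?thesis by (simp add: z_def)
    qed
  qed
qed

text \<open>Up to the finitely many coset representatives, every point of the core can be moved into the
compact set of reduced forms or into the standard horoball. The compact part is the image of the reduced
forms, and the cusps are the translates of the standard one.\<close>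
lemma geometrically_finite_Gam: "geometrically_finite 3 tr_vec lens Gam"
proof -
  obtain R where R: "finite R" "\<And>a b c d. (a, b, c, d) \<in> R \<Longrightarrow> a * d - b * c = 1"
    "\<And>a b c d. a * d - b * c = 1 \<Longrightarrow> \<exists>a' b' c' d' p q r s. (a', b', c', d') \<in> R \<and> lev3 p q r s \<and>
       a = p * a' + q * c' \<and> b = p * b' + q * d' \<and> c = r * a' + s * c' \<and> d = r * b' + s * d'"
    by (rule finite_coset_representatives[OF that])
  let ?O = "orbit tr_vec Gam" and ?X = "v4 (1/2) 0 (1/2) 0"
  define K where "K = (\<Union>(a, b, c, d)\<in>R. ?O ` cact a b c d ` reduced)"
  define F where "F = (\<lambda>(a, b, c, d). (dirpt (real_of_int b) (real_of_int d), cact a b c d ?X)) ` R"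
  have X: "?X \<in> flat_core" using lens_base by (simp add: flat_core_def)
  have Xl: "?X \<in> lens" by (rule lens_base)
  have primR: "prim b d" if "(a, b, c, d) \<in> R" for a b c d
    unfolding prim_def using R(2)[OF that] by (intro exI[of _ "- a"] exI[of _ "- c"]) (simp add: algebra_simps)
  have short: "qf (- real_of_int d) b (cact a b c d z) < rt (cact a b c d z) \<longleftrightarrow> qf 1 0 z < rt z"
    "qf (- real_of_int d) b (cact a b c d z) = rt (cact a b c d z) \<longleftrightarrow> qf 1 0 z = rt z"
    if r: "(a, b, c, d) \<in> R" and z: "z \<in> lens" for a b c d z
  proof -
    note det = R(2)[OF r]
    define N where "N = qf (real_of_int a) b z + qf (real_of_int c) d z"
    have N: "N > 0" using cact_lens(2)[OF det z] by (simp add: N_def)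
    have det': "real_of_int a * d - b * c = 1" using det by (metis of_int_1 of_int_diff of_int_mult)
    have "- real_of_int d * a + b * c = - 1" "- real_of_int d * b + real_of_int b * d = 0" using det' by (simp_all add: algebra_simps)
    then have "qf (- real_of_int d) b (cact a b c d z) = qf (- 1) 0 z / N"
      using cact_data(3)[OF det z, of "- real_of_int d" b] by (simp add: N_def)
    also have "qf (- 1) 0 z = qf 1 0 z" by (simp add: qf_def)
    finally have e: "qf (- real_of_int d) b (cact a b c d z) = qf 1 0 z / N" .
    have e': "rt (cact a b c d z) = rt z / N" using cact_data(4)[OF det z] by (simp add: N_def)
    show "qf (- real_of_int d) b (cact a b c d z) < rt (cact a b c d z) \<longleftrightarrow> qf 1 0 z < rt z"
      "qf (- real_of_int d) b (cact a b c d z) = rt (cact a b c d z) \<longleftrightarrow> qf 1 0 z = rt z"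
      unfolding e e' using N by (simp_all add: divide_less_cancel)
  qed
  have baseX: "qf 1 0 ?X = rt ?X"
  proof -
    have "dt ?X = (1 / 2)\<^sup>2" by (simp add: dt_def power2_eq_square)
    then have "rt ?X = 1 / 2" unfolding rt_def by (simp only: real_sqrt_abs)
    then show ?thesis by (simp add: qf_def)
  qed
  have ball: "horoball lens (dirpt b d) (cact a b c d ?X) \<inter> flat_core = {y \<in> flat_core. qf (- real_of_int d) b y < rt y}"
    if r: "(a, b, c, d) \<in> R" for a b c d
  proof (rule horoball_flat_core)
    show "real_of_int b \<noteq> 0 \<or> real_of_int d \<noteq> 0" using prim_nonzero[OF primR[OF r]] .
    show "cact a b c d ?X \<in> flat_core" by (rule flat_core_cact[OF R(2)[OF r] X])
    show "qf (- real_of_int d) b (cact a b c d ?X) = rt (cact a b c d ?X)" using short(2)[OF r Xl] baseX by blast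
  qed
  have K: "compactin (quotient_topology (top_of_set lens) ?O) K"
    unfolding K_def
  proof (rule compactin_Union)
    show "finite ((\<lambda>(a, b, c, d). ?O ` cact a b c d ` reduced) ` R)" using R(1) by simp
    fix S assume S: "S \<in> (\<lambda>(a, b, c, d). ?O ` cact a b c d ` reduced) ` R"
    obtain a b c d where "(a, b, c, d) \<in> R" "S = ?O ` cact a b c d ` reduced"
    proof -
      obtain e where e: "e \<in> R" "S = (\<lambda>(a, b, c, d). ?O ` cact a b c d ` reduced) e" using S by blast
      obtain a b c d where "e = (a, b, c, d)" by (rule prod_cases4)
      then show thesis using e by (intro that[of a b c d]) simp_all
    qed
    then show "compactin (quotient_topology (top_of_set lens) ?O) S"
      using compactin_orbit_cact_reduced[OF R(2)] by simp
  qed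
  have F: "\<xi> \<in> bdry lens \<and> x \<in> lens \<and> maximal_parabolic_subgroup 3 tr_vec lens Gam (stab tr_vec Gam \<xi>) \<and>
      (\<forall>g\<in>Gam. \<forall>y\<in>horoball lens \<xi> x \<inter> flat_core.
        chart_act tr_vec g y \<in> horoball lens \<xi> x \<inter> flat_core \<longrightarrow> g \<in> stab tr_vec Gam \<xi>)"
    if "(\<xi>, x) \<in> F" for \<xi> x
  proof -
    obtain a b c d where r: "(a, b, c, d) \<in> R" and e: "\<xi> = dirpt b d" "x = cact a b c d ?X"
    proof -
      obtain e where e: "e \<in> R" "(\<xi>, x) = (\<lambda>(a, b, c, d). (dirpt (real_of_int b) (real_of_int d), cact a b c d ?X)) e"
        using \<open>(\<xi>, x) \<in> F\<close> unfolding F_def by blast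
      obtain a b c d where "e = (a, b, c, d)" by (rule prod_cases4)
      then show thesis using e by (intro that[of a b c d]) simp_all
    qed
    show ?thesis
      unfolding e ball[OF r]
    proof (intro conjI ballI impI)
      show "dirpt b d \<in> bdry lens" using circle_bdry[OF dirpt_circle[OF prim_nonzero[OF primR[OF r]]]] .
      show "cact a b c d ?X \<in> lens" by (rule cact_lens(1)[OF R(2)[OF r] Xl])
      show "maximal_parabolic_subgroup 3 tr_vec lens Gam (stab tr_vec Gam (dirpt b d))"
        by (rule maximal_parabolic[OF primR[OF r]])
      fix g y assume g: "g \<in> Gam" and y: "y \<in> {y \<in> flat_core. qf (- real_of_int d) b y < rt y}"
        and gy: "chart_act tr_vec g y \<in> {y \<in> flat_core. qf (- real_of_int d) b y < rt y}"
      obtain a' b' c' d' where g': "g = rho a' b' c' d'" "lev3 a' b' c' d'" using g unfolding Gam_def by blast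
      show "g \<in> stab tr_vec Gam (dirpt b d)"
        unfolding g'(1)
        by (rule cusp_embedded[OF primR[OF r] g'(2), of y]) (use y gy g' in auto)
    qed
  qed
  have cover: "?O ` flat_core = K \<union> (\<Union>(\<xi>, x)\<in>F. ?O ` (horoball lens \<xi> x \<inter> flat_core))"
  proof
    have "K \<subseteq> ?O ` flat_core"
    proof
      fix P assume "P \<in> K"
      then obtain a b c d z where "(a, b, c, d) \<in> R" "z \<in> reduced" "P = ?O (cact a b c d z)" unfolding K_def by fast
      then show "P \<in> ?O ` flat_core" using flat_core_cact[OF R(2)] reduced_flat_core by blast
    qed
    then show "K \<union> (\<Union>(\<xi>, x)\<in>F. ?O ` (horoball lens \<xi> x \<inter> flat_core)) \<subseteq> ?O ` flat_core" by auto
    show "?O ` flat_core \<subseteq> K \<union> (\<Union>(\<xi>, x)\<in>F. ?O ` (horoball lens \<xi> x \<inter> flat_core))"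
    proof
      fix P assume "P \<in> ?O ` flat_core"
      then obtain y where y: "y \<in> flat_core" "P = ?O y" by blast
      have yl: "y \<in> lens" using y(1) by (simp add: flat_core_def)
      obtain m n r s where det: "m * s - n * r = 1"
        and alt: "qf 1 0 (cact m n r s y) < rt (cact m n r s y) \<or> cact m n r s y \<in> reduced"
        by (rule reduction[OF y(1) that])
      define z where "z = cact m n r s y"
      have z: "z \<in> flat_core" "z \<in> lens" unfolding z_def using flat_core_cact[OF det y(1)] by (auto simp: flat_core_def)
      have "s * m - (- n) * (- r) = 1" using det by (simp add: algebra_simps)
      note e0 = R(3)[OF this]
      obtain a b c d p q p' q' where r: "(a, b, c, d) \<in> R" and l: "lev3 p q p' q'"
        and e: "s = p * a + q * c" "- n = p * b + q * d" "- r = p' * a + q' * c" "m = p' * b + q' * d"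
        using e0 by (elim exE conjE) (rule that; assumption)
      have yz: "y = cact p q p' q' (cact a b c d z)"
      proof -
        have "cact p q p' q' (cact a b c d z) = cact s (- n) (- r) m z"
          unfolding cact_mult[OF R(2)[OF r] z(2)] e[symmetric] ..
        also have "\<dots> = cact (s * m + - n * r) (s * n + - n * s) (- r * m + m * r) (- r * n + m * s) y"
          unfolding z_def by (rule cact_mult[OF det yl])
        also have "\<dots> = cact 1 0 0 1 y"
        proof -
          have "s * m + - n * r = 1" "s * n + - n * s = 0" "- r * m + m * r = 0" "- r * n + m * s = 1"
            using det by (simp_all add: algebra_simps)
          then show ?thesis by simp
        qed
        finally show ?thesis using cact_one[OF yl] by simp
      qed
      have P: "P = ?O (cact a b c d z)"
        unfolding y(2) by (subst yz) (rule orbit_cact[OF l cact_lens(1)[OF R(2)[OF r] z(2)]])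
      show "P \<in> K \<union> (\<Union>(\<xi>, x)\<in>F. ?O ` (horoball lens \<xi> x \<inter> flat_core))"
        using alt unfolding z_def[symmetric]
      proof
        assume "z \<in> reduced"
        then have "P \<in> K" unfolding K_def P using r by force
        then show ?thesis by blast
      next
        assume "qf 1 0 z < rt z"
        then have "cact a b c d z \<in> horoball lens (dirpt b d) (cact a b c d ?X) \<inter> flat_core"
          unfolding ball[OF r] using short(1)[OF r z(2)] flat_core_cact[OF R(2)[OF r] z(1)] by blast
        moreover have "(dirpt b d, cact a b c d ?X) \<in> F" unfolding F_def using r by force
        ultimately show ?thesis unfolding P by blast
      qed
    qed
  qed
  have "finite F" unfolding F_def using R(1) by simp
  then show ?thesis
    unfolding geometrically_finite_def core_lift_eq
    using K F cover by (intro exI[of _ K] exI[of _ F]) auto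
qed

section \<open>The lens as a projective domain\<close>

lemma span_line_eqD:
  assumes "span {x} = span {v}" "x \<noteq> (0 :: rseq)"
  obtains c where "c \<noteq> 0" "x = c *\<^sub>R v"
proof -
  have "x \<in> span {v}" using assms(1) by (metis insertI1 span_base)
  then obtain c where "x = c *\<^sub>R v" by (auto simp: span_singleton)
  then show ?thesis using assms(2) that by auto
qed

lemma span_line_scale: "c \<noteq> 0 \<Longrightarrow> span {c *\<^sub>R v} = span {v :: rseq}"
  by (rule span_image_scale[of "{v}" "\<lambda>_. c", simplified])

lemma lens_cone_nonzero: "v \<in> lens_cone \<Longrightarrow> v \<noteq> 0"
  by (auto simp: lens_cone_def pd_def)

lemma span_in_Omega_iff:
  assumes "x \<noteq> 0" shows "span {x} \<in> Omega \<longleftrightarrow> x \<in> lens_cone \<or> - x \<in> lens_cone"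
proof
  assume "span {x} \<in> Omega"
  then obtain v where v: "v \<in> lens_cone" "span {x} = span {v}" unfolding Omega_def by blast
  obtain c where c: "c \<noteq> 0" "x = c *\<^sub>R v" using span_line_eqD[OF v(2) assms] .
  show "x \<in> lens_cone \<or> - x \<in> lens_cone"
  proof (cases "c > 0")
    case True then show ?thesis using lens_cone_scale[OF v(1)] c by simp
  next
    case False
    then have "(- c) *\<^sub>R v \<in> lens_cone" using c(1) by (intro lens_cone_scale[OF v(1)]) simp
    then show ?thesis using c by simp
  qed
next
  assume "x \<in> lens_cone \<or> - x \<in> lens_cone"
  moreover have "span {- x} = span {x}" using span_line_scale[of "- 1" x] by simp
  ultimately show "span {x} \<in> Omega" unfolding Omega_def by (metis imageI)
qed

lemma openin_Omega: "openin (proj_space 3) Omega"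
proof -
  have four: "Suc 3 = 4" by simp
  have zero: "0 \<notin> lens_cone" using lens_cone_nonzero by blast
  have sub: "lens_cone \<subseteq> Rn 4 - {0}" using zero by (auto simp: lens_cone_def)
  have pre: "{x \<in> Rn 4 - {0}. span {x} \<in> Omega} = lens_cone \<union> uminus ` lens_cone"
  proof
    show "{x \<in> Rn 4 - {0}. span {x} \<in> Omega} \<subseteq> lens_cone \<union> uminus ` lens_cone"
      using span_in_Omega_iff by force
    show "lens_cone \<union> uminus ` lens_cone \<subseteq> {x \<in> Rn 4 - {0}. span {x} \<in> Omega}"
    proof
      fix x assume x: "x \<in> lens_cone \<union> uminus ` lens_cone"
      then have "x \<in> lens_cone \<or> - x \<in> lens_cone" by auto
      moreover have "x \<in> Rn 4 - {0}" using x sub Rn4_intros(4) by auto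
      ultimately show "x \<in> {x \<in> Rn 4 - {0}. span {x} \<in> Omega}" using span_in_Omega_iff by blast
    qed
  qed
  have ball: "\<exists>e>0. \<forall>y\<in>Rn 4. dist y x < e \<longrightarrow> y \<in> lens_cone" if x: "x \<in> lens_cone" for x
  proof -
    obtain e where e: "e > 0" "\<And>w. w \<in> Rn 4 \<Longrightarrow> norm w < e \<Longrightarrow> x + w \<in> lens_cone" using lens_cone_open[OF x] by blast
    have "y \<in> lens_cone" if "y \<in> Rn 4" "dist y x < e" for y
    proof -
      have "y - x \<in> Rn 4" using that(1) x sub by (auto intro: Rn4_intros)
      then show ?thesis using e(2)[of "y - x"] that(2) by (simp add: dist_norm)
    qed
    then show ?thesis using e(1) by blast
  qed
  have "openin (top_of_set (Rn 4 - {0})) (lens_cone \<union> uminus ` lens_cone)"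
    unfolding openin_euclidean_subtopology_iff
  proof (intro conjI ballI)
    show "lens_cone \<union> uminus ` lens_cone \<subseteq> Rn 4 - {0}" unfolding pre[symmetric] by blast
    fix x assume "x \<in> lens_cone \<union> uminus ` lens_cone"
    then consider "x \<in> lens_cone" | "- x \<in> lens_cone" by auto
    then show "\<exists>e>0. \<forall>x'\<in>Rn 4 - {0}. dist x' x < e \<longrightarrow> x' \<in> lens_cone \<union> uminus ` lens_cone"
    proof cases
      case 1 then show ?thesis using ball by blast
    next
      case 2
      then obtain e where e: "e > 0" "\<And>y. y \<in> Rn 4 \<Longrightarrow> dist y (- x) < e \<Longrightarrow> y \<in> lens_cone" using ball by blast
      have "y \<in> uminus ` lens_cone" if "y \<in> Rn 4 - {0}" "dist y x < e" for y
      proof (rule image_eqI[of _ _ "- y"])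
        show "- y \<in> lens_cone"
        proof (rule e(2))
          show "- y \<in> Rn 4" using that(1) Rn4_intros(4) by blast
          show "dist (- y) (- x) < e" using that(2) by (simp add: dist_minus)
        qed
      qed simp
      then show ?thesis using e(1) by blast
    qed
  qed
  moreover have "Omega \<subseteq> (\<lambda>v. span {v}) ` (Rn 4 - {0})" unfolding Omega_def using sub by blast
  ultimately show ?thesis unfolding proj_space_def openin_quotient_topology four using pre by simp
qed

text \<open>The lines with \<open>v\<^sub>3\<^sup>2 \<le> dt v\<close> form a closed set that contains
the domain. On them the trace vanishes only at 0, so they lie in the chart.\<close>
lemma closure_of_Omega:
  "proj_space 3 closure_of Omega \<subseteq> (\<lambda>v. span {v}) ` affine_chart 3 tr_vec"
proof -
  have four: "Suc 3 = 4" by simp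
  define C where "C = {x \<in> Rn 4 - {0}. (lk x 3)\<^sup>2 \<le> dt x}"
  let ?T = "(\<lambda>v. span {v}) ` C"
  have top: "topspace (proj_space 3) = (\<lambda>v. span {v}) ` (Rn 4 - {0})"
    unfolding proj_space_def topspace_quotient_topology four by simp
  have mem: "span {x} \<in> ?T \<longleftrightarrow> x \<in> C" if x: "x \<in> Rn 4 - {0}" for x
  proof
    assume "span {x} \<in> ?T"
    then obtain v where v: "v \<in> C" "span {x} = span {v}" by blast
    obtain c where c: "c \<noteq> 0" "x = c *\<^sub>R v" using span_line_eqD[OF v(2)] x by blast
    have "(lk v 3)\<^sup>2 \<le> dt v" using v(1) by (simp add: C_def)
    then have "(lk x 3)\<^sup>2 \<le> dt x" by (simp add: c(2) dt_scale power_mult_distrib mult_left_mono)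
    then show "x \<in> C" using x by (simp add: C_def)
  qed blast
  have "closedin (proj_space 3) ?T"
    unfolding closedin_def
  proof
    show "?T \<subseteq> topspace (proj_space 3)" unfolding top by (auto simp: C_def)
    have pre: "{x \<in> Rn 4 - {0}. span {x} \<in> topspace (proj_space 3) - ?T} = (Rn 4 - {0}) \<inter> {x. dt x < (lk x 3)\<^sup>2}"
    proof (rule equalityI; rule subsetI)
      fix x assume "x \<in> {x \<in> Rn 4 - {0}. span {x} \<in> topspace (proj_space 3) - ?T}"
      then have x: "x \<in> Rn 4 - {0}" "x \<notin> C" using mem by blast+
      then show "x \<in> (Rn 4 - {0}) \<inter> {x. dt x < (lk x 3)\<^sup>2}" by (simp add: C_def not_le)
    next
      fix x assume x: "x \<in> (Rn 4 - {0}) \<inter> {x. dt x < (lk x 3)\<^sup>2}"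
      then have "x \<in> Rn 4 - {0}" "x \<notin> C" by (auto simp: C_def)
      then show "x \<in> {x \<in> Rn 4 - {0}. span {x} \<in> topspace (proj_space 3) - ?T}" using mem unfolding top by blast
    qed
    have "open {x. dt x < (lk x 3)\<^sup>2}"
      by (intro open_Collect_less continuous_on_dt continuous_on_power continuous_on_lookup continuous_on_id)
    then have "openin (top_of_set (Rn 4 - {0})) {x \<in> Rn 4 - {0}. span {x} \<in> topspace (proj_space 3) - ?T}"
      unfolding pre by (rule openin_open_Int)
    then show "openin (proj_space 3) (topspace (proj_space 3) - ?T)"
      by (simp add: top) (simp add: proj_space_def openin_quotient_topology four Diff_subset)
  qed
  moreover have "Omega \<subseteq> ?T"
  proof -
    have "v \<in> C" if v: "v \<in> lens_cone" for v
    proof -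
      have pd: "pd v" and R: "v \<in> Rn 4" and w: "\<bar>lk v 3\<bar> \<le> rt v"
        using v width_le_rt[of v] by (auto simp: lens_cone_def)
      have "\<bar>lk v 3\<bar>\<^sup>2 \<le> (rt v)\<^sup>2" using w by (intro power_mono) auto
      then show ?thesis using rt_sq[OF pd_imp_psd[OF pd]] R lens_cone_nonzero[OF v] by (simp add: C_def)
    qed
    then show ?thesis unfolding Omega_def by blast
  qed
  ultimately have "proj_space 3 closure_of Omega \<subseteq> ?T" by (simp add: closure_of_minimal)
  also have "?T \<subseteq> (\<lambda>v. span {v}) ` affine_chart 3 tr_vec"
  proof
    fix P assume "P \<in> ?T"
    then obtain v where P: "P = span {v}" and v: "v \<in> Rn 4" "v \<noteq> 0" "(lk v 3)\<^sup>2 \<le> dt v" by (auto simp: C_def)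
    define \<tau> where "\<tau> = lk v 0 + lk v 2"
    have "\<tau> \<noteq> 0"
    proof
      assume "\<tau> = 0"
      then have "lk v 2 = - lk v 0" by (simp add: \<tau>_def)
      then have "(lk v 0)\<^sup>2 + ((lk v 1)\<^sup>2 + (lk v 3)\<^sup>2) \<le> 0" using v(3) unfolding dt_def by (simp add: power2_eq_square)
      moreover have "0 \<le> (lk v 0)\<^sup>2" "0 \<le> (lk v 1)\<^sup>2" "0 \<le> (lk v 3)\<^sup>2" by auto
      ultimately have "(lk v 0)\<^sup>2 = 0" "(lk v 1)\<^sup>2 = 0" "(lk v 3)\<^sup>2 = 0" by linarith+
      then have "v = 0" using \<open>lk v 2 = - lk v 0\<close> v(1) by (intro Rn4_eqI) (auto intro: Rn4_intros)
      then show False using v(2) by blast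
    qed
    then have "(1 / \<tau>) *\<^sub>R v \<in> affine_chart 3 tr_vec" "span {(1 / \<tau>) *\<^sub>R v} = span {v}"
      using v(1) span_line_scale[of "1 / \<tau>" v]
      by (auto simp: affine_chart_eq Rn4_intros \<tau>_def simp flip: add_divide_distrib)
    then show "P \<in> (\<lambda>v. span {v}) ` affine_chart 3 tr_vec" unfolding P by (metis imageI)
  qed
  finally show ?thesis .
qed

lemma in_chart_Omega: "in_chart 3 tr_vec Omega = lens"
proof (rule equalityI; rule subsetI)
  fix v assume "v \<in> in_chart 3 tr_vec Omega"
  then have v: "v \<in> Rn 4" "lk v 0 + lk v 2 = 1" "span {v} \<in> Omega" by (auto simp: in_chart_def affine_chart_eq)
  then have "v \<noteq> 0" by auto
  then have "v \<in> lens_cone \<or> - v \<in> lens_cone" using span_in_Omega_iff v(3) by blast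
  moreover have "- v \<notin> lens_cone" using lens_cone_normalise(1)[of "- v"] v(2) by auto
  ultimately show "v \<in> lens" using v by (simp add: lens_def)
next
  fix v assume "v \<in> lens"
  then show "v \<in> in_chart 3 tr_vec Omega"
    unfolding in_chart_def affine_chart_eq lens_def Omega_def by (auto simp: lens_cone_def)
qed

lemma properly_convex_Omega: "properly_convex_in 3 tr_vec Omega"
  unfolding properly_convex_in_def
proof (intro conjI)
  show "tr_vec \<in> Rn (Suc 3)" using tr_vec_Rn4 by simp
  show "tr_vec \<noteq> 0" using inner_tr_tr by auto
  show "Omega \<noteq> {}" unfolding Omega_def using lens_base by (auto simp: lens_def)
  show "convex (in_chart 3 tr_vec Omega)" unfolding in_chart_Omega by (rule convex_lens)
qed (rule openin_Omega closure_of_Omega)+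

section \<open>The slow geodesic\<close>

text \<open>The direction of the diameter of the disc that joins the two diagonal rank one
matrices.\<close>
definition axis_dir :: rseq where "axis_dir = (1 / sqrt 2) *\<^sub>R v4 1 0 (- 1) 0"

lemma axis_dir_V0: "axis_dir \<in> V0"
  by (auto simp: axis_dir_def V0_def intro: Rn4_intros)

lemma norm_axis_dir: "norm axis_dir = 1"
  by (simp add: axis_dir_def norm_eq_sqrt_inner inner_Rn4 power2_eq_square)

lemma axis_point:
  "v4 0 0 1 0 + s *\<^sub>R axis_dir = v4 (s / sqrt 2) 0 (1 - s / sqrt 2) 0"
  by (rule Rn4_eqI) (auto intro!: Rn4_intros simp: axis_dir_def lookup_add)

lemma flat_point_lens:
  assumes "0 < r" "r < 1" shows "v4 r 0 (1 - r) 0 \<in> lens"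
proof -
  have "pd (v4 r 0 (1 - r) 0)" using assms by (simp add: pd_def dt_def)
  then show ?thesis using width_pos by (simp add: lens_def lens_cone_def)
qed

lemma corner_circle: "v4 1 0 0 0 \<in> circle" "v4 0 0 1 0 \<in> circle"
  by (simp_all add: circle_def psd_def dt_def)

lemma inner_axis_dir: "inner axis_dir y = (lk y 0 - lk y 2) / sqrt 2"
  by (simp add: axis_dir_def inner_Rn4)

text \<open>The supporting half-spaces at the two ends are given by the positive entries
\<open>v\<^sub>2\<close> and \<open>v\<^sub>0\<close>. As \<open>v\<^sub>0 + v\<^sub>2 = 1\<close> in
the chart, both normals are parallel to the diameter.\<close>
lemma flat_line_axis: "flat_line V0 lens (v4 1 0 0 0) (v4 0 0 1 0) axis_dir (sqrt 2)"
proof (intro flat_line.intro flat_line_axioms.intro)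
  show "smooth_convex_domain V0 lens" by (rule smooth_convex_domain_lens)
  show p: "v4 1 0 0 0 \<in> bdry lens" and q: "v4 0 0 1 0 \<in> bdry lens"
    using corner_circle circle_bdry by blast+
  show "0 < sqrt 2" by simp
  show "axis_dir \<in> V0" by (rule axis_dir_V0)
  show "norm axis_dir = 1" by (rule norm_axis_dir)
  show "v4 1 0 0 0 = v4 0 0 1 0 + sqrt 2 *\<^sub>R axis_dir" unfolding axis_point by simp
  have y02: "lk y 0 > 0" "lk y 2 > 0" "lk y 0 + lk y 2 = 1" if "y \<in> lens" for y
    using lensD[OF that] pd_lookup2[of y] by (auto simp: pd_def)
  show "lens.nrm (v4 1 0 0 0) = - axis_dir"
  proof (rule lens.nrm_eqI[OF p])
    show "- axis_dir \<in> V0" using axis_dir_V0 subspace_neg[OF subspace_V0] by blast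
    show "norm (- axis_dir) = 1" using norm_axis_dir by simp
    fix y assume y: "y \<in> lens"
    have "inner (- axis_dir) (y - v4 1 0 0 0) = (1 - lk y 0 + lk y 2) / sqrt 2"
      by (simp add: inner_axis_dir inner_diff_right lookup_minus diff_divide_distrib add_divide_distrib)
    then show "0 \<le> inner (- axis_dir) (y - v4 1 0 0 0)" using y02[OF y] by simp
  qed
  show "lens.nrm (v4 0 0 1 0) = axis_dir"
  proof (rule lens.nrm_eqI[OF q axis_dir_V0 norm_axis_dir])
    fix y assume y: "y \<in> lens"
    have "inner axis_dir (y - v4 0 0 1 0) = (1 + lk y 0 - lk y 2) / sqrt 2"
      by (simp add: inner_axis_dir inner_diff_right lookup_minus diff_divide_distrib add_divide_distrib)
    then show "0 \<le> inner axis_dir (y - v4 0 0 1 0)" using y02[OF y] by simp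
  qed
  fix s :: real assume s: "0 < s" "s < sqrt 2"
  then show "v4 0 0 1 0 + s *\<^sub>R axis_dir \<in> lens"
    unfolding axis_point by (intro flat_point_lens) auto
qed

interpretation axis: flat_line V0 lens "v4 1 0 0 0" "v4 0 0 1 0" axis_dir "sqrt 2"
  by (rule flat_line_axis)

lemma HV_axis: "axis.HV = HOmega 3 tr_vec lens"
  by (simp add: axis.HV_def HOmega_def chart_dirs_eq)

lemma vertical_W: "v4 0 0 0 1 \<in> axis.W"
  unfolding axis.W_def by (simp add: V0_def inner_axis_dir)

lemma one_minus_share: "1 + x \<noteq> 0 \<Longrightarrow> 1 - x / (1 + x) = 1 / (1 + x)" for x :: real
  by (simp add: field_simps)

text \<open>For \<open>e > 1\<close> the vector \<open>(0, 1)\<close> is short, so it alone determines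
the width.\<close>
lemma width_axis:
  assumes e: "e > 1"
  shows "width (v4 (e\<^sup>2 / (1 + e\<^sup>2)) 0 (1 - e\<^sup>2 / (1 + e\<^sup>2)) 0) = prof e / (1 + e\<^sup>2)"
proof -
  have E: "1 + e\<^sup>2 > 0" "e\<^sup>2 > 0" using e by (auto simp: add_pos_pos)
  define y where "y = v4 (e\<^sup>2 / (1 + e\<^sup>2)) 0 (1 - e\<^sup>2 / (1 + e\<^sup>2)) 0"
  have r1: "1 - e\<^sup>2 / (1 + e\<^sup>2) = 1 / (1 + e\<^sup>2)" by (rule one_minus_share) (use E in linarith)
  have dty: "dt y = (e / (1 + e\<^sup>2))\<^sup>2" unfolding y_def r1 by (simp add: dt_def power_divide power2_eq_square)
  have "e / (1 + e\<^sup>2) > 0" by (rule divide_pos_pos) (use e E in linarith)+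
  then have rty: "rt y = e / (1 + e\<^sup>2)" unfolding rt_def dty by (simp only: real_sqrt_abs abs_of_pos)
  have q: "qf (real_of_int 0) (real_of_int 1) y = 1 / (1 + e\<^sup>2)" unfolding y_def r1 by (simp add: qf_def)
  have "dt y > 0" unfolding dty by (rule zero_less_power) (rule \<open>e / (1 + e\<^sup>2) > 0\<close>)
  moreover have "lk y 0 > 0" using divide_pos_pos[OF E(2,1)] by (simp add: y_def)
  ultimately have pd: "pd y" by (simp add: pd_def)
  have p: "prim 0 1" unfolding prim_def by (intro exI[of _ "-1"] exI[of _ 0]) simp
  have small: "qf (real_of_int 0) (real_of_int 1) y < rt y" unfolding q rty by (rule divide_strict_right_mono[OF e E(1)])
  have "width y = hgt (qf (real_of_int 0) (real_of_int 1) y) (rt y)"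
  proof (rule width_eqI[OF pd p])
    fix m' n' assume "prim m' n'"
    then show "hgt (qf (real_of_int 0) (real_of_int 1) y) (rt y) \<le> hgt (qf m' n' y) (rt y)"
      by (rule active_min[OF pd p _ small])
  qed
  also have "\<dots> = hgt (1 / (1 + e\<^sup>2)) (e / (1 + e\<^sup>2))" unfolding q rty ..
  also have "\<dots> = prof e / (1 + e\<^sup>2)"
  proof -
    have "hgt (1 / k) (e / k) = prof e / k" if "k > 0" for k using that by (simp add: hgt_def)
    then show ?thesis using E(1) by blast
  qed
  finally show ?thesis unfolding y_def .
qed

text \<open>The Euclidean contraction along the stable direction and the width of the lens have the same
denominator, so that only the profile remains.\<close>
lemma finsler_vertical_axis:
  assumes t: "exp t \<ge> 2"
  shows "finsler lens (axis.pt (axis.pos t (sqrt 2 / 2)))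
    (((sqrt 2 - axis.pos t (sqrt 2 / 2)) / (sqrt 2 - sqrt 2 / 2)) *\<^sub>R v4 0 0 0 1) = 1 / (1 + t - ln 2)"
proof -
  define e where "e = exp t"
  have e: "e > 1" "e \<ge> 2" using t unfolding e_def by linarith+
  have e2: "exp (2 * t) = e\<^sup>2" by (simp add: e_def exp_double)
  have E: "1 + e\<^sup>2 > 0" by (simp add: add_pos_nonneg)
  let ?l = "sqrt 2"
  define r where "r = e\<^sup>2 / (1 + e\<^sup>2)"
  have pos: "axis.pos t (?l / 2) = ?l * r"
  proof -
    have den: "?l - ?l / 2 + e\<^sup>2 * (?l / 2) = (?l / 2) * (1 + e\<^sup>2)" by (simp add: distrib_left)
    show ?thesis unfolding axis.pos_def e2 den r_def using E by simp
  qed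
  have r1: "1 - r = 1 / (1 + e\<^sup>2)" unfolding r_def by (rule one_minus_share) (use E in linarith)
  have pt: "axis.pt (?l * r) = v4 r 0 (1 - r) 0" unfolding axis.pt_def axis_point by simp
  have rr: "0 < r" "r < 1" using E e by (auto simp: r_def)
  have c: "(?l - ?l * r) / (?l - ?l / 2) = 2 / (1 + e\<^sup>2)"
  proof -
    have "?l - ?l * r = ?l * (1 - r)" by (simp add: right_diff_distrib)
    moreover have "?l - ?l / 2 = ?l / 2" by simp
    ultimately show ?thesis unfolding r1 by simp
  qed
  have w: "width (v4 r 0 (1 - r) 0) = prof e / (1 + e\<^sup>2)" unfolding r_def by (rule width_axis[OF e(1)])
  have pe: "prof e = 2 * (1 + t - ln 2)"
  proof (cases "e = 2")
    case True
    then have "t = ln 2" by (metis e_def ln_exp)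
    then show ?thesis using True by (simp add: prof_def)
  next
    case False
    have "ln (e / 2) = t - ln 2" using ln_div[of e 2] e by (simp add: e_def)
    then show ?thesis using False e by (simp add: prof_def)
  qed
  have "finsler lens (v4 r 0 (1 - r) 0) ((2 / (1 + e\<^sup>2)) *\<^sub>R v4 0 0 0 1) = (2 / (1 + e\<^sup>2)) / (prof e / (1 + e\<^sup>2))"
    using finsler_vertical[OF flat_point_lens[OF rr], of "2 / (1 + e\<^sup>2)"] E unfolding w by simp
  also have "\<dots> = 2 / prof e"
  proof -
    have "(2 / k) / (x / k) = 2 / x" if "k > 0" for k x :: real using that by simp
    then show ?thesis using E by blast
  qed
  also have "\<dots> = 1 / (1 + t - ln 2)"
  proof -
    have "2 / (2 * k) = 1 / k" for k :: real by simp
    then show ?thesis unfolding pe .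
  qed
  finally show ?thesis unfolding pos pt c .
qed

lemma half_bounds: "0 < sqrt 2 / 2" "sqrt 2 / 2 < sqrt 2" by simp_all

lemma exp_ge_two: "t \<ge> ln 2 \<Longrightarrow> exp t \<ge> (2::real)"
  by (metis exp_le_cancel_iff exp_ln zero_less_numeral)

lemma axis_NW:
  assumes "0 < s" "s < sqrt 2"
  shows "(axis.pt s, axis_dir) \<in> NW_lift 3 tr_vec lens Gam"
  using axis.line_in_D[OF assms] axis_dir_V0 norm_axis_dir axis.ray_end_pt[OF assms] corner_circle
  unfolding NW_lift_def limit_set_eq_circle HV_axis[symmetric] axis.HV_def fwd_end_def bwd_end_def
  by (simp add: axis.pt_def)

text \<open>The logarithm of a norm that decays like \<open>1 / t\<close> grows only like \<open>ln
t\<close>.\<close>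
lemma zero_exponent: "zero_Lyapunov_exponent 3 tr_vec lens Gam"
proof -
  let ?s = "sqrt 2 / 2" and ?e3 = "v4 0 0 0 1"
  let ?w = "(axis.pt ?s, axis_dir)" and ?Z = "axis.tan_vec ?s 0 (v4 0 0 0 1) 0"
  have Z: "?Z = (?e3, (- 1 / (sqrt 2 - ?s)) *\<^sub>R ?e3)" by (simp add: axis.tan_vec_def)
  have Zs: "?Z \<in> E_stable lens ?w" unfolding axis.E_stable_eq[OF half_bounds] Z using vertical_W by blast
  have "(0, (1 / ?s) *\<^sub>R 0) \<in> E_unstable lens ?w"
    unfolding axis.E_unstable_eq[OF half_bounds] using subspace_0[OF axis.subspace_W] by blast
  then have Zu: "0 \<in> E_unstable lens ?w" by (simp add: zero_prod_def)
  have "?e3 \<noteq> 0" by (metis lookup_v4_simps(4) lookup_zero zero_neq_one)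
  then have ne: "?Z + 0 \<noteq> 0" unfolding Z by (simp add: zero_prod_def)
  have ev: "hnorm lens (flow lens t ?w) (dflow 3 tr_vec lens t ?w (?Z + 0)) = 1 / (1 + t - ln 2)" if "t \<ge> ln 2" for t
    using axis.hnorm_dflow_stable[OF half_bounds vertical_W, of t] finsler_vertical_axis[OF exp_ge_two[OF that]]
    unfolding dflow_def HV_axis by simp
  have "((\<lambda>t::real. 1 / t * ln (1 / (1 + t - ln 2))) \<longlongrightarrow> 0) at_top"
    by real_asymp
  moreover have "\<forall>\<^sub>F t in at_top. 1 / t * ln (1 / (1 + t - ln 2)) =
      1 / t * ln (hnorm lens (flow lens t ?w) (dflow 3 tr_vec lens t ?w (?Z + 0)))"
    using eventually_ge_at_top[of "ln 2"] by eventually_elim (simp only: ev)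
  ultimately have "((\<lambda>t. 1 / t * ln (hnorm lens (flow lens t ?w) (dflow 3 tr_vec lens t ?w (?Z + 0)))) \<longlongrightarrow> 0) at_top"
    by (rule Lim_transform_eventually)
  then have "((\<lambda>t. ereal (1 / t * ln (hnorm lens (flow lens t ?w) (dflow 3 tr_vec lens t ?w (?Z + 0))))) \<longlongrightarrow> ereal 0) at_top"
    by (rule tendsto_ereal)
  then have "Limsup at_top (\<lambda>t. ereal (1 / t * ln (hnorm lens (flow lens t ?w) (dflow 3 tr_vec lens t ?w (?Z + 0))))) = 0"
    unfolding zero_ereal_def by (intro lim_imp_Limsup) simp_all
  then show ?thesis
    unfolding zero_Lyapunov_exponent_def using axis_NW[OF half_bounds] Zs Zu ne by blast
qed

lemma not_hyperbolic: "\<not> uniformly_hyperbolic 3 tr_vec lens Gam"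
proof
  assume "uniformly_hyperbolic 3 tr_vec lens Gam"
  then obtain As Au b C where split: "\<forall>w\<in>NW_lift 3 tr_vec lens Gam.
      subspace (As w) \<and> subspace (Au w) \<and>
      bij_betw (\<lambda>(\<alpha>, Zs, Zu). \<alpha> *\<^sub>R flow_field lens w + Zs + Zu) (UNIV \<times> As w \<times> Au w) (tangent_space (HOmega 3 tr_vec lens) w) \<and>
      (\<forall>t. dflow 3 tr_vec lens t w ` As w = As (flow lens t w) \<and> dflow 3 tr_vec lens t w ` Au w = Au (flow lens t w)) \<and>
      (\<forall>g\<in>Gam. dH_act 3 tr_vec lens g w ` As w = As (H_act tr_vec g w) \<and> dH_act 3 tr_vec lens g w ` Au w = Au (H_act tr_vec g w))"
    and bC: "b > 0" "C > 0"
    and hyp: "\<forall>w\<in>NW_lift 3 tr_vec lens Gam. \<forall>t\<ge>0.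
      (\<forall>Z\<in>As w. hnorm lens (flow lens t w) (dflow 3 tr_vec lens t w Z) \<le> C * exp (- b * t) * hnorm lens w Z) \<and>
      (\<forall>Z\<in>Au w. hnorm lens (flow lens (- t) w) (dflow 3 tr_vec lens (- t) w Z) \<le> C * exp (- b * t) * hnorm lens w Z)"
    unfolding uniformly_hyperbolic_def by (elim exE conjE bexE) (rule that; assumption)
  show False
  proof (rule axis.no_hyperbolic_splitting[OF half_bounds vertical_W, of "NW_lift 3 tr_vec lens Gam" As Au b C])
    fix b' C' :: real assume b': "b' > 0"
    have "((\<lambda>t::real. C' * exp (- b' * t) * (1 + t - ln 2)) \<longlongrightarrow> 0) at_top"
      using b' by real_asymp
    then have "\<forall>\<^sub>F t in at_top. C' * exp (- b' * t) * (1 + t - ln 2) < 1"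
      by (rule order_tendstoD) simp
    then have "\<forall>\<^sub>F t in at_top. C' * exp (- b' * t) * (1 + t - ln 2) < 1 \<and> ln 2 \<le> t"
      using eventually_ge_at_top by (rule eventually_conj)
    then obtain t where t: "C' * exp (- b' * t) * (1 + t - ln 2) < 1" "ln 2 \<le> t"
      by (rule eventually_happens'[rotated, THEN exE]) auto
    have "t \<ge> 0" using t(2) ln_ge_zero[of "2::real"] by linarith
    moreover have "C' * exp (- b' * t) < 1 / (1 + t - ln 2)"
      using t by (simp add: pos_less_divide_eq)
    ultimately show "\<exists>t\<ge>0. C' * exp (- b' * t) < finsler lens (axis.pt (axis.pos t (sqrt 2 / 2)))
        (((sqrt 2 - axis.pos t (sqrt 2 / 2)) / (sqrt 2 - sqrt 2 / 2)) *\<^sub>R v4 0 0 0 1)"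
      using finsler_vertical_axis[OF exp_ge_two[OF t(2)]] by (intro exI[of _ t]) simp
  next
    show "(axis.pt (axis.pos t (sqrt 2 / 2)), axis_dir) \<in> NW_lift 3 tr_vec lens Gam" for t
      by (rule axis_NW[OF axis.pos_bounds[OF half_bounds]])
    show "subspace (As w) \<and> subspace (Au w) \<and>
        bij_betw (\<lambda>(\<alpha>, Zs, Zu). \<alpha> *\<^sub>R flow_field lens w + Zs + Zu) (UNIV \<times> As w \<times> Au w) (tangent_space axis.HV w)"
      if "w \<in> NW_lift 3 tr_vec lens Gam" for w
      using split that unfolding HV_axis by blast
    show "frechet_derivative (flow lens t) (at w within axis.HV) ` Au w = Au (flow lens t w)"
      if "w \<in> NW_lift 3 tr_vec lens Gam" for w t
      using split that unfolding HV_axis dflow_def by blast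
    show "hnorm lens (flow lens t w) (frechet_derivative (flow lens t) (at w within axis.HV) Z) \<le> C * exp (- b * t) * hnorm lens w Z"
      if "w \<in> NW_lift 3 tr_vec lens Gam" "0 \<le> t" "Z \<in> As w" for w t Z
      using hyp that unfolding HV_axis dflow_def by blast
    show "hnorm lens (flow lens (- t) w) (frechet_derivative (flow lens (- t)) (at w within axis.HV) Z) \<le> C * exp (- b * t) * hnorm lens w Z"
      if "w \<in> NW_lift 3 tr_vec lens Gam" "0 \<le> t" "Z \<in> Au w" for w t Z
      using hyp that unfolding HV_axis dflow_def by blast
  qed (use bC in auto)
qed

theorem proposition1p1:
  shows "\<exists>(n::nat) (a::rseq) (\<Omega>::rseq set set) (\<Gamma>::real mat set) (D::rseq set).
    n \<ge> 2 \<and> properly_convex_in n a \<Omega> \<and> D = in_chart n a \<Omega> \<and>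
    strictly_convex D \<and> C1_boundary n a D \<and>
    subgroup \<Gamma> (Aut n \<Omega>) \<and> discrete_mats (Suc n) \<Gamma> \<and> torsion_free \<Gamma> \<and>
    geometrically_finite n a D \<Gamma> \<and>
    zero_Lyapunov_exponent n a D \<Gamma> \<and>
    \<not> uniformly_hyperbolic n a D \<Gamma>"
proof (intro exI conjI)
  show "(2::nat) \<le> 3" by simp
  show "properly_convex_in 3 tr_vec Omega" by (rule properly_convex_Omega)
  show "lens = in_chart 3 tr_vec Omega" by (rule in_chart_Omega[symmetric])
  show "strictly_convex lens" by (rule strictly_convex_lens)
  show "C1_boundary 3 tr_vec lens" by (rule C1_boundary_lens)
  show "subgroup Gam (Aut 3 Omega)" by (rule Gam_subgroup)
  show "discrete_mats (Suc 3) Gam" using Gam_discrete by simp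
  show "torsion_free Gam" by (rule Gam_torsion_free)
  show "geometrically_finite 3 tr_vec lens Gam" by (rule geometrically_finite_Gam)
  show "zero_Lyapunov_exponent 3 tr_vec lens Gam" by (rule zero_exponent)
  show "\<not> uniformly_hyperbolic 3 tr_vec lens Gam" by (rule not_hyperbolic)
qed

end
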